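(* Let $\mathsf f$ be an a.s. uniformly bounded additive functional on a uniformly elliptic Markov chain $\mathsf X$. Suppose $t>0$ and $\mathsf f$ is irreducible with algebraic range $t\mathbb Z$. Then $V_N\to\infty$, and there are constants $0\le\gamma_N<t$ such that for all $k\in\mathbb Z$ and for every sequence $z_N\in\gamma_N+t\mathbb Z$ such that $\frac{z_N-\mathbb E(S_N)}{\sqrt{V_N}}$ converges to a finite limit $z$, $$\mathbb P[S_N-z_N=kt]=[1+o(1)]\,\frac{e^{-z^2/2}\,t}{\sqrt{2\pi V_N}}\qquad\text{as }N\to\infty.$$ The constants $\gamma_N$ are determined by the condition $\mathbb P[S_N\in\gamma_N+t\mathbb Z]=1$ for all $N$.
   Context: A Markov chain $\mathsf X=\{X_n\}_{n\ge1}$ (possibly inhomogeneous) has complete separable metric state spaces $\mathfrak S_n\ni X_n$ with Borel $\sigma$-algebras, an arbitrary initial distribution on $\mathfrak S_1$ (possibly a point mass), and transition kernels $\pi_{n,n+1}(x,dy)$, so that $\mathbb P(X_{n+1}\in E\mid X_n,\dots,X_1)=\pi_{n,n+1}(X_n,E)$. It is uniformly elliptic if there are $0<\epsilon_0<1$, Borel probability measures $\mu_n$ on $\mathfrak S_n$ and measurable $p_n:\mathfrak S_n\times\mathfrak S_{n+1}\to[0,\infty)$ such that for all $n\ge1$: (a) $\pi_{n,n+1}(x,dy)=p_n(x,y)\mu_{n+1}(dy)$; (b) $0\le p_n\le1/\epsilon_0$; (c) $\int_{\mathfrak S_{n+1}}p_n(x,y)p_{n+1}(y,z)\mu_{n+1}(dy)>\epsilon_0$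 for all $x\in\mathfrak S_n$, $z\in\mathfrak S_{n+2}$. An additive functional is a sequence $\mathsf f=\{f_n\}$ of measurable $f_n:\mathfrak S_n\times\mathfrak S_{n+1}\to\mathbb R$; $S_N=\sum_{n=1}^Nf_n(X_n,X_{n+1})$; $V_N=\mathrm{Var}(S_N)$. $\mathsf f$ is a.s. uniformly bounded if $\sup_n\mathrm{ess\,sup}|f_n(X_n,X_{n+1})|<\infty$. $\mathsf f$ is center-tight if there are constants $m_N$ such that for every $\epsilon>0$ there is $M$ with $\mathbb P[|S_N-m_N|>M]<\epsilon$ for all $N$. $G_{alg}(\mathsf X,\mathsf f)$ (algebraic range) is the intersection of all closed subgroups $G\le\mathbb R$ for which there are $c_n\in\mathbb R$ with $\mathbb P[f_n(X_n,X_{n+1})-c_n\in G]=1$ for all $n\ge1$. $G_{ess}(\mathsf X,\mathsf f)=\bigcap\{G_{alg}(\mathsf X,\mathsf g):\mathsf g$ an additive functional on $\mathsf X$ with $\mathsf f-\mathsf g$ center-tight$\}$. $\mathsf f$ is irreducible if $G_{ess}(\mathsf X,\mathsf f)=G_{alg}(\mathsf X,\mathsf f)$. *)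

theory Defs
  imports "HOL-Probability.Probability" "HOL-Algebra.Group"
begin

text \<open>
  Sequences are of type \<open>nat \<Rightarrow> _\<close>, but only the indices \<open>n \<ge> 1\<close> matter; values at \<open>0\<close> are junk.
  The state spaces \<open>S n\<close> are metric spaces with carriers in one common type \<open>'a\<close>. This is no loss
  of generality, since \<open>'a\<close> is arbitrary and may be a disjoint union.
  Throughout, \<open>P\<close> is the underlying probability space and \<open>K n x\<close> is the transition
  measure \<open>\<pi>\<^sub>n\<^sub>,\<^sub>n\<^sub>+\<^sub>1(x, dy)\<close>.
\<close>

definition borel_metric :: "'a metric \<Rightarrow> 'a measure" where
  "borel_metric m = sigma (mspace m) {U. openin (mtopology_of m) U}"

text \<open>The \<open>\<sigma>\<close>-algebra generated by \<open>X\<^sub>1, \<dots>, X\<^sub>n\<close>.\<close>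

definition past_algebra ::
    "'w measure \<Rightarrow> (nat \<Rightarrow> 'a metric) \<Rightarrow> (nat \<Rightarrow> 'w \<Rightarrow> 'a) \<Rightarrow> nat \<Rightarrow> 'w measure" where
  "past_algebra P S X n =
     vimage_algebra (space P) (\<lambda>w. \<lambda>i\<in>{1..n}. X i w) (\<Pi>\<^sub>M i\<in>{1..n}. borel_metric (S i))"

text \<open>No condition is imposed on the law of \<open>X\<^sub>1\<close>: the initial distribution is arbitrary.\<close>

locale markov_chain = prob_space P
  for P :: "'w measure" +
  fixes S :: "nat \<Rightarrow> 'a metric"
    and X :: "nat \<Rightarrow> 'w \<Rightarrow> 'a"
    and K :: "nat \<Rightarrow> 'a \<Rightarrow> 'a measure"
  assumes complete_state_space: "\<And>n. 1 \<le> n \<Longrightarrow> mcomplete_of (S n)"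
    and separable_state_space: "\<And>n. 1 \<le> n \<Longrightarrow> separable_space (mtopology_of (S n))"
    and measurable_state: "\<And>n. 1 \<le> n \<Longrightarrow> X n \<in> P \<rightarrow>\<^sub>M borel_metric (S n)"
    and transition_kernel:
      "\<And>n. 1 \<le> n \<Longrightarrow> K n \<in> borel_metric (S n) \<rightarrow>\<^sub>M prob_algebra (borel_metric (S (Suc n)))"
    and markov_property:
      "\<And>n E. 1 \<le> n \<Longrightarrow> E \<in> sets (borel_metric (S (Suc n))) \<Longrightarrow>
        AE w in P. real_cond_exp P (past_algebra P S X n) (\<lambda>w. indicator E (X (Suc n) w)) w
          = measure (K n (X n w)) E"

definition uniformly_elliptic ::
    "(nat \<Rightarrow> 'a metric) \<Rightarrow> (nat \<Rightarrow> 'a \<Rightarrow> 'a measure) \<Rightarrow> bool" where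
  "uniformly_elliptic S K \<longleftrightarrow>
    (\<exists>(\<epsilon>\<^sub>0::real) (\<mu> :: nat \<Rightarrow> 'a measure) (p :: nat \<Rightarrow> 'a \<times> 'a \<Rightarrow> real).
      0 < \<epsilon>\<^sub>0 \<and> \<epsilon>\<^sub>0 < 1 \<and>
      (\<forall>n\<ge>1. prob_space (\<mu> n) \<and> sets (\<mu> n) = sets (borel_metric (S n))) \<and>
      (\<forall>n\<ge>1. p n \<in> borel_measurable (borel_metric (S n) \<Otimes>\<^sub>M borel_metric (S (Suc n)))) \<and>
      (\<forall>n\<ge>1. \<forall>x\<in>mspace (S n). K n x = density (\<mu> (Suc n)) (\<lambda>y. ennreal (p n (x, y)))) \<and>
      (\<forall>n\<ge>1. \<forall>x\<in>mspace (S n). \<forall>y\<in>mspace (S (Suc n)). 0 \<le> p n (x, y) \<and> p n (x, y) \<le> 1 / \<epsilon>\<^sub>0) \<and>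
      (\<forall>n\<ge>1. \<forall>x\<in>mspace (S n). \<forall>z\<in>mspace (S (Suc (Suc n))).
         (\<integral>y. p n (x, y) * p (Suc n) (y, z) \<partial>\<mu> (Suc n)) > \<epsilon>\<^sub>0))"

definition additive_functional :: "(nat \<Rightarrow> 'a metric) \<Rightarrow> (nat \<Rightarrow> 'a \<times> 'a \<Rightarrow> real) \<Rightarrow> bool" where
  "additive_functional S f \<longleftrightarrow>
    (\<forall>n\<ge>1. f n \<in> borel_measurable (borel_metric (S n) \<Otimes>\<^sub>M borel_metric (S (Suc n))))"

definition partial_sum ::
    "(nat \<Rightarrow> 'w \<Rightarrow> 'a) \<Rightarrow> (nat \<Rightarrow> 'a \<times> 'a \<Rightarrow> real) \<Rightarrow> nat \<Rightarrow> 'w \<Rightarrow> real" where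
  "partial_sum X f N w = (\<Sum>n=1..N. f n (X n w, X (Suc n) w))"

definition as_uniformly_bounded ::
    "'w measure \<Rightarrow> (nat \<Rightarrow> 'w \<Rightarrow> 'a) \<Rightarrow> (nat \<Rightarrow> 'a \<times> 'a \<Rightarrow> real) \<Rightarrow> bool" where
  "as_uniformly_bounded P X f \<longleftrightarrow>
    (SUP n\<in>{1..}. esssup P (\<lambda>w. ereal \<bar>f n (X n w, X (Suc n) w)\<bar>)) < \<infinity>"

definition center_tight ::
    "'w measure \<Rightarrow> (nat \<Rightarrow> 'w \<Rightarrow> 'a) \<Rightarrow> (nat \<Rightarrow> 'a \<times> 'a \<Rightarrow> real) \<Rightarrow> bool" where
  "center_tight P X f \<longleftrightarrow>
    (\<exists>m :: nat \<Rightarrow> real. \<forall>\<epsilon>>0. \<exists>M::real. \<forall>N\<ge>1.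
       measure P {w \<in> space P. \<bar>partial_sum X f N w - m N\<bar> > M} < \<epsilon>)"

definition real_add_group :: "real monoid" where
  "real_add_group = \<lparr>carrier = UNIV, monoid.mult = (+), one = 0\<rparr>"

definition algebraic_range ::
    "'w measure \<Rightarrow> (nat \<Rightarrow> 'w \<Rightarrow> 'a) \<Rightarrow> (nat \<Rightarrow> 'a \<times> 'a \<Rightarrow> real) \<Rightarrow> real set" where
  "algebraic_range P X f =
    \<Inter>{G. closed G \<and> subgroup G real_add_group \<and>
        (\<exists>c :: nat \<Rightarrow> real. \<forall>n\<ge>1.
           measure P {w \<in> space P. f n (X n w, X (Suc n) w) - c n \<in> G} = 1)}"

definition essential_range ::
    "'w measure \<Rightarrow> (nat \<Rightarrow> 'a metric) \<Rightarrow> (nat \<Rightarrow> 'w \<Rightarrow> 'a) \<Rightarrow> (nat \<Rightarrow> 'a \<times> 'a \<Rightarrow> real) \<Rightarrow> real set"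
  where
  "essential_range P S X f =
    \<Inter>{algebraic_range P X g | g.
        additive_functional S g \<and> center_tight P X (\<lambda>n xy. f n xy - g n xy)}"

definition irreducible_functional ::
    "'w measure \<Rightarrow> (nat \<Rightarrow> 'a metric) \<Rightarrow> (nat \<Rightarrow> 'w \<Rightarrow> 'a) \<Rightarrow> (nat \<Rightarrow> 'a \<times> 'a \<Rightarrow> real) \<Rightarrow> bool" where
  "irreducible_functional P S X f \<longleftrightarrow> essential_range P S X f = algebraic_range P X f"

text \<open>The coset \<open>a + t\<int>\<close>.\<close>

definition lattice_coset :: "real \<Rightarrow> real \<Rightarrow> real set" where
  "lattice_coset a t = range (\<lambda>j::int. a + t * of_int j)"

end

theory Submission
  imports Defs "HOL-Real_Asymp.Real_Asymp"
begin

text \<open>The local limit theorem is obtained by Fourier inversion over a period \<open>[-\<delta>, 2\<pi>/t - \<delta>]\<close>. Near \<open>0\<close> the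
  integrand is governed by the central limit theorem, which follows from a martingale approximation; elsewhere it has to be
  shown to be \<open>o(V\<^sub>N\<^sup>-\<^sup>1\<^sup>/\<^sup>2)\<close> in mean. Uniform ellipticity bounds the characteristic function of \<open>S\<^sub>N\<close> at \<open>\<xi>\<close> by \<open>exp (- c D\<^sub>N \<xi>)\<close>, where
  \<open>D\<^sub>N \<xi>\<close> is a sum over the levels of mean values of \<open>1 - cos (\<xi> \<Gamma>)\<close> over the balances \<open>\<Gamma>\<close> of random hexagons. A functional with
  small balances is a coboundary up to a small error, because one side of the hexagon can be fixed to lie on a typical
  trajectory. This has two consequences. First, \<open>(\<xi> - \<xi>')\<^sup>2 V\<^sub>N \<le> C (D\<^sub>N \<xi> + D\<^sub>N \<xi>' + 1)\<close> for close \<open>\<xi>\<close> and \<open>\<xi>'\<close>, so that on short arcs the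
  characteristic function decays like a Gaussian around the minimum of \<open>D\<^sub>N\<close>. Second, if \<open>D\<^sub>N \<xi>\<close> stays bounded for some
  \<open>0 < \<xi> < 2\<pi>/t\<close>, then the functional differs by a center-tight one from a functional with values in \<open>(2\<pi>/\<xi>)\<int>\<close>, contradicting
  irreducibility. Hence the minimum of \<open>D\<^sub>N\<close> over the arc tends to infinity.\<close>

subsection \<open>Kernels and the Markov property\<close>

text \<open>One-step densities may vanish, so every lower bound comes from two consecutive steps.
  Hence paths of three steps: their end points are shared and two intermediate states vary. Two more
  steps in front forget the starting point, so one factor of decay is gained per block of five
  steps. The initial law is arbitrary and need not be comparable with \<open>mu 0\<close>; hexagons
  are therefore based at level 2 or later, and the first levels only produce bounded errors. The
  obstacle away from frequency 0 is uniformity. Divergence of \<open>hex_sum f N \<xi>\<close> at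
  each fixed \<xi> comes with no rate relative to the variance, and the minimiser may wander with N.
  The Gaussian width supplies the order of the inverse standard deviation wherever the minimiser is,
  and the missing o(1) is a compactness argument over nested sublevel sets. The period starts at
  -\<delta> so that the central peak is integrated as a whole and only once. One variance bound by
  second moments serves twice: for the remainder after removal of a coboundary, and for the
  quadratic variation in the central limit theorem.\<close>

text \<open>Levels are indexed from \<open>0\<close>, and the density bounds are required off the state spaces as well.\<close>

locale elliptic_process = prob_space P
  for P :: "'w measure" +
  fixes B :: "nat \<Rightarrow> 'a measure"
    and F :: "nat \<Rightarrow> 'w measure"
    and X :: "nat \<Rightarrow> 'w \<Rightarrow> 'a"
    and K :: "nat \<Rightarrow> 'a \<Rightarrow> 'a measure"
    and mu :: "nat \<Rightarrow> 'a measure"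
    and p :: "nat \<Rightarrow> 'a \<times> 'a \<Rightarrow> real"
    and e :: real
  assumes filtration: "\<And>n. subalgebra P (F n)"
    and filtration_Suc: "\<And>n. subalgebra (F (Suc n)) (F n)"
    and adapted: "\<And>i n. i \<le> n \<Longrightarrow> X i \<in> F n \<rightarrow>\<^sub>M B i"
    and kernel: "\<And>n. K n \<in> B n \<rightarrow>\<^sub>M prob_algebra (B (Suc n))"
    and markov: "\<And>n A C. A \<in> sets (F n) \<Longrightarrow> C \<in> sets (B (Suc n)) \<Longrightarrow>
      emeasure P (A \<inter> X (Suc n) -` C) = (\<integral>\<^sup>+w\<in>A. emeasure (K n (X n w)) C \<partial>P)"
    and prob_mu: "\<And>n. prob_space (mu n)"
    and sets_mu [measurable_cong, simp]: "\<And>n. sets (mu n) = sets (B n)"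
    and p_measurable [measurable]: "\<And>n. p n \<in> borel_measurable (B n \<Otimes>\<^sub>M B (Suc n))"
    and kernel_density: "\<And>n x. x \<in> space (B n) \<Longrightarrow>
      K n x = density (mu (Suc n)) (\<lambda>y. ennreal (p n (x, y)))"
    and p_nonneg: "\<And>n xy. 0 \<le> p n xy"
    and p_le: "\<And>n xy. p n xy \<le> 1 / e"
    and e_pos: "0 < e" and e_less_1: "e < 1"
    and two_step: "\<And>n x z. x \<in> space (B n) \<Longrightarrow> z \<in> space (B (Suc (Suc n))) \<Longrightarrow>
      e < (\<integral>y. p n (x, y) * p (Suc n) (y, z) \<partial>mu (Suc n))"
begin

lemma space_mu [simp]: "space (mu n) = space (B n)"
  using sets_mu by (rule sets_eq_imp_space_eq)

lemma space_F [simp]: "space (F n) = space P"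
  using filtration by (simp add: subalgebra_def)

lemma kernel_subprob [measurable]: "K n \<in> B n \<rightarrow>\<^sub>M subprob_algebra (B (Suc n))"
  by (rule measurable_prob_algebraD[OF kernel])

lemma sets_kernel [simp]: "x \<in> space (B n) \<Longrightarrow> sets (K n x) = sets (B (Suc n))"
  using measurable_space[OF kernel_subprob, of x n] by (simp add: space_subprob_algebra)

lemma space_kernel [simp]: "x \<in> space (B n) \<Longrightarrow> space (K n x) = space (B (Suc n))"
  by (rule sets_eq_imp_space_eq) simp

lemma prob_kernel: "x \<in> space (B n) \<Longrightarrow> prob_space (K n x)"
  using measurable_space[OF kernel, of x n] by (simp add: space_prob_algebra)

lemma measurable_F: "g \<in> F n \<rightarrow>\<^sub>M M \<Longrightarrow> g \<in> P \<rightarrow>\<^sub>M M"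
  by (rule measurable_from_subalg[OF filtration])

lemma measurable_X [measurable]: "X n \<in> P \<rightarrow>\<^sub>M B n"
  by (rule measurable_F[OF adapted[OF order_refl]])

lemma measurable_X_self [measurable]: "X n \<in> F n \<rightarrow>\<^sub>M B n"
  by (rule adapted) simp

lemma X_in_space [simp]: "w \<in> space P \<Longrightarrow> X n w \<in> space (B n)"
  by (rule measurable_space[OF measurable_X])

lemma space_B_nonempty: "space (B n) \<noteq> {}"
  using not_empty X_in_space by blast

lemma kernel_integrable:
  fixes g :: "'a \<Rightarrow> 'c::{banach,second_countable_topology}"
  assumes "x \<in> space (B n)" "g \<in> borel_measurable (B (Suc n))"
    and "\<And>y. y \<in> space (B (Suc n)) \<Longrightarrow> norm (g y) \<le> c"
  shows "integrable (K n x) g"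
proof -
  interpret kx: prob_space "K n x" by (rule prob_kernel) fact
  show ?thesis using assms
    by (intro kx.integrable_const_bound[where B=c] AE_I2)
      (auto simp: measurable_cong_sets[OF sets_kernel refl])
qed

lemma measure_kernel_space [simp]:
  "x \<in> space (B n) \<Longrightarrow> measure (K n x) (space (B (Suc n))) = 1"
  using prob_space.prob_space[OF prob_kernel, of x n] by simp

lemma kernel_integral_const:
  "x \<in> space (B n) \<Longrightarrow> (\<integral>y. (c::'c::{banach,second_countable_topology}) \<partial>K n x) = c"
  by simp

lemma kernel_integral_bound:
  fixes g :: "'a \<Rightarrow> 'c::{banach,second_countable_topology}"
  assumes x: "x \<in> space (B n)" and g: "g \<in> borel_measurable (B (Suc n))"
    and b: "\<And>y. y \<in> space (B (Suc n)) \<Longrightarrow> norm (g y) \<le> c"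
  shows "norm (\<integral>y. g y \<partial>K n x) \<le> c"
proof -
  have "norm (\<integral>y. g y \<partial>K n x) \<le> (\<integral>y. norm (g y) \<partial>K n x)" by (rule integral_norm_bound)
  also have "\<dots> \<le> (\<integral>y. c \<partial>K n x)"
    by (rule integral_mono)
       (use x b in \<open>auto intro!: integrable_norm kernel_integrable[OF x g b] kernel_integrable[OF x]\<close>)
  finally show ?thesis using x by simp
qed

lemma kernel_integral_le:
  fixes g :: "'a \<Rightarrow> real"
  assumes x: "x \<in> space (B n)" and g: "g \<in> borel_measurable (B (Suc n))"
    and h: "h \<in> borel_measurable (B (Suc n))"
    and "\<And>y. y \<in> space (B (Suc n)) \<Longrightarrow> \<bar>g y\<bar> \<le> c"
    and "\<And>y. y \<in> space (B (Suc n)) \<Longrightarrow> \<bar>h y\<bar> \<le> d"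
    and "\<And>y. y \<in> space (B (Suc n)) \<Longrightarrow> g y \<le> h y"
  shows "(\<integral>y. g y \<partial>K n x) \<le> (\<integral>y. h y \<partial>K n x)"
  by (rule integral_mono) (use assms in \<open>auto intro!: kernel_integrable[OF x]\<close>)

text \<open>The integrand depends on the parameter both directly and through the kernel. Pushing
  \<open>K n (g w)\<close> forward under \<open>Pair w\<close> to the product space turns this into
  the integral of one fixed function against a measurable family of measures.\<close>

lemma measurable_kernel_integral [measurable (raw)]:
  fixes H :: "'b \<Rightarrow> 'a \<Rightarrow> 'c::{banach,second_countable_topology}"
  assumes H: "(\<lambda>(w, y). H w y) \<in> borel_measurable (M \<Otimes>\<^sub>M B (Suc n))" and g: "g \<in> M \<rightarrow>\<^sub>M B n"
  shows "(\<lambda>w. \<integral>y. H w y \<partial>K n (g w)) \<in> borel_measurable M"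
proof -
  have k: "(\<lambda>w. K n (g w)) \<in> M \<rightarrow>\<^sub>M subprob_algebra (B (Suc n))"
    using measurable_compose[OF g kernel_subprob] .
  note measurable_distr2[measurable] k[measurable] H[measurable]
  have "(\<lambda>w. integral\<^sup>L (distr (K n (g w)) (M \<Otimes>\<^sub>M B (Suc n)) (Pair w)) (\<lambda>(w, y). H w y))
      \<in> borel_measurable M"
    by (rule measurable_compose[OF measurable_distr2[where M="B (Suc n)"]
          integral_measurable_subprob_algebra]) (simp_all add: k H split_beta')
  moreover have "integral\<^sup>L (distr (K n (g w)) (M \<Otimes>\<^sub>M B (Suc n)) (Pair w)) (\<lambda>(w, y). H w y)
      = (\<integral>y. H w y \<partial>K n (g w))" if "w \<in> space M" for w
  proof -
    have "Pair w \<in> B (Suc n) \<rightarrow>\<^sub>M M \<Otimes>\<^sub>M B (Suc n)" using that by simp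
    then have "Pair w \<in> K n (g w) \<rightarrow>\<^sub>M M \<Otimes>\<^sub>M B (Suc n)"
      using measurable_space[OF g that] by (simp cong: measurable_cong_sets)
    then show ?thesis by (subst integral_distr) (auto simp: H)
  qed
  ultimately show ?thesis by (simp cong: measurable_cong)
qed

text \<open>The two laws agree on rectangles by \<open>markov\<close>, and rectangles generate the
  product algebra. The first coordinate keeps the whole outcome with the algebra \<open>F n\<close>,
  so that later integrands may depend on the entire past.\<close>

lemma markov_law:
  defines "M \<equiv> \<lambda>n. F n \<Otimes>\<^sub>M B (Suc n)"
  shows "distr P (M n) (\<lambda>w. (w, X (Suc n) w)) = P \<bind> (\<lambda>w. distr (K n (X n w)) (M n) (Pair w))"
    and "(\<lambda>w. distr (K n (X n w)) (M n) (Pair w)) \<in> P \<rightarrow>\<^sub>M subprob_algebra (M n)"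
proof -
  have id: "(\<lambda>w. w) \<in> P \<rightarrow>\<^sub>M F n"
    using filtration[of n] by (auto simp: subalgebra_def measurable_def)
  note id[measurable]
  have pr[measurable]: "(\<lambda>w. (w, X (Suc n) w)) \<in> P \<rightarrow>\<^sub>M M n" unfolding M_def by measurable
  show mk: "(\<lambda>w. distr (K n (X n w)) (M n) (Pair w)) \<in> P \<rightarrow>\<^sub>M subprob_algebra (M n)"
  proof (rule measurable_distr2[where M="B (Suc n)"])
    show "(\<lambda>w. K n (X n w)) \<in> P \<rightarrow>\<^sub>M subprob_algebra (B (Suc n))"
      by (rule measurable_compose[OF measurable_X kernel_subprob])
    show "case_prod Pair \<in> P \<Otimes>\<^sub>M B (Suc n) \<rightarrow>\<^sub>M M n" unfolding M_def by measurable
  qed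
  let ?E = "{A \<times> C |A C. A \<in> sets (F n) \<and> C \<in> sets (B (Suc n))}"
  show "distr P (M n) (\<lambda>w. (w, X (Suc n) w)) = P \<bind> (\<lambda>w. distr (K n (X n w)) (M n) (Pair w))"
  proof (rule measure_eqI_generator_eq[where E="?E" and \<Omega>="space (M n)" and
        A="\<lambda>_. space (F n) \<times> space (B (Suc n))"])
    show "Int_stable ?E" by (rule Int_stable_pair_measure_generator)
    show "?E \<subseteq> Pow (space (M n))"
      using pair_measure_closed[of "F n" "B (Suc n)"] by (simp add: M_def space_pair_measure)
    show "sets (distr P (M n) (\<lambda>w. (w, X (Suc n) w))) = sigma_sets (space (M n)) ?E"
      by (simp add: M_def sets_pair_measure space_pair_measure)
    show "sets (P \<bind> (\<lambda>w. distr (K n (X n w)) (M n) (Pair w))) = sigma_sets (space (M n)) ?E"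
      by (subst sets_bind[where N="M n"]) (auto simp: M_def sets_pair_measure space_pair_measure not_empty)
    show "emeasure (distr P (M n) (\<lambda>w. (w, X (Suc n) w))) (space (F n) \<times> space (B (Suc n))) \<noteq> \<infinity>"
      using finite_measure.emeasure_finite[OF finite_measure_distr[OF pr]] by (simp add: infinity_ennreal_def)
    show "range (\<lambda>_. space (F n) \<times> space (B (Suc n))) \<subseteq> ?E"
      using sets.top[of "F n"] sets.top[of "B (Suc n)"] by blast
  next
    fix D assume "D \<in> ?E"
    then obtain A C where D: "D = A \<times> C" and A: "A \<in> sets (F n)" and C: "C \<in> sets (B (Suc n))"
      by blast
    have Dm: "D \<in> sets (M n)" using A C by (auto simp: D M_def)
    have AP: "A \<in> sets P" using filtration[of n] A by (auto simp: subalgebra_def)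
    then have sub: "A \<subseteq> space P" by (rule sets.sets_into_space)
    have "emeasure (distr P (M n) (\<lambda>w. (w, X (Suc n) w))) D = emeasure P (A \<inter> X (Suc n) -` C)"
      using sub by (subst emeasure_distr[OF pr Dm]) (auto simp: D intro!: arg_cong[where f="emeasure P"])
    also have "\<dots> = (\<integral>\<^sup>+w\<in>A. emeasure (K n (X n w)) C \<partial>P)" by (rule markov[OF A C])
    also have "\<dots> = (\<integral>\<^sup>+w. emeasure (distr (K n (X n w)) (M n) (Pair w)) D \<partial>P)"
    proof (rule nn_integral_cong)
      fix w assume w: "w \<in> space P"
      have "Pair w \<in> K n (X n w) \<rightarrow>\<^sub>M M n"
        using w by (subst measurable_cong_sets[OF sets_kernel refl]) (auto simp: M_def)
      then show "emeasure (K n (X n w)) C * indicator A w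
          = emeasure (distr (K n (X n w)) (M n) (Pair w)) D"
        using w sub sets.sets_into_space[OF C]
        by (subst emeasure_distr[OF _ Dm])
           (auto simp: D indicator_def intro!: arg_cong[where f="emeasure (K n (X n w))"])
    qed
    also have "\<dots> = emeasure (P \<bind> (\<lambda>w. distr (K n (X n w)) (M n) (Pair w))) D"
      by (rule emeasure_bind[OF not_empty mk Dm, symmetric])
    finally show "emeasure (distr P (M n) (\<lambda>w. (w, X (Suc n) w))) D = \<dots>" .
  qed (auto simp: M_def space_pair_measure)
qed

text \<open>The tower property without conditional expectations: everything known at level
  \<open>n\<close> is frozen while the next state is integrated under the kernel.\<close>

lemma markov_step:
  fixes H :: "'w \<Rightarrow> 'a \<Rightarrow> real"
  assumes H: "(\<lambda>(w, y). H w y) \<in> borel_measurable (F n \<Otimes>\<^sub>M B (Suc n))"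
    and bound: "\<And>w y. w \<in> space P \<Longrightarrow> y \<in> space (B (Suc n)) \<Longrightarrow> \<bar>H w y\<bar> \<le> c"
  shows "(\<integral>w. H w (X (Suc n) w) \<partial>P) = (\<integral>w. \<integral>y. H w y \<partial>K n (X n w) \<partial>P)"
proof -
  let ?M = "F n \<Otimes>\<^sub>M B (Suc n)"
  have id [measurable]: "(\<lambda>w. w) \<in> P \<rightarrow>\<^sub>M F n"
    using filtration[of n] by (auto simp: subalgebra_def measurable_def)
  have "(\<integral>w. H w (X (Suc n) w) \<partial>P)
      = (\<integral>z. (case z of (w, y) \<Rightarrow> H w y) \<partial>distr P ?M (\<lambda>w. (w, X (Suc n) w)))"
    by (subst integral_distr[OF _ H]) auto
  also have "\<dots> = (\<integral>w. \<integral>z. (case z of (w, y) \<Rightarrow> H w y) \<partial>distr (K n (X n w)) ?M (Pair w) \<partial>P)"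
    unfolding markov_law
  proof (rule integral_bind[OF H _ markov_law(2)])
    show "\<bar>case z of (w, y) \<Rightarrow> H w y\<bar> \<le> c" if "z \<in> space ?M" for z
      using that bound by (auto simp: space_pair_measure)
    show "finite_measure P" by unfold_locales
    show "AE w in P. emeasure (distr (K n (X n w)) ?M (Pair w))
        (space (distr (K n (X n w)) ?M (Pair w))) \<le> ennreal 1"
    proof (rule AE_I2)
      fix w assume w: "w \<in> space P"
      interpret D: subprob_space "distr (K n (X n w)) ?M (Pair w)"
        using measurable_space[OF markov_law(2) w] by (simp add: space_subprob_algebra)
      show "emeasure (distr (K n (X n w)) ?M (Pair w))
        (space (distr (K n (X n w)) ?M (Pair w))) \<le> ennreal 1"
        using D.emeasure_space_le_1 by simp
    qed
  qed
  also have "\<dots> = (\<integral>w. \<integral>y. H w y \<partial>K n (X n w) \<partial>P)"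
  proof (rule Bochner_Integration.integral_cong[OF refl])
    fix w assume w: "w \<in> space P"
    have "Pair w \<in> K n (X n w) \<rightarrow>\<^sub>M ?M"
      using w by (subst measurable_cong_sets[OF sets_kernel refl]) auto
    then show "(\<integral>z. (case z of (w, y) \<Rightarrow> H w y) \<partial>distr (K n (X n w)) ?M (Pair w))
        = (\<integral>y. H w y \<partial>K n (X n w))"
      by (subst integral_distr[OF _ H]) auto
  qed
  finally show ?thesis .
qed

lemma markov_step_complex:
  fixes H :: "'w \<Rightarrow> 'a \<Rightarrow> complex"
  assumes H [measurable]: "(\<lambda>(w, y). H w y) \<in> borel_measurable (F n \<Otimes>\<^sub>M B (Suc n))"
    and bound: "\<And>w y. w \<in> space P \<Longrightarrow> y \<in> space (B (Suc n)) \<Longrightarrow> norm (H w y) \<le> c"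
  shows "(\<integral>w. H w (X (Suc n) w) \<partial>P) = (\<integral>w. \<integral>y. H w y \<partial>K n (X n w) \<partial>P)"
proof -
  have id [measurable]: "(\<lambda>w. w) \<in> P \<rightarrow>\<^sub>M F n"
    using filtration[of n] by (auto simp: subalgebra_def measurable_def)
  have [measurable]: "(\<lambda>w. H w (X (Suc n) w)) \<in> borel_measurable P"
    by measurable
  have Hw: "(\<lambda>y. H w y) \<in> borel_measurable (B (Suc n))" if "w \<in> space P" for w
  proof -
    have "Pair w \<in> B (Suc n) \<rightarrow>\<^sub>M F n \<Otimes>\<^sub>M B (Suc n)" using that by simp
    from measurable_compose[OF this H] show ?thesis by simp
  qed
  have i1: "integrable P (\<lambda>w. H w (X (Suc n) w))"
    by (rule integrable_const_bound[where B=c]) (use bound in auto)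
  have ik: "integrable (K n (X n w)) (H w)" if "w \<in> space P" for w
    using that bound by (intro kernel_integrable[where c=c] Hw) auto
  have m2: "(\<lambda>w. \<integral>y. H w y \<partial>K n (X n w)) \<in> borel_measurable (F n)"
    by (rule measurable_kernel_integral[OF H]) simp
  have i2: "integrable P (\<lambda>w. \<integral>y. H w y \<partial>K n (X n w))"
    by (rule integrable_const_bound[where B=c])
       (use bound measurable_F[OF m2] in \<open>auto intro!: kernel_integral_bound Hw\<close>)
  have b: "\<bar>Re (H w y)\<bar> \<le> c" "\<bar>Im (H w y)\<bar> \<le> c" if "w \<in> space P" "y \<in> space (B (Suc n))" for w y
    using bound[OF that] abs_Re_le_cmod[of "H w y"] abs_Im_le_cmod[of "H w y"] by linarith+
  show ?thesis
  proof (rule complex_eqI)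
    have "Re (\<integral>w. H w (X (Suc n) w) \<partial>P) = (\<integral>w. Re (H w (X (Suc n) w)) \<partial>P)"
      by (rule integral_Re[OF i1, symmetric])
    also have "\<dots> = (\<integral>w. \<integral>y. Re (H w y) \<partial>K n (X n w) \<partial>P)"
      by (rule markov_step[where c=c]) (use b in auto)
    also have "\<dots> = (\<integral>w. Re (\<integral>y. H w y \<partial>K n (X n w)) \<partial>P)"
      by (intro Bochner_Integration.integral_cong refl integral_Re ik) auto
    also have "\<dots> = Re (\<integral>w. \<integral>y. H w y \<partial>K n (X n w) \<partial>P)" by (rule integral_Re[OF i2])
    finally show "Re (\<integral>w. H w (X (Suc n) w) \<partial>P) = \<dots>" .
    have "Im (\<integral>w. H w (X (Suc n) w) \<partial>P) = (\<integral>w. Im (H w (X (Suc n) w)) \<partial>P)"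
      by (rule integral_Im[OF i1, symmetric])
    also have "\<dots> = (\<integral>w. \<integral>y. Im (H w y) \<partial>K n (X n w) \<partial>P)"
      by (rule markov_step[where c=c]) (use b in auto)
    also have "\<dots> = (\<integral>w. Im (\<integral>y. H w y \<partial>K n (X n w)) \<partial>P)"
      by (intro Bochner_Integration.integral_cong refl integral_Im ik) auto
    also have "\<dots> = Im (\<integral>w. \<integral>y. H w y \<partial>K n (X n w) \<partial>P)" by (rule integral_Im[OF i2])
    finally show "Im (\<integral>w. H w (X (Suc n) w) \<partial>P) = \<dots>" .
  qed
qed

end

subsection \<open>Contraction of oscillations\<close>

lemma (in prob_space) expectation_square_le:
  fixes g :: "'a \<Rightarrow> real"
  assumes "integrable M g" "integrable M (\<lambda>x. (g x)\<^sup>2)"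
  shows "(expectation g)\<^sup>2 \<le> expectation (\<lambda>x. (g x)\<^sup>2)"
  using variance_eq[OF assms] variance_positive[of g] by simp

lemma bounded_Fubini:
  fixes g :: "'a \<Rightarrow> 'b \<Rightarrow> 'c::{banach,second_countable_topology}"
  assumes "prob_space M" "prob_space N"
    and g: "(\<lambda>(x, y). g x y) \<in> borel_measurable (M \<Otimes>\<^sub>M N)"
    and bound: "\<And>x y. x \<in> space M \<Longrightarrow> y \<in> space N \<Longrightarrow> norm (g x y) \<le> c"
  shows "(\<integral>x. \<integral>y. g x y \<partial>N \<partial>M) = (\<integral>y. \<integral>x. g x y \<partial>M \<partial>N)"
    and "(\<integral>x. \<integral>y. g x y \<partial>N \<partial>M) = (\<integral>z. g (fst z) (snd z) \<partial>(M \<Otimes>\<^sub>M N))"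
proof -
  interpret M: prob_space M by fact
  interpret N: prob_space N by fact
  interpret pair_prob_space M N ..
  have int: "integrable (M \<Otimes>\<^sub>M N) (\<lambda>(x, y). g x y)"
    by (rule P.integrable_const_bound[where B=c])
       (use g bound in \<open>auto simp: space_pair_measure\<close>)
  show "(\<integral>x. \<integral>y. g x y \<partial>N \<partial>M) = (\<integral>y. \<integral>x. g x y \<partial>M \<partial>N)"
    by (rule Fubini_integral[OF int, symmetric])
  show "(\<integral>x. \<integral>y. g x y \<partial>N \<partial>M) = (\<integral>z. g (fst z) (snd z) \<partial>(M \<Otimes>\<^sub>M N))"
    using integral_fst'[OF int] by (simp add: split_beta')
qed

text \<open>Contraction takes place once every two steps, hence the exponent \<open>i div 2\<close>;
  each power of q occurs at most twice.\<close>

lemma sum_power_div2_le: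
  fixes q :: real
  assumes "0 \<le> q" "q < 1"
  shows "(\<Sum>i<n. q ^ (i div 2)) \<le> 2 / (1 - q)"
proof -
  have "(\<Sum>i<n. q ^ (i div 2)) \<le> (\<Sum>i<2*n. q ^ (i div 2))"
    by (rule sum_mono2) (use assms in auto)
  also have "\<dots> = 2 * (\<Sum>i<n. q ^ i)"
    by (induction n) (auto simp: algebra_simps)
  also have "(\<Sum>i<n. q ^ i) \<le> 1 / (1 - q)"
    using assms by (subst sum_gp_strict) (auto simp: field_simps mult_left_le_one_le)
  finally show ?thesis by simp
qed

lemma square_sum_le:
  fixes a b :: real
  shows "(a + b)\<^sup>2 \<le> 2 * a\<^sup>2 + 2 * b\<^sup>2"
  using zero_le_power2[of "a - b"] by (simp add: power2_eq_square algebra_simps)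

context elliptic_process
begin

lemma measurable_F_Suc: "g \<in> F n \<rightarrow>\<^sub>M M \<Longrightarrow> g \<in> F (Suc n) \<rightarrow>\<^sub>M M"
  by (rule measurable_from_subalg[OF filtration_Suc])

lemma measurable_X_Suc [measurable]: "X n \<in> F (Suc n) \<rightarrow>\<^sub>M B n"
  by (rule adapted) simp

lemma mu_integrable:
  fixes g :: "'a \<Rightarrow> 'c::{banach,second_countable_topology}"
  assumes "g \<in> borel_measurable (B n)" "\<And>y. y \<in> space (B n) \<Longrightarrow> norm (g y) \<le> c"
  shows "integrable (mu n) g"
proof -
  interpret m: prob_space "mu n" by (rule prob_mu)
  show ?thesis using assms
    by (intro m.integrable_const_bound[where B=c] AE_I2)
      (auto simp: measurable_cong_sets[OF sets_mu refl])
qed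

lemma measure_mu_space [simp]: "measure (mu n) (space (B n)) = 1"
  using prob_space.prob_space[OF prob_mu, of n] by simp

lemma P_integrable:
  fixes g :: "'w \<Rightarrow> 'c::{banach,second_countable_topology}"
  assumes "g \<in> borel_measurable P" "\<And>w. w \<in> space P \<Longrightarrow> norm (g w) \<le> c"
  shows "integrable P g"
  by (rule integrable_const_bound[where B=c]) (use assms in auto)

lemma kernel_integral_eq:
  fixes g :: "'a \<Rightarrow> 'c::{banach,second_countable_topology}"
  assumes "x \<in> space (B n)" and [measurable]: "g \<in> borel_measurable (B (Suc n))"
  shows "(\<integral>y. g y \<partial>K n x) = (\<integral>y. p n (x, y) *\<^sub>R g y \<partial>mu (Suc n))"
  unfolding kernel_density[OF assms(1)]
  by (rule integral_density) (use assms p_nonneg in \<open>auto simp: measurable_cong_sets[OF sets_mu refl]\<close>)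

lemma kernel_integral_abs_le:
  fixes g :: "'a \<Rightarrow> real"
  assumes "x \<in> space (B n)" "g \<in> borel_measurable (B (Suc n))"
    and "\<And>y. y \<in> space (B (Suc n)) \<Longrightarrow> \<bar>g y\<bar> \<le> c"
  shows "\<bar>\<integral>y. g y \<partial>K n x\<bar> \<le> c"
  using kernel_integral_bound[of x n g c] assms by simp

text \<open>This upper comparison with \<open>mu\<close> and the lower one in
  \<open>two_step_lower\<close> allow passing between the law of the chain and the reference
  measures in both directions.\<close>

lemma kernel_integral_le_mu:
  fixes v :: "'a \<Rightarrow> real"
  assumes x: "x \<in> space (B n)" and v [measurable]: "v \<in> borel_measurable (B (Suc n))"
    and b: "\<And>y. y \<in> space (B (Suc n)) \<Longrightarrow> 0 \<le> v y \<and> v y \<le> c"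
  shows "(\<integral>y. v y \<partial>K n x) \<le> (\<integral>y. v y \<partial>mu (Suc n)) / e"
proof -
  have c: "0 \<le> c" using b space_B_nonempty[of "Suc n"] by fastforce
  have "(\<integral>y. v y \<partial>K n x) = (\<integral>y. p n (x, y) * v y \<partial>mu (Suc n))"
    using kernel_integral_eq[OF x v] by simp
  also have "\<dots> \<le> (\<integral>y. (1 / e) * v y \<partial>mu (Suc n))"
  proof (rule integral_mono)
    show "integrable (mu (Suc n)) (\<lambda>y. p n (x, y) * v y)"
      using x b p_nonneg p_le c e_pos
      by (intro mu_integrable[where c="(1/e) * c"]) (auto intro!: mult_mono simp: abs_mult simp del: times_divide_eq_left)
    show "integrable (mu (Suc n)) (\<lambda>y. (1 / e) * v y)"
      using b by (intro integrable_mult_right mu_integrable[where c=c]) auto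
    show "p n (x, y) * v y \<le> (1 / e) * v y" if "y \<in> space (mu (Suc n))" for y
      using that b p_le by (intro mult_right_mono) auto
  qed
  finally show ?thesis by simp
qed

text \<open>Doeblin minorisation. Fubini turns the two-step kernel into a density with respect to
  \<open>mu (Suc (Suc n))\<close>, and ellipticity bounds this density below by e; a single step
  need not admit such a bound.\<close>

lemma two_step_lower:
  fixes v :: "'a \<Rightarrow> real"
  assumes x: "x \<in> space (B n)" and v [measurable]: "v \<in> borel_measurable (B (Suc (Suc n)))"
    and b: "\<And>y. y \<in> space (B (Suc (Suc n))) \<Longrightarrow> 0 \<le> v y \<and> v y \<le> c"
  shows "e * (\<integral>z. v z \<partial>mu (Suc (Suc n))) \<le> (\<integral>y. \<integral>z. v z \<partial>K (Suc n) y \<partial>K n x)"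
proof -
  have c: "0 \<le> c" using b space_B_nonempty[of "Suc (Suc n)"] by fastforce
  have px [measurable]: "(\<lambda>y. p n (x, y)) \<in> borel_measurable (B (Suc n))" using x by measurable
  have vb: "\<bar>v z\<bar> \<le> c" "0 \<le> v z" if "z \<in> space (B (Suc (Suc n)))" for z using b[OF that] by auto
  have pb: "\<bar>p i z\<bar> \<le> 1 / e" for i z using p_nonneg[of i z] p_le[of i z] by simp
  have "(\<integral>y. \<integral>z. v z \<partial>K (Suc n) y \<partial>K n x) = (\<integral>y. p n (x, y) * (\<integral>z. v z \<partial>K (Suc n) y) \<partial>mu (Suc n))"
    using kernel_integral_eq[OF x, of "\<lambda>y. \<integral>z. v z \<partial>K (Suc n) y"] by simp
  also have "\<dots> = (\<integral>y. \<integral>z. p n (x, y) * (p (Suc n) (y, z) * v z) \<partial>mu (Suc (Suc n)) \<partial>mu (Suc n))"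
    by (intro Bochner_Integration.integral_cong refl) (simp add: kernel_integral_eq)
  also have "\<dots> = (\<integral>z. \<integral>y. p n (x, y) * (p (Suc n) (y, z) * v z) \<partial>mu (Suc n) \<partial>mu (Suc (Suc n)))"
  proof (rule bounded_Fubini(1)[OF prob_mu prob_mu, where c="1/e * (1/e * c)"])
    show "norm (p n (x, y) * (p (Suc n) (y, z) * v z)) \<le> 1/e * (1/e * c)"
      if "z \<in> space (mu (Suc (Suc n)))" for y z
      unfolding real_norm_def abs_mult using that vb pb c e_pos
      by (intro mult_mono mult_nonneg_nonneg abs_ge_zero) auto
  qed measurable
  also have "\<dots> = (\<integral>z. (\<integral>y. p n (x, y) * p (Suc n) (y, z) \<partial>mu (Suc n)) * v z \<partial>mu (Suc (Suc n)))"
    by (simp flip: mult.assoc)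
  finally have eq: "(\<integral>y. \<integral>z. v z \<partial>K (Suc n) y \<partial>K n x)
      = (\<integral>z. (\<integral>y. p n (x, y) * p (Suc n) (y, z) \<partial>mu (Suc n)) * v z \<partial>mu (Suc (Suc n)))" .
  have p2: "norm (\<integral>y. p n (x, y) * p (Suc n) (y, z) \<partial>mu (Suc n)) \<le> 1/e"
    if "z \<in> space (B (Suc (Suc n)))" for z
  proof -
    have "(\<integral>y. p n (x, y) * p (Suc n) (y, z) \<partial>mu (Suc n)) = (\<integral>y. p (Suc n) (y, z) \<partial>K n x)"
      using that by (subst kernel_integral_eq[OF x]) auto
    then show ?thesis using kernel_integral_bound[OF x, of "\<lambda>y. p (Suc n) (y, z)" "1/e"] that pb by auto
  qed
  have "e * (\<integral>z. v z \<partial>mu (Suc (Suc n))) = (\<integral>z. e * v z \<partial>mu (Suc (Suc n)))" by simp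
  also have "\<dots> \<le> (\<integral>z. (\<integral>y. p n (x, y) * p (Suc n) (y, z) \<partial>mu (Suc n)) * v z \<partial>mu (Suc (Suc n)))"
  proof (rule integral_mono)
    show "integrable (mu (Suc (Suc n))) (\<lambda>z. e * v z)"
      using vb by (intro integrable_mult_right mu_integrable[where c=c]) auto
    interpret mu: prob_space "mu (Suc n)" by (rule prob_mu)
    show "integrable (mu (Suc (Suc n))) (\<lambda>z. (\<integral>y. p n (x, y) * p (Suc n) (y, z) \<partial>mu (Suc n)) * v z)"
    proof (rule mu_integrable[where c="1/e * c"])
      show "norm ((\<integral>y. p n (x, y) * p (Suc n) (y, z) \<partial>mu (Suc n)) * v z) \<le> 1/e * c"
        if "z \<in> space (B (Suc (Suc n)))" for z
        unfolding norm_mult using that vb p2 c e_pos by (intro mult_mono) auto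
    qed measurable
    show "e * v z \<le> (\<integral>y. p n (x, y) * p (Suc n) (y, z) \<partial>mu (Suc n)) * v z"
      if "z \<in> space (mu (Suc (Suc n)))" for z
      using that two_step[OF x, of z] vb(2)[of z] by (intro mult_right_mono) auto
  qed
  finally show ?thesis using eq by simp
qed

text \<open>Let m be the mean of v under \<open>mu\<close> and a, b the bounds of v. Minorisation
  applied to v - a and b - v confines the two-step mean to the interval from a + e (m - a) to b - e
  (b - m), which does not depend on the starting point and has length (1 - e) (b - a).\<close>

lemma osc_contraction:
  fixes v :: "'a \<Rightarrow> real"
  assumes x: "x \<in> space (B n)" "x' \<in> space (B n)" and v [measurable]: "v \<in> borel_measurable (B (Suc (Suc n)))"
    and osc: "\<And>y z. y \<in> space (B (Suc (Suc n))) \<Longrightarrow> z \<in> space (B (Suc (Suc n))) \<Longrightarrow> \<bar>v y - v z\<bar> \<le> d"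
  shows "\<bar>(\<integral>y. \<integral>z. v z \<partial>K (Suc n) y \<partial>K n x) - (\<integral>y. \<integral>z. v z \<partial>K (Suc n) y \<partial>K n x')\<bar> \<le> (1 - e) * d"
proof -
  let ?S = "space (B (Suc (Suc n)))"
  let ?T = "\<lambda>v x. \<integral>y. \<integral>z. v z \<partial>K (Suc n) y \<partial>K n x"
  obtain z0 where z0: "z0 \<in> ?S" using space_B_nonempty by blast
  define a where "a = Inf (v ` ?S)"
  define b where "b = Sup (v ` ?S)"
  have bd: "\<bar>v z\<bar> \<le> \<bar>v z0\<bar> + d" if "z \<in> ?S" for z using osc[OF that z0] by linarith
  then have bda: "bdd_below (v ` ?S)" "bdd_above (v ` ?S)"
    by (auto intro!: bdd_belowI2[where m="-(\<bar>v z0\<bar> + d)"] bdd_aboveI2[where M="\<bar>v z0\<bar> + d"]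
        simp: abs_le_iff) (use abs_le_D2 in force)
  have ab: "a \<le> v z" "v z \<le> b" if "z \<in> ?S" for z
    using that bda by (auto simp: a_def b_def intro: cInf_lower cSup_upper)
  have "b \<le> a + d"
  proof -
    have "v z - d \<le> a" if "z \<in> ?S" for z
      unfolding a_def using z0 osc[OF that] by (intro cInf_greatest) (auto simp: abs_le_iff algebra_simps)
    then show ?thesis unfolding b_def using z0 by (intro cSup_least) (auto simp: algebra_simps)
  qed
  have int: "integrable (K (Suc n) y) v" if "y \<in> space (B (Suc n))" for y
    by (rule kernel_integrable[OF that v]) (use bd in auto)
  have int2: "integrable (K n x) (\<lambda>y. \<integral>z. v z \<partial>K (Suc n) y)" if "x \<in> space (B n)" for x
    by (rule kernel_integrable[OF that, where c="\<bar>v z0\<bar> + d"])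
       (use bd in \<open>auto intro!: kernel_integral_abs_le\<close>)
  have imu: "integrable (mu (Suc (Suc n))) v"
    by (rule mu_integrable[OF v]) (use bd in auto)
  have T: "a + e * (integral\<^sup>L (mu (Suc (Suc n))) v - a) \<le> ?T v x"
      "?T v x \<le> b - e * (b - integral\<^sup>L (mu (Suc (Suc n))) v)" if x: "x \<in> space (B n)" for x
  proof -
    have "e * (\<integral>z. v z - a \<partial>mu (Suc (Suc n))) \<le> ?T (\<lambda>z. v z - a) x"
      using ab by (intro two_step_lower[OF x, where c="b - a"]) auto
    also have "?T (\<lambda>z. v z - a) x = (\<integral>y. (\<integral>z. v z \<partial>K (Suc n) y) - a \<partial>K n x)"
      using x by (intro Bochner_Integration.integral_cong refl)
        (simp add: Bochner_Integration.integral_diff int kernel_integrable[where c="\<bar>a\<bar>"])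
    also have "\<dots> = ?T v x - a"
      using x by (simp add: Bochner_Integration.integral_diff int2 kernel_integrable[where c="\<bar>a\<bar>"])
    also have "(\<integral>z. v z - a \<partial>mu (Suc (Suc n))) = integral\<^sup>L (mu (Suc (Suc n))) v - a"
      by (simp add: Bochner_Integration.integral_diff imu mu_integrable[where c="\<bar>a\<bar>"])
    finally show "a + e * (integral\<^sup>L (mu (Suc (Suc n))) v - a) \<le> ?T v x" by simp
    have "e * (\<integral>z. b - v z \<partial>mu (Suc (Suc n))) \<le> ?T (\<lambda>z. b - v z) x"
      using ab by (intro two_step_lower[OF x, where c="b - a"]) auto
    also have "?T (\<lambda>z. b - v z) x = (\<integral>y. b - (\<integral>z. v z \<partial>K (Suc n) y) \<partial>K n x)"
      using x by (intro Bochner_Integration.integral_cong refl)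
        (simp add: Bochner_Integration.integral_diff int kernel_integrable[where c="\<bar>b\<bar>"])
    also have "\<dots> = b - ?T v x"
      using x by (simp add: Bochner_Integration.integral_diff int2 kernel_integrable[where c="\<bar>b\<bar>"])
    also have "(\<integral>z. b - v z \<partial>mu (Suc (Suc n))) = b - integral\<^sup>L (mu (Suc (Suc n))) v"
      by (simp add: Bochner_Integration.integral_diff imu mu_integrable[where c="\<bar>b\<bar>"])
    finally show "?T v x \<le> b - e * (b - integral\<^sup>L (mu (Suc (Suc n))) v)" by simp
  qed
  have "\<bar>?T v x - ?T v x'\<bar> \<le> (1 - e) * (b - a)"
    using T[OF x(1)] T[OF x(2)] by (simp add: abs_le_iff algebra_simps)
  also have "\<dots> \<le> (1 - e) * d"
    using \<open>b \<le> a + d\<close> e_less_1 by (intro mult_left_mono) auto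
  finally show ?thesis .
qed

text \<open>Boundedness is demanded at every point and not just almost surely, so that it survives
  integration against any kernel. The final theorem reaches this form by truncation.\<close>

definition bounded_functional :: "(nat \<Rightarrow> 'a \<times> 'a \<Rightarrow> real) \<Rightarrow> real \<Rightarrow> bool" where
  "bounded_functional r R \<longleftrightarrow> (\<forall>n. r n \<in> borel_measurable (B n \<Otimes>\<^sub>M B (Suc n))) \<and>
    (\<forall>n. \<forall>x\<in>space (B n). \<forall>y\<in>space (B (Suc n)). \<bar>r n (x, y)\<bar> \<le> R)"

lemma bounded_functional_measurable:
  "bounded_functional r R \<Longrightarrow> r n \<in> borel_measurable (B n \<Otimes>\<^sub>M B (Suc n))"
  by (simp add: bounded_functional_def)

lemma bounded_functional_bound:
  "bounded_functional r R \<Longrightarrow> x \<in> space (B n) \<Longrightarrow> y \<in> space (B (Suc n)) \<Longrightarrow> \<bar>r n (x, y)\<bar> \<le> R"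
  by (simp add: bounded_functional_def)

lemma bounded_functional_nonneg: "bounded_functional r R \<Longrightarrow> 0 \<le> R"
  using space_B_nonempty by (meson abs_ge_zero bounded_functional_bound equals0I order_trans)

text \<open>The conditional expectation of \<open>r\<^sub>n + \<dots> + r\<^sub>n\<^sub>+\<^sub>k\<^sub>-\<^sub>1\<close> given \<open>X\<^sub>n = x\<close>.\<close>

primrec cum :: "(nat \<Rightarrow> 'a \<times> 'a \<Rightarrow> real) \<Rightarrow> nat \<Rightarrow> nat \<Rightarrow> 'a \<Rightarrow> real" where
  "cum r 0 n x = 0"
| "cum r (Suc k) n x = (\<integral>y. r n (x, y) + cum r k (Suc n) y \<partial>K n x)"

declare cum.simps(2) [simp del]

lemma measurable_cum [measurable]:
  assumes "bounded_functional r R"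
  shows "cum r k n \<in> borel_measurable (B n)"
proof (induction k arbitrary: n)
  case (Suc k)
  note [measurable] = Suc bounded_functional_measurable[OF assms]
  show ?case unfolding cum.simps(2)[abs_def] by measurable
qed (simp add: cum.simps(1)[abs_def])

lemma cum_bound:
  assumes r: "bounded_functional r R" and "x \<in> space (B n)"
  shows "\<bar>cum r k n x\<bar> \<le> real k * R"
  using assms(2)
proof (induction k arbitrary: n x)
  case (Suc k)
  note [measurable] = measurable_cum[OF r] bounded_functional_measurable[OF r]
  have "\<bar>r n (x, y) + cum r k (Suc n) y\<bar> \<le> real (Suc k) * R" if "y \<in> space (B (Suc n))" for y
    using Suc(1)[OF that] bounded_functional_bound[OF r Suc(2) that] by (simp add: algebra_simps)
  then show ?case unfolding cum.simps(2) real_norm_def[symmetric]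
    using Suc(2) by (intro kernel_integral_bound) auto
qed simp

definition mean_step :: "(nat \<Rightarrow> 'a \<times> 'a \<Rightarrow> real) \<Rightarrow> nat \<Rightarrow> 'a \<Rightarrow> real" where
  "mean_step r n x = (\<integral>y. r n (x, y) \<partial>K n x)"

lemma measurable_mean_step [measurable]:
  assumes "bounded_functional r R"
  shows "mean_step r n \<in> borel_measurable (B n)"
proof -
  note [measurable] = bounded_functional_measurable[OF assms]
  show ?thesis unfolding mean_step_def[abs_def] by measurable
qed

lemma mean_step_bound:
  assumes r: "bounded_functional r R" and "x \<in> space (B n)"
  shows "\<bar>mean_step r n x\<bar> \<le> R"
proof -
  note [measurable] = bounded_functional_measurable[OF r]
  show ?thesis unfolding mean_step_def real_norm_def[symmetric]
    using assms bounded_functional_bound[OF r] by (intro kernel_integral_bound) auto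
qed

lemma cum_Suc:
  assumes r: "bounded_functional r R" and x: "x \<in> space (B n)"
  shows "cum r (Suc k) n x = mean_step r n x + (\<integral>y. cum r k (Suc n) y \<partial>K n x)"
proof -
  note [measurable] = measurable_cum[OF r] bounded_functional_measurable[OF r]
  show ?thesis unfolding cum.simps(2) mean_step_def
    using x bounded_functional_bound[OF r x] cum_bound[OF r]
    by (intro Bochner_Integration.integral_add kernel_integrable) auto
qed

text \<open>The number 4R/e solves d = 4R + (1 - e) d: the first two mean steps oscillate by at most
  2R each, and the rest is seen through a two-step kernel, to which \<open>osc_contraction\<close>
  applies. Uniformity in k is what later bounds the martingale increments.\<close>

lemma cum_osc:
  assumes r: "bounded_functional r R" and x: "x \<in> space (B n)" "x' \<in> space (B n)"
  shows "\<bar>cum r k n x - cum r k n x'\<bar> \<le> 4 * R / e"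
  using x
proof (induction k arbitrary: n x x' rule: induct_nat_012)
  note [measurable] = measurable_cum[OF r] measurable_mean_step[OF r]
  note R = bounded_functional_nonneg[OF r]
  have Re: "R \<le> R / e" using R e_pos e_less_1 by (simp add: field_simps mult_left_le)
  {
    case 0 show ?case using R e_pos by simp
  next
    case 1
    have "\<bar>mean_step r n x - mean_step r n x'\<bar> \<le> 2 * R"
      using mean_step_bound[OF r 1(1)] mean_step_bound[OF r 1(2)] by linarith
    then show ?case using 1 Re R by (simp add: cum_Suc[OF r])
  next
    case (ge2 k)
    have split: "cum r (Suc (Suc k)) n x = mean_step r n x + (\<integral>y. mean_step r (Suc n) y \<partial>K n x)
        + (\<integral>y. \<integral>z. cum r k (Suc (Suc n)) z \<partial>K (Suc n) y \<partial>K n x)" if "x \<in> space (B n)" for x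
    proof -
      have "(\<integral>y. cum r (Suc k) (Suc n) y \<partial>K n x)
        = (\<integral>y. mean_step r (Suc n) y + (\<integral>z. cum r k (Suc (Suc n)) z \<partial>K (Suc n) y) \<partial>K n x)"
        using that by (intro Bochner_Integration.integral_cong refl) (simp add: cum_Suc[OF r])
      also have "\<dots> = (\<integral>y. mean_step r (Suc n) y \<partial>K n x)
          + (\<integral>y. \<integral>z. cum r k (Suc (Suc n)) z \<partial>K (Suc n) y \<partial>K n x)"
      proof (rule Bochner_Integration.integral_add)
        show "integrable (K n x) (mean_step r (Suc n))"
          using mean_step_bound[OF r] by (intro kernel_integrable[OF that, where c=R]) auto
        show "integrable (K n x) (\<lambda>y. \<integral>z. cum r k (Suc (Suc n)) z \<partial>K (Suc n) y)"
          using cum_bound[OF r] by (intro kernel_integrable[OF that, where c="real k * R"])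
            (auto intro!: kernel_integral_abs_le)
      qed
      finally show ?thesis using that by (simp add: cum_Suc[OF r])
    qed
    have m: "\<bar>\<integral>y. mean_step r (Suc n) y \<partial>K n x\<bar> \<le> R" if "x \<in> space (B n)" for x
      using that mean_step_bound[OF r] by (auto intro!: kernel_integral_abs_le)
    have "\<bar>(\<integral>y. \<integral>z. cum r k (Suc (Suc n)) z \<partial>K (Suc n) y \<partial>K n x)
        - (\<integral>y. \<integral>z. cum r k (Suc (Suc n)) z \<partial>K (Suc n) y \<partial>K n x')\<bar> \<le> (1 - e) * (4 * R / e)"
      by (rule osc_contraction) (use ge2 in auto)
    also have "\<dots> = 4 * R / e - 4 * R" using e_pos by (simp add: field_simps)
    finally show ?case
      using split[OF ge2.prems(1)] split[OF ge2.prems(2)] m[OF ge2.prems(1)] m[OF ge2.prems(2)]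
        mean_step_bound[OF r ge2.prems(1)] mean_step_bound[OF r ge2.prems(2)] by linarith
  }
qed

text \<open>Testing against weights G measurable at level \<open>n\<close> is how \<open>cum\<close>
  is used as a conditional expectation; the induction moves one summand at a time into the weight's
  future by \<open>markov_step\<close>.\<close>

lemma cum_expectation:
  assumes r: "bounded_functional r R" and G: "G \<in> borel_measurable (F n)"
    and b: "\<And>w. w \<in> space P \<Longrightarrow> \<bar>G w\<bar> \<le> c"
  shows "(\<integral>w. G w * (\<Sum>m=n..<n+k. r m (X m w, X (Suc m) w)) \<partial>P) = (\<integral>w. G w * cum r k n (X n w) \<partial>P)"
  using G
proof (induction k arbitrary: n)
  case (Suc k)
  note [measurable] = measurable_cum[OF r] bounded_functional_measurable[OF r] Suc(2)
  have [measurable]: "G \<in> borel_measurable P" by (rule measurable_F) fact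
  have R: "0 \<le> R" by (rule bounded_functional_nonneg[OF r])
  have c: "0 \<le> c" using b not_empty by fastforce
  have rb: "\<bar>r m (X m w, X (Suc m) w)\<bar> \<le> R" if "w \<in> space P" for m w
    using that by (intro bounded_functional_bound[OF r]) auto
  have i1: "integrable P (\<lambda>w. G w * r n (X n w, X (Suc n) w))"
    by (rule P_integrable[where c="c * R"]) (auto simp: abs_mult intro!: mult_mono b rb c)
  have i2: "integrable P (\<lambda>w. G w * (\<Sum>m=Suc n..<Suc n+k. r m (X m w, X (Suc m) w)))"
  proof (rule P_integrable[where c="c * (\<Sum>m=Suc n..<Suc n+k. R)"])
    show "norm (G w * (\<Sum>m=Suc n..<Suc n+k. r m (X m w, X (Suc m) w))) \<le> c * (\<Sum>m=Suc n..<Suc n+k. R)"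
      if "w \<in> space P" for w
      unfolding real_norm_def abs_mult using that rb c
      by (intro mult_mono abs_ge_zero b order_trans[OF sum_abs] sum_mono) auto
  qed measurable
  have i3: "integrable P (\<lambda>w. G w * cum r k (Suc n) (X (Suc n) w))"
    by (rule P_integrable[where c="c * (real k * R)"])
       (auto simp: abs_mult intro!: mult_mono b cum_bound[OF r] c)
  have "(\<integral>w. G w * (\<Sum>m=n..<n+Suc k. r m (X m w, X (Suc m) w)) \<partial>P)
      = (\<integral>w. G w * r n (X n w, X (Suc n) w) + G w * (\<Sum>m=Suc n..<Suc n+k. r m (X m w, X (Suc m) w)) \<partial>P)"
    by (intro Bochner_Integration.integral_cong refl) (simp add: sum.atLeast_Suc_lessThan algebra_simps)
  also have "\<dots> = (\<integral>w. G w * r n (X n w, X (Suc n) w) \<partial>P) + (\<integral>w. G w * cum r k (Suc n) (X (Suc n) w) \<partial>P)"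
    unfolding Suc(1)[OF measurable_F_Suc[OF Suc(2)], symmetric] by (rule Bochner_Integration.integral_add[OF i1 i2])
  also have "\<dots> = (\<integral>w. G w * (r n (X n w, X (Suc n) w) + cum r k (Suc n) (X (Suc n) w)) \<partial>P)"
    unfolding Bochner_Integration.integral_add[OF i1 i3, symmetric] by (simp add: distrib_left)
  also have "\<dots> = (\<integral>w. \<integral>y. G w * (r n (X n w, y) + cum r k (Suc n) y) \<partial>K n (X n w) \<partial>P)"
  proof (rule markov_step[where c="c * (R + real k * R)"])
    show "\<bar>G w * (r n (X n w, y) + cum r k (Suc n) y)\<bar> \<le> c * (R + real k * R)"
      if "w \<in> space P" "y \<in> space (B (Suc n))" for w y
      unfolding abs_mult using that c
      by (intro mult_mono b order_trans[OF abs_triangle_ineq] add_mono bounded_functional_bound[OF r] cum_bound[OF r]) auto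
  qed measurable
  also have "\<dots> = (\<integral>w. G w * cum r (Suc k) n (X n w) \<partial>P)"
    by (simp add: cum.simps(2))
  finally show ?case .
qed simp

end

subsection \<open>Variance bounds\<close>

text \<open>Convexity of the square with weights e and 1 - e, after writing u as e (u/e).\<close>

lemma convex_square_bound:
  fixes u d e :: real
  assumes "0 < e" "e < 1"
  shows "(u + (1 - e) * d)\<^sup>2 \<le> u\<^sup>2 / e + (1 - e) * d\<^sup>2"
proof -
  have "u\<^sup>2 / e + (1 - e) * d\<^sup>2 - (u + (1 - e) * d)\<^sup>2 = (1 - e) / e * (u - e * d)\<^sup>2"
    using assms by (simp add: field_simps power2_eq_square)
  moreover have "0 \<le> (1 - e) / e * (u - e * d)\<^sup>2" using assms by simp
  ultimately show ?thesis by linarith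
qed

lemma square_le_of_abs_le:
  fixes x y :: real
  assumes "\<bar>x\<bar> \<le> y"
  shows "x\<^sup>2 \<le> y\<^sup>2"
  using power_mono[OF assms abs_ge_zero, of 2] by simp

lemma sum_power_div2_shift:
  fixes q :: real
  shows "(\<Sum>j<Suc (Suc k). q ^ (j div 2) * g j) = g 0 + g 1 + q * (\<Sum>j<k. q ^ (j div 2) * g (Suc (Suc j)))"
  by (simp add: sum.lessThan_Suc_shift sum_distrib_left mult.assoc del: sum.lessThan_Suc)

lemma abs_diff3_le:
  fixes x1 :: real
  assumes "\<bar>x1\<bar> \<le> a" "\<bar>y1\<bar> \<le> a" "\<bar>x2\<bar> \<le> b" "\<bar>y2\<bar> \<le> b" "\<bar>x3 - y3\<bar> \<le> c"
  shows "\<bar>(x1 + x2 + x3) - (y1 + y2 + y3)\<bar> \<le> 2 * a + 2 * b + c"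
  using assms by linarith

context elliptic_process
begin

definition psum :: "(nat \<Rightarrow> 'a \<times> 'a \<Rightarrow> real) \<Rightarrow> nat \<Rightarrow> 'w \<Rightarrow> real" where
  "psum r N w = (\<Sum>n<N. r n (X n w, X (Suc n) w))"

definition second_moment :: "(nat \<Rightarrow> 'a \<times> 'a \<Rightarrow> real) \<Rightarrow> nat \<Rightarrow> real" where
  "second_moment r n = (\<integral>w. (r n (X n w, X (Suc n) w))\<^sup>2 \<partial>P)"

lemma second_moment_nonneg: "0 \<le> second_moment r n"
  by (simp add: second_moment_def)

lemma measurable_psum:
  assumes "\<And>n. r n \<in> borel_measurable (B n \<Otimes>\<^sub>M B (Suc n))"
  shows "psum r N \<in> borel_measurable P"
proof -
  note assms[measurable]
  show ?thesis unfolding psum_def[abs_def] by measurable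
qed

lemma square_integral_le_kernel:
  fixes g :: "'a \<Rightarrow> real"
  assumes x: "x \<in> space (B n)" and g [measurable]: "g \<in> borel_measurable (B (Suc n))"
    and b: "\<And>y. y \<in> space (B (Suc n)) \<Longrightarrow> \<bar>g y\<bar> \<le> c"
  shows "(\<integral>y. g y \<partial>K n x)\<^sup>2 \<le> (\<integral>y. (g y)\<^sup>2 \<partial>K n x)"
proof (rule prob_space.expectation_square_le[OF prob_kernel[OF x]])
  show "integrable (K n x) g" by (rule kernel_integrable[OF x g]) (use b in auto)
  show "integrable (K n x) (\<lambda>y. (g y)\<^sup>2)"
    using b by (intro kernel_integrable[OF x, where c="c\<^sup>2"]) (auto simp: abs_le_square_iff[symmetric] intro!: power_mono order_trans[OF b])
qed

lemma expectation_step: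
  fixes g :: "'a \<Rightarrow> real"
  assumes [measurable]: "g \<in> borel_measurable (B (Suc n))"
    and "\<And>y. y \<in> space (B (Suc n)) \<Longrightarrow> \<bar>g y\<bar> \<le> c"
  shows "(\<integral>w. g (X (Suc n) w) \<partial>P) = (\<integral>w. \<integral>y. g y \<partial>K n (X n w) \<partial>P)"
  by (rule markov_step[where c=c]) (use assms in auto)

text \<open>Uniform in x: replacing the law given x by \<open>mu\<close> costs 1/e, and replacing
  \<open>mu\<close> by the law of the chain, through the two steps from level j, costs another
  1/e.\<close>

lemma mean_step_square_bound:
  assumes r: "bounded_functional r R" and x: "x \<in> space (B (Suc j))"
  shows "(\<integral>y. (mean_step r (Suc (Suc j)) y)\<^sup>2 \<partial>K (Suc j) x) \<le> second_moment r (Suc (Suc j)) / e\<^sup>2"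
proof -
  let ?m = "Suc (Suc j)"
  note [measurable] = measurable_mean_step[OF r] bounded_functional_measurable[OF r]
  define g where "g y = (\<integral>z. (r ?m (y, z))\<^sup>2 \<partial>K ?m y)" for y
  have [measurable]: "g \<in> borel_measurable (B ?m)" unfolding g_def by measurable
  have rb: "(r ?m (y, z))\<^sup>2 \<le> R\<^sup>2" if "y \<in> space (B ?m)" "z \<in> space (B (Suc ?m))" for y z
    using bounded_functional_bound[OF r that] by (meson abs_le_square_iff abs_ge_self order_trans)
  have gb: "0 \<le> g y \<and> g y \<le> R\<^sup>2" if y: "y \<in> space (B ?m)" for y
  proof -
    have "\<bar>g y\<bar> \<le> R\<^sup>2" unfolding g_def by (rule kernel_integral_abs_le[OF y]) (use rb y in auto)
    then show ?thesis by (simp add: g_def)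
  qed
  have "(\<integral>y. (mean_step r ?m y)\<^sup>2 \<partial>K (Suc j) x) \<le> (\<integral>y. g y \<partial>K (Suc j) x)"
  proof (rule kernel_integral_le[OF x, where c="R\<^sup>2" and d="R\<^sup>2"])
    show mg: "(mean_step r ?m y)\<^sup>2 \<le> g y" if "y \<in> space (B ?m)" for y
      unfolding mean_step_def g_def using that bounded_functional_bound[OF r that]
      by (intro square_integral_le_kernel) auto
    show "\<bar>(mean_step r ?m y)\<^sup>2\<bar> \<le> R\<^sup>2" if "y \<in> space (B ?m)" for y
      using mg[OF that] gb[OF that] by simp
  qed (use gb in auto)
  also have "\<dots> \<le> (\<integral>y. g y \<partial>mu ?m) / e"
    by (rule kernel_integral_le_mu[OF x, where c="R\<^sup>2"]) (use gb in auto)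
  also have "e * (\<integral>y. g y \<partial>mu ?m) \<le> second_moment r ?m"
  proof -
    have Kg: "\<bar>\<integral>y. g y \<partial>K (Suc j) x\<bar> \<le> R\<^sup>2" if "x \<in> space (B (Suc j))" for x
      by (rule kernel_integral_abs_le[OF that]) (use gb in auto)
    have "e * (\<integral>y. g y \<partial>mu ?m) = (\<integral>w. e * (\<integral>y. g y \<partial>mu ?m) \<partial>P)"
      by (simp add: prob_space)
    also have "\<dots> \<le> (\<integral>w. \<integral>x. \<integral>y. g y \<partial>K (Suc j) x \<partial>K j (X j w) \<partial>P)"
    proof (rule integral_mono)
      show "integrable P (\<lambda>w. \<integral>x. \<integral>y. g y \<partial>K (Suc j) x \<partial>K j (X j w))"
        by (rule P_integrable[where c="R\<^sup>2"]) (auto intro!: kernel_integral_abs_le Kg)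
      show "e * (\<integral>y. g y \<partial>mu ?m) \<le> (\<integral>x. \<integral>y. g y \<partial>K (Suc j) x \<partial>K j (X j w))" if "w \<in> space P" for w
        by (rule two_step_lower[where c="R\<^sup>2"]) (use gb that in auto)
    qed simp
    also have "\<dots> = (\<integral>w. \<integral>y. g y \<partial>K (Suc j) (X (Suc j) w) \<partial>P)"
      by (rule expectation_step[symmetric, where c="R\<^sup>2"]) (use Kg in auto)
    also have "\<dots> = (\<integral>w. g (X ?m w) \<partial>P)"
      by (rule expectation_step[symmetric, where c="R\<^sup>2"]) (use gb in auto)
    also have "\<dots> = second_moment r ?m"
      unfolding g_def second_moment_def by (rule markov_step[symmetric, where c="R\<^sup>2"]) (use rb in auto)
    finally show ?thesis .
  qed
  then have "(\<integral>y. g y \<partial>mu ?m) / e \<le> second_moment r ?m / e\<^sup>2"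
    using e_pos by (simp add: field_simps power2_eq_square)
  finally show ?thesis .
qed

lemma mean_step_kernel_bound:
  assumes r: "bounded_functional r R" and x: "x \<in> space (B (Suc j))"
  shows "\<bar>\<integral>y. mean_step r (Suc (Suc j)) y \<partial>K (Suc j) x\<bar> \<le> sqrt (second_moment r (Suc (Suc j))) / e"
proof -
  note [measurable] = measurable_mean_step[OF r]
  have "(\<integral>y. mean_step r (Suc (Suc j)) y \<partial>K (Suc j) x)\<^sup>2 \<le> second_moment r (Suc (Suc j)) / e\<^sup>2"
    using square_integral_le_kernel[OF x, of "mean_step r (Suc (Suc j))" R] mean_step_bound[OF r]
      mean_step_square_bound[OF assms] by force
  then have "sqrt ((\<integral>y. mean_step r (Suc (Suc j)) y \<partial>K (Suc j) x)\<^sup>2) \<le> sqrt (second_moment r (Suc (Suc j)) / e\<^sup>2)"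
    by (rule real_sqrt_le_mono)
  then show ?thesis using e_pos by (simp add: real_sqrt_divide)
qed

text \<open>The square-mean analogue of \<open>cum_osc\<close>, with second moments in place of the
  sup bound. Two mean steps contribute 2a + 2b and the tail contracts by 1 - e;
  \<open>convex_square_bound\<close> keeps the factor 1 - e in front of the squared tail at the
  price of 1/e. With the 1/e^2 of the mean steps this gives 8/e^3.\<close>

lemma cum_kernel_osc:
  assumes r: "bounded_functional r R"
    and "x \<in> space (B (Suc i))" "x' \<in> space (B (Suc i))"
  shows "((\<integral>y. cum r k (Suc (Suc i)) y \<partial>K (Suc i) x) - (\<integral>y. cum r k (Suc (Suc i)) y \<partial>K (Suc i) x'))\<^sup>2
    \<le> 8 / e ^ 3 * (\<Sum>j<k. (1 - e) ^ (j div 2) * second_moment r (Suc (Suc i) + j))"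
  using assms(2,3)
proof (induction k arbitrary: i x x' rule: induct_nat_012)
  note [measurable] = measurable_cum[OF r] measurable_mean_step[OF r]
  note R = bounded_functional_nonneg[OF r]
  let ?rho = "second_moment r"
  have e3: "1 / e\<^sup>2 \<le> 1 / e ^ 3"
    using e_pos e_less_1 by (simp add: field_simps power2_eq_square power3_eq_cube mult_left_le)
  {
    case 0 show ?case by simp
  next
    case 1
    have eq: "(\<integral>y. cum r (Suc 0) (Suc (Suc i)) y \<partial>K (Suc i) x) = (\<integral>y. mean_step r (Suc (Suc i)) y \<partial>K (Suc i) x)"
      if "x \<in> space (B (Suc i))" for x
      using that by (intro Bochner_Integration.integral_cong refl) (simp add: cum_Suc[OF r])
    have "\<bar>(\<integral>y. mean_step r (Suc (Suc i)) y \<partial>K (Suc i) x) - (\<integral>y. mean_step r (Suc (Suc i)) y \<partial>K (Suc i) x')\<bar>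
        \<le> 2 * (sqrt (?rho (Suc (Suc i))) / e)"
      using mean_step_kernel_bound[OF r 1(1)] mean_step_kernel_bound[OF r 1(2)] by linarith
    then have "((\<integral>y. mean_step r (Suc (Suc i)) y \<partial>K (Suc i) x) - (\<integral>y. mean_step r (Suc (Suc i)) y \<partial>K (Suc i) x'))\<^sup>2
        \<le> (2 * (sqrt (?rho (Suc (Suc i))) / e))\<^sup>2"
      by (rule square_le_of_abs_le)
    also have "\<dots> = 4 * ?rho (Suc (Suc i)) * (1 / e\<^sup>2)"
      by (simp add: power_mult_distrib power_divide second_moment_nonneg)
    also have "\<dots> \<le> 8 * ?rho (Suc (Suc i)) * (1 / e ^ 3)"
      using e3 second_moment_nonneg[of r "Suc (Suc i)"] e_pos by (intro mult_mono) auto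
    finally show ?case using 1 by (simp add: eq)
  next
    case (ge2 k)
    let ?n = "Suc i"
    let ?v = "\<lambda>z. \<integral>y. cum r k (Suc (Suc (Suc ?n))) y \<partial>K (Suc (Suc ?n)) z"
    let ?S = "8 / e ^ 3 * (\<Sum>j<k. (1 - e) ^ (j div 2) * ?rho (Suc (Suc (Suc (Suc i))) + j))"
    have vb: "\<bar>?v z\<bar> \<le> real k * R" if "z \<in> space (B (Suc (Suc ?n)))" for z
      by (rule kernel_integral_abs_le[OF that]) (use cum_bound[OF r] in auto)
    have split: "(\<integral>y. cum r (Suc (Suc k)) (Suc ?n) y \<partial>K ?n x)
        = (\<integral>y. mean_step r (Suc ?n) y \<partial>K ?n x)
        + (\<integral>y. \<integral>z. mean_step r (Suc (Suc ?n)) z \<partial>K (Suc ?n) y \<partial>K ?n x)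
        + (\<integral>y. \<integral>z. ?v z \<partial>K (Suc ?n) y \<partial>K ?n x)" if x: "x \<in> space (B ?n)" for x
    proof -
      have "(\<integral>y. cum r (Suc (Suc k)) (Suc ?n) y \<partial>K ?n x)
        = (\<integral>y. mean_step r (Suc ?n) y + (\<integral>z. cum r (Suc k) (Suc (Suc ?n)) z \<partial>K (Suc ?n) y) \<partial>K ?n x)"
        using x by (intro Bochner_Integration.integral_cong refl) (simp add: cum_Suc[OF r])
      also have "\<dots> = (\<integral>y. mean_step r (Suc ?n) y \<partial>K ?n x)
          + (\<integral>y. \<integral>z. cum r (Suc k) (Suc (Suc ?n)) z \<partial>K (Suc ?n) y \<partial>K ?n x)"
      proof (rule Bochner_Integration.integral_add)
        show "integrable (K ?n x) (mean_step r (Suc ?n))"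
          using mean_step_bound[OF r] by (intro kernel_integrable[OF x, where c=R]) auto
        show "integrable (K ?n x) (\<lambda>y. \<integral>z. cum r (Suc k) (Suc (Suc ?n)) z \<partial>K (Suc ?n) y)"
          using cum_bound[OF r] by (intro kernel_integrable[OF x, where c="real (Suc k) * R"])
            (auto intro!: kernel_integral_abs_le simp del: of_nat_Suc)
      qed
      also have "(\<integral>y. \<integral>z. cum r (Suc k) (Suc (Suc ?n)) z \<partial>K (Suc ?n) y \<partial>K ?n x)
          = (\<integral>y. (\<integral>z. mean_step r (Suc (Suc ?n)) z \<partial>K (Suc ?n) y) + (\<integral>z. ?v z \<partial>K (Suc ?n) y) \<partial>K ?n x)"
      proof (intro Bochner_Integration.integral_cong refl)
        fix y assume "y \<in> space (K ?n x)"
        then have y: "y \<in> space (B (Suc ?n))" using x by simp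
        have "(\<integral>z. cum r (Suc k) (Suc (Suc ?n)) z \<partial>K (Suc ?n) y)
            = (\<integral>z. mean_step r (Suc (Suc ?n)) z + ?v z \<partial>K (Suc ?n) y)"
          using y by (intro Bochner_Integration.integral_cong refl) (simp add: cum_Suc[OF r])
        also have "\<dots> = (\<integral>z. mean_step r (Suc (Suc ?n)) z \<partial>K (Suc ?n) y) + (\<integral>z. ?v z \<partial>K (Suc ?n) y)"
        proof (rule Bochner_Integration.integral_add)
          show "integrable (K (Suc ?n) y) (mean_step r (Suc (Suc ?n)))"
            using mean_step_bound[OF r] by (intro kernel_integrable[OF y, where c=R]) auto
          show "integrable (K (Suc ?n) y) ?v"
            using vb by (intro kernel_integrable[OF y, where c="real k * R"]) auto
        qed
        finally show "(\<integral>z. cum r (Suc k) (Suc (Suc ?n)) z \<partial>K (Suc ?n) y)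
            = (\<integral>z. mean_step r (Suc (Suc ?n)) z \<partial>K (Suc ?n) y) + (\<integral>z. ?v z \<partial>K (Suc ?n) y)" .
      qed
      also have "\<dots> = (\<integral>y. \<integral>z. mean_step r (Suc (Suc ?n)) z \<partial>K (Suc ?n) y \<partial>K ?n x)
          + (\<integral>y. \<integral>z. ?v z \<partial>K (Suc ?n) y \<partial>K ?n x)"
      proof (rule Bochner_Integration.integral_add)
        show "integrable (K ?n x) (\<lambda>y. \<integral>z. mean_step r (Suc (Suc ?n)) z \<partial>K (Suc ?n) y)"
          using mean_step_bound[OF r] by (intro kernel_integrable[OF x, where c=R])
            (auto intro!: kernel_integral_abs_le)
        show "integrable (K ?n x) (\<lambda>y. \<integral>z. ?v z \<partial>K (Suc ?n) y)"
        proof (rule kernel_integrable[OF x, where c="real k * R"])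
          show "norm (\<integral>z. ?v z \<partial>K (Suc ?n) y) \<le> real k * R" if "y \<in> space (B (Suc ?n))" for y
            unfolding real_norm_def by (rule kernel_integral_abs_le[OF that _ vb]) measurable
        qed measurable
      qed
      finally show ?thesis by simp
    qed
    define a where "a = sqrt (?rho (Suc ?n)) / e"
    define b where "b = sqrt (?rho (Suc (Suc ?n))) / e"
    have S0: "0 \<le> ?S" using e_pos e_less_1
      by (intro mult_nonneg_nonneg sum_nonneg) (auto intro!: mult_nonneg_nonneg second_moment_nonneg)
    have m1: "\<bar>\<integral>y. mean_step r (Suc ?n) y \<partial>K ?n x\<bar> \<le> a" if "x \<in> space (B ?n)" for x
      unfolding a_def by (rule mean_step_kernel_bound[OF r that])
    have m2: "\<bar>\<integral>y. \<integral>z. mean_step r (Suc (Suc ?n)) z \<partial>K (Suc ?n) y \<partial>K ?n x\<bar> \<le> b" if x: "x \<in> space (B ?n)" for x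
      unfolding b_def by (rule kernel_integral_abs_le[OF x]) (auto intro!: mean_step_kernel_bound[OF r])
    have osc: "\<bar>(\<integral>y. \<integral>z. ?v z \<partial>K (Suc ?n) y \<partial>K ?n x) - (\<integral>y. \<integral>z. ?v z \<partial>K (Suc ?n) y \<partial>K ?n x')\<bar>
        \<le> (1 - e) * sqrt ?S"
    proof (rule osc_contraction[OF ge2.prems])
      fix y z assume "y \<in> space (B (Suc (Suc ?n)))" "z \<in> space (B (Suc (Suc ?n)))"
      from ge2.IH(1)[OF this] have "sqrt ((?v y - ?v z)\<^sup>2) \<le> sqrt ?S" by (rule real_sqrt_le_mono)
      then show "\<bar>?v y - ?v z\<bar> \<le> sqrt ?S" by simp
    qed measurable
    let ?L = "(\<integral>y. cum r (Suc (Suc k)) (Suc ?n) y \<partial>K ?n x) - (\<integral>y. cum r (Suc (Suc k)) (Suc ?n) y \<partial>K ?n x')"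
    have "\<bar>?L\<bar> \<le> (2 * a + 2 * b) + (1 - e) * sqrt ?S"
      unfolding split[OF ge2.prems(1)] split[OF ge2.prems(2)]
      by (rule abs_diff3_le[OF m1[OF ge2.prems(1)] m1[OF ge2.prems(2)]
            m2[OF ge2.prems(1)] m2[OF ge2.prems(2)] osc])
    then have "?L\<^sup>2 \<le> ((2 * a + 2 * b) + (1 - e) * sqrt ?S)\<^sup>2"
      by (rule square_le_of_abs_le)
    also have "\<dots> \<le> (2 * a + 2 * b)\<^sup>2 / e + (1 - e) * (sqrt ?S)\<^sup>2"
      by (rule convex_square_bound[OF e_pos e_less_1])
    also have "(sqrt ?S)\<^sup>2 = ?S" using S0 by simp
    also have "(2 * a + 2 * b)\<^sup>2 \<le> 2 * (2 * a)\<^sup>2 + 2 * (2 * b)\<^sup>2" by (rule square_sum_le)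
    also have "\<dots> = 8 * (?rho (Suc ?n) + ?rho (Suc (Suc ?n))) / e\<^sup>2"
      by (simp add: a_def b_def power_mult_distrib power_divide second_moment_nonneg add_divide_distrib distrib_left)
    also have "\<dots> / e = 8 / e ^ 3 * (?rho (Suc ?n) + ?rho (Suc (Suc ?n)))"
      by (simp add: power2_eq_square power3_eq_cube)
    finally have "?L\<^sup>2 \<le> 8 / e ^ 3 * (?rho (Suc ?n) + ?rho (Suc (Suc ?n))) + (1 - e) * ?S"
      using e_pos by (simp add: divide_right_mono)
    also have "\<dots> = 8 / e ^ 3 * (\<Sum>j<Suc (Suc k). (1 - e) ^ (j div 2) * ?rho (Suc ?n + j))"
      unfolding sum_power_div2_shift by (simp add: distrib_left)
    finally show ?case .
  }
qed

text \<open>Mixing makes the sum behave in square mean like one of independent terms. The centred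
  tail sums A are expanded backwards; in the cross term the future is replaced by its conditional
  mean, which is one mean step plus a rest of small oscillation by \<open>cum_kernel_osc\<close>.
  This yields 3 + 1 copies of each second moment, and summing the geometric tails gives 8/e^3 times
  2/e. It matters that the bound is free of the sup norm R.\<close>

lemma variance_psum_le:
  assumes r: "bounded_functional r R"
  shows "variance (psum r N) \<le> (4 + 16 / e ^ 4) * (\<Sum>n<N. second_moment r n)"
proof -
  note [measurable] = measurable_cum[OF r] measurable_mean_step[OF r] bounded_functional_measurable[OF r]
  note R = bounded_functional_nonneg[OF r]
  let ?rho = "second_moment r"
  define c where "c n = (\<integral>w. r n (X n w, X (Suc n) w) \<partial>P)" for n
  define Y where "Y n w = r n (X n w, X (Suc n) w) - c n" for n w
  define A where "A n w = (\<Sum>m=n..<N. Y m w)" for n w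
  have rb: "\<bar>r n (X n w, X (Suc n) w)\<bar> \<le> R" if "w \<in> space P" for n w
    by (rule bounded_functional_bound[OF r]) (use that in auto)
  have ri: "integrable P (\<lambda>w. r n (X n w, X (Suc n) w))" for n
    by (rule P_integrable[where c=R]) (use rb in auto)
  have ri2: "integrable P (\<lambda>w. (r n (X n w, X (Suc n) w))\<^sup>2)" for n
    by (rule P_integrable[where c="R\<^sup>2"]) (use rb R in \<open>auto simp: abs_le_square_iff[symmetric]\<close>)
  have cb: "\<bar>c n\<bar> \<le> R" for n
  proof -
    have "\<bar>c n\<bar> \<le> (\<integral>w. \<bar>r n (X n w, X (Suc n) w)\<bar> \<partial>P)" unfolding c_def by (rule integral_abs_bound)
    also have "\<dots> \<le> (\<integral>w. R \<partial>P)" by (rule integral_mono) (use rb ri in auto)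
    finally show ?thesis by (simp add: prob_space)
  qed
  have Yb: "\<bar>Y n w\<bar> \<le> 2 * R" if "w \<in> space P" for n w
    using rb[OF that, of n] cb[of n] by (simp add: Y_def)
  have YF [measurable]: "Y n \<in> borel_measurable (F (Suc n))" for n unfolding Y_def by measurable
  have YP [measurable]: "Y n \<in> borel_measurable P" for n by (rule measurable_F[OF YF])
  have Ab: "\<bar>A n w\<bar> \<le> real N * (2 * R)" if "w \<in> space P" for n w
  proof -
    have "\<bar>A n w\<bar> \<le> (\<Sum>m=n..<N. 2 * R)" unfolding A_def
      by (rule order_trans[OF sum_abs sum_mono[OF Yb[OF that]]])
    also have "\<dots> \<le> real N * (2 * R)" using R by (simp add: mult_right_mono)
    finally show ?thesis .
  qed
  have AP [measurable]: "A n \<in> borel_measurable P" for n unfolding A_def by measurable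
  have YAi: "integrable P (\<lambda>w. Y n w * A m w)" for n m
  proof (rule P_integrable[where c="(2 * R) * (real N * (2 * R))"])
    show "norm (Y n w * A m w) \<le> (2 * R) * (real N * (2 * R))" if "w \<in> space P" for w
      unfolding real_norm_def abs_mult using R by (intro mult_mono Yb[OF that] Ab[OF that]) auto
  qed measurable
  have Y2i: "integrable P (\<lambda>w. (Y n w)\<^sup>2)" for n
    by (rule P_integrable[where c="(2 * R)\<^sup>2"]; (unfold real_norm_def abs_power2)?)
      (measurable, rule square_le_of_abs_le[OF Yb])
  have Yi: "integrable P (Y n)" for n
    by (rule P_integrable[where c="2 * R"]) (use Yb in auto)
  have A2i: "integrable P (\<lambda>w. (A n w)\<^sup>2)" for n
    by (rule P_integrable[where c="(real N * (2 * R))\<^sup>2"]; (unfold real_norm_def abs_power2)?)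
      (measurable, rule square_le_of_abs_le[OF Ab])
  have EY: "(\<integral>w. Y n w \<partial>P) = 0" for n
    unfolding Y_def using ri by (simp add: c_def prob_space)
  have EY2: "(\<integral>w. (Y n w)\<^sup>2 \<partial>P) \<le> ?rho n" for n
  proof -
    have "(\<integral>w. (Y n w)\<^sup>2 \<partial>P) = ?rho n - (c n)\<^sup>2"
      unfolding Y_def second_moment_def c_def by (rule variance_eq[OF ri ri2])
    then show ?thesis by simp
  qed
  define es where "es n = 8 / e ^ 3 * (\<Sum>j<N - Suc (Suc n). (1 - e) ^ (j div 2) * ?rho (Suc (Suc n) + j))" for n
  have step: "(\<integral>w. (A n w)\<^sup>2 \<partial>P) \<le> (\<integral>w. (A (Suc n) w)\<^sup>2 \<partial>P)
      + (3 * ?rho n + (if Suc n < N then ?rho (Suc n) + es n else 0))" if n: "n < N" for n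
  proof -
    have "(\<integral>w. (A n w)\<^sup>2 \<partial>P) = (\<integral>w. (A (Suc n) w)\<^sup>2 + ((Y n w)\<^sup>2 + 2 * (Y n w * A (Suc n) w)) \<partial>P)"
      unfolding A_def using n
      by (intro Bochner_Integration.integral_cong refl) (simp add: sum.atLeast_Suc_lessThan power2_eq_square algebra_simps)
    also have "\<dots> = (\<integral>w. (A (Suc n) w)\<^sup>2 \<partial>P) + ((\<integral>w. (Y n w)\<^sup>2 \<partial>P) + 2 * (\<integral>w. Y n w * A (Suc n) w \<partial>P))"
      by (simp add: A2i Y2i YAi)
    finally have eq: "(\<integral>w. (A n w)\<^sup>2 \<partial>P)
      = (\<integral>w. (A (Suc n) w)\<^sup>2 \<partial>P) + ((\<integral>w. (Y n w)\<^sup>2 \<partial>P) + 2 * (\<integral>w. Y n w * A (Suc n) w \<partial>P))" .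
    have cross: "(\<integral>w. Y n w * A (Suc n) w \<partial>P) \<le> ?rho n + (if Suc n < N then ?rho (Suc n) + es n else 0) / 2"
    proof (cases "Suc n < N")
      case False
      then show ?thesis by (simp add: A_def second_moment_nonneg)
    next
      case True
      define k where "k = N - Suc (Suc n)"
      have N: "N = Suc n + Suc k" using True by (simp add: k_def)
      \<comment> \<open>Subtracting the value at a reference point is free because
        \<open>Y n\<close> has mean zero; only the oscillation of \<open>?v\<close> enters.\<close>
      obtain x0 where x0: "x0 \<in> space (B (Suc n))" using space_B_nonempty by blast
      let ?v = "\<lambda>x. \<integral>y. cum r k (Suc (Suc n)) y \<partial>K (Suc n) x"
      have vb: "\<bar>?v x\<bar> \<le> real k * R" if "x \<in> space (B (Suc n))" for x
        by (rule kernel_integral_abs_le[OF that]) (use cum_bound[OF r] in auto)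
      define C where "C = (\<Sum>m=Suc n..<N. c m)"
      have SP: "(\<lambda>w. \<Sum>m=Suc n..<N. r m (X m w, X (Suc m) w)) \<in> borel_measurable P" by measurable
      have Si: "integrable P (\<lambda>w. Y n w * (\<Sum>m=Suc n..<N. r m (X m w, X (Suc m) w)))"
      proof (rule P_integrable[where c="(2 * R) * (\<Sum>m=Suc n..<N. R)"])
        show "norm (Y n w * (\<Sum>m=Suc n..<N. r m (X m w, X (Suc m) w))) \<le> (2 * R) * (\<Sum>m=Suc n..<N. R)"
          if "w \<in> space P" for w
          unfolding real_norm_def abs_mult using that rb R
          by (intro mult_mono abs_ge_zero Yb order_trans[OF sum_abs] sum_mono) auto
      qed measurable
      have "(\<integral>w. Y n w * A (Suc n) w \<partial>P)
          = (\<integral>w. Y n w * (\<Sum>m=Suc n..<N. r m (X m w, X (Suc m) w)) - C * Y n w \<partial>P)"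
        by (intro Bochner_Integration.integral_cong refl)
          (simp add: A_def C_def Y_def[of m for m] sum_subtractf algebra_simps)
      also have "\<dots> = (\<integral>w. Y n w * (\<Sum>m=Suc n..<N. r m (X m w, X (Suc m) w)) \<partial>P)"
        by (simp add: Si Yi EY)
      also have "\<dots> = (\<integral>w. Y n w * cum r (Suc k) (Suc n) (X (Suc n) w) \<partial>P)"
        unfolding N by (rule cum_expectation[OF r YF Yb])
      also have "\<dots> = (\<integral>w. Y n w * mean_step r (Suc n) (X (Suc n) w)
          + Y n w * (?v (X (Suc n) w) - ?v x0) + ?v x0 * Y n w \<partial>P)"
        by (intro Bochner_Integration.integral_cong refl) (simp add: cum_Suc[OF r] algebra_simps)
      also have "\<dots> \<le> (\<integral>w. ((Y n w)\<^sup>2 + (mean_step r (Suc n) (X (Suc n) w))\<^sup>2) / 2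
          + ((Y n w)\<^sup>2 + es n) / 2 + ?v x0 * Y n w \<partial>P)"
      proof (rule integral_mono)
        show "integrable P (\<lambda>w. Y n w * mean_step r (Suc n) (X (Suc n) w)
          + Y n w * (?v (X (Suc n) w) - ?v x0) + ?v x0 * Y n w)"
        proof (intro Bochner_Integration.integrable_add integrable_mult_right Yi)
          show "integrable P (\<lambda>w. Y n w * mean_step r (Suc n) (X (Suc n) w))"
            by (rule P_integrable[where c="(2 * R) * R"])
              (use Yb R mean_step_bound[OF r] in \<open>auto simp: abs_mult intro!: mult_mono\<close>)
          show "integrable P (\<lambda>w. Y n w * (?v (X (Suc n) w) - ?v x0))"
          proof (rule P_integrable[where c="(2 * R) * (real k * R + real k * R)"])
            show "norm (Y n w * (?v (X (Suc n) w) - ?v x0)) \<le> (2 * R) * (real k * R + real k * R)"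
              if "w \<in> space P" for w
              unfolding real_norm_def abs_mult using that R
              by (intro mult_mono Yb abs_ge_zero order_trans[OF abs_triangle_ineq4] add_mono vb x0) auto
          qed measurable
        qed
        have Mi: "integrable P (\<lambda>w. (mean_step r (Suc n) (X (Suc n) w))\<^sup>2)"
          by (rule P_integrable[where c="R\<^sup>2"])
            (use R mean_step_bound[OF r] in \<open>auto simp: abs_le_square_iff[symmetric]\<close>)
        then show "integrable P (\<lambda>w. ((Y n w)\<^sup>2 + (mean_step r (Suc n) (X (Suc n) w))\<^sup>2) / 2
          + ((Y n w)\<^sup>2 + es n) / 2 + ?v x0 * Y n w)"
          by (simp add: Y2i Yi)
        fix w assume w: "w \<in> space P"
        have ab: "a * b \<le> (a\<^sup>2 + b\<^sup>2) / 2" for a b :: real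
          using zero_le_power2[of "a - b"] by (simp add: power2_eq_square algebra_simps)
        have "(?v (X (Suc n) w) - ?v x0)\<^sup>2 \<le> es n"
          unfolding es_def k_def[symmetric] by (rule cum_kernel_osc[OF r]) (use w x0 in auto)
        then show "Y n w * mean_step r (Suc n) (X (Suc n) w)
          + Y n w * (?v (X (Suc n) w) - ?v x0) + ?v x0 * Y n w
          \<le> ((Y n w)\<^sup>2 + (mean_step r (Suc n) (X (Suc n) w))\<^sup>2) / 2
          + ((Y n w)\<^sup>2 + es n) / 2 + ?v x0 * Y n w"
          by (intro add_mono order_refl ab order_trans[OF ab[of "Y n w" "?v (X (Suc n) w) - ?v x0"]])
            simp
      qed
      also have "\<dots> = (\<integral>w. (Y n w)\<^sup>2 \<partial>P) + (\<integral>w. (mean_step r (Suc n) (X (Suc n) w))\<^sup>2 \<partial>P) / 2 + es n / 2"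
      proof -
        have Mi: "integrable P (\<lambda>w. (mean_step r (Suc n) (X (Suc n) w))\<^sup>2)"
          by (rule P_integrable[where c="R\<^sup>2"])
            (use R mean_step_bound[OF r] in \<open>auto simp: abs_le_square_iff[symmetric]\<close>)
        have "(\<integral>w. ((Y n w)\<^sup>2 + (mean_step r (Suc n) (X (Suc n) w))\<^sup>2) / 2
          + ((Y n w)\<^sup>2 + es n) / 2 + ?v x0 * Y n w \<partial>P)
          = ((\<integral>w. (Y n w)\<^sup>2 \<partial>P) + (\<integral>w. (mean_step r (Suc n) (X (Suc n) w))\<^sup>2 \<partial>P)) / 2
            + ((\<integral>w. (Y n w)\<^sup>2 \<partial>P) + es n) / 2 + ?v x0 * (\<integral>w. Y n w \<partial>P)"
          using Mi by (simp add: Y2i Yi prob_space)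
        then show ?thesis by (simp add: EY field_simps)
      qed
      also have "\<dots> \<le> ?rho n + (?rho (Suc n) + es n) / 2"
      proof -
        have "(\<integral>w. (mean_step r (Suc n) (X (Suc n) w))\<^sup>2 \<partial>P)
            \<le> (\<integral>w. \<integral>y. (r (Suc n) (X (Suc n) w, y))\<^sup>2 \<partial>K (Suc n) (X (Suc n) w) \<partial>P)"
        proof (rule integral_mono)
          have b: "\<bar>(r (Suc n) (x, y))\<^sup>2\<bar> \<le> R\<^sup>2" if "x \<in> space (B (Suc n))" "y \<in> space (B (Suc (Suc n)))" for x y
            using bounded_functional_bound[OF r that] R by (simp add: abs_le_square_iff[symmetric])
          show "integrable P (\<lambda>w. (mean_step r (Suc n) (X (Suc n) w))\<^sup>2)"
            by (rule P_integrable[where c="R\<^sup>2"])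
              (use R mean_step_bound[OF r] in \<open>auto simp: abs_le_square_iff[symmetric]\<close>)
          show "integrable P (\<lambda>w. \<integral>y. (r (Suc n) (X (Suc n) w, y))\<^sup>2 \<partial>K (Suc n) (X (Suc n) w))"
          proof (rule P_integrable[where c="R\<^sup>2"])
            show "norm (\<integral>y. (r (Suc n) (X (Suc n) w, y))\<^sup>2 \<partial>K (Suc n) (X (Suc n) w)) \<le> R\<^sup>2"
              if w: "w \<in> space P" for w
              unfolding real_norm_def
              by (rule kernel_integral_abs_le) (use w b in auto)
          qed measurable
          show "(mean_step r (Suc n) (X (Suc n) w))\<^sup>2
              \<le> (\<integral>y. (r (Suc n) (X (Suc n) w, y))\<^sup>2 \<partial>K (Suc n) (X (Suc n) w))" if "w \<in> space P" for w
            unfolding mean_step_def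
            by (rule square_integral_le_kernel[where c=R]) (use that bounded_functional_bound[OF r] in auto)
        qed
        also have "\<dots> = ?rho (Suc n)"
          unfolding second_moment_def
          by (rule markov_step[symmetric, where c="R\<^sup>2"])
            (use bounded_functional_bound[OF r] R in \<open>auto simp: abs_le_square_iff[symmetric]\<close>)
        finally show ?thesis using EY2[of n] by argo
      qed
      finally show ?thesis using True by simp
    qed
    show ?thesis using EY2[of n] eq cross by argo
  qed
  have tele: "(\<integral>w. (A (N - k) w)\<^sup>2 \<partial>P)
      \<le> (\<Sum>n=N-k..<N. 3 * ?rho n + (if Suc n < N then ?rho (Suc n) + es n else 0))" if "k \<le> N" for k
    using that
  proof (induction k)
    case 0 show ?case by (simp add: A_def)
  next
    case (Suc k)
    then have *: "N - Suc k < N" "Suc (N - Suc k) = N - k" by auto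
    show ?case using step[OF *(1)] Suc * by (simp add: sum.atLeast_Suc_lessThan)
  qed
  have r0: "0 \<le> ?rho n" for n by (rule second_moment_nonneg)
  have es_sum: "(\<Sum>n<N. es n) \<le> 16 / e ^ 4 * (\<Sum>n<N. ?rho n)"
  proof -
    have "(\<Sum>n<N. es n) = 8 / e ^ 3 * (\<Sum>n<N. \<Sum>j<N - Suc (Suc n). (1 - e) ^ (j div 2) * ?rho (Suc (Suc n) + j))"
      by (simp add: es_def sum_distrib_left)
    also have "(\<Sum>n<N. \<Sum>j<N - Suc (Suc n). (1 - e) ^ (j div 2) * ?rho (Suc (Suc n) + j))
        = (\<Sum>j<N. \<Sum>n<N - Suc (Suc j). (1 - e) ^ (j div 2) * ?rho (Suc (Suc n) + j))"
      by (subst (1 2) sum.Sigma) (auto intro!: sum.reindex_bij_witness[where i="\<lambda>(a, b). (b, a)" and j="\<lambda>(a, b). (b, a)"])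
    also have "\<dots> \<le> (\<Sum>j<N. (1 - e) ^ (j div 2) * (\<Sum>n<N. ?rho n))"
    proof (rule sum_mono)
      fix j assume "j \<in> {..<N}"
      have "(\<Sum>n<N - Suc (Suc j). ?rho (Suc (Suc n) + j)) = sum ?rho ((\<lambda>n. Suc (Suc n) + j) ` {..<N - Suc (Suc j)})"
        by (subst sum.reindex) (auto simp: inj_on_def)
      also have "\<dots> \<le> sum ?rho {..<N}" by (rule sum_mono2) (auto simp: r0)
      finally show "(\<Sum>n<N - Suc (Suc j). (1 - e) ^ (j div 2) * ?rho (Suc (Suc n) + j))
          \<le> (1 - e) ^ (j div 2) * (\<Sum>n<N. ?rho n)"
        unfolding sum_distrib_left[symmetric] using e_less_1 by (intro mult_left_mono) auto
    qed
    also have "\<dots> = (\<Sum>j<N. (1 - e) ^ (j div 2)) * (\<Sum>n<N. ?rho n)" by (simp add: sum_distrib_right)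
    also have "\<dots> \<le> 2 / e * (\<Sum>n<N. ?rho n)"
      using sum_power_div2_le[of "1 - e" N] e_pos e_less_1 by (intro mult_right_mono) (auto intro!: sum_nonneg r0)
    finally have "(\<Sum>n<N. es n) \<le> 8 / e ^ 3 * (2 / e * (\<Sum>n<N. ?rho n))"
      using e_pos by (simp add: mult_left_mono divide_right_mono)
    also have "\<dots> = 16 / e ^ 4 * (\<Sum>n<N. ?rho n)" by (simp add: power4_eq_xxxx power3_eq_cube)
    finally show ?thesis .
  qed
  have es0: "0 \<le> es n" for n unfolding es_def using e_pos e_less_1
    by (intro mult_nonneg_nonneg sum_nonneg) (auto intro!: mult_nonneg_nonneg r0)
  have "variance (psum r N) = (\<integral>w. (A 0 w)\<^sup>2 \<partial>P)"
  proof (intro Bochner_Integration.integral_cong refl)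
    have "expectation (psum r N) = (\<Sum>n<N. c n)"
      unfolding psum_def c_def using ri by simp
    then show "(psum r N w - expectation (psum r N))\<^sup>2 = (A 0 w)\<^sup>2" for w
      by (simp add: psum_def A_def Y_def sum_subtractf atLeast0LessThan)
  qed
  also have "\<dots> \<le> (\<Sum>n<N. 3 * ?rho n + (if Suc n < N then ?rho (Suc n) + es n else 0))"
    using tele[of N] by (simp add: atLeast0LessThan)
  also have "\<dots> \<le> 3 * (\<Sum>n<N. ?rho n) + ((\<Sum>n<N. if Suc n < N then ?rho (Suc n) else 0) + (\<Sum>n<N. es n))"
    unfolding sum_distrib_left sum.distrib[symmetric] by (rule sum_mono) (use es0 in auto)
  also have "(\<Sum>n<N. if Suc n < N then ?rho (Suc n) else 0) \<le> (\<Sum>n<N. ?rho n)"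
  proof -
    have "(\<Sum>n<N. if Suc n < N then ?rho (Suc n) else 0) = sum ?rho (Suc ` {n. Suc n < N})"
    proof (subst sum.reindex)
      show "(\<Sum>n<N. if Suc n < N then ?rho (Suc n) else 0) = sum (?rho \<circ> Suc) {n. Suc n < N}"
        by (rule sum.mono_neutral_cong_right) auto
    qed auto
    also have "\<dots> \<le> (\<Sum>n<N. ?rho n)" by (rule sum_mono2) (auto simp: r0)
    finally show ?thesis .
  qed
  finally show ?thesis using es_sum by (simp add: algebra_simps)
qed

end

subsection \<open>Martingale approximation and the central limit theorem\<close>

lemma norm_cis_minus_1_le: "norm (cis x - 1) \<le> \<bar>x\<bar>"
  using iexp_approx1[of x 0] by (simp add: cis_conv_exp)

lemma norm_cis_taylor2_le: "norm (cis x - (1 + \<i> * x - x\<^sup>2 / 2)) \<le> \<bar>x\<bar> ^ 3"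
proof -
  have "norm (cis x - (1 + \<i> * x - x\<^sup>2 / 2)) \<le> \<bar>x\<bar> ^ 3 / 6"
    using iexp_approx1[of x 2] by (simp add: cis_conv_exp numeral_eq_Suc power2_eq_square field_simps)
  also have "\<dots> \<le> \<bar>x\<bar> ^ 3" by simp
  finally show ?thesis .
qed

lemma exp_minus_taylor1_le:
  fixes a :: real
  assumes "0 \<le> a"
  shows "\<bar>exp (- a) - (1 - a)\<bar> \<le> a\<^sup>2"
proof -
  have "exp (- a) \<le> 1 / (1 + a)"
    using exp_ge_add_one_self[of a] assms by (simp add: exp_minus field_simps)
  also have "\<dots> \<le> 1 - a + a\<^sup>2"
  proof -
    have "1 \<le> (1 - a + a\<^sup>2) * (1 + a)" using assms by (simp add: algebra_simps power2_eq_square)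
    then show ?thesis using assms by (simp add: divide_le_eq)
  qed
  finally have "exp (- a) \<le> 1 - a + a\<^sup>2" .
  moreover have "1 - a \<le> exp (- a)" using exp_ge_add_one_self[of "- a"] by simp
  ultimately show ?thesis by simp
qed

lemma exp_lipschitz_le:
  fixes a b :: real
  assumes "a \<le> c" "b \<le> c"
  shows "\<bar>exp a - exp b\<bar> \<le> exp c * \<bar>a - b\<bar>"
proof -
  have *: "exp a - exp b \<le> exp c * (a - b)" if "b \<le> a" "a \<le> c" for a b :: real
  proof -
    have "exp a - exp b = exp a * (1 - exp (b - a))" by (simp add: exp_diff field_simps)
    also have "\<dots> \<le> exp c * (a - b)"
    proof (rule mult_mono)
      show "1 - exp (b - a) \<le> a - b" using exp_ge_add_one_self[of "b - a"] by linarith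
    qed (use that in auto)
    finally show ?thesis .
  qed
  show ?thesis
  proof (cases "b \<le> a")
    case True
    then show ?thesis using *[of b a] assms by simp
  next
    case False
    then show ?thesis using *[of a b] assms by simp
  qed
qed

context elliptic_process
begin

text \<open>The Doob martingale of \<open>psum f N\<close>, its increments, and their conditional second moments. The latter depend
  only on the first coordinate; they are written as functions of a pair so that the variance bound applies to their sum.\<close>

definition mart :: "(nat \<Rightarrow> 'a \<times> 'a \<Rightarrow> real) \<Rightarrow> nat \<Rightarrow> nat \<Rightarrow> 'w \<Rightarrow> real" where
  "mart f N n w = psum f n w + cum f (N - n) n (X n w) - expectation (psum f N)"

definition incr :: "(nat \<Rightarrow> 'a \<times> 'a \<Rightarrow> real) \<Rightarrow> nat \<Rightarrow> nat \<Rightarrow> 'a \<Rightarrow> 'a \<Rightarrow> real" where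
  "incr f N n x y = f n (x, y) + cum f (N - Suc n) (Suc n) y - cum f (N - n) n x"

definition qvar :: "(nat \<Rightarrow> 'a \<times> 'a \<Rightarrow> real) \<Rightarrow> nat \<Rightarrow> nat \<Rightarrow> 'a \<times> 'a \<Rightarrow> real" where
  "qvar f N n z = (if n < N then \<integral>y. (incr f N n (fst z) y)\<^sup>2 \<partial>K n (fst z) else 0)"

lemma psum_bound:
  assumes f: "bounded_functional f R" and "w \<in> space P"
  shows "\<bar>psum f n w\<bar> \<le> real n * R"
proof -
  have "\<bar>psum f n w\<bar> \<le> (\<Sum>k<n. R)" unfolding psum_def
    by (rule order_trans[OF sum_abs sum_mono[OF bounded_functional_bound[OF f]]]) (use assms in auto)
  then show ?thesis by simp
qed

lemma psum_measurable [measurable]: "bounded_functional f R \<Longrightarrow> psum f n \<in> borel_measurable P"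
  by (rule measurable_psum) (rule bounded_functional_measurable)

lemma psum_measurable_F:
  assumes "bounded_functional f R"
  shows "psum f n \<in> borel_measurable (F n)"
proof -
  note [measurable] = bounded_functional_measurable[OF assms]
  have [measurable]: "X i \<in> F n \<rightarrow>\<^sub>M B i" if "i \<le> n" for i using adapted[OF that] .
  have "(\<lambda>w. f i (X i w, X (Suc i) w)) \<in> borel_measurable (F n)" if "i < n" for i
  proof -
    have [measurable]: "X i \<in> F n \<rightarrow>\<^sub>M B i" "X (Suc i) \<in> F n \<rightarrow>\<^sub>M B (Suc i)"
      using that by (auto intro!: adapted)
    show ?thesis by measurable
  qed
  then show ?thesis unfolding psum_def[abs_def] by (intro borel_measurable_sum) auto
qed

lemma psum_integrable: "bounded_functional f R \<Longrightarrow> integrable P (psum f n)"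
  by (rule P_integrable[where c="real n * R"]) (auto simp: psum_bound)

lemma expectation_psum:
  assumes "bounded_functional f R"
  shows "expectation (psum f N) = expectation (\<lambda>w. cum f N 0 (X 0 w))"
  using cum_expectation[OF assms, of "\<lambda>_. 1" 0 1 N]
  by (simp add: psum_def[abs_def] atLeast0LessThan)

lemma cum_expectation_osc:
  assumes f: "bounded_functional f R" and "x \<in> space (B n)"
  shows "\<bar>cum f k n x - expectation (\<lambda>w. cum f k n (X n w))\<bar> \<le> 4 * R / e"
proof -
  note [measurable] = measurable_cum[OF f]
  have i: "integrable P (\<lambda>w. cum f k n (X n w))"
    by (rule P_integrable[where c="real k * R"]) (use cum_bound[OF f] in auto)
  have "cum f k n x - expectation (\<lambda>w. cum f k n (X n w)) = expectation (\<lambda>w. cum f k n x - cum f k n (X n w))"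
    using i by (simp add: prob_space)
  also have "\<bar>\<dots>\<bar> \<le> expectation (\<lambda>w. \<bar>cum f k n x - cum f k n (X n w)\<bar>)" by (rule integral_abs_bound)
  also have "\<dots> \<le> expectation (\<lambda>w. 4 * R / e)"
    using i by (intro integral_mono cum_osc[OF f]) (use assms in auto)
  finally show ?thesis by (simp add: prob_space)
qed

context
  fixes f :: "nat \<Rightarrow> 'a \<times> 'a \<Rightarrow> real" and R :: real and N :: nat
  assumes f: "bounded_functional f R"
begin

lemma R_le: "R \<le> R / e"
  using bounded_functional_nonneg[OF f] e_pos e_less_1 by (simp add: field_simps mult_left_le)

lemma R_nonneg: "0 \<le> R" by (rule bounded_functional_nonneg[OF f])

lemma mart_Suc:
  assumes "n < N"
  shows "mart f N (Suc n) w = mart f N n w + incr f N n (X n w) (X (Suc n) w)"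
  by (simp add: mart_def incr_def psum_def)

lemma mart_0_bound: "w \<in> space P \<Longrightarrow> \<bar>mart f N 0 w\<bar> \<le> 6 * R / e"
proof -
  assume "w \<in> space P"
  then have "\<bar>mart f N 0 w\<bar> \<le> 4 * R / e"
    unfolding mart_def expectation_psum[OF f] using cum_expectation_osc[OF f, of "X 0 w" 0 N] by (simp add: psum_def)
  \<comment> \<open>The bound is weakened to the constant of the increments, so that one constant D
    serves for both.\<close>
  also have "\<dots> \<le> 6 * R / e" using R_nonneg e_pos by (simp add: divide_right_mono)
  finally show ?thesis .
qed

lemma mart_N: "mart f N N w = psum f N w - expectation (psum f N)"
  by (simp add: mart_def)

lemma mart_measurable: "mart f N n \<in> borel_measurable (F n)"
proof -
  note [measurable] = psum_measurable_F[OF f] measurable_cum[OF f]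
  show ?thesis unfolding mart_def[abs_def] by measurable
qed

lemma incr_measurable: "(\<lambda>(x, y). incr f N n x y) \<in> borel_measurable (B n \<Otimes>\<^sub>M B (Suc n))"
proof -
  note [measurable] = bounded_functional_measurable[OF f] measurable_cum[OF f]
  show ?thesis unfolding incr_def[abs_def] by measurable
qed

lemma incr_measurable2 [measurable]: "x \<in> space (B n) \<Longrightarrow> incr f N n x \<in> borel_measurable (B (Suc n))"
  using measurable_compose[OF measurable_Pair1' incr_measurable] by simp

text \<open>The increment is g y minus the mean of g under \<open>K n x\<close>, where g is
  \<open>f n\<close> plus the remaining conditional sum. The oscillation of g is at most 2R from f
  plus 4R/e from \<open>cum_osc\<close>, uniformly in N; R \<le> R/e merges the two.\<close>

lemma incr_bound:
  assumes n: "n < N" and x: "x \<in> space (B n)" and y: "y \<in> space (B (Suc n))"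
  shows "\<bar>incr f N n x y\<bar> \<le> 6 * R / e"
proof -
  note [measurable] = bounded_functional_measurable[OF f] measurable_cum[OF f]
  define k where "k = N - Suc n"
  have k: "N - n = Suc k" using n by (simp add: k_def)
  let ?g = "\<lambda>y. f n (x, y) + cum f k (Suc n) y"
  have gm [measurable]: "?g \<in> borel_measurable (B (Suc n))" using x by measurable
  have gb: "\<bar>?g y\<bar> \<le> R + real k * R" if "y \<in> space (B (Suc n))" for y
    using bounded_functional_bound[OF f x that] cum_bound[OF f that, of k] by linarith
  have gi: "integrable (K n x) ?g" by (rule kernel_integrable[OF x gm]) (use gb in auto)
  have "incr f N n x y = ?g y - (\<integral>z. ?g z \<partial>K n x)"
    by (simp add: incr_def k cum.simps(2) k_def)
  also have "\<dots> = (\<integral>z. ?g y - ?g z \<partial>K n x)"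
    using x gi by (subst Bochner_Integration.integral_diff) (auto intro!: kernel_integrable)
  also have "\<bar>\<dots>\<bar> \<le> 2 * R + 4 * R / e"
  proof (rule kernel_integral_abs_le[OF x])
    show "\<bar>?g y - ?g z\<bar> \<le> 2 * R + 4 * R / e" if z: "z \<in> space (B (Suc n))" for z
      using bounded_functional_bound[OF f x y] bounded_functional_bound[OF f x z] cum_osc[OF f y z, of k] by linarith
  qed measurable
  also have "\<dots> \<le> 6 * R / e" using R_le by simp
  finally show ?thesis .
qed

lemma incr_mean:
  assumes n: "n < N" and x: "x \<in> space (B n)"
  shows "(\<integral>y. incr f N n x y \<partial>K n x) = 0"
proof -
  note [measurable] = bounded_functional_measurable[OF f] measurable_cum[OF f]
  define k where "k = N - Suc n"
  have k: "N - n = Suc k" using n by (simp add: k_def)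
  let ?g = "\<lambda>y. f n (x, y) + cum f k (Suc n) y"
  have gm [measurable]: "?g \<in> borel_measurable (B (Suc n))" using x by measurable
  have gb: "\<bar>?g y\<bar> \<le> R + real k * R" if "y \<in> space (B (Suc n))" for y
    using bounded_functional_bound[OF f x that] cum_bound[OF f that, of k] by linarith
  have gi: "integrable (K n x) ?g" by (rule kernel_integrable[OF x gm]) (use gb in auto)
  have "(\<integral>y. incr f N n x y \<partial>K n x) = (\<integral>y. ?g y - cum f (Suc k) n x \<partial>K n x)"
    by (simp add: incr_def k k_def)
  also have "\<dots> = (\<integral>y. ?g y \<partial>K n x) - cum f (Suc k) n x"
    using x gi by (subst Bochner_Integration.integral_diff) (auto intro!: kernel_integrable)
  finally show ?thesis by (simp add: cum.simps(2))
qed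

lemma qvar_bound:
  assumes x: "x \<in> space (B n)"
  shows "0 \<le> qvar f N n (x, y)" "qvar f N n (x, y) \<le> (6 * R / e)\<^sup>2"
proof -
  show "0 \<le> qvar f N n (x, y)" by (simp add: qvar_def)
  have "\<bar>\<integral>y. (incr f N n x y)\<^sup>2 \<partial>K n x\<bar> \<le> (6 * R / e)\<^sup>2" if "n < N"
    using incr_bound[OF that x] x
    by (intro kernel_integral_abs_le) (auto intro!: square_le_of_abs_le)
  then show "qvar f N n (x, y) \<le> (6 * R / e)\<^sup>2" by (simp add: qvar_def)
qed

lemma qvar_functional: "bounded_functional (qvar f N) ((6 * R / e)\<^sup>2)"
  unfolding bounded_functional_def
proof (intro conjI allI ballI)
  fix n
  have *: "(\<lambda>x. \<integral>y. (incr f N n x y)\<^sup>2 \<partial>K n x) \<in> borel_measurable (B n)"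
  proof (rule measurable_kernel_integral)
    show "(\<lambda>(x, y). (incr f N n x y)\<^sup>2) \<in> borel_measurable (B n \<Otimes>\<^sub>M B (Suc n))"
      using borel_measurable_power[OF incr_measurable, of n 2] by (simp add: split_beta')
  qed simp
  show "qvar f N n \<in> borel_measurable (B n \<Otimes>\<^sub>M B (Suc n))"
  proof (cases "n < N")
    case True
    have "(\<lambda>z. \<integral>y. (incr f N n (fst z) y)\<^sup>2 \<partial>K n (fst z)) \<in> borel_measurable (B n \<Otimes>\<^sub>M B (Suc n))"
      by (rule measurable_compose[OF measurable_fst *])
    with True show ?thesis by (simp add: qvar_def[abs_def])
  qed (simp add: qvar_def[abs_def])
  show "\<bar>qvar f N n (x, y)\<bar> \<le> (6 * R / e)\<^sup>2" if "x \<in> space (B n)" for x y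
    using qvar_bound[OF that, of y] by simp
qed

lemma mart_bound: "w \<in> space P \<Longrightarrow> n \<le> N \<Longrightarrow> \<bar>mart f N n w\<bar> \<le> real (Suc n) * (6 * R / e)"
proof (induction n)
  case 0 then show ?case using mart_0_bound by simp
next
  case (Suc n)
  then have "\<bar>mart f N n w\<bar> \<le> real (Suc n) * (6 * R / e)" "n < N" by auto
  moreover have "\<bar>incr f N n (X n w) (X (Suc n) w)\<bar> \<le> 6 * R / e"
    using Suc by (intro incr_bound) auto
  moreover have "real (Suc (Suc n)) * (6 * R / e) = real (Suc n) * (6 * R / e) + 6 * R / e"
    by (subst of_nat_Suc) (simp only: distrib_right mult_1_left add.commute)
  ultimately show ?case unfolding mart_Suc[OF \<open>n < N\<close>] by linarith
qed

text \<open>Orthogonality of increments: the cross term vanishes by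
  \<open>incr_mean\<close>.\<close>

lemma mart_square_step:
  assumes n: "n < N"
  shows "expectation (\<lambda>w. (mart f N (Suc n) w)\<^sup>2)
    = expectation (\<lambda>w. (mart f N n w)\<^sup>2) + expectation (\<lambda>w. qvar f N n (X n w, X (Suc n) w))"
proof -
  let ?D = "6 * R / e" and ?M = "real (Suc n) * (6 * R / e)"
  have D: "0 \<le> ?D" using R_nonneg e_pos by simp
  note [measurable] = mart_measurable incr_measurable
  have [measurable]: "mart f N n \<in> borel_measurable P" by (rule measurable_F[OF mart_measurable])
  note [measurable] = bounded_functional_measurable[OF qvar_functional]
  have mb: "\<bar>mart f N n w\<bar> \<le> ?M" if "w \<in> space P" for w using mart_bound[OF that] n by simp
  have "expectation (\<lambda>w. (mart f N (Suc n) w)\<^sup>2)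
      = expectation (\<lambda>w. (mart f N n w + incr f N n (X n w) (X (Suc n) w))\<^sup>2)"
    by (simp add: mart_Suc[OF n])
  also have "\<dots> = expectation (\<lambda>w. \<integral>y. (mart f N n w + incr f N n (X n w) y)\<^sup>2 \<partial>K n (X n w))"
  proof (rule markov_step[where c="(?M + ?D)\<^sup>2"])
    show "(\<lambda>(w, y). (mart f N n w + incr f N n (X n w) y)\<^sup>2) \<in> borel_measurable (F n \<Otimes>\<^sub>M B (Suc n))"
      by measurable
    show "\<bar>(mart f N n w + incr f N n (X n w) y)\<^sup>2\<bar> \<le> (?M + ?D)\<^sup>2"
      if "w \<in> space P" "y \<in> space (B (Suc n))" for w y
      unfolding abs_power2 using that
      by (intro square_le_of_abs_le order_trans[OF abs_triangle_ineq] add_mono mb incr_bound[OF n]) auto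
  qed
  also have "\<dots> = expectation (\<lambda>w. (mart f N n w)\<^sup>2 + qvar f N n (X n w, X (Suc n) w))"
  proof (intro Bochner_Integration.integral_cong refl)
    fix w assume w: "w \<in> space P"
    then have x: "X n w \<in> space (B n)" by simp
    have i1: "integrable (K n (X n w)) (\<lambda>y. incr f N n (X n w) y)"
      using incr_bound[OF n x] x by (intro kernel_integrable[where c="?D"]) auto
    have i2: "integrable (K n (X n w)) (\<lambda>y. (incr f N n (X n w) y)\<^sup>2)"
      using x by (intro kernel_integrable[where c="?D\<^sup>2"]) (auto intro!: square_le_of_abs_le incr_bound[OF n x])
    have "(\<integral>y. (mart f N n w + incr f N n (X n w) y)\<^sup>2 \<partial>K n (X n w))
        = (\<integral>y. (mart f N n w)\<^sup>2 + 2 * mart f N n w * incr f N n (X n w) y + (incr f N n (X n w) y)\<^sup>2 \<partial>K n (X n w))"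
      by (simp add: power2_sum algebra_simps)
    also have "\<dots> = (mart f N n w)\<^sup>2 + 2 * mart f N n w * (\<integral>y. incr f N n (X n w) y \<partial>K n (X n w))
        + (\<integral>y. (incr f N n (X n w) y)\<^sup>2 \<partial>K n (X n w))"
      using x i1 i2 by (simp add: kernel_integrable[OF x, where c="\<bar>(mart f N n w)\<^sup>2\<bar>"])
    finally show "(\<integral>y. (mart f N n w + incr f N n (X n w) y)\<^sup>2 \<partial>K n (X n w))
        = (mart f N n w)\<^sup>2 + qvar f N n (X n w, X (Suc n) w)"
      using n by (simp add: incr_mean[OF n x] qvar_def)
  qed
  also have "\<dots> = expectation (\<lambda>w. (mart f N n w)\<^sup>2) + expectation (\<lambda>w. qvar f N n (X n w, X (Suc n) w))"
  proof (rule Bochner_Integration.integral_add)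
    show "integrable P (\<lambda>w. (mart f N n w)\<^sup>2)"
      by (rule P_integrable[where c="?M\<^sup>2"]; (unfold real_norm_def abs_power2)?)
        (measurable, rule square_le_of_abs_le[OF mb])
    show "integrable P (\<lambda>w. qvar f N n (X n w, X (Suc n) w))"
      by (rule P_integrable[where c="?D\<^sup>2"]) (use qvar_bound in auto)
  qed
  finally show ?thesis .
qed

lemma mart_square:
  "n \<le> N \<Longrightarrow> expectation (\<lambda>w. (mart f N n w)\<^sup>2)
    = expectation (\<lambda>w. (mart f N 0 w)\<^sup>2) + expectation (psum (qvar f N) n)"
proof (induction n)
  case 0 show ?case by (simp add: psum_def)
next
  case (Suc n)
  note [measurable] = bounded_functional_measurable[OF qvar_functional]
  have "expectation (psum (qvar f N) (Suc n)) = expectation (\<lambda>w. psum (qvar f N) n w + qvar f N n (X n w, X (Suc n) w))"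
    by (simp add: psum_def[abs_def])
  also have "\<dots> = expectation (psum (qvar f N) n) + expectation (\<lambda>w. qvar f N n (X n w, X (Suc n) w))"
    by (rule Bochner_Integration.integral_add[OF psum_integrable[OF qvar_functional]])
      (rule P_integrable[where c="(6 * R / e)\<^sup>2"]; use qvar_bound in auto)
  finally show ?case using Suc mart_square_step[of n] by simp
qed

text \<open>The quadratic variation is itself an additive functional with values in [0, D^2], so
  \<open>variance_psum_le\<close> applies to it. Its second moments are at most D^2 times its means,
  which makes its variance of order V and not V^2; hence it deviates from V by order sqrt V in mean.
  The extra D^2 bounds the second moment of \<open>mart f N 0\<close>, by which V exceeds the mean
  of the quadratic variation.\<close>

lemma qvar_concentration:
  defines "D \<equiv> 6 * R / e" and "V \<equiv> variance (psum f N)"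
  shows "expectation (psum (qvar f N) N) \<le> V"
    and "expectation (\<lambda>w. \<bar>psum (qvar f N) N w - V\<bar>) \<le> sqrt ((4 + 16 / e ^ 4) * D\<^sup>2 * V) + D\<^sup>2"
proof -
  let ?Q = "psum (qvar f N) N"
  have D: "0 \<le> D" using R_nonneg e_pos by (simp add: D_def)
  note [measurable] = bounded_functional_measurable[OF qvar_functional]
  have V: "V = expectation (\<lambda>w. (mart f N 0 w)\<^sup>2) + expectation ?Q"
    using mart_square[of N] by (simp add: V_def mart_N)
  have m0: "0 \<le> expectation (\<lambda>w. (mart f N 0 w)\<^sup>2)" by simp
  have m1: "expectation (\<lambda>w. (mart f N 0 w)\<^sup>2) \<le> D\<^sup>2"
  proof -
    have [measurable]: "mart f N 0 \<in> borel_measurable P" by (rule measurable_F[OF mart_measurable])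
    have b: "(mart f N 0 w)\<^sup>2 \<le> D\<^sup>2" if "w \<in> space P" for w
      unfolding D_def by (rule square_le_of_abs_le[OF mart_0_bound[OF that]])
    have "expectation (\<lambda>w. (mart f N 0 w)\<^sup>2) \<le> expectation (\<lambda>w. D\<^sup>2)"
      using b by (intro integral_mono P_integrable[where c="D\<^sup>2"]) auto
    then show ?thesis by (simp add: prob_space)
  qed
  show EQ: "expectation ?Q \<le> V" using V m0 by simp
  have qi: "integrable P (\<lambda>w. qvar f N n (X n w, X (Suc n) w))" for n
    by (rule P_integrable[where c="D\<^sup>2"]) (use qvar_bound in \<open>auto simp: D_def\<close>)
  have "second_moment (qvar f N) n \<le> D\<^sup>2 * expectation (\<lambda>w. qvar f N n (X n w, X (Suc n) w))" for n
  proof -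
    have "second_moment (qvar f N) n \<le> expectation (\<lambda>w. D\<^sup>2 * qvar f N n (X n w, X (Suc n) w))"
      unfolding second_moment_def
    proof (rule integral_mono)
      show le: "(qvar f N n (X n w, X (Suc n) w))\<^sup>2 \<le> D\<^sup>2 * qvar f N n (X n w, X (Suc n) w)" if "w \<in> space P" for w
        unfolding power2_eq_square[of "qvar f N n (X n w, X (Suc n) w)"] D_def
        using qvar_bound[of "X n w" n "X (Suc n) w"] that by (intro mult_right_mono) auto
      show "integrable P (\<lambda>w. (qvar f N n (X n w, X (Suc n) w))\<^sup>2)"
      proof (rule P_integrable[where c="(D\<^sup>2)\<^sup>2"])
        show "norm ((qvar f N n (X n w, X (Suc n) w))\<^sup>2) \<le> (D\<^sup>2)\<^sup>2" if "w \<in> space P" for w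
          unfolding real_norm_def abs_power2 D_def using that by (intro power_mono qvar_bound) auto
      qed measurable
    qed (use qi in simp)
    then show ?thesis by simp
  qed
  then have "(\<Sum>n<N. second_moment (qvar f N) n) \<le> (\<Sum>n<N. D\<^sup>2 * expectation (\<lambda>w. qvar f N n (X n w, X (Suc n) w)))"
    by (rule sum_mono)
  also have "\<dots> = D\<^sup>2 * expectation ?Q"
    unfolding psum_def using qi by (simp add: sum_distrib_left)
  also have "\<dots> \<le> D\<^sup>2 * V" using EQ by (intro mult_left_mono) auto
  finally have "(\<Sum>n<N. second_moment (qvar f N) n) \<le> D\<^sup>2 * V" .
  then have var: "variance ?Q \<le> (4 + 16 / e ^ 4) * D\<^sup>2 * V"
    using variance_psum_le[OF qvar_functional, of N] e_pos
    by (smt (verit, best) mult.assoc mult_left_mono zero_le_divide_iff zero_le_power)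
  have Qi: "integrable P ?Q" by (rule psum_integrable[OF qvar_functional])
  have Q2i: "integrable P (\<lambda>w. \<bar>?Q w - expectation ?Q\<bar>\<^sup>2)"
  proof (rule P_integrable[where c="(real N * (6 * R / e)\<^sup>2 + \<bar>expectation ?Q\<bar>)\<^sup>2"])
    have [measurable]: "?Q \<in> borel_measurable P" by (rule psum_measurable[OF qvar_functional])
    show "(\<lambda>w. \<bar>?Q w - expectation ?Q\<bar>\<^sup>2) \<in> borel_measurable P" by measurable
    show "norm (\<bar>?Q w - expectation ?Q\<bar>\<^sup>2) \<le> (real N * (6 * R / e)\<^sup>2 + \<bar>expectation ?Q\<bar>)\<^sup>2" if "w \<in> space P" for w
      unfolding real_norm_def abs_power2 power2_abs
      by (intro square_le_of_abs_le order_trans[OF abs_triangle_ineq4] add_mono psum_bound[OF qvar_functional that] order_refl)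
  qed
  have "(expectation (\<lambda>w. \<bar>?Q w - expectation ?Q\<bar>))\<^sup>2 \<le> variance ?Q"
    using expectation_square_le[OF _ Q2i] Qi by simp
  then have "(expectation (\<lambda>w. \<bar>?Q w - expectation ?Q\<bar>))\<^sup>2 \<le> (4 + 16 / e ^ 4) * D\<^sup>2 * V"
    using var by linarith
  then have 1: "expectation (\<lambda>w. \<bar>?Q w - expectation ?Q\<bar>) \<le> sqrt ((4 + 16 / e ^ 4) * D\<^sup>2 * V)"
    by (rule real_le_rsqrt)
  have "expectation (\<lambda>w. \<bar>?Q w - V\<bar>) \<le> expectation (\<lambda>w. \<bar>?Q w - expectation ?Q\<bar> + D\<^sup>2)"
  proof (rule integral_mono)
    show "\<bar>?Q w - V\<bar> \<le> \<bar>?Q w - expectation ?Q\<bar> + D\<^sup>2" for w using V m0 m1 by linarith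
  qed (use Qi in auto)
  also have "\<dots> = expectation (\<lambda>w. \<bar>?Q w - expectation ?Q\<bar>) + D\<^sup>2"
    using Qi by (simp add: prob_space)
  finally show "expectation (\<lambda>w. \<bar>?Q w - V\<bar>) \<le> sqrt ((4 + 16 / e ^ 4) * D\<^sup>2 * V) + D\<^sup>2"
    using 1 by linarith
qed

end

end

lemma abs_cube: "\<bar>x\<bar> ^ 3 = \<bar>x\<bar> * (x::real)\<^sup>2"
  by (simp only: power3_eq_cube power2_eq_square mult.assoc abs_mult_self_eq)

lemma power4_eq_square: "x ^ 4 = x\<^sup>2 * (x::real)\<^sup>2"
  by (simp flip: power_add)

lemma norm_integral_le:
  fixes f :: "'a \<Rightarrow> 'b::{banach,second_countable_topology}"
  assumes f: "integrable M f" and g: "integrable M g"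
    and le: "\<And>x. x \<in> space M \<Longrightarrow> norm (f x) \<le> g x"
  shows "norm (\<integral>x. f x \<partial>M) \<le> (\<integral>x. g x \<partial>M)"
proof -
  have "norm (\<integral>x. f x \<partial>M) \<le> (\<integral>x. norm (f x) \<partial>M)" by (rule integral_norm_bound)
  also have "\<dots> \<le> (\<integral>x. g x \<partial>M)"
    by (rule integral_mono[OF integrable_norm[OF f] g le])
  finally show ?thesis .
qed

lemma borel_measurable_cis [measurable]: "cis \<in> borel_measurable borel"
  by (intro borel_measurable_continuous_onI continuous_intros)

context elliptic_process
begin

context
  fixes f :: "nat \<Rightarrow> 'a \<times> 'a \<Rightarrow> real" and R :: real and N :: nat
  assumes f: "bounded_functional f R"
begin

text \<open>The linear Taylor term vanishes by \<open>incr_mean\<close>. The cubic remainder is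
  bounded by D times the second moment, so the errors of all steps together are of the order of the
  total quadratic variation.\<close>

lemma incr_char_approx:
  assumes n: "n < N" and x: "x \<in> space (B n)"
  shows "norm ((\<integral>y. cis (u * incr f N n x y) \<partial>K n x) - (1 - u\<^sup>2 * qvar f N n (x, y) / 2))
    \<le> \<bar>u\<bar> ^ 3 * (6 * R / e) * qvar f N n (x, y)"
proof -
  let ?D = "6 * R / e" and ?i = "incr f N n x"
  note [measurable] = incr_measurable2[OF f, of x n N, OF x]
  have b: "\<bar>?i y\<bar> \<le> ?D" if "y \<in> space (B (Suc n))" for y by (rule incr_bound[OF f n x that])
  have D: "0 \<le> ?D" using R_nonneg[OF f] e_pos by simp
  have i0: "integrable (K n x) (\<lambda>y. cis (u * ?i y))"
  proof (rule kernel_integrable[OF x, where c=1])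
    show "(\<lambda>y. cis (u * ?i y)) \<in> borel_measurable (B (Suc n))" by measurable
  qed simp
  have i1: "integrable (K n x) ?i" using b by (intro kernel_integrable[OF x, where c="?D"]) auto
  have i2: "integrable (K n x) (\<lambda>y. (?i y)\<^sup>2)"
    using b by (intro kernel_integrable[OF x, where c="?D\<^sup>2"]) (auto intro!: square_le_of_abs_le)
  have i3: "integrable (K n x) (\<lambda>y. \<bar>u * ?i y\<bar> ^ 3)"
    using b by (intro kernel_integrable[OF x, where c="(\<bar>u\<bar> * ?D) ^ 3"])
      (auto intro!: power_mono mult_left_mono simp: abs_mult simp del: times_divide_eq_right)
  have h1: "integrable (K n x) (\<lambda>y. 1 :: complex)" by (rule kernel_integrable[OF x, where c=1]) auto
  have h2: "integrable (K n x) (\<lambda>y. \<i> * of_real u * of_real (?i y))" using i1 by simp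
  have h3: "integrable (K n x) (\<lambda>y. of_real (u\<^sup>2 / 2) * of_real ((?i y)\<^sup>2) :: complex)"
    using integrable_of_real[OF i2] by (rule integrable_mult_right)
  have q: "qvar f N n (x, y) = (\<integral>y. (?i y)\<^sup>2 \<partial>K n x)" using n by (simp add: qvar_def)
  have "(\<integral>y. 1 + \<i> * of_real (u * ?i y) - of_real ((u * ?i y)\<^sup>2 / 2) \<partial>K n x)
      = (\<integral>y. 1 + \<i> * of_real u * of_real (?i y) - of_real (u\<^sup>2 / 2) * of_real ((?i y)\<^sup>2) \<partial>K n x)"
    by (intro Bochner_Integration.integral_cong refl) (simp add: power_mult_distrib)
  also have "\<dots> = 1 + \<i> * of_real u * of_real (\<integral>y. ?i y \<partial>K n x) - of_real (u\<^sup>2 / 2) * of_real (\<integral>y. (?i y)\<^sup>2 \<partial>K n x)"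
  proof -
    have "(\<integral>y. of_real (u\<^sup>2 / 2) * of_real ((?i y)\<^sup>2) \<partial>K n x) = complex_of_real (u\<^sup>2 / 2) * of_real (\<integral>y. (?i y)\<^sup>2 \<partial>K n x)"
      using i2 by (simp del: of_real_power)
    then show ?thesis
      unfolding Bochner_Integration.integral_diff[OF Bochner_Integration.integrable_add[OF h1 h2] h3]
        Bochner_Integration.integral_add[OF h1 h2] integral_mult_right_zero integral_of_real
        kernel_integral_const[OF x] by simp
  qed
  also have "\<dots> = 1 - of_real (u\<^sup>2 * qvar f N n (x, y) / 2)"
    by (simp add: incr_mean[OF f n x] q)
  finally have eq: "(\<integral>y. 1 + \<i> * of_real (u * ?i y) - of_real ((u * ?i y)\<^sup>2 / 2) \<partial>K n x)
      = 1 - of_real (u\<^sup>2 * qvar f N n (x, y) / 2)" .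
  have i4: "integrable (K n x) (\<lambda>y. 1 + \<i> * of_real (u * ?i y) - of_real ((u * ?i y)\<^sup>2 / 2) :: complex)"
  proof -
    have eq: "(\<lambda>y. 1 + \<i> * of_real (u * ?i y) - of_real ((u * ?i y)\<^sup>2 / 2) :: complex)
        = (\<lambda>y. 1 + \<i> * of_real u * of_real (?i y) - of_real (u\<^sup>2 / 2) * of_real ((?i y)\<^sup>2))"
      by (simp add: fun_eq_iff power_mult_distrib)
    show ?thesis unfolding eq
      by (rule Bochner_Integration.integrable_diff[OF Bochner_Integration.integrable_add[OF h1 h2] h3])
  qed
  have "norm ((\<integral>y. cis (u * ?i y) \<partial>K n x) - (1 - of_real (u\<^sup>2 * qvar f N n (x, y) / 2)))
      = norm (\<integral>y. cis (u * ?i y) - (1 + \<i> * of_real (u * ?i y) - of_real ((u * ?i y)\<^sup>2 / 2)) \<partial>K n x)"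
    unfolding eq[symmetric] Bochner_Integration.integral_diff[OF i0 i4] ..
  also have "\<dots> \<le> (\<integral>y. \<bar>u * ?i y\<bar> ^ 3 \<partial>K n x)"
    using norm_cis_taylor2_le[of "u * ?i y" for y] i3 i0 i4
    by (intro norm_integral_le) auto
  also have "\<dots> \<le> (\<integral>y. \<bar>u\<bar> ^ 3 * ?D * (?i y)\<^sup>2 \<partial>K n x)"
  proof (rule integral_mono)
    show "integrable (K n x) (\<lambda>y. \<bar>u\<bar> ^ 3 * ?D * (?i y)\<^sup>2)" using i2 by simp
    show "\<bar>u * ?i y\<bar> ^ 3 \<le> \<bar>u\<bar> ^ 3 * ?D * (?i y)\<^sup>2" if "y \<in> space (K n x)" for y
    proof -
      have "\<bar>?i y\<bar> ^ 3 = \<bar>?i y\<bar> * (?i y)\<^sup>2"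
        by (rule abs_cube)
      then have "\<bar>u * ?i y\<bar> ^ 3 = \<bar>u\<bar> ^ 3 * (\<bar>?i y\<bar> * (?i y)\<^sup>2)"
        by (simp add: abs_mult power_mult_distrib)
      also have "\<dots> \<le> \<bar>u\<bar> ^ 3 * (?D * (?i y)\<^sup>2)"
        using b[of y] that x by (intro mult_left_mono mult_right_mono) auto
      finally show ?thesis by (simp only: mult.assoc)
    qed
  qed (fact i3)
  also have "\<dots> = \<bar>u\<bar> ^ 3 * ?D * qvar f N n (x, y)" by (simp add: q)
  finally show ?thesis by simp
qed

text \<open>The characteristic function of the martingale is multiplied by the exponential of half the quadratic variation.
  Truncating the latter at \<open>2 * V\<close> keeps the product bounded, at a cost controlled by the concentration of the
  quadratic variation around \<open>V\<close>.\<close>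

lemma clt_bound:
  defines "D \<equiv> 6 * R / e" and "V \<equiv> variance (psum f N)"
  assumes V: "0 < V"
  shows "norm (expectation (\<lambda>w. cis (s / sqrt V * (psum f N w - expectation (psum f N)))) - exp (- s\<^sup>2 / 2))
    \<le> exp (s\<^sup>2) * (\<bar>s\<bar> ^ 3 * D / sqrt V + s ^ 4 * D\<^sup>2 / V
        + s\<^sup>2 / V * (sqrt ((4 + 16 / e ^ 4) * D\<^sup>2 * V) + D\<^sup>2) + \<bar>s\<bar> * D / sqrt V)"
proof -
  define u where "u = s / sqrt V"
  have u2: "u\<^sup>2 = s\<^sup>2 / V" using V by (simp add: u_def power_divide)
  have u2V: "u\<^sup>2 * V = s\<^sup>2" using V by (simp add: u2)
  have D: "0 \<le> D" using R_nonneg[OF f] e_pos by (simp add: D_def)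
  let ?q = "\<lambda>n w. qvar f N n (X n w, X (Suc n) w)"
  define Q where "Q n = psum (qvar f N) n" for n
  define m where "m n w = min (Q n w) (2 * V)" for n w
  define E where "E n w = exp (u\<^sup>2 * m n w / 2)" for n w
  define T where "T n w = cis (u * mart f N n w) * of_real (E n w)" for n w
  define c where "c = \<bar>u\<bar> ^ 3 * D + u ^ 4 * D\<^sup>2"
  \<comment> \<open>A majorant that telescopes: its increments dominate those of \<open>T\<close>.
    The term with \<open>c\<close> collects the Taylor errors, proportional to the quadratic
    variation; the other collects the part of the quadratic variation cut off by the
    truncation.\<close>
  define W where "W n w = exp (s\<^sup>2) * (c * Q n w + u\<^sup>2 / 2 * (Q n w - m n w))" for n w
  note qf = qvar_functional[OF f, of N]
  note [measurable] = bounded_functional_measurable[OF qf]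
  have [measurable]: "Q n \<in> borel_measurable P" for n unfolding Q_def by (rule psum_measurable[OF qf])
  have QF [measurable]: "Q n \<in> borel_measurable (F n)" for n unfolding Q_def by (rule psum_measurable_F[OF qf])
  have mF [measurable]: "mart f N n \<in> borel_measurable (F n)" for n by (rule mart_measurable[OF f])
  have [measurable]: "mart f N n \<in> borel_measurable P" for n by (rule measurable_F[OF mF])
  have [measurable]: "m n \<in> borel_measurable P" "E n \<in> borel_measurable P" for n
    unfolding m_def[abs_def] E_def[abs_def] by measurable
  have [measurable]: "T n \<in> borel_measurable P" "W n \<in> borel_measurable P" for n
    unfolding T_def[abs_def] W_def[abs_def] by measurable
  have q0: "0 \<le> ?q n w" and qD: "?q n w \<le> D\<^sup>2" if "w \<in> space P" for n w
    using qvar_bound[OF f, of "X n w" n N "X (Suc n) w"] that by (auto simp: D_def)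
  have Q_Suc: "Q (Suc n) w = Q n w + ?q n w" for n w by (simp add: Q_def psum_def)
  have Q0: "0 \<le> Q n w" if "w \<in> space P" for n w
    unfolding Q_def psum_def using q0[OF that] by (intro sum_nonneg) auto
  have Qb: "Q n w \<le> real n * D\<^sup>2" if "w \<in> space P" for n w
    using psum_bound[OF qf that, of n] by (simp add: Q_def D_def)
  have m0: "0 \<le> m n w" "m n w \<le> 2 * V" if "w \<in> space P" for n w
    using Q0[OF that] V by (auto simp: m_def)
  have Eb: "0 < E n w" "E n w \<le> exp (s\<^sup>2)" if "w \<in> space P" for n w
  proof -
    have "u\<^sup>2 * m n w / 2 \<le> u\<^sup>2 * (2 * V) / 2"
      using m0[OF that] by (intro divide_right_mono mult_left_mono) auto
    then show "E n w \<le> exp (s\<^sup>2)" by (simp add: E_def u2V)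
  qed (simp add: E_def)
  have Tb: "norm (T n w) \<le> exp (s\<^sup>2)" if "w \<in> space P" for n w
    using Eb[OF that, of n] by (simp add: T_def norm_mult)
  have Ti: "integrable P (T n)" for n by (rule P_integrable[OF _ Tb]) auto
  have Qi: "integrable P (Q n)" for n unfolding Q_def by (rule psum_integrable[OF qf])
  have mi: "integrable P (m n)" for n
    by (rule P_integrable[where c="2 * V"]) (use m0 in auto)
  have Wi: "integrable P (W n)" for n unfolding W_def[abs_def] using Qi mi by simp
  have step: "norm (expectation (T (Suc n)) - expectation (T n)) \<le> expectation (W (Suc n)) - expectation (W n)"
    if n: "n < N" for n
  proof -
    \<comment> \<open>\<open>G\<close> equals \<open>Q (Suc n)\<close> but is written as a function
      of the past at level \<open>n\<close>. The quadratic variation is thus predictable, and the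
      exponential factor can be pulled out of the integral over the next state.\<close>
    define G where "G w = Q n w + (\<integral>y. (incr f N n (X n w) y)\<^sup>2 \<partial>K n (X n w))" for w
    define E' where "E' w = exp (u\<^sup>2 * min (G w) (2 * V) / 2)" for w
    have GQ: "G w = Q (Suc n) w" for w using n by (simp add: G_def Q_Suc qvar_def)
    have EE: "E' w = E (Suc n) w" for w by (simp add: E'_def E_def m_def GQ)
    note [measurable] = incr_measurable[OF f, of N n]
    have [measurable]: "G \<in> borel_measurable (F n)" unfolding G_def[abs_def] by measurable
    have [measurable]: "E' \<in> borel_measurable (F n)" unfolding E'_def[abs_def] by measurable
    let ?psi = "\<lambda>w. \<integral>y. cis (u * incr f N n (X n w) y) \<partial>K n (X n w)"
    have "expectation (T (Suc n)) = expectation (\<lambda>w. (cis (u * mart f N n w) * of_real (E' w)) * cis (u * incr f N n (X n w) (X (Suc n) w)))"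
      by (intro Bochner_Integration.integral_cong refl)
        (simp add: T_def mart_Suc[OF f n] EE cis_mult[symmetric] distrib_left mult_ac)
    also have "\<dots> = expectation (\<lambda>w. \<integral>y. (cis (u * mart f N n w) * of_real (E' w)) * cis (u * incr f N n (X n w) y) \<partial>K n (X n w))"
    proof (rule markov_step_complex[where c="exp (s\<^sup>2)"])
      show "norm (cis (u * mart f N n w) * of_real (E' w) * cis (u * incr f N n (X n w) y)) \<le> exp (s\<^sup>2)"
        if "w \<in> space P" for w y
        using Eb[OF that, of "Suc n"] by (simp add: norm_mult EE)
    qed measurable
    also have "\<dots> = expectation (\<lambda>w. (cis (u * mart f N n w) * of_real (E' w)) * ?psi w)" by simp
    finally have ET: "expectation (T (Suc n)) = expectation (\<lambda>w. (cis (u * mart f N n w) * of_real (E' w)) * ?psi w)" .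
    have E'P [measurable]: "E' \<in> borel_measurable P" by (rule measurable_F) measurable
    have psiF: "?psi \<in> borel_measurable (F n)" by measurable
    have [measurable]: "?psi \<in> borel_measurable P" by (rule measurable_F[OF psiF])
    have psib: "norm (?psi w) \<le> 1" if "w \<in> space P" for w
      using that by (intro kernel_integral_bound) auto
    have i: "integrable P (\<lambda>w. (cis (u * mart f N n w) * of_real (E' w)) * ?psi w)"
    proof (rule P_integrable[where c="exp (s\<^sup>2) * 1"])
      show "norm (cis (u * mart f N n w) * of_real (E' w) * ?psi w) \<le> exp (s\<^sup>2) * 1" if "w \<in> space P" for w
        unfolding norm_mult[of _ "?psi w"] using Eb[OF that, of "Suc n"] psib[OF that]
        by (intro mult_mono) (auto simp: norm_mult EE)
    qed measurable
    have "norm (expectation (T (Suc n)) - expectation (T n))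
        = norm (expectation (\<lambda>w. (cis (u * mart f N n w) * of_real (E' w)) * ?psi w - T n w))"
      unfolding ET by (simp add: Bochner_Integration.integral_diff[OF i Ti])
    also have "\<dots> \<le> expectation (\<lambda>w. W (Suc n) w - W n w)"
    proof (rule norm_integral_le)
      fix w assume w: "w \<in> space P"
      define q where "q = ?q n w"
      define d where "d = m (Suc n) w - m n w"
      have d: "0 \<le> d" "d \<le> q" using q0[OF w, of n] by (auto simp: d_def q_def m_def Q_Suc)
      have q': "0 \<le> q" "q \<le> D\<^sup>2" using q0[OF w] qD[OF w] by (auto simp: q_def)
      have En: "E n w = E' w * exp (- (u\<^sup>2 * d / 2))"
        unfolding EE E_def d_def by (simp add: exp_add[symmetric] field_simps)
      have 1: "norm (?psi w - (1 - u\<^sup>2 * q / 2)) \<le> \<bar>u\<bar> ^ 3 * D * q"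
        using incr_char_approx[OF n, of "X n w" u "X (Suc n) w"] w by (simp add: q_def D_def)
      have "\<bar>exp (- (u\<^sup>2 * d / 2)) - (1 - u\<^sup>2 * d / 2)\<bar> \<le> (u\<^sup>2 * d / 2)\<^sup>2"
        using d by (intro exp_minus_taylor1_le) auto
      also have "\<dots> \<le> (u\<^sup>2 * d)\<^sup>2" using d by (intro power_mono) auto
      also have "\<dots> \<le> (u\<^sup>2 * q)\<^sup>2" using d by (intro power_mono mult_left_mono) auto
      also have "\<dots> = u ^ 4 * (q * q)" by (simp add: power_mult_distrib power2_eq_square power4_eq_xxxx)
      also have "\<dots> \<le> u ^ 4 * (D\<^sup>2 * q)" using q' by (intro mult_left_mono mult_right_mono) auto
      finally have 2: "\<bar>(1 - u\<^sup>2 * d / 2) - exp (- (u\<^sup>2 * d / 2))\<bar> \<le> u ^ 4 * D\<^sup>2 * q" by (simp add: abs_minus_commute)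
      have 3: "\<bar>(1 - u\<^sup>2 * q / 2) - (1 - u\<^sup>2 * d / 2)\<bar> \<le> u\<^sup>2 / 2 * (q - d)"
      proof -
        have "(1 - u\<^sup>2 * q / 2) - (1 - u\<^sup>2 * d / 2) = - (u\<^sup>2 / 2 * (q - d))" by (simp add: field_simps)
        then show ?thesis using d by simp
      qed
      have "norm (?psi w - of_real (exp (- (u\<^sup>2 * d / 2))))
          = norm ((?psi w - of_real (1 - u\<^sup>2 * q / 2)) + of_real ((1 - u\<^sup>2 * q / 2) - (1 - u\<^sup>2 * d / 2))
            + of_real ((1 - u\<^sup>2 * d / 2) - exp (- (u\<^sup>2 * d / 2))))" by simp
      also have "\<dots> \<le> norm (?psi w - of_real (1 - u\<^sup>2 * q / 2)) + \<bar>(1 - u\<^sup>2 * q / 2) - (1 - u\<^sup>2 * d / 2)\<bar>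
          + \<bar>(1 - u\<^sup>2 * d / 2) - exp (- (u\<^sup>2 * d / 2))\<bar>"
        by (intro norm_triangle_le add_mono order_refl) (simp_all only: norm_of_real order_refl)
      also have "\<dots> \<le> \<bar>u\<bar> ^ 3 * D * q + u\<^sup>2 / 2 * (q - d) + u ^ 4 * D\<^sup>2 * q"
        using 1 by (intro add_mono 2 3) simp
      also have "\<dots> = c * q + u\<^sup>2 / 2 * (q - d)" by (simp add: c_def algebra_simps)
      finally have 4: "norm (?psi w - of_real (exp (- (u\<^sup>2 * d / 2)))) \<le> c * q + u\<^sup>2 / 2 * (q - d)" .
      have "(cis (u * mart f N n w) * of_real (E' w)) * ?psi w - T n w
          = (cis (u * mart f N n w) * of_real (E' w)) * (?psi w - of_real (exp (- (u\<^sup>2 * d / 2))))"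
        by (simp add: T_def En algebra_simps)
      also have "norm \<dots> = E' w * norm (?psi w - of_real (exp (- (u\<^sup>2 * d / 2))))"
        using Eb[OF w, of "Suc n"] by (simp add: norm_mult EE)
      also have "\<dots> \<le> exp (s\<^sup>2) * (c * q + u\<^sup>2 / 2 * (q - d))"
        using Eb[OF w, of "Suc n"] 4 by (intro mult_mono) (auto simp: EE)
      also have "\<dots> = W (Suc n) w - W n w"
        by (simp add: W_def Q_Suc q_def[symmetric] d_def field_simps)
      finally show "norm ((cis (u * mart f N n w) * of_real (E' w)) * ?psi w - T n w) \<le> W (Suc n) w - W n w" .
    qed (use i Ti Wi in auto)
    also have "\<dots> = expectation (W (Suc n)) - expectation (W n)" by (rule Bochner_Integration.integral_diff[OF Wi Wi])
    finally show ?thesis .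
  qed
  have "norm (expectation (T n) - expectation (T 0)) \<le> expectation (W n)" if "n \<le> N" for n
    using that
  proof (induction n)
    case 0 show ?case using V by (simp add: W_def m_def Q_def psum_def)
  next
    case (Suc n)
    have "norm (expectation (T (Suc n)) - expectation (T 0))
        \<le> norm (expectation (T (Suc n)) - expectation (T n)) + norm (expectation (T n) - expectation (T 0))"
      using norm_triangle_ineq[of "expectation (T (Suc n)) - expectation (T n)" "expectation (T n) - expectation (T 0)"] by simp
    also have "\<dots> \<le> expectation (W (Suc n))" using Suc step[of n] by simp
    finally show ?case .
  qed
  from this[of N] have a1: "norm (expectation (T N) - expectation (T 0)) \<le> expectation (W N)" by simp
  define A where "A = sqrt ((4 + 16 / e ^ 4) * D\<^sup>2 * V) + D\<^sup>2"
  have QA: "expectation (\<lambda>w. \<bar>Q N w - V\<bar>) \<le> A"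
    using qvar_concentration(2)[OF f, of N] by (simp add: A_def D_def V_def Q_def)
  have QVi: "integrable P (\<lambda>w. \<bar>Q N w - V\<bar>)" using Qi by simp
  have EQ: "expectation (Q N) \<le> V" using qvar_concentration(1)[OF f, of N] by (simp add: V_def Q_def)
  have c0: "0 \<le> c" using D by (simp add: c_def)
  have a2: "expectation (W N) \<le> exp (s\<^sup>2) * (c * V + u\<^sup>2 / 2 * A)"
  proof -
    have "expectation (W N) = exp (s\<^sup>2) * (c * expectation (Q N) + u\<^sup>2 / 2 * expectation (\<lambda>w. Q N w - m N w))"
      unfolding W_def[abs_def] using Qi mi by simp
    also have "\<dots> \<le> exp (s\<^sup>2) * (c * V + u\<^sup>2 / 2 * A)"
    proof (intro mult_left_mono add_mono EQ c0)
      have "expectation (\<lambda>w. Q N w - m N w) \<le> expectation (\<lambda>w. \<bar>Q N w - V\<bar>)"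
        using Qi mi V by (intro integral_mono) (auto simp: m_def)
      then show "expectation (\<lambda>w. Q N w - m N w) \<le> A" using QA by linarith
    qed auto
    finally show ?thesis .
  qed
  have a3: "norm (expectation (T 0) - 1) \<le> \<bar>u\<bar> * D"
  proof -
    have T0: "T 0 w = cis (u * mart f N 0 w)" for w
      using V by (simp add: T_def E_def m_def Q_def psum_def)
    have "norm (expectation (T 0) - 1) = norm (expectation (\<lambda>w. T 0 w - 1))"
      using Ti by (simp add: prob_space)
    also have "\<dots> \<le> expectation (\<lambda>w. \<bar>u\<bar> * D)"
    proof (rule norm_integral_le)
      show "norm (T 0 w - 1) \<le> \<bar>u\<bar> * D" if "w \<in> space P" for w
      proof -
        have "norm (T 0 w - 1) \<le> \<bar>u * mart f N 0 w\<bar>" unfolding T0 by (rule norm_cis_minus_1_le)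
        also have "\<dots> \<le> \<bar>u\<bar> * D" unfolding abs_mult D_def
          by (intro mult_left_mono mart_0_bound[OF f that]) simp
        finally show ?thesis .
      qed
    qed (use Ti in auto)
    finally show ?thesis by (simp add: prob_space)
  qed
  let ?C = "expectation (\<lambda>w. cis (u * mart f N N w))"
  have Ci: "integrable P (\<lambda>w. cis (u * mart f N N w))" by (rule P_integrable[where c=1]) auto
  \<comment> \<open>Both exponents are at most s^2, where \<open>exp\<close> is Lipschitz with
    constant exp (s^2); the distance is therefore controlled by the mean of |Q N - V|.\<close>
  have a4: "norm (of_real (exp (s\<^sup>2 / 2)) * ?C - expectation (T N)) \<le> exp (s\<^sup>2) * (u\<^sup>2 / 2 * A)"
  proof -
    have "norm (of_real (exp (s\<^sup>2 / 2)) * ?C - expectation (T N))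
        = norm (expectation (\<lambda>w. of_real (exp (s\<^sup>2 / 2)) * cis (u * mart f N N w) - T N w))"
      using Ci Ti by simp
    also have "\<dots> \<le> expectation (\<lambda>w. exp (s\<^sup>2) * (u\<^sup>2 / 2 * \<bar>Q N w - V\<bar>))"
    proof (rule norm_integral_le)
      fix w assume w: "w \<in> space P"
      have "of_real (exp (s\<^sup>2 / 2)) * cis (u * mart f N N w) - T N w
          = cis (u * mart f N N w) * of_real (exp (s\<^sup>2 / 2) - E N w)"
        by (simp add: T_def algebra_simps)
      also have "norm \<dots> = \<bar>exp (s\<^sup>2 / 2) - E N w\<bar>" by (simp add: norm_mult del: of_real_diff)
      also have "\<dots> \<le> exp (s\<^sup>2) * \<bar>s\<^sup>2 / 2 - u\<^sup>2 * m N w / 2\<bar>"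
        unfolding E_def
      proof (rule exp_lipschitz_le)
        have "u\<^sup>2 * m N w \<le> u\<^sup>2 * (2 * V)" using m0[OF w] by (intro mult_left_mono) auto
        also have "u\<^sup>2 * (2 * V) = 2 * s\<^sup>2" unfolding u2V[symmetric] by simp
        finally show "u\<^sup>2 * m N w / 2 \<le> s\<^sup>2" by simp
      qed simp
      also have "s\<^sup>2 / 2 - u\<^sup>2 * m N w / 2 = u\<^sup>2 / 2 * (V - m N w)" using u2V by (simp add: algebra_simps)
      also have "\<bar>\<dots>\<bar> \<le> u\<^sup>2 / 2 * \<bar>Q N w - V\<bar>"
        unfolding abs_mult using V by (intro mult_mono) (auto simp: m_def)
      finally show "norm (of_real (exp (s\<^sup>2 / 2)) * cis (u * mart f N N w) - T N w)
          \<le> exp (s\<^sup>2) * (u\<^sup>2 / 2 * \<bar>Q N w - V\<bar>)" by simp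
    qed (use Ci Ti QVi in auto)
    also have "\<dots> = exp (s\<^sup>2) * (u\<^sup>2 / 2 * expectation (\<lambda>w. \<bar>Q N w - V\<bar>))" by simp
    also have "\<dots> \<le> exp (s\<^sup>2) * (u\<^sup>2 / 2 * A)" by (intro mult_left_mono QA) auto
    finally show ?thesis .
  qed
  have e1: "1 \<le> exp (s\<^sup>2)" by simp
  have "norm (?C - of_real (exp (- s\<^sup>2 / 2))) \<le> exp (s\<^sup>2 / 2) * norm (?C - of_real (exp (- s\<^sup>2 / 2)))"
    using mult_right_mono[of 1 "exp (s\<^sup>2 / 2)" "norm (?C - of_real (exp (- s\<^sup>2 / 2)))"] by simp
  also have "\<dots> = norm (of_real (exp (s\<^sup>2 / 2)) * (?C - of_real (exp (- s\<^sup>2 / 2))))"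
    by (simp add: norm_mult)
  also have "of_real (exp (s\<^sup>2 / 2)) * (?C - of_real (exp (- s\<^sup>2 / 2))) = of_real (exp (s\<^sup>2 / 2)) * ?C - 1"
  proof -
    have "exp (s\<^sup>2 / 2) * exp (- s\<^sup>2 / 2) = 1" by (simp add: exp_minus)
    then show ?thesis by (simp add: right_diff_distrib flip: of_real_mult)
  qed
  \<comment> \<open>The two halves of the term with \<open>A\<close> are the cost of the truncation
    along the way and that of replacing the truncated quadratic variation by V at the end.\<close>
  also have "\<dots> = (of_real (exp (s\<^sup>2 / 2)) * ?C - expectation (T N)) + (expectation (T N) - expectation (T 0))
      + (expectation (T 0) - 1)" by simp
  also have "norm \<dots> \<le> exp (s\<^sup>2) * (u\<^sup>2 / 2 * A) + exp (s\<^sup>2) * (c * V + u\<^sup>2 / 2 * A) + \<bar>u\<bar> * D"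
    using a1 a2 by (intro norm_triangle_le add_mono a3 a4) linarith
  also have "\<dots> \<le> exp (s\<^sup>2) * (u\<^sup>2 / 2 * A) + exp (s\<^sup>2) * (c * V + u\<^sup>2 / 2 * A) + exp (s\<^sup>2) * (\<bar>u\<bar> * D)"
    using mult_right_mono[OF e1, of "\<bar>u\<bar> * D"] D by simp
  also have "\<dots> = exp (s\<^sup>2) * (c * V + u\<^sup>2 * A + \<bar>u\<bar> * D)" by (simp add: algebra_simps)
  also have "c * V = \<bar>s\<bar> ^ 3 * D / sqrt V + s ^ 4 * D\<^sup>2 / V"
  proof -
    have absu: "\<bar>u\<bar> = \<bar>s\<bar> / sqrt V" using V by (simp add: u_def)
    have "\<bar>u\<bar> ^ 3 * V = \<bar>u\<bar> * (u\<^sup>2 * V)" unfolding abs_cube by simp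
    also have "\<dots> = \<bar>s\<bar> / sqrt V * s\<^sup>2" unfolding u2V absu ..
    also have "\<dots> = \<bar>s\<bar> ^ 3 / sqrt V" unfolding abs_cube by simp
    finally have 1: "\<bar>u\<bar> ^ 3 * V = \<bar>s\<bar> ^ 3 / sqrt V" .
    have "u ^ 4 * V = u\<^sup>2 * (u\<^sup>2 * V)" unfolding power4_eq_square by simp
    also have "\<dots> = s\<^sup>2 / V * s\<^sup>2" unfolding u2V unfolding u2 ..
    also have "\<dots> = s ^ 4 / V" unfolding power4_eq_square by simp
    finally have 2: "u ^ 4 * V = s ^ 4 / V" .
    have "c * V = D * (\<bar>u\<bar> ^ 3 * V) + D\<^sup>2 * (u ^ 4 * V)" by (simp add: c_def algebra_simps)
    then show ?thesis unfolding 1 2 by (simp add: mult.commute)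
  qed
  also have "\<bar>u\<bar> = \<bar>s\<bar> / sqrt V" using V by (simp add: u_def)
  finally show ?thesis by (simp add: mart_N[OF f] u_def[symmetric] u2 A_def)
qed

end

lemma clt:
  assumes f: "bounded_functional f R"
    and V: "filterlim (\<lambda>N. variance (psum f N)) at_top sequentially"
  shows "(\<lambda>N. expectation (\<lambda>w. cis (s / sqrt (variance (psum f N)) * (psum f N w - expectation (psum f N)))))
    \<longlonglongrightarrow> of_real (exp (- s\<^sup>2 / 2))"
proof -
  define D where "D = 6 * R / e"
  define C where "C = (4 + 16 / e ^ 4) * D\<^sup>2"
  have C: "0 \<le> C" using e_pos by (simp add: C_def)
  have "((\<lambda>v. exp (s\<^sup>2) * (\<bar>s\<bar> ^ 3 * D / sqrt v + s ^ 4 * D\<^sup>2 / v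
        + s\<^sup>2 / v * (sqrt (C * v) + D\<^sup>2) + \<bar>s\<bar> * D / sqrt v)) \<longlongrightarrow> 0) at_top"
  proof -
    have l: "((\<lambda>v::real. 1 / sqrt v) \<longlongrightarrow> 0) at_top" "((\<lambda>v::real. 1 / v) \<longlongrightarrow> 0) at_top"
        "((\<lambda>v::real. sqrt v / v) \<longlongrightarrow> 0) at_top"
      by real_asymp+
    have "((\<lambda>v. exp (s\<^sup>2) * (\<bar>s\<bar> ^ 3 * D * (1 / sqrt v) + s ^ 4 * D\<^sup>2 * (1 / v)
        + s\<^sup>2 * (sqrt C * (sqrt v / v) + D\<^sup>2 * (1 / v)) + \<bar>s\<bar> * D * (1 / sqrt v)))
      \<longlongrightarrow> exp (s\<^sup>2) * (\<bar>s\<bar> ^ 3 * D * 0 + s ^ 4 * D\<^sup>2 * 0 + s\<^sup>2 * (sqrt C * 0 + D\<^sup>2 * 0) + \<bar>s\<bar> * D * 0)) at_top"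
      by (intro tendsto_intros l)
    then show ?thesis by (simp add: real_sqrt_mult add_divide_distrib distrib_left)
  qed
  from filterlim_compose[OF this V] have lim: "(\<lambda>N. exp (s\<^sup>2) * (\<bar>s\<bar> ^ 3 * D / sqrt (variance (psum f N))
        + s ^ 4 * D\<^sup>2 / variance (psum f N)
        + s\<^sup>2 / variance (psum f N) * (sqrt (C * variance (psum f N)) + D\<^sup>2)
        + \<bar>s\<bar> * D / sqrt (variance (psum f N)))) \<longlonglongrightarrow> 0" .
  have "\<forall>\<^sub>F N in sequentially. 0 < variance (psum f N)"
    using V by (auto simp: filterlim_at_top_dense)
  then have "\<forall>\<^sub>F N in sequentially. norm (expectation (\<lambda>w. cis (s / sqrt (variance (psum f N)) * (psum f N w - expectation (psum f N))))
      - of_real (exp (- s\<^sup>2 / 2))) \<le> exp (s\<^sup>2) * (\<bar>s\<bar> ^ 3 * D / sqrt (variance (psum f N))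
        + s ^ 4 * D\<^sup>2 / variance (psum f N)
        + s\<^sup>2 / variance (psum f N) * (sqrt (C * variance (psum f N)) + D\<^sup>2)
        + \<bar>s\<bar> * D / sqrt (variance (psum f N)))"
    by eventually_elim (use clt_bound[OF f] in \<open>simp only: D_def C_def\<close>)
  from Lim_null_comparison[OF this lim] show ?thesis by (rule LIM_zero_cancel)
qed

end

subsection \<open>Hexagons and characteristic functions\<close>

text \<open>With A the integral of \<rho> and k the weighted integral of cis, expanding the cosine
  shows that the double integral is A^2 - |k|^2 = (A - |k|) (A + |k|), and A + |k| is at most
  2c.\<close>

lemma (in prob_space) norm_integral_cis_le:
  fixes \<rho> \<phi> :: "'a \<Rightarrow> real"
  assumes [measurable]: "\<rho> \<in> borel_measurable M" "\<phi> \<in> borel_measurable M"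
    and \<rho>: "\<And>x. x \<in> space M \<Longrightarrow> 0 \<le> \<rho> x \<and> \<rho> x \<le> b"
    and c: "(\<integral>x. \<rho> x \<partial>M) \<le> c" "0 < c"
  shows "norm (\<integral>x. of_real (\<rho> x) * cis (\<phi> x) \<partial>M)
    \<le> (\<integral>x. \<rho> x \<partial>M) - (\<integral>x. \<integral>y. \<rho> x * \<rho> y * (1 - cos (\<phi> x - \<phi> y)) \<partial>M \<partial>M) / (2 * c)"
proof -
  define A where "A = (\<integral>x. \<rho> x \<partial>M)"
  define a where "a = (\<integral>x. \<rho> x * cos (\<phi> x) \<partial>M)"
  define s where "s = (\<integral>x. \<rho> x * sin (\<phi> x) \<partial>M)"
  define k where "k = (\<integral>x. of_real (\<rho> x) * cis (\<phi> x) \<partial>M)"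
  define J where "J = (\<integral>x. \<integral>y. \<rho> x * \<rho> y * (1 - cos (\<phi> x - \<phi> y)) \<partial>M \<partial>M)"
  have b: "\<bar>\<rho> x * t\<bar> \<le> b" if "x \<in> space M" "\<bar>t\<bar> \<le> 1" for x t
    using mult_mono[of "\<bar>\<rho> x\<bar>" b "\<bar>t\<bar>" 1] \<rho>[OF that(1)] that(2) by (auto simp: abs_mult)
  have i0: "integrable M \<rho>"
    by (rule integrable_const_bound[where B=b]) (use \<rho> in auto)
  have ic: "integrable M (\<lambda>x. \<rho> x * cos (\<phi> x))" and isn: "integrable M (\<lambda>x. \<rho> x * sin (\<phi> x))"
    by (rule integrable_const_bound[where B=b]; use b in auto)+
  have ik: "integrable M (\<lambda>x. of_real (\<rho> x) * cis (\<phi> x))"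
    by (rule integrable_const_bound[where B=b]) (use \<rho> in \<open>auto simp: norm_mult\<close>)
  have Rek: "Re k = a" unfolding k_def a_def using ik by (simp flip: integral_Re)
  have Imk: "Im k = s" unfolding k_def s_def using ik by (simp flip: integral_Im)
  have "(\<integral>y. \<rho> x * \<rho> y * (1 - cos (\<phi> x - \<phi> y)) \<partial>M) = A * \<rho> x - a * (\<rho> x * cos (\<phi> x)) - s * (\<rho> x * sin (\<phi> x))" for x
  proof -
    have "(\<integral>y. \<rho> x * \<rho> y * (1 - cos (\<phi> x - \<phi> y)) \<partial>M)
        = (\<integral>y. \<rho> x * \<rho> y - \<rho> x * cos (\<phi> x) * (\<rho> y * cos (\<phi> y)) - \<rho> x * sin (\<phi> x) * (\<rho> y * sin (\<phi> y)) \<partial>M)"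
      by (simp add: cos_diff algebra_simps)
    also have "\<dots> = \<rho> x * A - \<rho> x * cos (\<phi> x) * a - \<rho> x * sin (\<phi> x) * s"
      using i0 ic isn by (simp add: A_def a_def s_def)
    finally show ?thesis by (simp add: mult_ac)
  qed
  then have "J = A * A - a * a - s * s"
    unfolding J_def using i0 ic isn by (simp add: A_def a_def s_def)
  also have "\<dots> = A\<^sup>2 - (norm k)\<^sup>2"
    unfolding cmod_power2 Rek Imk by (simp add: power2_eq_square)
  finally have J: "J = (A - norm k) * (A + norm k)" by (simp add: power2_eq_square algebra_simps)
  have kA: "norm k \<le> A"
  proof -
    have "norm k \<le> (\<integral>x. norm (of_real (\<rho> x) * cis (\<phi> x)) \<partial>M)" unfolding k_def by (rule integral_norm_bound)
    also have "\<dots> = A" unfolding A_def using \<rho>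
      by (intro Bochner_Integration.integral_cong) (auto simp: norm_mult)
    finally show ?thesis .
  qed
  have "J \<le> (A - norm k) * (2 * c)"
    unfolding J using kA c by (intro mult_left_mono) (auto simp: A_def[symmetric])
  then have "J / (2 * c) \<le> A - norm k" using c by (simp add: divide_le_eq)
  then show ?thesis unfolding A_def k_def J_def by simp
qed

context elliptic_process
begin

lemma sigma_finite_mu: "sigma_finite_measure (mu n)"
  using prob_mu[of n] by (rule prob_space_imp_sigma_finite)

lemma measurable_mu_integral [measurable (raw)]:
  fixes H :: "'b \<Rightarrow> 'a \<Rightarrow> 'c::{banach,second_countable_topology}"
  assumes "(\<lambda>(w, y). H w y) \<in> borel_measurable (M \<Otimes>\<^sub>M B n)"
  shows "(\<lambda>w. \<integral>y. H w y \<partial>mu n) \<in> borel_measurable M"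
proof -
  interpret m: sigma_finite_measure "mu n" by (rule sigma_finite_mu)
  have "(\<lambda>(w, y). H w y) \<in> borel_measurable (M \<Otimes>\<^sub>M mu n)"
    using assms by (simp cong: measurable_cong_sets)
  then show ?thesis by (rule m.borel_measurable_lebesgue_integral)
qed

definition mu_pair :: "nat \<Rightarrow> ('a \<times> 'a) measure" where
  "mu_pair n = mu n \<Otimes>\<^sub>M mu (Suc n)"

lemma prob_mu_pair: "prob_space (mu_pair n)"
proof -
  interpret m1: prob_space "mu n" by (rule prob_mu)
  interpret m2: prob_space "mu (Suc n)" by (rule prob_mu)
  interpret pair_prob_space "mu n" "mu (Suc n)" ..
  show ?thesis unfolding mu_pair_def by (rule P.prob_space_axioms)
qed

lemma sets_mu_pair [measurable_cong, simp]: "sets (mu_pair n) = sets (B n \<Otimes>\<^sub>M B (Suc n))"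
  unfolding mu_pair_def by (rule sets_pair_measure_cong) simp_all

lemma space_mu_pair [simp]: "space (mu_pair n) = space (B n) \<times> space (B (Suc n))"
  by (simp add: mu_pair_def space_pair_measure)

lemma measurable_mu_pair_integral [measurable (raw)]:
  fixes H :: "'b \<Rightarrow> 'a \<times> 'a \<Rightarrow> 'c::{banach,second_countable_topology}"
  assumes "(\<lambda>(w, y). H w y) \<in> borel_measurable (M \<Otimes>\<^sub>M (B n \<Otimes>\<^sub>M B (Suc n)))"
  shows "(\<lambda>w. \<integral>y. H w y \<partial>mu_pair n) \<in> borel_measurable M"
proof -
  interpret m: sigma_finite_measure "mu_pair n" using prob_mu_pair by (rule prob_space_imp_sigma_finite)
  have "(\<lambda>(w, y). H w y) \<in> borel_measurable (M \<Otimes>\<^sub>M mu_pair n)"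
    using assms by (simp cong: measurable_cong_sets)
  then show ?thesis by (rule m.borel_measurable_lebesgue_integral)
qed

definition path_weight :: "nat \<Rightarrow> 'a \<Rightarrow> 'a \<times> 'a \<Rightarrow> 'a \<Rightarrow> real" where
  "path_weight n z q x = p n (z, fst q) * p (Suc n) q * p (Suc (Suc n)) (snd q, x)"

definition path_sum :: "(nat \<Rightarrow> 'a \<times> 'a \<Rightarrow> real) \<Rightarrow> nat \<Rightarrow> 'a \<Rightarrow> 'a \<times> 'a \<Rightarrow> 'a \<Rightarrow> real" where
  "path_sum f n z q x = f n (z, fst q) + f (Suc n) q + f (Suc (Suc n)) (snd q, x)"

text \<open>The phase compares two paths of three steps with common end points, which together form a hexagon.
  The defect vanishes iff almost all of these hexagons have balance in \<open>(2\<pi>/\<xi>)\<int>\<close>.\<close>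

definition hex_defect :: "(nat \<Rightarrow> 'a \<times> 'a \<Rightarrow> real) \<Rightarrow> real \<Rightarrow> nat \<Rightarrow> 'a \<Rightarrow> 'a \<Rightarrow> real" where
  "hex_defect f \<xi> n z x = (\<integral>q. \<integral>q'. path_weight n z q x * path_weight n z q' x *
     (1 - cos (\<xi> * path_sum f n z q x - \<xi> * path_sum f n z q' x)) \<partial>mu_pair (Suc n) \<partial>mu_pair (Suc n))"

definition hex :: "(nat \<Rightarrow> 'a \<times> 'a \<Rightarrow> real) \<Rightarrow> real \<Rightarrow> nat \<Rightarrow> real" where
  "hex f \<xi> n = (\<integral>z. \<integral>x. hex_defect f \<xi> n z x \<partial>mu (Suc (Suc (Suc n))) \<partial>mu n)"

text \<open>A hexagon based at level n + 2 ends at level n + 5, and the two steps before its base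
  are spent on reaching \<open>mu\<close>. As \<open>psum f N\<close> involves the states up to
  level N, the admissible n are those with n + 5 \<le> N, which are N - 4 many.\<close>

definition hex_sum :: "(nat \<Rightarrow> 'a \<times> 'a \<Rightarrow> real) \<Rightarrow> nat \<Rightarrow> real \<Rightarrow> real" where
  "hex_sum f N \<xi> = (\<Sum>n<N - 4. hex f \<xi> (Suc (Suc n)))"

lemma path_weight_bounds: "0 \<le> path_weight n z q x" "path_weight n z q x \<le> (1 / e) ^ 3"
proof -
  show "0 \<le> path_weight n z q x" by (simp add: path_weight_def p_nonneg)
  have "path_weight n z q x \<le> (1 / e) * (1 / e) * (1 / e)"
    unfolding path_weight_def using e_pos by (intro mult_mono p_le p_nonneg mult_nonneg_nonneg) auto
  then show "path_weight n z q x \<le> (1 / e) ^ 3" by (simp add: power3_eq_cube)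
qed

lemma measurable_path_weight [measurable (raw)]:
  assumes [measurable]: "g \<in> M \<rightarrow>\<^sub>M B n" "h \<in> M \<rightarrow>\<^sub>M B (Suc n) \<Otimes>\<^sub>M B (Suc (Suc n))" "k \<in> M \<rightarrow>\<^sub>M B (Suc (Suc (Suc n)))"
  shows "(\<lambda>w. path_weight n (g w) (h w) (k w)) \<in> borel_measurable M"
  unfolding path_weight_def by measurable

lemma hex_integrand_bounds:
  "0 \<le> path_weight n z q x * path_weight n z q' x * (1 - cos t)"
  "\<bar>path_weight n z q x * path_weight n z q' x * (1 - cos t)\<bar> \<le> 2 * (1 / e) ^ 6"
proof -
  have c: "0 \<le> 1 - cos t" "1 - cos t \<le> 2" using cos_ge_minus_one[of t] by simp_all
  show 0: "0 \<le> path_weight n z q x * path_weight n z q' x * (1 - cos t)"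
    using c by (intro mult_nonneg_nonneg path_weight_bounds)
  have "path_weight n z q x * path_weight n z q' x * (1 - cos t) \<le> (1 / e) ^ 3 * (1 / e) ^ 3 * 2"
    using c e_pos by (intro mult_mono path_weight_bounds mult_nonneg_nonneg) auto
  also have "(1 / e) ^ 3 * (1 / e) ^ 3 * 2 = 2 * (1 / e) ^ 6"
    by (simp add: power_add[symmetric])
  finally show "\<bar>path_weight n z q x * path_weight n z q' x * (1 - cos t)\<bar> \<le> 2 * (1 / e) ^ 6"
    using 0 by simp
qed

lemma mu_integral_abs_le:
  fixes g :: "'a \<Rightarrow> real"
  assumes "g \<in> borel_measurable (B n)" "\<And>y. y \<in> space (B n) \<Longrightarrow> \<bar>g y\<bar> \<le> c"
  shows "\<bar>\<integral>y. g y \<partial>mu n\<bar> \<le> c"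
proof -
  have "\<bar>\<integral>y. g y \<partial>mu n\<bar> \<le> (\<integral>y. \<bar>g y\<bar> \<partial>mu n)" by (rule integral_abs_bound)
  also have "\<dots> \<le> (\<integral>y. c \<partial>mu n)"
  proof (rule integral_mono)
    show "integrable (mu n) (\<lambda>y. \<bar>g y\<bar>)" using assms by (intro mu_integrable[where c=c]) auto
    show "integrable (mu n) (\<lambda>y. c)" by (rule mu_integrable[where c="\<bar>c\<bar>"]) auto
  qed (use assms in simp)
  finally show ?thesis by simp
qed

lemma mu_pair_integrable:
  fixes g :: "'a \<times> 'a \<Rightarrow> 'c::{banach,second_countable_topology}"
  assumes "g \<in> borel_measurable (B n \<Otimes>\<^sub>M B (Suc n))" "\<And>q. q \<in> space (mu_pair n) \<Longrightarrow> norm (g q) \<le> c"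
  shows "integrable (mu_pair n) g"
proof -
  interpret m: prob_space "mu_pair n" by (rule prob_mu_pair)
  show ?thesis using assms
    by (intro m.integrable_const_bound[where B=c] AE_I2)
      (auto simp: measurable_cong_sets[OF sets_mu_pair refl])
qed

lemma measure_mu_pair_space [simp]: "measure (mu_pair n) (space (B n) \<times> space (B (Suc n))) = 1"
  using prob_space.prob_space[OF prob_mu_pair, of n] by simp

lemma mu_pair_integral_abs_le:
  fixes g :: "'a \<times> 'a \<Rightarrow> real"
  assumes "g \<in> borel_measurable (B n \<Otimes>\<^sub>M B (Suc n))" "\<And>q. q \<in> space (mu_pair n) \<Longrightarrow> \<bar>g q\<bar> \<le> c"
  shows "\<bar>\<integral>q. g q \<partial>mu_pair n\<bar> \<le> c"
proof -
  have "\<bar>\<integral>y. g y \<partial>mu_pair n\<bar> \<le> (\<integral>y. \<bar>g y\<bar> \<partial>mu_pair n)" by (rule integral_abs_bound)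
  also have "\<dots> \<le> (\<integral>y. c \<partial>mu_pair n)"
  proof (rule integral_mono)
    show "integrable (mu_pair n) (\<lambda>y. \<bar>g y\<bar>)" using assms by (intro mu_pair_integrable[where c=c]) auto
    show "integrable (mu_pair n) (\<lambda>y. c)" by (rule mu_pair_integrable[where c="\<bar>c\<bar>"]) auto
  qed (use assms in simp)
  finally show ?thesis by simp
qed

context
  fixes f :: "nat \<Rightarrow> 'a \<times> 'a \<Rightarrow> real"
  assumes f_measurable: "\<And>n. f n \<in> borel_measurable (B n \<Otimes>\<^sub>M B (Suc n))"
begin

lemma measurable_path_sum [measurable (raw)]:
  assumes [measurable]: "g \<in> M \<rightarrow>\<^sub>M B n" "h \<in> M \<rightarrow>\<^sub>M B (Suc n) \<Otimes>\<^sub>M B (Suc (Suc n))" "k \<in> M \<rightarrow>\<^sub>M B (Suc (Suc (Suc n)))"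
  shows "(\<lambda>w. path_sum f n (g w) (h w) (k w)) \<in> borel_measurable M"
proof -
  note f_measurable[measurable]
  show ?thesis unfolding path_sum_def by measurable
qed

lemma measurable_hex_defect [measurable (raw)]:
  assumes [measurable]: "g \<in> M \<rightarrow>\<^sub>M B n" "k \<in> M \<rightarrow>\<^sub>M B (Suc (Suc (Suc n)))"
  shows "(\<lambda>w. hex_defect f \<xi> n (g w) (k w)) \<in> borel_measurable M"
  unfolding hex_defect_def by measurable

lemma hex_defect_bounds:
  assumes [simp]: "z \<in> space (B n)" "x \<in> space (B (Suc (Suc (Suc n))))"
  shows "0 \<le> hex_defect f \<xi> n z x" "hex_defect f \<xi> n z x \<le> 2 * (1 / e) ^ 6"
proof -
  show "0 \<le> hex_defect f \<xi> n z x" unfolding hex_defect_def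
    by (intro Bochner_Integration.integral_nonneg hex_integrand_bounds)
  have "\<bar>hex_defect f \<xi> n z x\<bar> \<le> 2 * (1 / e) ^ 6"
    unfolding hex_defect_def by (intro mu_pair_integral_abs_le hex_integrand_bounds) measurable
  then show "hex_defect f \<xi> n z x \<le> 2 * (1 / e) ^ 6" by simp
qed

lemma hex_bounds: "0 \<le> hex f \<xi> n" "hex f \<xi> n \<le> 2 * (1 / e) ^ 6"
proof -
  show "0 \<le> hex f \<xi> n" unfolding hex_def by (intro Bochner_Integration.integral_nonneg hex_defect_bounds) auto
  have "\<bar>hex f \<xi> n\<bar> \<le> 2 * (1 / e) ^ 6" unfolding hex_def
    by (intro mu_integral_abs_le) (auto simp: hex_defect_bounds, measurable)
  then show "hex f \<xi> n \<le> 2 * (1 / e) ^ 6" by simp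
qed

text \<open>The perturbed transition operators of Nagaev's method; their compositions represent the
  characteristic function of the sum, see \<open>char_rec_expectation\<close>.\<close>

definition char_op :: "real \<Rightarrow> nat \<Rightarrow> ('a \<Rightarrow> complex) \<Rightarrow> 'a \<Rightarrow> complex" where
  "char_op \<xi> n u x = (\<integral>y. cis (\<xi> * f n (x, y)) * u y \<partial>K n x)"

lemma char_op_measurable [measurable (raw)]:
  assumes [measurable]: "u \<in> borel_measurable (B (Suc n))"
  shows "char_op \<xi> n u \<in> borel_measurable (B n)"
proof -
  note f_measurable[measurable]
  show ?thesis unfolding char_op_def[abs_def] by measurable
qed

lemma char_op_section [measurable]:
  "x \<in> space (B n) \<Longrightarrow> (\<lambda>y. f n (x, y)) \<in> borel_measurable (B (Suc n))"
  using measurable_compose[OF measurable_Pair1' f_measurable] by simp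

lemma char_op_bound:
  assumes x: "x \<in> space (B n)" and [measurable]: "u \<in> borel_measurable (B (Suc n))"
    and b: "\<And>y. y \<in> space (B (Suc n)) \<Longrightarrow> norm (u y) \<le> b"
  shows "norm (char_op \<xi> n u x) \<le> b"
  unfolding char_op_def
proof (rule kernel_integral_bound[OF x])
  show "(\<lambda>y. cis (\<xi> * f n (x, y)) * u y) \<in> borel_measurable (B (Suc n))" using x by measurable
qed (use b in \<open>simp add: norm_mult\<close>)

lemma char_op_norm_le:
  assumes x: "x \<in> space (B n)" and [measurable]: "u \<in> borel_measurable (B (Suc n))" "v \<in> borel_measurable (B (Suc n))"
    and uv: "\<And>y. y \<in> space (B (Suc n)) \<Longrightarrow> norm (u y) \<le> v y"
    and b: "\<And>y. y \<in> space (B (Suc n)) \<Longrightarrow> v y \<le> b"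
  shows "norm (char_op \<xi> n u x) \<le> (\<integral>y. v y \<partial>K n x)"
  unfolding char_op_def
proof (rule norm_integral_le)
  have "(\<lambda>y. cis (\<xi> * f n (x, y)) * u y) \<in> borel_measurable (B (Suc n))" using x by measurable
  then show "integrable (K n x) (\<lambda>y. cis (\<xi> * f n (x, y)) * u y)"
    using uv b by (intro kernel_integrable[OF x, where c=b]) (auto simp: norm_mult intro: order_trans)
  have "\<bar>v y\<bar> \<le> b" if "y \<in> space (B (Suc n))" for y
    using uv[OF that] b[OF that] norm_ge_zero[of "u y"] by linarith
  then show "integrable (K n x) v"
    by (intro kernel_integrable[OF x, where c=b]) auto
qed (use x uv in \<open>simp add: norm_mult\<close>)

text \<open>The three kernels are expanded into densities and the end point x' is moved outermost,
  so that for fixed end points only the two intermediate states remain to be integrated.\<close>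

lemma three_step_integral:
  fixes g :: "'a \<times> 'a \<Rightarrow> 'a \<Rightarrow> 'c::{real_normed_field,banach,second_countable_topology}"
  assumes z: "z \<in> space (B n)"
    and g: "(\<lambda>(q, x). g q x) \<in> borel_measurable ((B (Suc n) \<Otimes>\<^sub>M B (Suc (Suc n))) \<Otimes>\<^sub>M B (Suc (Suc (Suc n))))"
    and b: "\<And>q x. q \<in> space (mu_pair (Suc n)) \<Longrightarrow> x \<in> space (B (Suc (Suc (Suc n)))) \<Longrightarrow> norm (g q x) \<le> b"
  shows "(\<integral>y. \<integral>x. \<integral>x'. g (y, x) x' \<partial>K (Suc (Suc n)) x \<partial>K (Suc n) y \<partial>K n z)
    = (\<integral>x'. \<integral>q. of_real (path_weight n z q x') * g q x' \<partial>mu_pair (Suc n) \<partial>mu (Suc (Suc (Suc n))))"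
proof -
  note g[measurable] and z[simp]
  let ?n1 = "Suc n" let ?n2 = "Suc ?n1" let ?n3 = "Suc ?n2"
  have b0: "0 \<le> b"
  proof -
    obtain y x x' where "y \<in> space (B ?n1)" "x \<in> space (B ?n2)" "x' \<in> space (B ?n3)"
      using space_B_nonempty by blast
    then have "norm (g (y, x) x') \<le> b" by (intro b) auto
    then show ?thesis by (rule order_trans[OF norm_ge_zero])
  qed
  have pm [measurable]: "(\<lambda>y. p n (z, y)) \<in> borel_measurable (B ?n1)" by measurable
  have wb: "norm (of_real (path_weight n z q x') * g q x') \<le> (1 / e) ^ 3 * b"
    if "q \<in> space (mu_pair ?n1)" "x' \<in> space (B ?n3)" for q x'
    unfolding norm_mult using that path_weight_bounds[of n z q x'] b e_pos by (intro mult_mono) auto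
  have "(\<integral>y. \<integral>x. \<integral>x'. g (y, x) x' \<partial>K ?n2 x \<partial>K ?n1 y \<partial>K n z)
      = (\<integral>y. p n (z, y) *\<^sub>R (\<integral>x. \<integral>x'. g (y, x) x' \<partial>K ?n2 x \<partial>K ?n1 y) \<partial>mu ?n1)"
    by (rule kernel_integral_eq) measurable
  also have "\<dots> = (\<integral>y. \<integral>x. \<integral>x'. of_real (path_weight n z (y, x) x') * g (y, x) x' \<partial>mu ?n3 \<partial>mu ?n2 \<partial>mu ?n1)"
  proof (rule Bochner_Integration.integral_cong[OF refl])
    fix y assume "y \<in> space (mu ?n1)"
    then have y [simp]: "y \<in> space (B ?n1)" by simp
    have [measurable]: "(\<lambda>(x, x'). g (y, x) x') \<in> borel_measurable (B ?n2 \<Otimes>\<^sub>M B ?n3)" by measurable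
    have "(\<integral>x. \<integral>x'. g (y, x) x' \<partial>K ?n2 x \<partial>K ?n1 y) = (\<integral>x. p ?n1 (y, x) *\<^sub>R (\<integral>x'. g (y, x) x' \<partial>K ?n2 x) \<partial>mu ?n2)"
      by (rule kernel_integral_eq[OF y]) measurable
    also have "\<dots> = (\<integral>x. \<integral>x'. p ?n1 (y, x) *\<^sub>R p ?n2 (x, x') *\<^sub>R g (y, x) x' \<partial>mu ?n3 \<partial>mu ?n2)"
      by (intro Bochner_Integration.integral_cong refl) (subst kernel_integral_eq, auto simp del: scaleR_scaleR)
    also have "p n (z, y) *\<^sub>R \<dots> = (\<integral>x. \<integral>x'. p n (z, y) *\<^sub>R p ?n1 (y, x) *\<^sub>R p ?n2 (x, x') *\<^sub>R g (y, x) x' \<partial>mu ?n3 \<partial>mu ?n2)"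
      by (simp only: integral_scaleR_right)
    also have "\<dots> = (\<integral>x. \<integral>x'. of_real (path_weight n z (y, x) x') * g (y, x) x' \<partial>mu ?n3 \<partial>mu ?n2)"
      by (intro Bochner_Integration.integral_cong refl)
        (simp add: path_weight_def scaleR_conv_of_real mult.assoc)
    finally show "p n (z, y) *\<^sub>R (\<integral>x. \<integral>x'. g (y, x) x' \<partial>K ?n2 x \<partial>K ?n1 y)
        = (\<integral>x. \<integral>x'. of_real (path_weight n z (y, x) x') * g (y, x) x' \<partial>mu ?n3 \<partial>mu ?n2)" .
  qed
  also have "\<dots> = (\<integral>q. \<integral>x'. of_real (path_weight n z (fst q, snd q) x') * g (fst q, snd q) x' \<partial>mu ?n3 \<partial>mu_pair ?n1)"
    unfolding mu_pair_def
  proof (rule bounded_Fubini(2)[OF prob_mu prob_mu, where c="(1 / e) ^ 3 * b"])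
    show "(\<lambda>(y, x). \<integral>x'. of_real (path_weight n z (y, x) x') * g (y, x) x' \<partial>mu ?n3) \<in> borel_measurable (mu ?n1 \<Otimes>\<^sub>M mu ?n2)"
      by measurable
    show "norm (\<integral>x'. of_real (path_weight n z (y, x) x') * g (y, x) x' \<partial>mu ?n3) \<le> (1 / e) ^ 3 * b"
      if "y \<in> space (mu ?n1)" "x \<in> space (mu ?n2)" for y x
    proof -
      have [simp]: "(y, x) \<in> space (B ?n1 \<Otimes>\<^sub>M B ?n2)" using that by (simp add: space_pair_measure)
      have [measurable]: "(\<lambda>x'. g (y, x) x') \<in> borel_measurable (B ?n3)" by measurable
      have [measurable]: "(\<lambda>x'. path_weight n z (y, x) x') \<in> borel_measurable (B ?n3)" by measurable
      have "norm (\<integral>x'. of_real (path_weight n z (y, x) x') * g (y, x) x' \<partial>mu ?n3) \<le> (\<integral>x'. (1 / e) ^ 3 * b \<partial>mu ?n3)"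
      proof (rule norm_integral_le)
        show wb': "norm (of_real (path_weight n z (y, x) x') * g (y, x) x') \<le> (1 / e) ^ 3 * b"
          if "x' \<in> space (mu ?n3)" for x'
          by (rule wb) (use that \<open>y \<in> space (mu ?n1)\<close> \<open>x \<in> space (mu ?n2)\<close> in auto)
        show "integrable (mu ?n3) (\<lambda>x'. of_real (path_weight n z (y, x) x') * g (y, x) x')"
          using wb' by (intro mu_integrable[where c="(1 / e) ^ 3 * b"]) auto
        show "integrable (mu ?n3) (\<lambda>x'. (1 / e) ^ 3 * b)"
          by (rule mu_integrable[where c="\<bar>(1 / e) ^ 3 * b\<bar>"]) auto
      qed
      then show ?thesis by simp
    qed
  qed
  also have "\<dots> = (\<integral>x'. \<integral>q. of_real (path_weight n z q x') * g q x' \<partial>mu_pair ?n1 \<partial>mu ?n3)"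
    unfolding prod.collapse
  proof (rule bounded_Fubini(1)[OF prob_mu_pair prob_mu, where c="(1 / e) ^ 3 * b"])
    show "norm (of_real (path_weight n z q x') * g q x') \<le> (1 / e) ^ 3 * b"
      if "q \<in> space (mu_pair ?n1)" "x' \<in> space (mu ?n3)" for q x'
      using that by (intro wb) auto
  qed measurable
  finally show ?thesis .
qed

lemma path_weight_mass:
  assumes z: "z \<in> space (B n)"
  shows "(\<integral>x. \<integral>q. path_weight n z q x \<partial>mu_pair (Suc n) \<partial>mu (Suc (Suc (Suc n)))) = 1"
proof -
  have 1: "(\<integral>x'. (1::real) \<partial>K (Suc (Suc n)) x) = 1" if "x \<in> space (B (Suc (Suc n)))" for x
    by (rule kernel_integral_const[OF that])
  have 2: "(\<integral>x. \<integral>x'. (1::real) \<partial>K (Suc (Suc n)) x \<partial>K (Suc n) y) = 1" if y: "y \<in> space (B (Suc n))" for y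
  proof -
    have "(\<integral>x. \<integral>x'. (1::real) \<partial>K (Suc (Suc n)) x \<partial>K (Suc n) y) = (\<integral>x. 1 \<partial>K (Suc n) y)"
      by (rule Bochner_Integration.integral_cong[OF refl], rule 1) (simp add: y)
    then show ?thesis by (simp only: kernel_integral_const[OF y])
  qed
  have "(\<integral>x. \<integral>q. of_real (path_weight n z q x) * 1 \<partial>mu_pair (Suc n) \<partial>mu (Suc (Suc (Suc n))))
      = (\<integral>y. \<integral>x. \<integral>x'. (1::real) \<partial>K (Suc (Suc n)) x \<partial>K (Suc n) y \<partial>K n z)"
    by (rule three_step_integral[OF z, of "\<lambda>_ _. 1" 1, symmetric]) auto
  also have "\<dots> = (\<integral>y. 1 \<partial>K n z)"
    by (rule Bochner_Integration.integral_cong[OF refl], rule 2) (simp add: z)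
  also have "\<dots> = 1" by (rule kernel_integral_const[OF z])
  finally show ?thesis by (simp only: of_real_eq_id id_apply mult_1_right)
qed

text \<open>Only the last density is estimated, since the first two kernels have mass 1. This gives
  1/e where \<open>path_weight_bounds\<close> would give 1/e^3.\<close>

lemma path_weight_section_le:
  assumes z [simp]: "z \<in> space (B n)" and x [simp]: "x \<in> space (B (Suc (Suc (Suc n))))"
  shows "(\<integral>q. path_weight n z q x \<partial>mu_pair (Suc n)) \<le> 1 / e"
proof -
  let ?n1 = "Suc n" let ?n2 = "Suc ?n1"
  have [measurable]: "(\<lambda>y. p n (z, y)) \<in> borel_measurable (B ?n1)" "(\<lambda>y. p ?n2 (y, x)) \<in> borel_measurable (B ?n2)"
    by measurable
  have pb: "\<bar>p n w\<bar> \<le> 1 / e" for n w using p_le[of n w] p_nonneg[of n w] by simp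
  have "(\<integral>q. path_weight n z q x \<partial>mu_pair ?n1) = (\<integral>q. path_weight n z (fst q, snd q) x \<partial>mu_pair ?n1)" by simp
  also have "\<dots> = (\<integral>y. \<integral>u. path_weight n z (y, u) x \<partial>mu ?n2 \<partial>mu ?n1)"
    unfolding mu_pair_def
    by (rule bounded_Fubini(2)[OF prob_mu prob_mu, where c="(1 / e) ^ 3", symmetric])
      (measurable, use path_weight_bounds in auto)
  also have "\<dots> = (\<integral>y. p n (z, y) *\<^sub>R (\<integral>u. p ?n2 (u, x) \<partial>K ?n1 y) \<partial>mu ?n1)"
    by (intro Bochner_Integration.integral_cong refl)
      (simp add: path_weight_def kernel_integral_eq mult.assoc)
  also have "\<dots> = (\<integral>y. \<integral>u. p ?n2 (u, x) \<partial>K ?n1 y \<partial>K n z)"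
    by (rule kernel_integral_eq[symmetric]) measurable
  also have "\<dots> \<le> 1 / e"
  proof (rule abs_le_D1, rule kernel_integral_abs_le[OF z])
    show "\<bar>\<integral>u. p ?n2 (u, x) \<partial>K ?n1 y\<bar> \<le> 1 / e" if "y \<in> space (B ?n1)" for y
      by (rule kernel_integral_abs_le[OF that]) (auto simp: pb)
  qed measurable
  finally show ?thesis .
qed

text \<open>For fixed end points the value of u is constant, and \<open>norm_integral_cis_le\<close>
  compares the phases of all paths between them. By \<open>path_weight_section_le\<close> the
  constant c there may be 1/e, which produces the factor e/2.\<close>

lemma three_step_bound:
  assumes z [simp]: "z \<in> space (B n)" and u [measurable]: "u \<in> borel_measurable (B (Suc (Suc (Suc n))))"
    and b: "\<And>x. x \<in> space (B (Suc (Suc (Suc n)))) \<Longrightarrow> norm (u x) \<le> b"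
  shows "norm (char_op \<xi> n (char_op \<xi> (Suc n) (char_op \<xi> (Suc (Suc n)) u)) z)
    \<le> b * (1 - e / 2 * (\<integral>x. hex_defect f \<xi> n z x \<partial>mu (Suc (Suc (Suc n)))))"
proof -
  let ?n1 = "Suc n" let ?n2 = "Suc ?n1" let ?n3 = "Suc ?n2"
  note f_measurable[measurable]
  obtain x0 where "x0 \<in> space (B ?n3)" using space_B_nonempty by blast
  then have b0: "0 \<le> b" by (rule order_trans[OF norm_ge_zero b])
  have A_nonneg: "0 \<le> (\<integral>q. path_weight n z q x \<partial>mu_pair ?n1)" for x
    by (intro Bochner_Integration.integral_nonneg path_weight_bounds)
  define g where "g q x = cis (\<xi> * path_sum f n z q x) * u x" for q x
  have gm: "(\<lambda>(q, x). g q x) \<in> borel_measurable ((B ?n1 \<Otimes>\<^sub>M B ?n2) \<Otimes>\<^sub>M B ?n3)"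
    unfolding g_def by measurable
  have gb: "norm (g q x) \<le> b" if "x \<in> space (B ?n3)" for q x
    using b[OF that] by (simp add: g_def norm_mult)
  have "char_op \<xi> n (char_op \<xi> ?n1 (char_op \<xi> ?n2 u)) z = (\<integral>y. \<integral>x. \<integral>x'. g (y, x) x' \<partial>K ?n2 x \<partial>K ?n1 y \<partial>K n z)"
    unfolding char_op_def integral_mult_right_zero[symmetric] g_def path_sum_def
    by (simp only: cis_mult[symmetric] distrib_left mult.assoc fst_conv snd_conv)
  also have "\<dots> = (\<integral>x'. \<integral>q. of_real (path_weight n z q x') * g q x' \<partial>mu_pair ?n1 \<partial>mu ?n3)"
    by (rule three_step_integral[OF z gm, where b=b]) (use gb in auto)
  also have "norm \<dots> \<le> (\<integral>x'. b * ((\<integral>q. path_weight n z q x' \<partial>mu_pair ?n1) - hex_defect f \<xi> n z x' / (2 * (1 / e))) \<partial>mu ?n3)"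
  proof (rule norm_integral_le)
    have wm: "(\<lambda>x'. \<integral>q. of_real (path_weight n z q x') * g q x' \<partial>mu_pair ?n1) \<in> borel_measurable (B ?n3)"
      using gm by measurable
    have wm2 [measurable]: "(\<lambda>x'. \<integral>q. path_weight n z q x' \<partial>mu_pair ?n1) \<in> borel_measurable (B ?n3)"
      by measurable
    show bound: "norm (\<integral>q. of_real (path_weight n z q x') * g q x' \<partial>mu_pair ?n1)
        \<le> b * ((\<integral>q. path_weight n z q x' \<partial>mu_pair ?n1) - hex_defect f \<xi> n z x' / (2 * (1 / e)))"
      if "x' \<in> space (mu ?n3)" for x'
    proof -
      interpret m: prob_space "mu_pair ?n1" by (rule prob_mu_pair)
      have x [simp]: "x' \<in> space (B ?n3)" using that by simp
      have [measurable]: "(\<lambda>q. path_weight n z q x') \<in> borel_measurable (mu_pair ?n1)"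
         "(\<lambda>q. path_sum f n z q x') \<in> borel_measurable (mu_pair ?n1)" by measurable
      have "(\<integral>q. of_real (path_weight n z q x') * g q x' \<partial>mu_pair ?n1)
          = (\<integral>q. of_real (path_weight n z q x') * cis (\<xi> * path_sum f n z q x') \<partial>mu_pair ?n1) * u x'"
        unfolding g_def integral_mult_left_zero[symmetric] by (simp only: mult.assoc)
      also have "norm \<dots> \<le> ((\<integral>q. path_weight n z q x' \<partial>mu_pair ?n1) - hex_defect f \<xi> n z x' / (2 * (1 / e))) * b"
        unfolding norm_mult
      proof (rule mult_mono)
        show "norm (\<integral>q. of_real (path_weight n z q x') * cis (\<xi> * path_sum f n z q x') \<partial>mu_pair ?n1)
          \<le> (\<integral>q. path_weight n z q x' \<partial>mu_pair ?n1) - hex_defect f \<xi> n z x' / (2 * (1 / e))"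
          unfolding hex_defect_def
          by (rule m.norm_integral_cis_le[where b="(1 / e) ^ 3"])
            (use path_weight_bounds path_weight_section_le e_pos in auto)
        from order_trans[OF norm_ge_zero this]
        show "0 \<le> (\<integral>q. path_weight n z q x' \<partial>mu_pair ?n1) - hex_defect f \<xi> n z x' / (2 * (1 / e))" .
      qed (use b in auto)
      finally show ?thesis by (simp only: mult.commute)
    qed
    have mb: "b * ((\<integral>q. path_weight n z q x' \<partial>mu_pair ?n1) - hex_defect f \<xi> n z x' / (2 * (1 / e))) \<le> b * (1 / e)"
      if "x' \<in> space (B ?n3)" for x'
      using hex_defect_bounds(1)[OF z that, of \<xi>] path_weight_section_le[OF z that] e_pos b0
      by (intro mult_left_mono) (auto intro: order_trans[rotated])
    show "integrable (mu ?n3) (\<lambda>x'. \<integral>q. of_real (path_weight n z q x') * g q x' \<partial>mu_pair ?n1)"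
      using wm order_trans[OF bound mb] by (intro mu_integrable[where c="b * (1 / e)"]) auto
    have "0 \<le> b * ((\<integral>q. path_weight n z q x' \<partial>mu_pair ?n1) - hex_defect f \<xi> n z x' / (2 * (1 / e)))"
      if "x' \<in> space (B ?n3)" for x'
      using order_trans[OF norm_ge_zero bound[of x']] that by simp
    then show "integrable (mu ?n3) (\<lambda>x'. b * ((\<integral>q. path_weight n z q x' \<partial>mu_pair ?n1) - hex_defect f \<xi> n z x' / (2 * (1 / e))))"
    proof (intro mu_integrable[where c="b * (1 / e)"])
      show "(\<lambda>x'. b * ((\<integral>q. path_weight n z q x' \<partial>mu_pair ?n1) - hex_defect f \<xi> n z x' / (2 * (1 / e)))) \<in> borel_measurable (B ?n3)"
        by measurable
    qed (use mb in simp)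
  qed
  also have "\<dots> = b * ((\<integral>x'. \<integral>q. path_weight n z q x' \<partial>mu_pair ?n1 \<partial>mu ?n3) - (\<integral>x. hex_defect f \<xi> n z x \<partial>mu ?n3) / (2 * (1 / e)))"
  proof -
    have 1: "integrable (mu ?n3) (\<lambda>x'. \<integral>q. path_weight n z q x' \<partial>mu_pair ?n1)"
      by (rule mu_integrable[where c="1 / e"]) (measurable, use A_nonneg path_weight_section_le in auto)
    have 2: "integrable (mu ?n3) (hex_defect f \<xi> n z)"
      by (rule mu_integrable[where c="2 * (1 / e) ^ 6"]) (measurable, use hex_defect_bounds in auto)
    show ?thesis using 1 2 by simp
  qed
  finally show ?thesis by (simp add: path_weight_mass mult.commute)
qed

text \<open>The gain in \<open>three_step_bound\<close> depends on the starting point z. Two further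
  steps in front average it with at least e times \<open>mu\<close>, which replaces the gain by its
  mean \<open>hex\<close> at the cost of another factor e.\<close>

lemma five_step_bound:
  assumes w [simp]: "w \<in> space (B n)" and u [measurable]: "u \<in> borel_measurable (B (n + 5))"
    and b: "\<And>x. x \<in> space (B (n + 5)) \<Longrightarrow> norm (u x) \<le> b"
  shows "norm (char_op \<xi> n (char_op \<xi> (Suc n) (char_op \<xi> (Suc (Suc n)) (char_op \<xi> (n + 3) (char_op \<xi> (n + 4) u)))) w)
    \<le> b * (1 - e\<^sup>2 / 2 * hex f \<xi> (Suc (Suc n)))"
proof -
  let ?n2 = "Suc (Suc n)"
  have n: "n + 3 = Suc ?n2" "n + 4 = Suc (Suc ?n2)" "n + 5 = Suc (Suc (Suc ?n2))" by auto
  note [measurable] = u[unfolded n]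
  have b': "norm (u x) \<le> b" if "x \<in> space (B (Suc (Suc (Suc ?n2))))" for x
    using b that by (simp add: n)
  obtain x0 where "x0 \<in> space (B (Suc (Suc (Suc ?n2))))" using space_B_nonempty by blast
  then have b0: "0 \<le> b" by (rule order_trans[OF norm_ge_zero b'])
  let ?v = "char_op \<xi> ?n2 (char_op \<xi> (Suc ?n2) (char_op \<xi> (Suc (Suc ?n2)) u))"
  let ?J = "\<lambda>z. \<integral>x. hex_defect f \<xi> ?n2 z x \<partial>mu (Suc (Suc (Suc ?n2)))"
  let ?j = "\<lambda>z. b * (1 - e / 2 * ?J z)"
  have Jb: "0 \<le> ?J z" "?J z \<le> 2 * (1 / e) ^ 6" if [simp]: "z \<in> space (B ?n2)" for z
  proof -
    show "0 \<le> ?J z" by (intro Bochner_Integration.integral_nonneg hex_defect_bounds) auto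
    have "\<bar>?J z\<bar> \<le> 2 * (1 / e) ^ 6" by (intro mu_integral_abs_le) (auto simp: hex_defect_bounds)
    then show "?J z \<le> 2 * (1 / e) ^ 6" by simp
  qed
  have jb: "?j z \<le> b" if "z \<in> space (B ?n2)" for z
    using Jb(1)[OF that] e_pos b0 mult_left_mono[of "1 - e / 2 * ?J z" 1 b] by simp
  have v: "norm (?v z) \<le> ?j z" if "z \<in> space (B ?n2)" for z
    by (rule three_step_bound[OF that _ b']) measurable
  have j0: "0 \<le> ?j z" if "z \<in> space (B ?n2)" for z using order_trans[OF norm_ge_zero v[OF that]] .
  have jK: "norm (char_op \<xi> (Suc n) ?v y) \<le> (\<integral>z. ?j z \<partial>K (Suc n) y)" if "y \<in> space (B (Suc n))" for y
    by (rule char_op_norm_le[OF that _ _ v jb]) measurable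
  have "norm (char_op \<xi> n (char_op \<xi> (Suc n) ?v) w) \<le> (\<integral>y. \<integral>z. ?j z \<partial>K (Suc n) y \<partial>K n w)"
  proof (rule char_op_norm_le[OF w _ _ jK, where b=b])
    show "(\<integral>z. ?j z \<partial>K (Suc n) y) \<le> b" if "y \<in> space (B (Suc n))" for y
      by (rule abs_le_D1, rule kernel_integral_abs_le[OF that]) (use j0 jb in auto)
  qed measurable
  also have "\<dots> = (\<integral>y. b - b * e / 2 * (\<integral>z. ?J z \<partial>K (Suc n) y) \<partial>K n w)"
  proof (intro Bochner_Integration.integral_cong refl)
    fix y assume "y \<in> space (K n w)"
    then have y [simp]: "y \<in> space (B (Suc n))" by simp
    have "integrable (K (Suc n) y) ?J"
      by (rule kernel_integrable[OF y, where c="2 * (1 / e) ^ 6"]) (measurable, use Jb in auto)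
    then show "(\<integral>z. ?j z \<partial>K (Suc n) y) = b - b * e / 2 * (\<integral>z. ?J z \<partial>K (Suc n) y)"
      by (simp add: right_diff_distrib kernel_integrable[OF y, where c="\<bar>b\<bar>"] mult.assoc)
  qed
  also have "\<dots> = b - b * e / 2 * (\<integral>y. \<integral>z. ?J z \<partial>K (Suc n) y \<partial>K n w)"
  proof -
    have "\<bar>\<integral>z. ?J z \<partial>K (Suc n) y\<bar> \<le> 2 * (1 / e) ^ 6" if "y \<in> space (B (Suc n))" for y
      by (rule kernel_integral_abs_le[OF that]) (measurable, use Jb in auto)
    then have "integrable (K n w) (\<lambda>y. \<integral>z. ?J z \<partial>K (Suc n) y)"
    proof (intro kernel_integrable[OF w, where c="2 * (1 / e) ^ 6"])
      show "(\<lambda>y. \<integral>z. ?J z \<partial>K (Suc n) y) \<in> borel_measurable (B (Suc n))" by measurable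
    qed auto
    then show ?thesis by (simp add: kernel_integrable[OF w, where c="\<bar>b\<bar>"])
  qed
  also have "\<dots> \<le> b - b * e / 2 * (e * (\<integral>z. ?J z \<partial>mu ?n2))"
  proof -
    have "e * (\<integral>z. ?J z \<partial>mu ?n2) \<le> (\<integral>y. \<integral>z. ?J z \<partial>K (Suc n) y \<partial>K n w)"
      by (rule two_step_lower[OF w, where c="2 * (1 / e) ^ 6"]) (measurable, use Jb in auto)
    then show ?thesis using b0 e_pos by (intro diff_left_mono mult_left_mono) auto
  qed
  also have "\<dots> = b * (1 - e\<^sup>2 / 2 * hex f \<xi> ?n2)"
    by (simp add: hex_def power2_eq_square algebra_simps)
  finally show ?thesis unfolding n .
qed

primrec char_rec :: "real \<Rightarrow> nat \<Rightarrow> nat \<Rightarrow> 'a \<Rightarrow> complex" where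
  "char_rec \<xi> 0 n = (\<lambda>_. 1)"
| "char_rec \<xi> (Suc k) n = char_op \<xi> n (char_rec \<xi> k (Suc n))"

lemma char_rec_measurable [measurable]: "char_rec \<xi> k n \<in> borel_measurable (B n)"
  by (induction k arbitrary: n) auto

lemma char_rec_bound: "x \<in> space (B n) \<Longrightarrow> norm (char_rec \<xi> k n x) \<le> 1"
  by (induction k arbitrary: n x) (auto intro!: char_op_bound)

lemma char_rec_expectation:
  assumes "G \<in> borel_measurable (F n)" "\<And>w. w \<in> space P \<Longrightarrow> norm (G w) \<le> 1"
  shows "expectation (\<lambda>w. G w * cis (\<xi> * (\<Sum>m=n..<n+k. f m (X m w, X (Suc m) w))))
    = expectation (\<lambda>w. G w * char_rec \<xi> k n (X n w))"
  using assms
proof (induction k arbitrary: n G)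
  case (Suc k)
  note [measurable] = Suc.prems(1) f_measurable
  have 1: "expectation (\<lambda>w. G w * cis (\<xi> * (\<Sum>m=n..<n+Suc k. f m (X m w, X (Suc m) w))))
     = expectation (\<lambda>w. (G w * cis (\<xi> * f n (X n w, X (Suc n) w)))
         * cis (\<xi> * (\<Sum>m=Suc n..<Suc n+k. f m (X m w, X (Suc m) w))))"
    by (intro Bochner_Integration.integral_cong refl)
      (simp add: sum.atLeast_Suc_lessThan cis_mult[symmetric] distrib_left mult.assoc)
  also have "\<dots> = expectation (\<lambda>w. (G w * cis (\<xi> * f n (X n w, X (Suc n) w))) * char_rec \<xi> k (Suc n) (X (Suc n) w))"
  proof (rule Suc.IH)
    have [measurable]: "G \<in> borel_measurable (F (Suc n))" by (rule measurable_F_Suc[OF Suc.prems(1)])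
    show "(\<lambda>w. G w * cis (\<xi> * f n (X n w, X (Suc n) w))) \<in> borel_measurable (F (Suc n))" by measurable
  qed (use Suc.prems(2) in \<open>simp add: norm_mult\<close>)
  also have "\<dots> = expectation (\<lambda>w. \<integral>y. G w * cis (\<xi> * f n (X n w, y)) * char_rec \<xi> k (Suc n) y \<partial>K n (X n w))"
  proof (rule markov_step_complex[where c="1 * 1"])
    show "norm (G w * cis (\<xi> * f n (X n w, y)) * char_rec \<xi> k (Suc n) y) \<le> 1 * 1"
      if "w \<in> space P" "y \<in> space (B (Suc n))" for w y
      unfolding norm_mult[of _ "char_rec \<xi> k (Suc n) y"] using that
      by (intro mult_mono char_rec_bound) (auto simp: norm_mult Suc.prems(2))
  qed measurable
  also have "\<dots> = expectation (\<lambda>w. G w * char_rec \<xi> (Suc k) n (X n w))"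
    by (simp add: char_op_def mult.assoc)
  finally show ?case .
qed simp

end

text \<open>Let U n be the sup norm of the characteristic function of the part of the sum after
  level n. A block of five steps contracts by 1 - c n, but blocks starting at consecutive levels
  overlap. The product W of five consecutive values of U resolves this: moving it by one level
  replaces U n by U (n + 5), so every hexagon contributes. The fifth root at the end turns e^2/2
  into e^2/10.\<close>

lemma char_bound:
  assumes f: "bounded_functional f R"
  shows "norm (expectation (\<lambda>w. cis (\<xi> * psum f N w))) \<le> exp (- (e\<^sup>2 / 10 * hex_sum f N \<xi>))"
proof -
  note fm = bounded_functional_measurable[OF f]
  note [measurable] = char_rec_measurable[of f, OF fm]
  define u where "u n = char_rec f \<xi> (N - n) n" for n
  define U where "U n = (SUP x\<in>space (B n). norm (u n x))" for n
  have ub: "norm (u n x) \<le> 1" if "x \<in> space (B n)" for n x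
    unfolding u_def by (rule char_rec_bound[of f, OF fm that])
  have [measurable]: "u n \<in> borel_measurable (B n)" for n
    unfolding u_def by (rule char_rec_measurable[of f, OF fm])
  have bdd: "bdd_above ((\<lambda>x. norm (u n x)) ` space (B n))" for n
    using ub by (intro bdd_aboveI2[where M=1]) auto
  have uU: "norm (u n x) \<le> U n" if "x \<in> space (B n)" for n x
    unfolding U_def by (rule cSUP_upper[OF that bdd])
  have U1: "U n \<le> 1" for n unfolding U_def by (rule cSUP_least) (use space_B_nonempty ub in auto)
  have U0: "0 \<le> U n" for n
  proof -
    obtain x0 where "x0 \<in> space (B n)" using space_B_nonempty by blast
    then show ?thesis by (rule order_trans[OF norm_ge_zero uU])
  qed
  have Um: "U n \<le> U (Suc n)" if "n < N" for n
    unfolding U_def[of n]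
  proof (rule cSUP_least)
    have k: "N - n = Suc (N - Suc n)" using that by simp
    show "norm (u n x) \<le> U (Suc n)" if "x \<in> space (B n)" for x
      unfolding u_def k char_rec.simps(2)[of f, OF fm] using uU[of _ "Suc n"]
      by (intro char_op_bound[of f, OF fm that]) (auto simp: u_def)
  qed (rule space_B_nonempty)
  define c where "c n = e\<^sup>2 / 2 * hex f \<xi> (Suc (Suc n))" for n
  have U5: "U n \<le> U (n + 5) * (1 - c n)" if "n + 5 \<le> N" for n
    unfolding U_def[of n]
  proof (rule cSUP_least)
    have k: "N - n = Suc (Suc (Suc (Suc (Suc (N - (n + 5))))))" using that by simp
    show "norm (u n x) \<le> U (n + 5) * (1 - c n)" if "x \<in> space (B n)" for x
      unfolding u_def k char_rec.simps(2)[of f, OF fm] c_def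
      using five_step_bound[of f, OF fm that, of "u (n + 5)" "U (n + 5)" \<xi>] uU[of _ "n + 5"]
      by (simp add: u_def numeral_eq_Suc)
  qed (rule space_B_nonempty)
  define W where "W n = U n * U (n+1) * U (n+2) * U (n+3) * U (n+4)" for n
  have W_step: "W n \<le> exp (- c n) * W (Suc n)" if n: "n + 5 \<le> N" for n
  proof -
    have "W n = U n * (U (n+1) * U (n+2) * U (n+3) * U (n+4))" by (simp add: W_def mult_ac)
    also have "\<dots> \<le> (U (n + 5) * (1 - c n)) * (U (n+1) * U (n+2) * U (n+3) * U (n+4))"
      by (intro mult_right_mono U5 n mult_nonneg_nonneg U0)
    also have "\<dots> \<le> (U (n + 5) * exp (- c n)) * (U (n+1) * U (n+2) * U (n+3) * U (n+4))"
      using exp_ge_add_one_self[of "- c n"]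
      by (intro mult_right_mono mult_left_mono mult_nonneg_nonneg U0) auto
    also have "\<dots> = exp (- c n) * W (Suc n)" by (simp add: W_def mult_ac numeral_eq_Suc)
    finally show ?thesis .
  qed
  have W_bound: "W 0 \<le> exp (- (\<Sum>n<k. c n)) * W k" if "k \<le> N - 4" "5 \<le> N" for k
    using that
  proof (induction k)
    case (Suc k)
    have "W 0 \<le> exp (- (\<Sum>n<k. c n)) * W k" using Suc by simp
    also have "\<dots> \<le> exp (- (\<Sum>n<k. c n)) * (exp (- c k) * W (Suc k))"
      using Suc by (intro mult_left_mono W_step) auto
    finally show ?case by (simp add: exp_diff exp_minus field_simps)
  qed simp
  have "norm (expectation (\<lambda>w. cis (\<xi> * psum f N w))) \<le> U 0"
  proof -
    have "expectation (\<lambda>w. cis (\<xi> * psum f N w)) = expectation (\<lambda>w. u 0 (X 0 w))"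
      using char_rec_expectation[of f "\<lambda>_. 1" 0 \<xi> N, OF fm] by (simp add: psum_def u_def atLeast0LessThan)
    also have "norm \<dots> \<le> expectation (\<lambda>w. U 0)"
      by (rule norm_integral_le)
        (use uU ub in \<open>auto intro!: P_integrable[where c=1]\<close>)
    finally show ?thesis by (simp add: prob_space)
  qed
  also have "U 0 \<le> exp (- (e\<^sup>2 / 10 * hex_sum f N \<xi>))"
  proof (cases "5 \<le> N")
    case True
    have mono: "U 0 \<le> U k" if "k \<le> N" for k
      using that by (induction k) (auto intro: order_trans[OF _ Um])
    have "U 0 ^ 5 = U 0 * U 0 * U 0 * U 0 * U 0" by (simp add: numeral_eq_Suc)
    also have "\<dots> \<le> W 0"
      unfolding W_def using True by (intro mult_mono mono mult_nonneg_nonneg U0) auto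
    also have "\<dots> \<le> exp (- (\<Sum>n<N - 4. c n)) * W (N - 4)" using W_bound[of "N - 4"] True by simp
    also have "W (N - 4) \<le> 1" unfolding W_def by (intro mult_le_one U1 U0 mult_nonneg_nonneg)
    also have "(\<Sum>n<N - 4. c n) = 5 * (e\<^sup>2 / 10 * hex_sum f N \<xi>)"
      by (simp add: c_def hex_sum_def sum_distrib_left)
    finally have "U 0 ^ 5 \<le> exp (- (5 * (e\<^sup>2 / 10 * hex_sum f N \<xi>)))" by simp
    also have "\<dots> = exp (- (e\<^sup>2 / 10 * hex_sum f N \<xi>)) ^ 5"
      by (simp flip: exp_of_nat_mult)
    finally show ?thesis by (rule power_le_imp_le_base[where n=4, simplified]) simp
  next
    case False
    then show ?thesis using U1[of 0] by (simp add: hex_sum_def)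
  qed
  finally show ?thesis .
qed

end

subsection \<open>Bridges\<close>

text \<open>Since 1 - cos t = 2 sin^2 (t/2), it suffices that sin x \<ge> x/2 on [0, pi/2]. Up to
  pi/3 the derivative of sin x - x/2 is nonnegative; beyond that sin x is at least sqrt 3 /
  2.\<close>

lemma square_le_one_minus_cos:
  assumes "\<bar>t\<bar> \<le> pi"
  shows "t\<^sup>2 \<le> 8 * (1 - cos t)"
proof -
  have sin_ge: "x / 2 \<le> sin x" if x: "0 \<le> x" "x \<le> pi / 2" for x :: real
  proof (cases "x \<le> pi / 3")
    case True
    have "sin 0 - 0 / 2 \<le> sin x - x / 2"
    proof (rule DERIV_nonneg_imp_nondecreasing[OF x(1)])
      fix y assume y: "0 \<le> y" "y \<le> x"
      have "cos (pi / 3) \<le> cos y" using y True by (intro cos_monotone_0_pi_le) auto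
      then show "\<exists>d. ((\<lambda>x. sin x - x / 2) has_real_derivative d) (at y) \<and> 0 \<le> d"
        by (intro exI[of _ "cos y - 1 / 2"]) (auto intro!: derivative_eq_intros simp: cos_60)
    qed
    then show ?thesis by simp
  next
    case False
    have "x / 2 \<le> sqrt 3 / 2"
      using x pi_less_4 real_le_rsqrt[of "17/10" 3] pi_approx by (simp add: power2_eq_square)
    also have "\<dots> = sin (pi / 3)" by (simp add: sin_60)
    also have "\<dots> \<le> sin x" using False x by (intro sin_monotone_2pi_le) auto
    finally show ?thesis .
  qed
  define x where "x = \<bar>t\<bar> / 2"
  have x: "0 \<le> x" "x \<le> pi / 2" using assms by (auto simp: x_def)
  have "(x / 2)\<^sup>2 \<le> (sin x)\<^sup>2" using sin_ge[OF x] x by (intro power_mono) auto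
  moreover have "cos t = 1 - 2 * (sin x)\<^sup>2"
    using cos_double_sin[of x] by (simp add: x_def)
  moreover have "t\<^sup>2 = 4 * x\<^sup>2" by (simp add: x_def power_divide)
  ultimately show ?thesis by (simp add: power_divide)
qed

text \<open>The numbers a and b will be moduli of bridge characteristic functions. If cos t is
  negative the right side is already at least 2; otherwise shrinking the moduli only enlarges
  it.\<close>

lemma one_minus_cos_le_of_moduli:
  assumes "0 \<le> a" "a \<le> 1" "0 \<le> b" "b \<le> (1::real)"
  shows "1 - cos t \<le> 2 * (1 - a * b * cos t)"
proof (cases "0 \<le> cos t")
  case True
  have "a * b \<le> 1" using assms by (simp add: mult_le_one)
  then have "a * b * cos t \<le> 1 * cos t" using True by (intro mult_right_mono) auto
  then show ?thesis using cos_le_one[of t] unfolding right_diff_distrib by linarith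
next
  case False
  then have "a * b * cos t \<le> 0" using assms by (simp add: mult_nonneg_nonpos)
  then show ?thesis using cos_ge_minus_one[of t] unfolding right_diff_distrib by linarith
qed

lemma Re_rotated_product:
  "Re (cis t * w * cnj v) = norm w * norm v * cos (t + Arg w - Arg v)"
proof -
  have w: "w = of_real (norm w) * cis (Arg w)" "v = of_real (norm v) * cis (Arg v)"
    using rcis_cmod_Arg[of w] rcis_cmod_Arg[of v] by (simp_all add: rcis_def)
  have "cis t * w * cnj v = of_real (norm w * norm v) * cis (t + Arg w - Arg v)"
  proof -
    have "cis t * w * cnj v = cis t * (of_real (norm w) * cis (Arg w)) * cnj (of_real (norm v) * cis (Arg v))"
      using w by simp
    also have "\<dots> = of_real (norm w) * of_real (norm v) * (cis t * cis (Arg w) * cis (- Arg v))"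
      by (simp add: cis_cnj mult_ac)
    finally show ?thesis by (simp add: cis_mult)
  qed
  then show ?thesis by simp
qed

text \<open>\<open>Arg\<close> is continuous off the nonpositive reals; on the negative ones it is
  constantly pi, and at 0 it is 0.\<close>

lemma borel_measurable_Arg [measurable]: "Arg \<in> borel_measurable borel"
proof -
  have "Arg = (\<lambda>z. indicator (- \<real>\<^sub>\<le>\<^sub>0) z *\<^sub>R Arg z + indicator (\<real>\<^sub>\<le>\<^sub>0) z * (if z = 0 then 0 else pi))"
  proof
    fix z :: complex
    show "Arg z = indicator (- \<real>\<^sub>\<le>\<^sub>0) z *\<^sub>R Arg z + indicator (\<real>\<^sub>\<le>\<^sub>0) z * (if z = 0 then 0 else pi)"
    proof (cases "z \<in> \<real>\<^sub>\<le>\<^sub>0 \<and> z \<noteq> 0")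
      case True
      then have "Re z < 0 \<and> Im z = 0" by (auto simp: complex_nonpos_Reals_iff complex_eq_iff)
      then have "Arg z = pi" by (simp add: Arg_eq_pi)
      with True show ?thesis by simp
    qed (auto simp: Arg_zero)
  qed
  moreover have "(\<lambda>z. indicator (- \<real>\<^sub>\<le>\<^sub>0) z *\<^sub>R Arg z) \<in> borel_measurable borel"
    by (intro borel_measurable_continuous_on_indicator continuous_on_Arg) auto
  moreover have "(\<lambda>z::complex. indicator (\<real>\<^sub>\<le>\<^sub>0) z * (if z = 0 then 0 else pi)) \<in> borel_measurable borel"
  proof -
    have [measurable]: "(\<real>\<^sub>\<le>\<^sub>0 :: complex set) \<in> sets borel" by (rule borel_closed) simp
    show ?thesis by measurable
  qed
  ultimately show ?thesis by (subst \<open>Arg = _\<close>) (rule borel_measurable_add)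
qed

context elliptic_process
begin

text \<open>The \<open>bridge\<close> is the conditional density of the middle state given its two neighbours \<open>z\<close> and \<open>x\<close>.\<close>

definition two_step_density :: "nat \<Rightarrow> 'a \<Rightarrow> 'a \<Rightarrow> real" where
  "two_step_density n z x = (\<integral>y. p n (z, y) * p (Suc n) (y, x) \<partial>mu (Suc n))"

definition bridge :: "nat \<Rightarrow> 'a \<Rightarrow> 'a \<Rightarrow> 'a \<Rightarrow> real" where
  "bridge n z x y = p n (z, y) * p (Suc n) (y, x) / two_step_density n z x"

lemma measurable_two_step_density [measurable (raw)]:
  assumes [measurable]: "g \<in> M \<rightarrow>\<^sub>M B n" "h \<in> M \<rightarrow>\<^sub>M B (Suc (Suc n))"
  shows "(\<lambda>w. two_step_density n (g w) (h w)) \<in> borel_measurable M"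
  unfolding two_step_density_def by measurable

lemma measurable_bridge [measurable (raw)]:
  assumes [measurable]: "g \<in> M \<rightarrow>\<^sub>M B n" "h \<in> M \<rightarrow>\<^sub>M B (Suc (Suc n))" "k \<in> M \<rightarrow>\<^sub>M B (Suc n)"
  shows "(\<lambda>w. bridge n (g w) (h w) (k w)) \<in> borel_measurable M"
  unfolding bridge_def by measurable

lemma two_step_density_gt: "z \<in> space (B n) \<Longrightarrow> x \<in> space (B (Suc (Suc n))) \<Longrightarrow> e < two_step_density n z x"
  unfolding two_step_density_def by (rule two_step)

lemma density_product_bounds: "0 \<le> p n u * p m v" "p n u * p m v \<le> (1 / e)\<^sup>2"
  using e_pos unfolding power2_eq_square
  by (auto intro!: mult_nonneg_nonneg p_nonneg mult_mono p_le simp del: times_divide_eq_left times_divide_eq_right)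

lemma bridge_bounds:
  assumes "z \<in> space (B n)" "x \<in> space (B (Suc (Suc n)))"
  shows "0 \<le> bridge n z x y" "bridge n z x y \<le> p n (z, y) * p (Suc n) (y, x) / e"
    "bridge n z x y \<le> (1 / e) ^ 3"
proof -
  have t: "e < two_step_density n z x" by (rule two_step_density_gt[OF assms])
  show "0 \<le> bridge n z x y" unfolding bridge_def
    using density_product_bounds(1) t e_pos by (intro divide_nonneg_nonneg) auto
  show 1: "bridge n z x y \<le> p n (z, y) * p (Suc n) (y, x) / e" unfolding bridge_def
    using density_product_bounds(1) t e_pos by (intro divide_left_mono) auto
  also have "\<dots> \<le> (1 / e)\<^sup>2 / e" using e_pos by (intro divide_right_mono density_product_bounds) auto
  finally show "bridge n z x y \<le> (1 / e) ^ 3" by (simp add: power2_eq_square power3_eq_cube)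
qed

context
  fixes n :: nat and z x :: 'a
  assumes zx [simp]: "z \<in> space (B n)" "x \<in> space (B (Suc (Suc n)))"
begin

lemma bridge_mass: "(\<integral>y. bridge n z x y \<partial>mu (Suc n)) = 1"
  using two_step_density_gt[OF zx] e_pos by (simp add: bridge_def flip: two_step_density_def)

lemma bridge_integrable:
  fixes g :: "'a \<Rightarrow> 'c::{real_normed_field,banach,second_countable_topology}"
  assumes [measurable]: "g \<in> borel_measurable (B (Suc n))" and b: "\<And>y. y \<in> space (B (Suc n)) \<Longrightarrow> norm (g y) \<le> b"
  shows "integrable (mu (Suc n)) (\<lambda>y. of_real (bridge n z x y) * g y)"
proof (rule mu_integrable[where c="(1 / e) ^ 3 * b"])
  show "norm (of_real (bridge n z x y) * g y) \<le> (1 / e) ^ 3 * b" if "y \<in> space (B (Suc n))" for y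
    unfolding norm_mult using bridge_bounds[OF zx, of y] b[OF that] e_pos by (intro mult_mono) auto
qed measurable

lemma bridge_integrable_real:
  fixes g :: "'a \<Rightarrow> real"
  assumes "g \<in> borel_measurable (B (Suc n))" "\<And>y. y \<in> space (B (Suc n)) \<Longrightarrow> \<bar>g y\<bar> \<le> b"
  shows "integrable (mu (Suc n)) (\<lambda>y. bridge n z x y * g y)"
  using bridge_integrable[of g b] assms by simp

lemma bridge_integral_abs_le:
  fixes g :: "'a \<Rightarrow> real"
  assumes g [measurable]: "g \<in> borel_measurable (B (Suc n))" and b: "\<And>y. y \<in> space (B (Suc n)) \<Longrightarrow> \<bar>g y\<bar> \<le> b"
  shows "\<bar>\<integral>y. bridge n z x y * g y \<partial>mu (Suc n)\<bar> \<le> b"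
proof -
  have i: "integrable (mu (Suc n)) (\<lambda>y. bridge n z x y * b)"
    by (rule bridge_integrable_real[where b="\<bar>b\<bar>"]) auto
  have "\<bar>\<integral>y. bridge n z x y * g y \<partial>mu (Suc n)\<bar> \<le> (\<integral>y. \<bar>bridge n z x y * g y\<bar> \<partial>mu (Suc n))"
    by (rule integral_abs_bound)
  also have "\<dots> \<le> (\<integral>y. bridge n z x y * b \<partial>mu (Suc n))"
  proof (rule integral_mono[OF integrable_abs[OF bridge_integrable_real[OF g b]] i])
    show "\<bar>bridge n z x y * g y\<bar> \<le> bridge n z x y * b" if "y \<in> space (mu (Suc n))" for y
      unfolding abs_mult using bridge_bounds(1)[OF zx, of y] b that by (intro mult_mono) auto
  qed
  finally show ?thesis by (simp add: bridge_mass)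
qed

lemma bridge_square_le:
  fixes g :: "'a \<Rightarrow> real"
  assumes g [measurable]: "g \<in> borel_measurable (B (Suc n))" and b: "\<And>y. y \<in> space (B (Suc n)) \<Longrightarrow> \<bar>g y\<bar> \<le> b"
  shows "(\<integral>y. bridge n z x y * g y \<partial>mu (Suc n))\<^sup>2 \<le> (\<integral>y. bridge n z x y * (g y)\<^sup>2 \<partial>mu (Suc n))"
proof -
  define m where "m = (\<integral>y. bridge n z x y * g y \<partial>mu (Suc n))"
  have i1: "integrable (mu (Suc n)) (\<lambda>y. bridge n z x y * g y)" by (rule bridge_integrable_real[OF g b])
  have i2: "integrable (mu (Suc n)) (\<lambda>y. bridge n z x y * (g y)\<^sup>2)"
    by (rule bridge_integrable_real[where b="b\<^sup>2"]) (use b in \<open>auto intro!: square_le_of_abs_le\<close>)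
  have i0: "integrable (mu (Suc n)) (bridge n z x)" using bridge_integrable_real[of "\<lambda>_. 1" 1] by simp
  have "0 \<le> (\<integral>y. bridge n z x y * (g y - m)\<^sup>2 \<partial>mu (Suc n))"
    using bridge_bounds(1)[OF zx] by (intro Bochner_Integration.integral_nonneg) auto
  also have "(\<lambda>y. bridge n z x y * (g y - m)\<^sup>2)
      = (\<lambda>y. bridge n z x y * (g y)\<^sup>2 - 2 * m * (bridge n z x y * g y) + m\<^sup>2 * bridge n z x y)"
    by (simp add: fun_eq_iff power2_eq_square algebra_simps)
  also have "(\<integral>y. bridge n z x y * (g y)\<^sup>2 - 2 * m * (bridge n z x y * g y) + m\<^sup>2 * bridge n z x y \<partial>mu (Suc n))
      = (\<integral>y. bridge n z x y * (g y)\<^sup>2 \<partial>mu (Suc n)) - 2 * m * m + m\<^sup>2"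
    using i0 i1 i2 by (simp add: bridge_mass m_def)
  finally show ?thesis by (simp add: m_def power2_eq_square)
qed

end

definition bridge_sum :: "(nat \<Rightarrow> 'a \<times> 'a \<Rightarrow> real) \<Rightarrow> nat \<Rightarrow> 'a \<Rightarrow> 'a \<Rightarrow> 'a \<Rightarrow> real" where
  "bridge_sum f n z x y = f n (z, y) + f (Suc n) (y, x)"

definition bridge_char :: "(nat \<Rightarrow> 'a \<times> 'a \<Rightarrow> real) \<Rightarrow> real \<Rightarrow> nat \<Rightarrow> 'a \<Rightarrow> 'a \<Rightarrow> complex" where
  "bridge_char f \<xi> n z x = (\<integral>y. of_real (bridge n z x y) * cis (\<xi> * bridge_sum f n z x y) \<partial>mu (Suc n))"

definition bridge_mean :: "(nat \<Rightarrow> 'a \<times> 'a \<Rightarrow> real) \<Rightarrow> nat \<Rightarrow> 'a \<Rightarrow> 'a \<Rightarrow> real" where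
  "bridge_mean f n z x = (\<integral>y. bridge n z x y * bridge_sum f n z x y \<partial>mu (Suc n))"

text \<open>The two paths of the hexagon are z, y, x, x' and z, z', y', x'. The grouping separates
  the edges at levels n + 2 and n from two bridges, one between z and x and the other between z' and
  x'. With (z, z') fixed, averaging over y and y' therefore leaves f at level n + 2 plus a constant
  and a coboundary.\<close>

definition balance :: "(nat \<Rightarrow> 'a \<times> 'a \<Rightarrow> real) \<Rightarrow> nat \<Rightarrow> 'a \<Rightarrow> 'a \<Rightarrow> 'a \<Rightarrow> 'a \<Rightarrow> 'a \<Rightarrow> 'a \<Rightarrow> real" where
  "balance f n z z' x x' y y' = bridge_sum f n z x y + (f (Suc (Suc n)) (x, x') - f n (z, z')) - bridge_sum f (Suc n) z' x' y'"

definition bridge_defect :: "(nat \<Rightarrow> 'a \<times> 'a \<Rightarrow> real) \<Rightarrow> real \<Rightarrow> nat \<Rightarrow> 'a \<Rightarrow> 'a \<Rightarrow> 'a \<Rightarrow> 'a \<Rightarrow> real" where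
  "bridge_defect f \<xi> n z z' x x' = (\<integral>y. \<integral>y'. bridge n z x y * (bridge (Suc n) z' x' y' *
      (1 - cos (\<xi> * balance f n z z' x x' y y'))) \<partial>mu (Suc (Suc n)) \<partial>mu (Suc n))"

context
  fixes f :: "nat \<Rightarrow> 'a \<times> 'a \<Rightarrow> real"
  assumes f_measurable: "\<And>n. f n \<in> borel_measurable (B n \<Otimes>\<^sub>M B (Suc n))"
begin

lemma measurable_bridge_sum [measurable (raw)]:
  assumes [measurable]: "g \<in> M \<rightarrow>\<^sub>M B n" "h \<in> M \<rightarrow>\<^sub>M B (Suc (Suc n))" "k \<in> M \<rightarrow>\<^sub>M B (Suc n)"
  shows "(\<lambda>w. bridge_sum f n (g w) (h w) (k w)) \<in> borel_measurable M"
proof -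
  note f_measurable[measurable]
  show ?thesis unfolding bridge_sum_def by measurable
qed

lemma measurable_bridge_char [measurable (raw)]:
  assumes [measurable]: "g \<in> M \<rightarrow>\<^sub>M B n" "h \<in> M \<rightarrow>\<^sub>M B (Suc (Suc n))"
  shows "(\<lambda>w. bridge_char f \<xi> n (g w) (h w)) \<in> borel_measurable M"
  unfolding bridge_char_def by measurable

lemma measurable_bridge_mean [measurable (raw)]:
  assumes [measurable]: "g \<in> M \<rightarrow>\<^sub>M B n" "h \<in> M \<rightarrow>\<^sub>M B (Suc (Suc n))"
  shows "(\<lambda>w. bridge_mean f n (g w) (h w)) \<in> borel_measurable M"
  unfolding bridge_mean_def by measurable

lemma measurable_balance [measurable (raw)]:
  assumes [measurable]: "g \<in> M \<rightarrow>\<^sub>M B n" "g' \<in> M \<rightarrow>\<^sub>M B (Suc n)" "h \<in> M \<rightarrow>\<^sub>M B (Suc (Suc n))"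
    "h' \<in> M \<rightarrow>\<^sub>M B (Suc (Suc (Suc n)))" "k \<in> M \<rightarrow>\<^sub>M B (Suc n)" "k' \<in> M \<rightarrow>\<^sub>M B (Suc (Suc n))"
  shows "(\<lambda>w. balance f n (g w) (g' w) (h w) (h' w) (k w) (k' w)) \<in> borel_measurable M"
proof -
  note f_measurable[measurable]
  show ?thesis unfolding balance_def by measurable
qed

lemma bridge_char_le:
  assumes [simp]: "z \<in> space (B n)" "x \<in> space (B (Suc (Suc n)))"
  shows "norm (bridge_char f \<xi> n z x) \<le> 1"
proof -
  have "norm (bridge_char f \<xi> n z x) \<le> (\<integral>y. bridge n z x y \<partial>mu (Suc n))"
    unfolding bridge_char_def
  proof (rule norm_integral_le)
    show "integrable (mu (Suc n)) (\<lambda>y. complex_of_real (bridge n z x y) * cis (\<xi> * bridge_sum f n z x y))"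
      by (rule bridge_integrable[where b=1]) auto
    show "integrable (mu (Suc n)) (bridge n z x)" using bridge_integrable_real[of z n x "\<lambda>_. 1" 1] by simp
  qed (simp add: norm_mult bridge_bounds(1))
  then show ?thesis by (simp add: bridge_mass)
qed

lemma bridge_char_Re_Im:
  assumes [simp]: "z \<in> space (B n)" "x \<in> space (B (Suc (Suc n)))"
  shows "Re (bridge_char f \<xi> n z x) = (\<integral>y. bridge n z x y * cos (\<xi> * bridge_sum f n z x y) \<partial>mu (Suc n))"
  "Im (bridge_char f \<xi> n z x) = (\<integral>y. bridge n z x y * sin (\<xi> * bridge_sum f n z x y) \<partial>mu (Suc n))"
proof -
  have i: "integrable (mu (Suc n)) (\<lambda>y. complex_of_real (bridge n z x y) * cis (\<xi> * bridge_sum f n z x y))"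
    by (rule bridge_integrable[where b=1]) auto
  show "Re (bridge_char f \<xi> n z x) = (\<integral>y. bridge n z x y * cos (\<xi> * bridge_sum f n z x y) \<partial>mu (Suc n))"
    unfolding bridge_char_def using i by (simp flip: integral_Re)
  show "Im (bridge_char f \<xi> n z x) = (\<integral>y. bridge n z x y * sin (\<xi> * bridge_sum f n z x y) \<partial>mu (Suc n))"
    unfolding bridge_char_def using i by (simp flip: integral_Im)
qed

text \<open>The middle states y and y' are independent under the two bridges, so the mean of the cis
  of the phase factors into the two bridge characteristic functions.\<close>

lemma bridge_defect_eq:
  assumes zx [simp]: "z \<in> space (B n)" "z' \<in> space (B (Suc n))" "x \<in> space (B (Suc (Suc n)))"
    "x' \<in> space (B (Suc (Suc (Suc n))))"
  shows "bridge_defect f \<xi> n z z' x x' = 1 - Re (cis (\<xi> * (f (Suc (Suc n)) (x, x') - f n (z, z')))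
      * bridge_char f \<xi> n z x * cnj (bridge_char f \<xi> (Suc n) z' x'))"
proof -
  let ?t = "\<xi> * (f (Suc (Suc n)) (x, x') - f n (z, z'))"
  let ?a = "\<lambda>y. \<xi> * bridge_sum f n z x y" and ?b = "\<lambda>y'. \<xi> * bridge_sum f (Suc n) z' x' y'"
  let ?u = "bridge n z x" and ?v = "bridge (Suc n) z' x'"
  let ?M = "mu (Suc n)" and ?N = "mu (Suc (Suc n))"
  let ?w = "bridge_char f \<xi> n z x" and ?w' = "bridge_char f \<xi> (Suc n) z' x'"
  have [measurable]: "?a \<in> borel_measurable (B (Suc n))" "?b \<in> borel_measurable (B (Suc (Suc n)))" by measurable
  have u0: "integrable ?M ?u" using bridge_integrable_real[of z n x "\<lambda>_. 1" 1] by simp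
  have v0: "integrable ?N ?v" using bridge_integrable_real[of z' "Suc n" x' "\<lambda>_. 1" 1] by simp
  have uc: "integrable ?M (\<lambda>y. ?u y * cos (?a y))" and us: "integrable ?M (\<lambda>y. ?u y * sin (?a y))"
    by (rule bridge_integrable_real[where b=1]; simp)+
  have vc: "integrable ?N (\<lambda>y. ?v y * cos (?b y))" and vs: "integrable ?N (\<lambda>y. ?v y * sin (?b y))"
    by (rule bridge_integrable_real[where b=1]; simp)+
  have bal: "\<xi> * balance f n z z' x x' y y' = (?a y + ?t) - ?b y'" for y y'
    by (simp add: balance_def algebra_simps)
  have inner: "(\<integral>y'. ?u y * (?v y' * (1 - cos (\<xi> * balance f n z z' x x' y y'))) \<partial>?N)
      = ?u y - ?u y * cos (?a y) * (cos ?t * Re ?w' + sin ?t * Im ?w')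
        + ?u y * sin (?a y) * (sin ?t * Re ?w' - cos ?t * Im ?w')" for y
  proof -
    have "(\<integral>y'. ?u y * (?v y' * (1 - cos (\<xi> * balance f n z z' x x' y y'))) \<partial>?N)
      = (\<integral>y'. ?u y * ?v y' - ?u y * cos (?a y + ?t) * (?v y' * cos (?b y')) - ?u y * sin (?a y + ?t) * (?v y' * sin (?b y')) \<partial>?N)"
      unfolding bal cos_diff by (intro Bochner_Integration.integral_cong refl) (simp add: algebra_simps)
    also have "\<dots> = ?u y - ?u y * cos (?a y + ?t) * Re ?w' - ?u y * sin (?a y + ?t) * Im ?w'"
      using v0 vc vs by (simp add: bridge_mass bridge_char_Re_Im[OF zx(2,4)])
    also have "\<dots> = ?u y - ?u y * cos (?a y) * (cos ?t * Re ?w' + sin ?t * Im ?w')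
        + ?u y * sin (?a y) * (sin ?t * Re ?w' - cos ?t * Im ?w')"
      unfolding cos_add sin_add by (simp only: ring_distribs mult_ac add_ac diff_conv_add_uminus minus_add_distrib mult_minus_left mult_minus_right minus_minus)
    finally show ?thesis .
  qed
  have "bridge_defect f \<xi> n z z' x x' = 1 - Re ?w * (cos ?t * Re ?w' + sin ?t * Im ?w')
        + Im ?w * (sin ?t * Re ?w' - cos ?t * Im ?w')"
    unfolding bridge_defect_def inner using u0 uc us by (simp add: bridge_mass bridge_char_Re_Im[OF zx(1,3)])
  then show ?thesis by (simp add: algebra_simps)
qed

text \<open>Counterpart of \<open>bridge_mean_square_le\<close> for arbitrary frequencies, where
  balances are controlled only modulo 2 pi / \<xi>: the arguments of the bridge characteristic
  functions take the place of the bridge means.\<close>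

lemma one_minus_cos_le_bridge_defect:
  assumes "z \<in> space (B n)" "z' \<in> space (B (Suc n))" "x \<in> space (B (Suc (Suc n)))"
    "x' \<in> space (B (Suc (Suc (Suc n))))"
  shows "1 - cos (\<xi> * (f (Suc (Suc n)) (x, x') - f n (z, z')) + Arg (bridge_char f \<xi> n z x)
      - Arg (bridge_char f \<xi> (Suc n) z' x')) \<le> 2 * bridge_defect f \<xi> n z z' x x'"
  unfolding bridge_defect_eq[OF assms] Re_rotated_product
  by (rule one_minus_cos_le_of_moduli) (use assms bridge_char_le in auto)

end
context
  fixes f :: "nat \<Rightarrow> 'a \<times> 'a \<Rightarrow> real"
  assumes f_measurable: "\<And>n. f n \<in> borel_measurable (B n \<Otimes>\<^sub>M B (Suc n))"
begin
lemmas [measurable (raw)] = measurable_bridge_sum[of f, OF f_measurable] measurable_balance[of f, OF f_measurable]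
text \<open>The left side is the squared mean of the balance under the product of the two bridges.
  Jensen's inequality is applied to each bridge in turn; the restriction on d keeps d times the
  balance within [-pi, pi], where \<open>square_le_one_minus_cos\<close> applies.\<close>

lemma bridge_mean_square_le:
  assumes zx [simp]: "z \<in> space (B n)" "z' \<in> space (B (Suc n))" "x \<in> space (B (Suc (Suc n)))"
    "x' \<in> space (B (Suc (Suc (Suc n))))"
    and R: "\<And>m u v. u \<in> space (B m) \<Longrightarrow> v \<in> space (B (Suc m)) \<Longrightarrow> \<bar>f m (u, v)\<bar> \<le> R"
    and d: "0 < d" "6 * R * d \<le> pi"
  shows "(f (Suc (Suc n)) (x, x') - f n (z, z') + bridge_mean f n z x - bridge_mean f (Suc n) z' x')\<^sup>2
    \<le> 8 / d\<^sup>2 * bridge_defect f d n z z' x x'"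
proof -
  let ?t = "f (Suc (Suc n)) (x, x') - f n (z, z')"
  let ?a = "bridge_sum f n z x" and ?b = "bridge_sum f (Suc n) z' x'"
  let ?u = "bridge n z x" and ?v = "bridge (Suc n) z' x'"
  let ?M = "mu (Suc n)" and ?N = "mu (Suc (Suc n))"
  let ?B = "balance f n z z' x x'"
  have [measurable]: "?a \<in> borel_measurable (B (Suc n))" "?b \<in> borel_measurable (B (Suc (Suc n)))" by measurable
  have ab: "\<bar>?a y\<bar> \<le> 2 * R" if "y \<in> space (B (Suc n))" for y
    using R[OF zx(1) that] R[OF that zx(3)] by (simp add: bridge_sum_def)
  have bb: "\<bar>?b y\<bar> \<le> 2 * R" if "y \<in> space (B (Suc (Suc n)))" for y
    using R[OF zx(2) that] R[OF that zx(4)] by (simp add: bridge_sum_def)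
  have tb: "\<bar>?t\<bar> \<le> 2 * R" using R[OF zx(3,4)] R[OF zx(1,2)] by linarith
  have Bb: "\<bar>?B y y'\<bar> \<le> 6 * R" if "y \<in> space (B (Suc n))" "y' \<in> space (B (Suc (Suc n)))" for y y'
    unfolding balance_def using ab[OF that(1)] bb[OF that(2)] tb by linarith
  have Bm [measurable]: "(\<lambda>(y, y'). ?B y y') \<in> borel_measurable (B (Suc n) \<Otimes>\<^sub>M B (Suc (Suc n)))" by measurable
  have Bm2 [measurable]: "?B y \<in> borel_measurable (B (Suc (Suc n)))" if "y \<in> space (B (Suc n))" for y
    using that by measurable
  have inner: "(\<integral>y'. ?v y' * ?B y y' \<partial>?N) = ?a y + ?t - bridge_mean f (Suc n) z' x'" for y
  proof -
    have i: "integrable ?N (\<lambda>y'. ?v y' * ?b y')" by (rule bridge_integrable_real[where b="2 * R"]) (use bb in auto)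
    have v0: "integrable ?N ?v" using bridge_integrable_real[of z' "Suc n" x' "\<lambda>_. 1" 1] by simp
    have "(\<integral>y'. ?v y' * ?B y y' \<partial>?N) = (\<integral>y'. (?a y + ?t) * ?v y' - ?v y' * ?b y' \<partial>?N)"
      by (simp add: balance_def algebra_simps)
    also have "\<dots> = (?a y + ?t) - bridge_mean f (Suc n) z' x'"
      using i v0 by (simp add: bridge_mass bridge_mean_def)
    finally show ?thesis .
  qed
  let ?m = "\<lambda>y. \<integral>y'. ?v y' * ?B y y' \<partial>?N"
  have mb: "\<bar>?m y\<bar> \<le> 6 * R" if "y \<in> space (B (Suc n))" for y
    by (rule bridge_integral_abs_le) (use that Bb in auto)
  have mu_pair: "?m \<in> borel_measurable (B (Suc n))" by measurable
  have eq: "?t + bridge_mean f n z x - bridge_mean f (Suc n) z' x' = (\<integral>y. ?u y * ?m y \<partial>?M)"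
  proof -
    have i: "integrable ?M (\<lambda>y. ?u y * ?a y)" by (rule bridge_integrable_real[where b="2 * R"]) (use ab in auto)
    have u0: "integrable ?M ?u" using bridge_integrable_real[of z n x "\<lambda>_. 1" 1] by simp
    have "(\<integral>y. ?u y * ?m y \<partial>?M) = (\<integral>y. ?u y * ?a y + (?t - bridge_mean f (Suc n) z' x') * ?u y \<partial>?M)"
    proof (intro Bochner_Integration.integral_cong refl)
      fix y
      show "?u y * ?m y = ?u y * ?a y + (?t - bridge_mean f (Suc n) z' x') * ?u y"
        unfolding inner by (simp only: ring_distribs mult.commute diff_conv_add_uminus add.assoc)
    qed
    also have "\<dots> = bridge_mean f n z x + (?t - bridge_mean f (Suc n) z' x')"
      unfolding Bochner_Integration.integral_add[OF i integrable_mult_right[OF u0]] integral_mult_right_zero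
        bridge_mass[OF zx(1,3)] bridge_mean_def[of f n z x] by simp
    finally show ?thesis by simp
  qed
  have "(\<integral>y. ?u y * ?m y \<partial>?M)\<^sup>2 \<le> (\<integral>y. ?u y * (?m y)\<^sup>2 \<partial>?M)"
    by (rule bridge_square_le[where g="?m" and b="6 * R", OF zx(1,3) mu_pair]) (rule mb)
  also have "\<dots> \<le> (\<integral>y. 8 / d\<^sup>2 * (\<integral>y'. ?u y * (?v y' * (1 - cos (d * ?B y y'))) \<partial>?N) \<partial>?M)"
  proof (rule integral_mono)
    show "integrable ?M (\<lambda>y. ?u y * (?m y)\<^sup>2)"
    proof (rule bridge_integrable_real[where b="(6 * R)\<^sup>2", OF zx(1,3)])
      show "(\<lambda>y. (?m y)\<^sup>2) \<in> borel_measurable (B (Suc n))" by (rule borel_measurable_power[OF mu_pair])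
      show "\<bar>(?m y)\<^sup>2\<bar> \<le> (6 * R)\<^sup>2" if "y \<in> space (B (Suc n))" for y
        unfolding abs_power2 by (rule square_le_of_abs_le[OF mb[OF that]])
    qed
    have cm: "(\<lambda>y. \<integral>y'. ?v y' * (1 - cos (d * ?B y y')) \<partial>?N) \<in> borel_measurable (B (Suc n))" by measurable
    have cb: "\<bar>1 - cos t\<bar> \<le> 2" for t :: real using cos_ge_minus_one[of t] cos_le_one[of t] by linarith
    have ci: "\<bar>\<integral>y'. ?v y' * (1 - cos (d * ?B y y')) \<partial>?N\<bar> \<le> 2" if "y \<in> space (B (Suc n))" for y
      by (rule bridge_integral_abs_le) (use that cb in auto)
    have "integrable ?M (\<lambda>y. ?u y * (\<integral>y'. ?v y' * (1 - cos (d * ?B y y')) \<partial>?N))"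
      by (rule bridge_integrable_real[OF zx(1,3) cm ci])
    then show "integrable ?M (\<lambda>y. 8 / d\<^sup>2 * (\<integral>y'. ?u y * (?v y' * (1 - cos (d * ?B y y'))) \<partial>?N))"
      by simp
    show "?u y * (?m y)\<^sup>2 \<le> 8 / d\<^sup>2 * (\<integral>y'. ?u y * (?v y' * (1 - cos (d * ?B y y'))) \<partial>?N)"
      if "y \<in> space ?M" for y
    proof -
      have y [simp]: "y \<in> space (B (Suc n))" using that by simp
      have "(?m y)\<^sup>2 \<le> (\<integral>y'. ?v y' * (?B y y')\<^sup>2 \<partial>?N)"
        by (rule bridge_square_le[OF zx(2,4) Bm2[OF y] Bb[OF y]])
      also have "\<dots> \<le> (\<integral>y'. 8 / d\<^sup>2 * (?v y' * (1 - cos (d * ?B y y'))) \<partial>?N)"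
      proof (rule integral_mono)
        show "integrable ?N (\<lambda>y'. ?v y' * (?B y y')\<^sup>2)"
        proof (rule bridge_integrable_real[where b="(6 * R)\<^sup>2", OF zx(2,4)])
          show "(\<lambda>y'. (?B y y')\<^sup>2) \<in> borel_measurable (B (Suc (Suc n)))"
            by (rule borel_measurable_power[OF Bm2[OF y]])
          show "\<bar>(?B y y')\<^sup>2\<bar> \<le> (6 * R)\<^sup>2" if "y' \<in> space (B (Suc (Suc n)))" for y'
            unfolding abs_power2 by (rule square_le_of_abs_le[OF Bb[OF y that]])
        qed
        show "integrable ?N (\<lambda>y'. 8 / d\<^sup>2 * (?v y' * (1 - cos (d * ?B y y'))))"
          by (rule integrable_mult_right, rule bridge_integrable_real[OF zx(2,4) _ cb]) measurable
        show "?v y' * (?B y y')\<^sup>2 \<le> 8 / d\<^sup>2 * (?v y' * (1 - cos (d * ?B y y')))" if "y' \<in> space ?N" for y'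
        proof -
          have "\<bar>d * ?B y y'\<bar> \<le> pi"
          proof -
            have "\<bar>d * ?B y y'\<bar> = d * \<bar>?B y y'\<bar>" using d by (simp add: abs_mult)
            also have "\<dots> \<le> d * (6 * R)" using Bb[of y y'] that d by (intro mult_left_mono) auto
            also have "\<dots> \<le> pi" using d(2) by (simp only: mult.commute)
            finally show ?thesis .
          qed
          then have "(d * ?B y y')\<^sup>2 \<le> 8 * (1 - cos (d * ?B y y'))" by (rule square_le_one_minus_cos)
          then have "(?B y y')\<^sup>2 \<le> 8 / d\<^sup>2 * (1 - cos (d * ?B y y'))"
            using d by (simp add: power_mult_distrib field_simps)
          then have "?v y' * (?B y y')\<^sup>2 \<le> ?v y' * (8 / d\<^sup>2 * (1 - cos (d * ?B y y')))"
            by (rule mult_left_mono) (simp add: bridge_bounds(1))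
          then show ?thesis by (subst mult.left_commute)
        qed
      qed
      finally have "?u y * (?m y)\<^sup>2 \<le> ?u y * (\<integral>y'. 8 / d\<^sup>2 * (?v y' * (1 - cos (d * ?B y y'))) \<partial>?N)"
        by (rule mult_left_mono) (simp add: bridge_bounds(1))
      also have "\<dots> = 8 / d\<^sup>2 * (?u y * (\<integral>y'. ?v y' * (1 - cos (d * ?B y y')) \<partial>?N))"
        unfolding integral_mult_right_zero by (rule mult.left_commute)
      finally show ?thesis unfolding integral_mult_right_zero .
    qed
  qed
  also have "\<dots> = 8 / d\<^sup>2 * bridge_defect f d n z z' x x'"
    unfolding bridge_defect_def by (rule integral_mult_right_zero)
  finally show ?thesis unfolding eq .
qed

end

lemma mu_nested_abs_le:
  fixes g :: "'a \<Rightarrow> 'a \<Rightarrow> real"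
  assumes "(\<lambda>(x, y). g x y) \<in> borel_measurable (B m \<Otimes>\<^sub>M B k)"
    and "\<And>x y. x \<in> space (B m) \<Longrightarrow> y \<in> space (B k) \<Longrightarrow> \<bar>g x y\<bar> \<le> c"
  shows "\<bar>\<integral>x. \<integral>y. g x y \<partial>mu k \<partial>mu m\<bar> \<le> c"
proof (rule mu_integral_abs_le)
  show "(\<lambda>x. \<integral>y. g x y \<partial>mu k) \<in> borel_measurable (B m)"
    by (rule measurable_mu_integral) fact
  fix x assume x: "x \<in> space (B m)"
  show "\<bar>\<integral>y. g x y \<partial>mu k\<bar> \<le> c"
    using measurable_compose[OF measurable_Pair1'[OF x] assms(1)] assms(2)[OF x]
    by (intro mu_integral_abs_le) auto
qed

lemma mu_swap:
  fixes g :: "'a \<Rightarrow> 'a \<Rightarrow> real"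
  assumes "(\<lambda>(x, y). g x y) \<in> borel_measurable (B m \<Otimes>\<^sub>M B k)"
    and "\<And>x y. x \<in> space (B m) \<Longrightarrow> y \<in> space (B k) \<Longrightarrow> \<bar>g x y\<bar> \<le> c"
  shows "(\<integral>x. \<integral>y. g x y \<partial>mu k \<partial>mu m) = (\<integral>y. \<integral>x. g x y \<partial>mu m \<partial>mu k)"
proof (rule bounded_Fubini(1)[OF prob_mu prob_mu])
  show "(\<lambda>(x, y). g x y) \<in> borel_measurable (mu m \<Otimes>\<^sub>M mu k)"
    using assms(1) by (simp cong: measurable_cong_sets)
qed (use assms(2) in auto)

lemma mu_pair_integral_eq:
  fixes g :: "'a \<times> 'a \<Rightarrow> real"
  assumes g: "g \<in> borel_measurable (B n \<Otimes>\<^sub>M B (Suc n))"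
    and b: "\<And>x y. x \<in> space (B n) \<Longrightarrow> y \<in> space (B (Suc n)) \<Longrightarrow> \<bar>g (x, y)\<bar> \<le> c"
  shows "(\<integral>q. g q \<partial>mu_pair n) = (\<integral>y. \<integral>x. g (y, x) \<partial>mu (Suc n) \<partial>mu n)"
proof -
  have "(\<integral>y. \<integral>x. g (y, x) \<partial>mu (Suc n) \<partial>mu n) = (\<integral>q. g (fst q, snd q) \<partial>mu_pair n)"
    unfolding mu_pair_def
  proof (rule bounded_Fubini(2)[OF prob_mu prob_mu])
    show "(\<lambda>(y, x). g (y, x)) \<in> borel_measurable (mu n \<Otimes>\<^sub>M mu (Suc n))"
      using g by (simp cong: measurable_cong_sets)
  qed (use b in auto)
  then show ?thesis by simp
qed

text \<open>The reordering needed in \<open>hex_eq\<close>, done by adjacent swaps: the variables a,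
  b, c, d, u stand for x', y, x, z', y' there, and d = z' has to come first, followed by x and
  x'.\<close>

lemma integral_rotate5:
  fixes G :: "'a \<times> 'a \<times> 'a \<times> 'a \<times> 'a \<Rightarrow> real"
  assumes G [measurable]: "G \<in> borel_measurable (B i1 \<Otimes>\<^sub>M B i2 \<Otimes>\<^sub>M B i3 \<Otimes>\<^sub>M B i4 \<Otimes>\<^sub>M B i5)"
    and b: "\<And>a b c d u. a \<in> space (B i1) \<Longrightarrow> b \<in> space (B i2) \<Longrightarrow> c \<in> space (B i3) \<Longrightarrow>
      d \<in> space (B i4) \<Longrightarrow> u \<in> space (B i5) \<Longrightarrow> \<bar>G (a, b, c, d, u)\<bar> \<le> k"
  shows "(\<integral>a. \<integral>b. \<integral>c. \<integral>d. \<integral>u. G (a, b, c, d, u) \<partial>mu i5 \<partial>mu i4 \<partial>mu i3 \<partial>mu i2 \<partial>mu i1)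
    = (\<integral>d. \<integral>c. \<integral>a. \<integral>b. \<integral>u. G (a, b, c, d, u) \<partial>mu i5 \<partial>mu i2 \<partial>mu i1 \<partial>mu i3 \<partial>mu i4)"
proof -
  have b1: "\<bar>\<integral>u. G (a, b, c, d, u) \<partial>mu i5\<bar> \<le> k"
    if [simp]: "a \<in> space (B i1)" "b \<in> space (B i2)" "c \<in> space (B i3)" "d \<in> space (B i4)" for a b c d
    by (rule mu_integral_abs_le) (measurable, simp add: b)
  have "(\<integral>a. \<integral>b. \<integral>c. \<integral>d. \<integral>u. G (a, b, c, d, u) \<partial>mu i5 \<partial>mu i4 \<partial>mu i3 \<partial>mu i2 \<partial>mu i1)
      = (\<integral>a. \<integral>b. \<integral>d. \<integral>c. \<integral>u. G (a, b, c, d, u) \<partial>mu i5 \<partial>mu i3 \<partial>mu i4 \<partial>mu i2 \<partial>mu i1)"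
  proof (rule Bochner_Integration.integral_cong[OF refl], rule Bochner_Integration.integral_cong[OF refl])
    fix a b assume "a \<in> space (mu i1)" "b \<in> space (mu i2)"
    then have [simp]: "a \<in> space (B i1)" "b \<in> space (B i2)" by auto
    show "(\<integral>c. \<integral>d. \<integral>u. G (a, b, c, d, u) \<partial>mu i5 \<partial>mu i4 \<partial>mu i3)
      = (\<integral>d. \<integral>c. \<integral>u. G (a, b, c, d, u) \<partial>mu i5 \<partial>mu i3 \<partial>mu i4)"
      by (rule mu_swap[where c=k]) (measurable, simp add: b1)
  qed
  also have "\<dots> = (\<integral>a. \<integral>d. \<integral>b. \<integral>c. \<integral>u. G (a, b, c, d, u) \<partial>mu i5 \<partial>mu i3 \<partial>mu i2 \<partial>mu i4 \<partial>mu i1)"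
  proof (rule Bochner_Integration.integral_cong[OF refl])
    fix a assume "a \<in> space (mu i1)"
    then have [simp]: "a \<in> space (B i1)" by auto
    show "(\<integral>b. \<integral>d. \<integral>c. \<integral>u. G (a, b, c, d, u) \<partial>mu i5 \<partial>mu i3 \<partial>mu i4 \<partial>mu i2)
      = (\<integral>d. \<integral>b. \<integral>c. \<integral>u. G (a, b, c, d, u) \<partial>mu i5 \<partial>mu i3 \<partial>mu i2 \<partial>mu i4)"
    proof (rule mu_swap[where c=k])
      show "\<bar>\<integral>c. \<integral>u. G (a, b, c, d, u) \<partial>mu i5 \<partial>mu i3\<bar> \<le> k"
        if [simp]: "b \<in> space (B i2)" "d \<in> space (B i4)" for b d
        by (rule mu_integral_abs_le) (measurable, simp add: b1)
    qed measurable
  qed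
  also have "\<dots> = (\<integral>d. \<integral>a. \<integral>b. \<integral>c. \<integral>u. G (a, b, c, d, u) \<partial>mu i5 \<partial>mu i3 \<partial>mu i2 \<partial>mu i1 \<partial>mu i4)"
  proof (rule mu_swap[where c=k])
    show "\<bar>\<integral>b. \<integral>c. \<integral>u. G (a, b, c, d, u) \<partial>mu i5 \<partial>mu i3 \<partial>mu i2\<bar> \<le> k"
      if [simp]: "a \<in> space (B i1)" "d \<in> space (B i4)" for a d
      by (rule mu_nested_abs_le) (measurable, simp add: b1)
  qed measurable
  also have "\<dots> = (\<integral>d. \<integral>a. \<integral>c. \<integral>b. \<integral>u. G (a, b, c, d, u) \<partial>mu i5 \<partial>mu i2 \<partial>mu i3 \<partial>mu i1 \<partial>mu i4)"
  proof (rule Bochner_Integration.integral_cong[OF refl], rule Bochner_Integration.integral_cong[OF refl])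
    fix d a assume "d \<in> space (mu i4)" "a \<in> space (mu i1)"
    then have [simp]: "a \<in> space (B i1)" "d \<in> space (B i4)" by auto
    show "(\<integral>b. \<integral>c. \<integral>u. G (a, b, c, d, u) \<partial>mu i5 \<partial>mu i3 \<partial>mu i2)
      = (\<integral>c. \<integral>b. \<integral>u. G (a, b, c, d, u) \<partial>mu i5 \<partial>mu i2 \<partial>mu i3)"
      by (rule mu_swap[where c=k]) (measurable, simp add: b1)
  qed
  also have "\<dots> = (\<integral>d. \<integral>c. \<integral>a. \<integral>b. \<integral>u. G (a, b, c, d, u) \<partial>mu i5 \<partial>mu i2 \<partial>mu i1 \<partial>mu i3 \<partial>mu i4)"
  proof (rule Bochner_Integration.integral_cong[OF refl])
    fix d assume "d \<in> space (mu i4)"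
    then have [simp]: "d \<in> space (B i4)" by auto
    show "(\<integral>a. \<integral>c. \<integral>b. \<integral>u. G (a, b, c, d, u) \<partial>mu i5 \<partial>mu i2 \<partial>mu i3 \<partial>mu i1)
      = (\<integral>c. \<integral>a. \<integral>b. \<integral>u. G (a, b, c, d, u) \<partial>mu i5 \<partial>mu i2 \<partial>mu i1 \<partial>mu i3)"
    proof (rule mu_swap[where c=k])
      show "\<bar>\<integral>b. \<integral>u. G (a, b, c, d, u) \<partial>mu i5 \<partial>mu i2\<bar> \<le> k"
        if [simp]: "a \<in> space (B i1)" "c \<in> space (B i3)" for a c
        by (rule mu_integral_abs_le) (measurable, simp add: b1)
    qed measurable
  qed
  finally show ?thesis .
qed

definition hex_weight :: "(nat \<Rightarrow> 'a \<times> 'a \<Rightarrow> real) \<Rightarrow> real \<Rightarrow> nat \<Rightarrow> 'a \<Rightarrow> 'a \<Rightarrow> 'a \<Rightarrow> 'a \<Rightarrow> 'a \<Rightarrow> 'a \<Rightarrow> real" where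
  "hex_weight f \<xi> n z z' x x' y y' = p n (z, y) * p (Suc n) (y, x) * (p (Suc n) (z', y') * p (Suc (Suc n)) (y', x')
     * (1 - cos (\<xi> * balance f n z z' x x' y y')))"

definition hex_inner :: "(nat \<Rightarrow> 'a \<times> 'a \<Rightarrow> real) \<Rightarrow> real \<Rightarrow> nat \<Rightarrow> 'a \<Rightarrow> 'a \<Rightarrow> real" where
  "hex_inner f \<xi> n z z' = (\<integral>x. \<integral>x'. p (Suc (Suc n)) (x, x') *
     (\<integral>y. \<integral>y'. hex_weight f \<xi> n z z' x x' y y' \<partial>mu (Suc (Suc n)) \<partial>mu (Suc n)) \<partial>mu (Suc (Suc (Suc n))) \<partial>mu (Suc (Suc n)))"

lemma hex_weight_bounds: "0 \<le> hex_weight f \<xi> n z z' x x' y y'" "\<bar>hex_weight f \<xi> n z z' x x' y y'\<bar> \<le> 2 * (1 / e) ^ 4"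
proof -
  have c: "0 \<le> 1 - cos t" "1 - cos t \<le> 2" for t :: real using cos_ge_minus_one[of t] by simp_all
  show 0: "0 \<le> hex_weight f \<xi> n z z' x x' y y'" unfolding hex_weight_def
    by (rule mult_nonneg_nonneg[OF density_product_bounds(1) mult_nonneg_nonneg[OF density_product_bounds(1) c(1)]])
  have "hex_weight f \<xi> n z z' x x' y y' \<le> (1 / e)\<^sup>2 * ((1 / e)\<^sup>2 * 2)" unfolding hex_weight_def
    by (rule mult_mono[OF density_product_bounds(2) mult_mono[OF density_product_bounds(2) c(2) zero_le_power2 c(1)] zero_le_power2
          mult_nonneg_nonneg[OF density_product_bounds(1) c(1)]])
  also have "(1 / e)\<^sup>2 * ((1 / e)\<^sup>2 * 2) = 2 * (1 / e) ^ 4"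
    unfolding power4_eq_square by (simp only: mult_ac)
  finally show "\<bar>hex_weight f \<xi> n z z' x x' y y'\<bar> \<le> 2 * (1 / e) ^ 4"
    unfolding abs_of_nonneg[OF 0] .
qed

context
  fixes f :: "nat \<Rightarrow> 'a \<times> 'a \<Rightarrow> real"
  assumes f_measurable: "\<And>n. f n \<in> borel_measurable (B n \<Otimes>\<^sub>M B (Suc n))"
begin

lemma measurable_hex_weight [measurable (raw)]:
  assumes [measurable]: "g \<in> M \<rightarrow>\<^sub>M B n" "g' \<in> M \<rightarrow>\<^sub>M B (Suc n)" "h \<in> M \<rightarrow>\<^sub>M B (Suc (Suc n))"
    "h' \<in> M \<rightarrow>\<^sub>M B (Suc (Suc (Suc n)))" "k \<in> M \<rightarrow>\<^sub>M B (Suc n)" "k' \<in> M \<rightarrow>\<^sub>M B (Suc (Suc n))"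
  shows "(\<lambda>w. hex_weight f \<xi> n (g w) (g' w) (h w) (h' w) (k w) (k' w)) \<in> borel_measurable M"
proof -
  note measurable_balance[of f, OF f_measurable, measurable (raw)]
  show ?thesis unfolding hex_weight_def by measurable
qed

lemma measurable_hex_inner [measurable (raw)]:
  assumes [measurable]: "g \<in> M \<rightarrow>\<^sub>M B n" "g' \<in> M \<rightarrow>\<^sub>M B (Suc n)"
  shows "(\<lambda>w. hex_inner f \<xi> n (g w) (g' w)) \<in> borel_measurable M"
  unfolding hex_inner_def by measurable

text \<open>Here the edge (z, z') is outermost and carries its one-step density. This allows one
  side of the hexagon to be sampled from the chain, while the other vertices are integrated in
  \<open>hex_inner\<close>.\<close>

lemma hex_eq:
  "hex f \<xi> n = (\<integral>z. \<integral>z'. p n (z, z') * hex_inner f \<xi> n z z' \<partial>mu (Suc n) \<partial>mu n)"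
  unfolding hex_def
proof (rule Bochner_Integration.integral_cong[OF refl])
  fix z assume "z \<in> space (mu n)"
  then have z [simp]: "z \<in> space (B n)" by simp
  let ?n1 = "Suc n" and ?n2 = "Suc (Suc n)" and ?n3 = "Suc (Suc (Suc n))"
  note measurable_path_sum[of f, OF f_measurable, measurable (raw)]
  note measurable_balance[of f, OF f_measurable, measurable (raw)]
  let ?g = "\<lambda>x' q q'. path_weight n z q x' * path_weight n z q' x'
      * (1 - cos (\<xi> * path_sum f n z q x' - \<xi> * path_sum f n z q' x'))"
  let ?k = "2 * (1 / e) ^ 6"
  have gb: "\<bar>?g x' q q'\<bar> \<le> ?k" for x' q q' by (rule hex_integrand_bounds(2))
  have gm [measurable]: "(\<lambda>(x', y, x, z', y'). ?g x' (y, x) (z', y'))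
      \<in> borel_measurable (B ?n3 \<Otimes>\<^sub>M B ?n1 \<Otimes>\<^sub>M B ?n2 \<Otimes>\<^sub>M B ?n1 \<Otimes>\<^sub>M B ?n2)"
    by measurable
  have "(\<integral>x'. hex_defect f \<xi> n z x' \<partial>mu ?n3)
    = (\<integral>x'. \<integral>y. \<integral>x. \<integral>z'. \<integral>y'. ?g x' (y, x) (z', y') \<partial>mu ?n2 \<partial>mu ?n1 \<partial>mu ?n2 \<partial>mu ?n1 \<partial>mu ?n3)"
  proof (rule Bochner_Integration.integral_cong[OF refl])
    fix x' assume "x' \<in> space (mu ?n3)"
    then have [simp]: "x' \<in> space (B ?n3)" by simp
    have "hex_defect f \<xi> n z x' = (\<integral>q. \<integral>z'. \<integral>y'. ?g x' q (z', y') \<partial>mu ?n2 \<partial>mu ?n1 \<partial>mu_pair ?n1)"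
      unfolding hex_defect_def
    proof (rule Bochner_Integration.integral_cong[OF refl])
      fix q assume "q \<in> space (mu_pair ?n1)"
      then have [simp]: "q \<in> space (B ?n1 \<Otimes>\<^sub>M B ?n2)" by (simp add: space_pair_measure)
      show "(\<integral>q'. ?g x' q q' \<partial>mu_pair ?n1) = (\<integral>z'. \<integral>y'. ?g x' q (z', y') \<partial>mu ?n2 \<partial>mu ?n1)"
        by (rule mu_pair_integral_eq[where c="?k"]) (measurable, rule gb)
    qed
    also have "\<dots> = (\<integral>y. \<integral>x. \<integral>z'. \<integral>y'. ?g x' (y, x) (z', y') \<partial>mu ?n2 \<partial>mu ?n1 \<partial>mu ?n2 \<partial>mu ?n1)"
    proof (rule mu_pair_integral_eq[where c="?k"])
      show "\<bar>\<integral>z'. \<integral>y'. ?g x' (y, x) (z', y') \<partial>mu ?n2 \<partial>mu ?n1\<bar> \<le> ?k"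
        if [simp]: "y \<in> space (B ?n1)" "x \<in> space (B ?n2)" for y x
        by (rule mu_nested_abs_le) (measurable, rule gb)
    qed measurable
    finally show "hex_defect f \<xi> n z x'
        = (\<integral>y. \<integral>x. \<integral>z'. \<integral>y'. ?g x' (y, x) (z', y') \<partial>mu ?n2 \<partial>mu ?n1 \<partial>mu ?n2 \<partial>mu ?n1)" .
  qed
  also have "\<dots> = (\<integral>z'. \<integral>x. \<integral>x'. \<integral>y. \<integral>y'. ?g x' (y, x) (z', y') \<partial>mu ?n2 \<partial>mu ?n1 \<partial>mu ?n3 \<partial>mu ?n2 \<partial>mu ?n1)"
    by (rule integral_rotate5[OF gm, where k="?k", unfolded prod.case]) (rule gb)
  also have "\<dots> = (\<integral>z'. p n (z, z') * hex_inner f \<xi> n z z' \<partial>mu ?n1)"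
  proof -
    have "?g x' (y, x) (z', y') = p n (z, z') * (p ?n2 (x, x') * hex_weight f \<xi> n z z' x x' y y')" for x' y x z' y'
    proof -
      have "\<xi> * path_sum f n z (y, x) x' - \<xi> * path_sum f n z (z', y') x' = \<xi> * balance f n z z' x x' y y'"
        by (simp add: path_sum_def balance_def bridge_sum_def algebra_simps)
      then show ?thesis unfolding path_weight_def hex_weight_def fst_conv snd_conv by (simp only: mult_ac)
    qed
    then show ?thesis unfolding hex_inner_def by (simp only: integral_mult_right_zero)
  qed
  finally show "(\<integral>x'. hex_defect f \<xi> n z x' \<partial>mu ?n3) = (\<integral>z'. p n (z, z') * hex_inner f \<xi> n z z' \<partial>mu ?n1)" .
qed

lemma hex_weight_integral_bounds:
  fixes \<xi> :: real
  assumes zx [simp]: "z \<in> space (B n)" "z' \<in> space (B (Suc n))" "x \<in> space (B (Suc (Suc n)))"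
    "x' \<in> space (B (Suc (Suc (Suc n))))"
  defines "I \<equiv> \<integral>y. \<integral>y'. hex_weight f \<xi> n z z' x x' y y' \<partial>mu (Suc (Suc n)) \<partial>mu (Suc n)"
  shows "0 \<le> I" "I \<le> 2 * (1 / e) ^ 4"
proof -
  show "0 \<le> I" unfolding I_def by (intro Bochner_Integration.integral_nonneg hex_weight_bounds)
  have "\<bar>I\<bar> \<le> 2 * (1 / e) ^ 4" unfolding I_def
    by (rule mu_nested_abs_le) (measurable, rule hex_weight_bounds)
  then show "I \<le> 2 * (1 / e) ^ 4" by simp
qed

lemma hex_inner_bounds:
  assumes zx [simp]: "z \<in> space (B n)" "z' \<in> space (B (Suc n))"
  shows "0 \<le> hex_inner f \<xi> n z z'" "hex_inner f \<xi> n z z' \<le> 1 / e * (2 * (1 / e) ^ 4)"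
proof -
  show "0 \<le> hex_inner f \<xi> n z z'" unfolding hex_inner_def
    by (intro Bochner_Integration.integral_nonneg mult_nonneg_nonneg p_nonneg hex_weight_bounds)
  have "\<bar>hex_inner f \<xi> n z z'\<bar> \<le> 1 / e * (2 * (1 / e) ^ 4)" unfolding hex_inner_def
  proof (rule mu_nested_abs_le)
    show "\<bar>p (Suc (Suc n)) (x, x') * (\<integral>y. \<integral>y'. hex_weight f \<xi> n z z' x x' y y' \<partial>mu (Suc (Suc n)) \<partial>mu (Suc n))\<bar>
        \<le> 1 / e * (2 * (1 / e) ^ 4)" if "x \<in> space (B (Suc (Suc n)))" "x' \<in> space (B (Suc (Suc (Suc n))))" for x x'
      unfolding abs_mult using hex_weight_integral_bounds[OF zx that] p_nonneg p_le e_pos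
      by (intro mult_mono) auto
  qed measurable
  then show "hex_inner f \<xi> n z z' \<le> 1 / e * (2 * (1 / e) ^ 4)" by simp
qed

text \<open>A bridge is an unnormalised weight divided by a two-step density, which exceeds e; each
  of the two bridges costs one factor 1/e.\<close>

lemma bridge_defect_le:
  assumes zx [simp]: "z \<in> space (B n)" "z' \<in> space (B (Suc n))" "x \<in> space (B (Suc (Suc n)))"
    "x' \<in> space (B (Suc (Suc (Suc n))))"
  shows "0 \<le> bridge_defect f \<xi> n z z' x x'"
    "bridge_defect f \<xi> n z z' x x' \<le> (1 / e)\<^sup>2 * (\<integral>y. \<integral>y'. hex_weight f \<xi> n z z' x x' y y' \<partial>mu (Suc (Suc n)) \<partial>mu (Suc n))"
proof -
  note measurable_balance[of f, OF f_measurable, measurable (raw)]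
  let ?M = "mu (Suc n)" and ?N = "mu (Suc (Suc n))"
  let ?g = "\<lambda>y y'. bridge n z x y * (bridge (Suc n) z' x' y' * (1 - cos (\<xi> * balance f n z z' x x' y y')))"
  have c: "0 \<le> 1 - cos t" "1 - cos t \<le> 2" for t :: real using cos_ge_minus_one[of t] by simp_all
  have g0: "0 \<le> ?g y y'" for y y' by (intro mult_nonneg_nonneg bridge_bounds(1) c) auto
  then show "0 \<le> bridge_defect f \<xi> n z z' x x'" unfolding bridge_defect_def
    by (intro Bochner_Integration.integral_nonneg)
  have le: "?g y y' \<le> (1 / e)\<^sup>2 * hex_weight f \<xi> n z z' x x' y y'" for y y'
  proof -
    have "?g y y' \<le> (p n (z, y) * p (Suc n) (y, x) / e) * ((p (Suc n) (z', y') * p (Suc (Suc n)) (y', x') / e)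
        * (1 - cos (\<xi> * balance f n z z' x x' y y')))"
      using e_pos by (intro mult_mono mult_right_mono bridge_bounds c mult_nonneg_nonneg divide_nonneg_pos density_product_bounds(1)) auto
    also have "\<dots> = (1 / e)\<^sup>2 * hex_weight f \<xi> n z z' x x' y y'"
      by (simp add: hex_weight_def power2_eq_square)
    finally show ?thesis .
  qed
  let ?b = "(1 / e)\<^sup>2 * (2 * (1 / e) ^ 4)"
  have hb: "(1 / e)\<^sup>2 * hex_weight f \<xi> n z z' x x' y y' \<le> ?b" for y y'
    using hex_weight_bounds(2)[of f \<xi> n z z' x x' y y'] by (intro mult_left_mono) auto
  have h0: "0 \<le> (1 / e)\<^sup>2 * hex_weight f \<xi> n z z' x x' y y'" for y y'
    using hex_weight_bounds(1) by simp
  have habs: "\<bar>(1 / e)\<^sup>2 * hex_weight f \<xi> n z z' x x' y y'\<bar> \<le> ?b" for y y' using hb h0 by simp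
  have gb: "\<bar>?g y y'\<bar> \<le> ?b" for y y' using g0 order_trans[OF le hb] by simp
  have inner: "(\<integral>y'. ?g y y' \<partial>?N) \<le> (\<integral>y'. (1 / e)\<^sup>2 * hex_weight f \<xi> n z z' x x' y y' \<partial>?N)"
    if [simp]: "y \<in> space (B (Suc n))" for y
  proof (rule integral_mono[OF _ _ le])
    show "integrable ?N (?g y)"
      by (rule mu_integrable[where c="?b"]) (measurable, unfold real_norm_def, rule gb)
    show "integrable ?N (\<lambda>y'. (1 / e)\<^sup>2 * hex_weight f \<xi> n z z' x x' y y')"
      by (rule mu_integrable[where c="?b"]) (measurable, unfold real_norm_def, rule habs)
  qed
  have "bridge_defect f \<xi> n z z' x x' \<le> (\<integral>y. \<integral>y'. (1 / e)\<^sup>2 * hex_weight f \<xi> n z z' x x' y y' \<partial>?N \<partial>?M)"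
    unfolding bridge_defect_def
  proof (rule integral_mono)
    show "integrable ?M (\<lambda>y. \<integral>y'. ?g y y' \<partial>?N)"
    proof (rule mu_integrable[where c="?b"])
      show "norm (\<integral>y'. ?g y y' \<partial>?N) \<le> ?b" if [simp]: "y \<in> space (B (Suc n))" for y
        unfolding real_norm_def by (rule mu_integral_abs_le) (measurable, rule gb)
    qed measurable
    show "integrable ?M (\<lambda>y. \<integral>y'. (1 / e)\<^sup>2 * hex_weight f \<xi> n z z' x x' y y' \<partial>?N)"
    proof (rule mu_integrable[where c="?b"])
      show "norm (\<integral>y'. (1 / e)\<^sup>2 * hex_weight f \<xi> n z z' x x' y y' \<partial>?N) \<le> ?b"
        if [simp]: "y \<in> space (B (Suc n))" for y
        unfolding real_norm_def by (rule mu_integral_abs_le) (measurable, rule habs)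
    qed measurable
  qed (use inner in simp)
  then show "bridge_defect f \<xi> n z z' x x' \<le> (1 / e)\<^sup>2 * (\<integral>y. \<integral>y'. hex_weight f \<xi> n z z' x x' y y' \<partial>?N \<partial>?M)"
    by simp
qed

text \<open>Given the state at level \<open>Suc j\<close>, the next one has exactly the density that
  appears in \<open>hex_eq\<close>. Only the law at level \<open>Suc j\<close> is compared with
  \<open>mu\<close>, through the step from level j; the arbitrary law at level 0 is avoided in this
  way.\<close>

lemma expectation_hex_inner_le:
  "expectation (\<lambda>w. hex_inner f \<xi> (Suc j) (X (Suc j) w) (X (Suc (Suc j)) w)) \<le> hex f \<xi> (Suc j) / e"
proof -
  let ?n = "Suc j" and ?b = "1 / e * (2 * (1 / e) ^ 4)"
  define g where "g z = (\<integral>z'. hex_inner f \<xi> ?n z z' \<partial>K ?n z)" for z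
  have [measurable]: "g \<in> borel_measurable (B ?n)" unfolding g_def by measurable
  have hb: "\<bar>hex_inner f \<xi> ?n z z'\<bar> \<le> ?b" if "z \<in> space (B ?n)" "z' \<in> space (B (Suc ?n))" for z z'
    using hex_inner_bounds[OF that, of \<xi>] by simp
  have gb: "0 \<le> g z \<and> g z \<le> ?b" if z: "z \<in> space (B ?n)" for z
  proof
    show "0 \<le> g z" unfolding g_def using z by (intro Bochner_Integration.integral_nonneg hex_inner_bounds) auto
    have "\<bar>g z\<bar> \<le> ?b" unfolding g_def by (rule kernel_integral_abs_le[OF z]) (use hb z in auto)
    then show "g z \<le> ?b" by simp
  qed
  have "expectation (\<lambda>w. hex_inner f \<xi> ?n (X ?n w) (X (Suc ?n) w)) = expectation (\<lambda>w. g (X ?n w))"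
    unfolding g_def by (rule markov_step[where c="?b"]) (use hb in auto)
  also have "\<dots> = expectation (\<lambda>w. \<integral>z. g z \<partial>K j (X j w))"
    by (rule expectation_step[where c="?b"]) (use gb in auto)
  also have "\<dots> \<le> expectation (\<lambda>w. (\<integral>z. g z \<partial>mu ?n) / e)"
  proof (rule integral_mono)
    show "integrable P (\<lambda>w. \<integral>z. g z \<partial>K j (X j w))"
    proof (rule P_integrable[where c="?b"])
      show "norm (\<integral>z. g z \<partial>K j (X j w)) \<le> ?b" if "w \<in> space P" for w
        unfolding real_norm_def by (rule kernel_integral_abs_le) (use that gb in auto)
    qed measurable
    show "(\<integral>z. g z \<partial>K j (X j w)) \<le> (\<integral>z. g z \<partial>mu ?n) / e" if "w \<in> space P" for w
      by (rule kernel_integral_le_mu[where c="?b"]) (use that gb in auto)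
  qed simp
  also have "\<dots> = (\<integral>z. g z \<partial>mu ?n) / e" by (simp add: prob_space)
  also have "(\<integral>z. g z \<partial>mu ?n) = hex f \<xi> ?n"
    unfolding hex_eq g_def
    by (rule Bochner_Integration.integral_cong[OF refl]) (subst kernel_integral_eq, auto)
  finally show ?thesis .
qed

text \<open>The second moment is taken under the chain, whereas \<open>hex_inner\<close> integrates
  against \<open>mu\<close> with (z, z') fixed. Replacing the law at level n + 2 by
  \<open>mu\<close> costs 1/e, and passing from bridges to unnormalised weights costs 1/e^2; the
  edge (x, x') carries its kernel density on both sides.\<close>

lemma second_moment_le_hex_inner:
  assumes r: "bounded_functional r R" and z [simp]: "z \<in> space (B n)" "z' \<in> space (B (Suc n))"
    and le: "\<And>x x'. x \<in> space (B (Suc (Suc n))) \<Longrightarrow> x' \<in> space (B (Suc (Suc (Suc n)))) \<Longrightarrow>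
      (r (Suc (Suc n)) (x, x'))\<^sup>2 \<le> c * bridge_defect f \<xi> n z z' x x'"
    and c: "0 \<le> c"
  shows "second_moment r (Suc (Suc n)) \<le> c / e ^ 3 * hex_inner f \<xi> n z z'"
proof -
  let ?n1 = "Suc n" let ?m = "Suc ?n1" let ?n3 = "Suc ?m"
  note bounded_functional_measurable[OF r, measurable]
  define g where "g x = (\<integral>x'. (r ?m (x, x'))\<^sup>2 \<partial>K ?m x)" for x
  have [measurable]: "g \<in> borel_measurable (B ?m)" unfolding g_def by measurable
  have rb: "\<bar>(r ?m (x, x'))\<^sup>2\<bar> \<le> R\<^sup>2" if "x \<in> space (B ?m)" "x' \<in> space (B ?n3)" for x x'
    unfolding abs_power2 by (rule square_le_of_abs_le[OF bounded_functional_bound[OF r that]])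
  have gb: "0 \<le> g x \<and> g x \<le> R\<^sup>2" if x: "x \<in> space (B ?m)" for x
  proof
    show "0 \<le> g x" unfolding g_def by (intro Bochner_Integration.integral_nonneg) auto
    have "\<bar>g x\<bar> \<le> R\<^sup>2" unfolding g_def by (rule kernel_integral_abs_le[OF x]) (use rb x in auto)
    then show "g x \<le> R\<^sup>2" by simp
  qed
  have "second_moment r ?m = expectation (\<lambda>w. g (X ?m w))"
    unfolding g_def second_moment_def by (rule markov_step[where c="R\<^sup>2"]) (use rb in auto)
  also have "\<dots> = expectation (\<lambda>w. \<integral>x. g x \<partial>K ?n1 (X ?n1 w))"
    by (rule expectation_step[where c="R\<^sup>2"]) (use gb in auto)
  also have "\<dots> \<le> expectation (\<lambda>w. (\<integral>x. g x \<partial>mu ?m) / e)"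
  proof (rule integral_mono)
    show "integrable P (\<lambda>w. \<integral>x. g x \<partial>K ?n1 (X ?n1 w))"
    proof (rule P_integrable[where c="R\<^sup>2"])
      show "norm (\<integral>z. g z \<partial>K ?n1 (X ?n1 w)) \<le> R\<^sup>2" if "w \<in> space P" for w
        unfolding real_norm_def by (rule kernel_integral_abs_le) (use that gb in auto)
    qed measurable
    show "(\<integral>z. g z \<partial>K ?n1 (X ?n1 w)) \<le> (\<integral>z. g z \<partial>mu ?m) / e" if "w \<in> space P" for w
      by (rule kernel_integral_le_mu[where c="R\<^sup>2"]) (use that gb in auto)
  qed simp
  also have "\<dots> = (\<integral>x. g x \<partial>mu ?m) / e" by (simp add: prob_space)
  also have "(\<integral>x. g x \<partial>mu ?m) \<le> c * (1 / e)\<^sup>2 * hex_inner f \<xi> n z z'"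
  proof -
    let ?I = "\<lambda>x x'. \<integral>y. \<integral>y'. hex_weight f \<xi> n z z' x x' y y' \<partial>mu ?m \<partial>mu ?n1"
    let ?h = "\<lambda>x x'. p ?m (x, x') * (c * ((1 / e)\<^sup>2 * ?I x x'))"
    let ?b = "1 / e * (c * ((1 / e)\<^sup>2 * (2 * (1 / e) ^ 4)))"
    have hb: "\<bar>?h x x'\<bar> \<le> ?b" if "x \<in> space (B ?m)" "x' \<in> space (B ?n3)" for x x'
    proof -
      have "0 \<le> ?h x x'" using hex_weight_integral_bounds(1)[OF z that] c
        by (intro mult_nonneg_nonneg p_nonneg) auto
      moreover have "?h x x' \<le> ?b"
        using hex_weight_integral_bounds[OF z that] c e_pos
        by (intro mult_mono mult_left_mono p_le mult_nonneg_nonneg) auto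
      ultimately show ?thesis by simp
    qed
    have gh: "g x \<le> (\<integral>x'. ?h x x' \<partial>mu ?n3)" if x [simp]: "x \<in> space (B ?m)" for x
    proof -
      have "g x = (\<integral>x'. p ?m (x, x') * (r ?m (x, x'))\<^sup>2 \<partial>mu ?n3)"
        unfolding g_def by (subst kernel_integral_eq) auto
      also have "\<dots> \<le> (\<integral>x'. ?h x x' \<partial>mu ?n3)"
      proof (rule integral_mono)
        show "integrable (mu ?n3) (\<lambda>x'. p ?m (x, x') * (r ?m (x, x'))\<^sup>2)"
        proof (rule mu_integrable[where c="1 / e * R\<^sup>2"])
          show "norm (p ?m (x, x') * (r ?m (x, x'))\<^sup>2) \<le> 1 / e * R\<^sup>2" if "x' \<in> space (B ?n3)" for x'
            unfolding real_norm_def abs_mult using rb[OF x that] p_nonneg[of ?m "(x, x')"] p_le[of ?m "(x, x')"] e_pos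
            by (intro mult_mono) auto
        qed measurable
        show "integrable (mu ?n3) (?h x)"
        proof (rule mu_integrable[where c="?b"])
          show "norm (?h x x') \<le> ?b" if "x' \<in> space (B ?n3)" for x' unfolding real_norm_def by (rule hb[OF x that])
        qed measurable
        show "p ?m (x, x') * (r ?m (x, x'))\<^sup>2 \<le> ?h x x'" if "x' \<in> space (mu ?n3)" for x'
        proof -
          have x' [simp]: "x' \<in> space (B ?n3)" using that by simp
          have "(r ?m (x, x'))\<^sup>2 \<le> c * ((1 / e)\<^sup>2 * ?I x x')"
            by (rule order_trans[OF le[OF x x'] mult_left_mono[OF bridge_defect_le(2)[OF z x x'] c]])
          then show ?thesis by (rule mult_left_mono) (rule p_nonneg)
        qed
      qed
      finally show ?thesis .
    qed
    have "(\<integral>x. g x \<partial>mu ?m) \<le> (\<integral>x. \<integral>x'. ?h x x' \<partial>mu ?n3 \<partial>mu ?m)"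
    proof (rule integral_mono)
      show "integrable (mu ?m) g" by (rule mu_integrable[where c="R\<^sup>2"]) (use gb in auto)
      show "integrable (mu ?m) (\<lambda>x. \<integral>x'. ?h x x' \<partial>mu ?n3)"
      proof (rule mu_integrable[where c="?b"])
        show "norm (\<integral>x'. ?h x x' \<partial>mu ?n3) \<le> ?b" if [simp]: "x \<in> space (B ?m)" for x
          unfolding real_norm_def
        proof (rule mu_integral_abs_le)
          show "?h x \<in> borel_measurable (B ?n3)" by measurable
        qed (rule hb, auto)
      qed measurable
    qed (use gh in simp)
    also have "\<dots> = c * (1 / e)\<^sup>2 * hex_inner f \<xi> n z z'"
    proof -
      have "?h x x' = c * (1 / e)\<^sup>2 * (p ?m (x, x') * ?I x x')" for x x' by (simp only: mult_ac)
      then show ?thesis unfolding hex_inner_def by (simp only: integral_mult_right_zero)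
    qed
    finally show ?thesis .
  qed
  then have "(\<integral>x. g x \<partial>mu ?m) / e \<le> c * (1 / e)\<^sup>2 * hex_inner f \<xi> n z z' / e"
    using e_pos by (intro divide_right_mono) auto
  also have "\<dots> = c / e ^ 3 * hex_inner f \<xi> n z z'" by (simp add: power2_eq_square power3_eq_cube)
  finally show ?thesis .
qed

end

end

subsection \<open>Recovering a coboundary from the hexagons\<close>

context elliptic_process
begin

lemma variance_add_bounded_le:
  assumes Y: "Y \<in> borel_measurable P" "\<And>w. w \<in> space P \<Longrightarrow> \<bar>Y w\<bar> \<le> c"
    and Z: "Z \<in> borel_measurable P" "\<And>w. w \<in> space P \<Longrightarrow> \<bar>Z w\<bar> \<le> b"
  shows "variance (\<lambda>w. Y w + Z w + (t::real)) \<le> 2 * variance Y + 2 * b\<^sup>2"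
proof -
  note [measurable] = Y(1) Z(1)
  have iY: "integrable P Y" and iZ: "integrable P Z"
    by (rule P_integrable[where c=c], use Y in auto)(rule P_integrable[where c=b], use Z in auto)
  have sq: "integrable P (\<lambda>w. (U w - m)\<^sup>2)"
    if "U \<in> borel_measurable P" "\<And>w. w \<in> space P \<Longrightarrow> \<bar>U w\<bar> \<le> k" for U k and m :: real
  proof (rule P_integrable[where c="(k + \<bar>m\<bar>)\<^sup>2"])
    show "(\<lambda>w. (U w - m)\<^sup>2) \<in> borel_measurable P" using that(1) by measurable
    show "norm ((U w - m)\<^sup>2) \<le> (k + \<bar>m\<bar>)\<^sup>2" if "w \<in> space P" for w
      unfolding real_norm_def abs_power2 using \<open>\<And>w. w \<in> space P \<Longrightarrow> \<bar>U w\<bar> \<le> k\<close>[OF that]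
      by (intro square_le_of_abs_le) linarith
  qed
  have E: "expectation (\<lambda>w. Y w + Z w + t) = expectation Y + expectation Z + t"
    using iY iZ by (simp add: prob_space)
  have YZ: "\<bar>Y w + Z w + t\<bar> \<le> c + b + \<bar>t\<bar>" if "w \<in> space P" for w
    using Y(2)[OF that] Z(2)[OF that] by linarith
  have "variance (\<lambda>w. Y w + Z w + t) \<le> expectation (\<lambda>w. 2 * (Y w - expectation Y)\<^sup>2 + 2 * (Z w - expectation Z)\<^sup>2)"
  proof (rule integral_mono)
    show "integrable P (\<lambda>w. (Y w + Z w + t - expectation (\<lambda>w. Y w + Z w + t))\<^sup>2)"
      by (rule sq[OF _ YZ]) measurable
    show "integrable P (\<lambda>w. 2 * (Y w - expectation Y)\<^sup>2 + 2 * (Z w - expectation Z)\<^sup>2)"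
      using sq[OF Y] sq[OF Z] by simp
    show "(Y w + Z w + t - expectation (\<lambda>w. Y w + Z w + t))\<^sup>2 \<le> 2 * (Y w - expectation Y)\<^sup>2 + 2 * (Z w - expectation Z)\<^sup>2" for w
      unfolding E using square_sum_le[of "Y w - expectation Y" "Z w - expectation Z"] by (simp add: algebra_simps)
  qed
  also have "\<dots> = 2 * variance Y + 2 * variance Z" using sq[OF Y] sq[OF Z] by simp
  also have "variance Z \<le> b\<^sup>2"
  proof -
    have "variance Z = expectation (\<lambda>w. (Z w)\<^sup>2) - (expectation Z)\<^sup>2"
      using sq[OF Z, of 0] iZ by (intro variance_eq) auto
    also have "\<dots> \<le> expectation (\<lambda>w. (Z w)\<^sup>2)" by simp
    also have "\<dots> \<le> expectation (\<lambda>w. b\<^sup>2)"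
      using sq[OF Z, of 0] Z(2) by (intro integral_mono) (auto intro: square_le_of_abs_le)
    finally show ?thesis by (simp add: prob_space)
  qed
  finally show ?thesis by simp
qed

text \<open>A hexagon based at level n gives information on the functional at level n + 2, and bases
  start at 2; hence the decomposition starts at level 4. The coboundary telescopes to two terms
  bounded by A, the four initial levels contribute at most 4 R0, and the constants c do not affect
  the variance.\<close>

lemma variance_coboundary_le:
  assumes h: "bounded_functional h R'" and r: "bounded_functional r R"
    and a: "\<And>n. a n \<in> borel_measurable (B (Suc (Suc n)))" "\<And>n x. x \<in> space (B (Suc (Suc n))) \<Longrightarrow> \<bar>a n x\<bar> \<le> A"
    and hr: "\<And>n x x'. x \<in> space (B (Suc (Suc (Suc (Suc n))))) \<Longrightarrow> x' \<in> space (B (Suc (Suc (Suc (Suc (Suc n)))))) \<Longrightarrow>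
      h (Suc (Suc (Suc (Suc n)))) (x, x') = r (Suc (Suc (Suc (Suc n)))) (x, x') + c n + a (Suc (Suc (Suc n))) x' - a (Suc (Suc n)) x"
    and h0: "\<And>m x x'. m < 4 \<Longrightarrow> x \<in> space (B m) \<Longrightarrow> x' \<in> space (B (Suc m)) \<Longrightarrow> \<bar>h m (x, x')\<bar> \<le> R0"
    and r0: "\<And>m x x'. m < 4 \<Longrightarrow> r m (x, x') = 0"
  shows "variance (psum h N) \<le> 2 * ((4 + 16 / e ^ 4) * (\<Sum>n<N. second_moment r n)) + 2 * (4 * R0 + 2 * A)\<^sup>2"
proof -
  note [measurable] = a(1)
  define D where "D w = psum h (min N 4) w + (if N \<le> 4 then 0 else a (N - 2) (X (Suc (Suc (N - 2))) w) - a 2 (X (Suc (Suc 2)) w))" for w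
  define t where "t = (\<Sum>n<N - 4. c n)"
  have psum_small: "\<bar>psum h (min N 4) w\<bar> \<le> 4 * R0" if w: "w \<in> space P" for w
  proof -
    have R0: "0 \<le> R0" using h0[of 0 "X 0 w" "X (Suc 0) w"] w by force
    have "\<bar>psum h (min N 4) w\<bar> \<le> (\<Sum>n<min N 4. R0)"
      unfolding psum_def by (rule order_trans[OF sum_abs sum_mono]) (use w in \<open>auto intro!: h0\<close>)
    also have "\<dots> \<le> 4 * R0" using R0 by (auto intro!: mult_right_mono)
    finally show ?thesis .
  qed
  have Db: "\<bar>D w\<bar> \<le> 4 * R0 + 2 * A" if w: "w \<in> space P" for w
  proof -
    have "\<bar>a n (X (Suc (Suc n)) w)\<bar> \<le> A" for n using w by (intro a(2)) auto
    from this[of "N - 2"] this[of 2] psum_small[OF w] show ?thesis unfolding D_def by (auto simp: abs_le_iff)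
  qed
  have eq4: "psum h (4 + k) w = psum r (4 + k) w + (psum h 4 w + (a (Suc (Suc k)) (X (Suc (Suc (Suc (Suc k)))) w) - a 2 (X (Suc (Suc 2)) w)))
      + (\<Sum>n<k. c n)" if w: "w \<in> space P" for k w
  proof (induction k)
    case 0
    have "psum r 4 w = 0" unfolding psum_def by (rule sum.neutral) (auto simp: r0)
    then show ?case by (simp add: numeral_2_eq_2)
  next
    case (Suc k)
    have s: "psum g (4 + Suc k) w = psum g (4 + k) w + g (4 + k) (X (4 + k) w, X (Suc (4 + k)) w)" for g
      unfolding psum_def add_Suc_right by (rule sum.lessThan_Suc)
    have k4: "4 + k = Suc (Suc (Suc (Suc k)))" by simp
    have "h (4 + k) (X (4 + k) w, X (Suc (4 + k)) w) = r (4 + k) (X (4 + k) w, X (Suc (4 + k)) w) + c k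
      + a (Suc (Suc (Suc k))) (X (Suc (4 + k)) w) - a (Suc (Suc k)) (X (4 + k) w)"
      unfolding k4 using w by (intro hr) auto
    then show ?case unfolding s Suc by (simp add: k4)
  qed
  have eq: "psum h N w = psum r N w + D w + t" if w: "w \<in> space P" for w
  proof (cases "N \<le> 4")
    case True
    have "psum r N w = 0" unfolding psum_def using True by (intro sum.neutral) (auto simp: r0)
    then show ?thesis using True by (simp add: D_def t_def min_def)
  next
    case False
    then have N: "N = 4 + (N - 4)" "N - 2 = Suc (Suc (N - 4))" by auto
    from eq4[OF w, of "N - 4"] False show ?thesis
      unfolding D_def t_def N(2) using N(1) by simp
  qed
  have [measurable]: "D \<in> borel_measurable P" unfolding D_def[abs_def] using h by measurable
  have "variance (psum h N) = variance (\<lambda>w. psum r N w + D w + t)"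
  proof -
    have "expectation (psum h N) = expectation (\<lambda>w. psum r N w + D w + t)"
      by (rule Bochner_Integration.integral_cong[OF refl eq])
    then show ?thesis by (intro Bochner_Integration.integral_cong refl) (simp add: eq)
  qed
  also have "\<dots> \<le> 2 * variance (psum r N) + 2 * (4 * R0 + 2 * A)\<^sup>2"
    by (rule variance_add_bounded_le[OF psum_measurable[OF r] psum_bound[OF r] _ Db]) measurable
  also have "\<dots> \<le> 2 * ((4 + 16 / e ^ 4) * (\<Sum>n<N. second_moment r n)) + 2 * (4 * R0 + 2 * A)\<^sup>2"
    by (intro add_right_mono mult_left_mono variance_psum_le[OF r]) simp
  finally show ?thesis .
qed

lemma second_moment_zero: "(\<And>x x'. r n (x, x') = 0) \<Longrightarrow> second_moment r n = 0"
  by (simp add: second_moment_def)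

lemma sum_second_moment_le:
  assumes r0: "\<And>m x x'. m < 4 \<Longrightarrow> r m (x, x') = 0"
    and le: "\<And>n. second_moment r (Suc (Suc (Suc (Suc n)))) \<le> k n"
    and k: "\<And>n. 0 \<le> k n"
  shows "(\<Sum>m<N. second_moment r m) \<le> (\<Sum>n<N - 4. k n)"
proof (cases "N \<le> 4")
  case True
  then have "(\<Sum>m<N. second_moment r m) = 0" by (intro sum.neutral) (auto intro!: second_moment_zero r0)
  then show ?thesis using k by (simp add: sum_nonneg)
next
  case False
  have z: "(\<Sum>m<4. second_moment r m) = 0" by (intro sum.neutral) (auto intro!: second_moment_zero r0)
  have "(\<Sum>m<4 + j. second_moment r m) \<le> (\<Sum>n<j. k n)" for j
  proof (induction j)
    case 0 show ?case using z by simp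
  next
    case (Suc j)
    have "Suc (Suc (Suc (Suc j))) = 4 + j" by simp
    from Suc le[of j, unfolded this] show ?case unfolding add_Suc_right sum.lessThan_Suc by simp
  qed
  from this[of "N - 4"] False show ?thesis by simp
qed

context
  fixes f :: "nat \<Rightarrow> 'a \<times> 'a \<Rightarrow> real" and R :: real
  assumes f: "bounded_functional f R"
begin

lemma f_meas: "f n \<in> borel_measurable (B n \<Otimes>\<^sub>M B (Suc n))"
  by (rule bounded_functional_measurable[OF f])

lemma hex_inner_X_bounds:
  assumes "w \<in> space P"
  shows "0 \<le> hex_inner f \<xi> n (X n w) (X (Suc n) w)"
    "\<bar>hex_inner f \<xi> n (X n w) (X (Suc n) w)\<bar> \<le> 1 / e * (2 * (1 / e) ^ 4)"
proof -
  have x: "X n w \<in> space (B n)" "X (Suc n) w \<in> space (B (Suc n))" using assms by auto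
  show 0: "0 \<le> hex_inner f \<xi> n (X n w) (X (Suc n) w)" by (rule hex_inner_bounds(1)[of f, OF f_meas x])
  show "\<bar>hex_inner f \<xi> n (X n w) (X (Suc n) w)\<bar> \<le> 1 / e * (2 * (1 / e) ^ 4)"
    unfolding abs_of_nonneg[OF 0] by (rule hex_inner_bounds(2)[of f, OF f_meas x])
qed

lemma hex_inner_X_integrable: "integrable P (\<lambda>w. hex_inner f \<xi> n (X n w) (X (Suc n) w))"
proof (rule P_integrable[where c="1 / e * (2 * (1 / e) ^ 4)"])
  show "(\<lambda>w. hex_inner f \<xi> n (X n w) (X (Suc n) w)) \<in> borel_measurable P"
    by (rule measurable_hex_inner[of f, OF f_meas]) measurable
qed (unfold real_norm_def, rule hex_inner_X_bounds(2))

text \<open>First moment method: by \<open>expectation_hex_inner_le\<close> the sum has mean at most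
  the first term on the right. If every outcome exceeded the bound, the summand 1 would contradict
  this.\<close>

lemma exists_good_path:
  obtains w where "w \<in> space P"
    "(\<Sum>n<k. hex_inner f \<xi> (Suc (Suc n)) (X (Suc (Suc n)) w) (X (Suc (Suc (Suc n))) w))
      \<le> (\<Sum>n<k. hex f \<xi> (Suc (Suc n))) / e + 1"
proof -
  let ?h = "\<lambda>n w. hex_inner f \<xi> (Suc (Suc n)) (X (Suc (Suc n)) w) (X (Suc (Suc (Suc n))) w)"
  let ?c = "(\<Sum>n<k. hex f \<xi> (Suc (Suc n))) / e"
  have "\<exists>w\<in>space P. (\<Sum>n<k. ?h n w) \<le> ?c + 1"
  proof (rule ccontr)
    assume "\<not> ?thesis"
    then have gt: "?c + 1 \<le> (\<Sum>n<k. ?h n w)" if "w \<in> space P" for w using that by force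
    have "?c + 1 = expectation (\<lambda>w. ?c + 1)" by (simp add: prob_space)
    also have "\<dots> \<le> expectation (\<lambda>w. \<Sum>n<k. ?h n w)"
      by (rule integral_mono) (use gt hex_inner_X_integrable in auto)
    also have "\<dots> = (\<Sum>n<k. expectation (?h n))" using hex_inner_X_integrable by simp
    also have "\<dots> \<le> (\<Sum>n<k. hex f \<xi> (Suc (Suc n)) / e)"
      by (intro sum_mono expectation_hex_inner_le[of f, OF f_meas])
    also have "\<dots> = ?c" by (simp add: sum_divide_distrib)
    finally show False by simp
  qed
  then show ?thesis using that by blast
qed

text \<open>Unlike in \<open>exists_good_path\<close>, one trajectory has to serve all N at once,
  because the lattice valued functional built from it must not depend on N. The infinite series has
  finite mean and is therefore almost surely finite.\<close>

lemma exists_summable_path: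
  assumes s: "summable (\<lambda>n. hex f \<xi> (Suc (Suc n)))"
  obtains w where "w \<in> space P"
    "summable (\<lambda>n. hex_inner f \<xi> (Suc (Suc n)) (X (Suc (Suc n)) w) (X (Suc (Suc (Suc n))) w))"
proof -
  let ?h = "\<lambda>n w. hex_inner f \<xi> (Suc (Suc n)) (X (Suc (Suc n)) w) (X (Suc (Suc (Suc n))) w)"
  have hm: "?h n \<in> borel_measurable P" for n using hex_inner_X_integrable by (rule borel_measurable_integrable)
  have "(\<integral>\<^sup>+w. (\<Sum>n. ennreal (?h n w)) \<partial>P) = (\<Sum>n. \<integral>\<^sup>+w. ennreal (?h n w) \<partial>P)"
    using hm by (intro nn_integral_suminf) auto
  also have "\<dots> = (\<Sum>n. ennreal (expectation (?h n)))"
    using hex_inner_X_integrable hex_inner_X_bounds(1)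
    by (intro suminf_cong nn_integral_eq_integral) (auto intro!: AE_I2)
  also have "\<dots> \<le> (\<Sum>n. ennreal (hex f \<xi> (Suc (Suc n)) / e))"
    by (intro suminf_le ennreal_leI expectation_hex_inner_le[of f, OF f_meas]) auto
  also have "\<dots> = ennreal (\<Sum>n. hex f \<xi> (Suc (Suc n)) / e)"
    using s hex_bounds(1)[of f, OF f_meas] e_pos
    by (intro suminf_ennreal2 summable_divide) (auto intro!: divide_nonneg_pos)
  finally have "(\<integral>\<^sup>+w. (\<Sum>n. ennreal (?h n w)) \<partial>P) < \<infinity>"
    by (simp add: order_le_less_trans ennreal_less_top)
  then have "AE w in P. (\<Sum>n. ennreal (?h n w)) \<noteq> \<infinity>"
    using hm by (intro nn_integral_noteq_infinite) auto
  then have "AE w in P. w \<in> space P \<and> (\<Sum>n. ennreal (?h n w)) \<noteq> \<infinity>"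
    using AE_space by (rule AE_conjI[rotated])
  then have "\<exists>w. w \<in> space P \<and> (\<Sum>n. ennreal (?h n w)) \<noteq> \<infinity>"
    by (rule eventually_happens'[OF ae_filter_bot])
  then obtain w where w: "w \<in> space P" "(\<Sum>n. ennreal (?h n w)) \<noteq> \<infinity>" by auto
  then have "summable (\<lambda>n. ?h n w)"
    unfolding infinity_ennreal_def by (intro summable_suminf_not_top) (auto simp: hex_inner_X_bounds(1))
  with w that show ?thesis by blast
qed

lemma bridge_mean_le:
  assumes zx: "z \<in> space (B n)" "x \<in> space (B (Suc (Suc n)))"
  shows "\<bar>bridge_mean f n z x\<bar> \<le> 2 * R"
  unfolding bridge_mean_def
proof (rule bridge_integral_abs_le[OF zx])
  show "bridge_sum f n z x \<in> borel_measurable (B (Suc n))"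
    using zx by (intro measurable_bridge_sum[of f, OF f_meas]) auto
  show "\<bar>bridge_sum f n z x y\<bar> \<le> 2 * R" if "y \<in> space (B (Suc n))" for y
    using bounded_functional_bound[OF f zx(1) that] bounded_functional_bound[OF f that zx(2)]
    by (simp add: bridge_sum_def)
qed

end

context
  fixes f :: "nat \<Rightarrow> 'a \<times> 'a \<Rightarrow> real" and R :: real
  assumes f: "bounded_functional f R"
begin

lemmas f_measurable = bounded_functional_measurable[OF f]

text \<open>Along a good trajectory z, f at level n + 2 is a constant plus a coboundary of bridge
  means plus a remainder r, and r is the mean balance estimated in
  \<open>bridge_mean_square_le\<close>. The trajectory may depend on N and d, since only the
  variance of this one sum is at stake.\<close>

lemma variance_le_hex_sum:
  assumes d: "0 < d" "6 * R * d \<le> pi"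
  shows "variance (psum f N) \<le> 2 * ((4 + 16 / e ^ 4) * (8 / d\<^sup>2 / e ^ 3 * (hex_sum f N d / e + 1))) + 2 * (8 * R)\<^sup>2"
proof -
  obtain w where w: "w \<in> space P"
    and sum: "(\<Sum>n<N - 4. hex_inner f d (Suc (Suc n)) (X (Suc (Suc n)) w) (X (Suc (Suc (Suc n))) w))
      \<le> (\<Sum>n<N - 4. hex f d (Suc (Suc n))) / e + 1"
    by (rule exists_good_path[OF f])
  define z where "z n = X n w" for n
  have z [simp]: "z n \<in> space (B n)" for n using w by (simp add: z_def)
  define a where "a n x = - bridge_mean f n (z n) x" for n x
  define c where "c n = f n (z n, z (Suc n))" for n
  \<comment> \<open>At level m the fixed edge of the hexagon is the one of z at level m - 2, and the
    bridges start at levels m - 2 and m - 1. With the sign in \<open>a\<close> this is f minus the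
    constant, plus the first bridge mean, minus the second.\<close>
  define r where "r m q = (if m < 4 then 0 else f m q - c (m - 2) + a (m - 2) (fst q) * (-1) + a (m - 1) (snd q))" for m q
  have am: "a n \<in> borel_measurable (B (Suc (Suc n)))" for n
  proof -
    have "bridge_mean f n (z n) \<in> borel_measurable (B (Suc (Suc n)))"
      by (rule measurable_bridge_mean[of f, OF f_measurable]) auto
    then show ?thesis unfolding a_def[abs_def] by measurable
  qed
  have ab: "\<bar>a n x\<bar> \<le> 2 * R" if "x \<in> space (B (Suc (Suc n)))" for n x
    using bridge_mean_le[OF f z that] by (simp add: a_def)
  have cb: "\<bar>c n\<bar> \<le> R" for n unfolding c_def by (rule bounded_functional_bound[OF f]) auto
  have idx: "\<exists>n. m = Suc (Suc n) \<and> 2 \<le> n" if "\<not> m < 4" for m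
    using that by (intro exI[of _ "m - 2"]) auto
  have rm: "r m \<in> borel_measurable (B m \<Otimes>\<^sub>M B (Suc m))" for m
  proof (cases "m < 4")
    case False
    then obtain n where n: "m = Suc (Suc n)" using idx by blast
    note [measurable] = am[of n] am[of "Suc n"] f_measurable[of "Suc (Suc n)"]
    have "(\<lambda>q. f (Suc (Suc n)) q - c n + a n (fst q) * (-1) + a (Suc n) (snd q))
        \<in> borel_measurable (B (Suc (Suc n)) \<Otimes>\<^sub>M B (Suc (Suc (Suc n))))" by measurable
    then show ?thesis using False by (simp add: r_def[abs_def] n)
  qed (simp add: r_def[abs_def])
  have rb: "\<bar>r m (x, x')\<bar> \<le> 6 * R" if x: "x \<in> space (B m)" "x' \<in> space (B (Suc m))" for m x x'
  proof (cases "m < 4")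
    case True then show ?thesis using bounded_functional_nonneg[OF f] by (simp add: r_def)
  next
    case False
    then obtain n where n: "m = Suc (Suc n)" using idx by blast
    show ?thesis using False bounded_functional_bound[OF f x] cb[of n] ab[of x n] ab[of x' "Suc n"] x
      unfolding n r_def by auto
  qed
  have r: "bounded_functional r (6 * R)" using rm rb by (auto simp: bounded_functional_def)
  have "second_moment r (Suc (Suc (Suc (Suc n))))
      \<le> 8 / d\<^sup>2 / e ^ 3 * hex_inner f d (Suc (Suc n)) (z (Suc (Suc n))) (z (Suc (Suc (Suc n))))" for n
  proof (rule second_moment_le_hex_inner[of f, OF f_measurable r z z])
    let ?n = "Suc (Suc n)"
    fix x x' assume x: "x \<in> space (B (Suc (Suc ?n)))" "x' \<in> space (B (Suc (Suc (Suc ?n))))"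
    have "r (Suc (Suc ?n)) (x, x') = f (Suc (Suc ?n)) (x, x') - f ?n (z ?n, z (Suc ?n)) + bridge_mean f ?n (z ?n) x
        - bridge_mean f (Suc ?n) (z (Suc ?n)) x'"
      by (simp add: r_def a_def c_def)
    then show "(r (Suc (Suc ?n)) (x, x'))\<^sup>2 \<le> 8 / d\<^sup>2 * bridge_defect f d ?n (z ?n) (z (Suc ?n)) x x'"
      using bridge_mean_square_le[of f, OF f_measurable z z x bounded_functional_bound[OF f] d] by simp
  qed (use d in simp)
  then have "(\<Sum>m<N. second_moment r m) \<le> (\<Sum>n<N - 4. 8 / d\<^sup>2 / e ^ 3 *
      hex_inner f d (Suc (Suc n)) (z (Suc (Suc n))) (z (Suc (Suc (Suc n)))))"
    using hex_inner_X_bounds(1)[OF f w] e_pos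
    by (intro sum_second_moment_le) (auto simp: r_def z_def intro!: mult_nonneg_nonneg)
  also have "\<dots> \<le> 8 / d\<^sup>2 / e ^ 3 * (hex_sum f N d / e + 1)"
    unfolding sum_distrib_left[symmetric] hex_sum_def z_def using e_pos by (intro mult_left_mono sum) auto
  finally have S: "(\<Sum>m<N. second_moment r m) \<le> 8 / d\<^sup>2 / e ^ 3 * (hex_sum f N d / e + 1)" .
  have "variance (psum f N) \<le> 2 * ((4 + 16 / e ^ 4) * (\<Sum>n<N. second_moment r n)) + 2 * (4 * R + 2 * (2 * R))\<^sup>2"
  proof (rule variance_coboundary_le[OF f r])
    show "f (Suc (Suc (Suc (Suc n)))) (x, x') = r (Suc (Suc (Suc (Suc n)))) (x, x') + c (Suc (Suc n))
        + (- a (Suc (Suc (Suc n))) x') - (- a (Suc (Suc n)) x)" for n x x'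
      by (simp add: r_def)
  qed (use am ab in \<open>auto simp: r_def intro!: bounded_functional_bound[OF f]\<close>)
  also have "\<dots> \<le> 2 * ((4 + 16 / e ^ 4) * (8 / d\<^sup>2 / e ^ 3 * (hex_sum f N d / e + 1))) + 2 * (4 * R + 2 * (2 * R))\<^sup>2"
    using e_pos by (intro add_right_mono mult_left_mono S) auto
  finally show ?thesis by simp
qed

text \<open>Along a trajectory \<open>z\<close> with finite defect, the arguments of the bridge characteristic functions
  provide a coboundary whose removal leaves \<open>(2\<pi>/\<xi>)\<int>\<close>-valued functions up to a square summable error.\<close>

lemma lattice_reduction:
  assumes xi: "0 < \<xi>" and s: "summable (\<lambda>n. hex f \<xi> (Suc (Suc n)))"
  shows "\<exists>g R' C. (\<forall>n. g n \<in> borel_measurable (B n \<Otimes>\<^sub>M B (Suc n)))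
    \<and> (\<forall>n. \<forall>x\<in>space (B n). \<forall>x'\<in>space (B (Suc n)). \<exists>j::int. g n (x, x') = 2 * pi / \<xi> * of_int j)
    \<and> bounded_functional (\<lambda>n q. f n q - g n q) R'
    \<and> (\<forall>N. variance (psum (\<lambda>n q. f n q - g n q) N) \<le> C)"
proof -
  obtain w where w: "w \<in> space P"
    and sum: "summable (\<lambda>n. hex_inner f \<xi> (Suc (Suc n)) (X (Suc (Suc n)) w) (X (Suc (Suc (Suc n))) w))"
    by (rule exists_summable_path[OF f s])
  define z where "z n = X n w" for n
  have z [simp]: "z n \<in> space (B n)" for n using w by (simp add: z_def)
  define u where "u n x = Arg (bridge_char f \<xi> n (z n) x)" for n x
  define c where "c n = f n (z n, z (Suc n))" for n
  \<comment> \<open>This is \<xi> times f with the constant and the coboundary of arguments removed.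
    Its representative in (-pi, pi] becomes the small remainder r; the discarded multiple of 2 pi is
    what makes g lattice valued.\<close>
  define \<theta> where "\<theta> m q = \<xi> * (f m q - c (m - 2)) + u (m - 2) (fst q) - u (m - 1) (snd q)" for m q
  define r where "r m q = (if m < 4 then 0 else Arg (cis (\<theta> m q)) / \<xi>)" for m q
  define h where "h m q = (if m < 4 then f m q else r m q + c (m - 2) + u (m - 1) (snd q) / \<xi> - u (m - 2) (fst q) / \<xi>)" for m q
  define g where "g m q = f m q - h m q" for m q
  have um: "u n \<in> borel_measurable (B (Suc (Suc n)))" for n
  proof -
    have "bridge_char f \<xi> n (z n) \<in> borel_measurable (B (Suc (Suc n)))"
      by (rule measurable_bridge_char[of f, OF f_measurable]) auto
    then show ?thesis unfolding u_def[abs_def] by measurable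
  qed
  have ub: "\<bar>u n x\<bar> \<le> pi" for n x unfolding u_def using Arg_bounded[of "bridge_char f \<xi> n (z n) x"] by auto
  have cb: "\<bar>c n\<bar> \<le> R" for n unfolding c_def by (rule bounded_functional_bound[OF f]) auto
  have idx: "\<exists>n. m = Suc (Suc n) \<and> 2 \<le> n" if "\<not> m < 4" for m
    using that by (intro exI[of _ "m - 2"]) auto
  have tm: "\<theta> m \<in> borel_measurable (B m \<Otimes>\<^sub>M B (Suc m))" if "\<not> m < 4" for m
  proof -
    obtain n where n: "m = Suc (Suc n)" using idx[OF \<open>\<not> m < 4\<close>] by blast
    note [measurable] = um[of n] um[of "Suc n"] f_measurable[of "Suc (Suc n)"]
    have "(\<lambda>q. \<xi> * (f (Suc (Suc n)) q - c n) + u n (fst q) - u (Suc n) (snd q))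
        \<in> borel_measurable (B (Suc (Suc n)) \<Otimes>\<^sub>M B (Suc (Suc (Suc n))))" by measurable
    then show ?thesis by (simp add: \<theta>_def[abs_def] n)
  qed
  have rm: "r m \<in> borel_measurable (B m \<Otimes>\<^sub>M B (Suc m))" for m
  proof (cases "m < 4")
    case False
    note [measurable] = tm[OF False]
    have "(\<lambda>q. Arg (cis (\<theta> m q)) / \<xi>) \<in> borel_measurable (B m \<Otimes>\<^sub>M B (Suc m))" by measurable
    then show ?thesis using False by (simp add: r_def[abs_def])
  qed (simp add: r_def[abs_def])
  have hm: "h m \<in> borel_measurable (B m \<Otimes>\<^sub>M B (Suc m))" for m
  proof (cases "m < 4")
    case False
    then obtain n where n: "m = Suc (Suc n)" using idx by blast
    note [measurable] = um[of n] um[of "Suc n"] rm[of "Suc (Suc n)"]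
    have "(\<lambda>q. r (Suc (Suc n)) q + c n + u (Suc n) (snd q) / \<xi> - u n (fst q) / \<xi>)
        \<in> borel_measurable (B (Suc (Suc n)) \<Otimes>\<^sub>M B (Suc (Suc (Suc n))))" by measurable
    then show ?thesis using False by (simp add: h_def[abs_def] n)
  next
    case True then show ?thesis using f_measurable[of m] by (simp add: h_def[abs_def])
  qed
  have rb: "\<bar>r m q\<bar> \<le> pi / \<xi>" for m q
    using Arg_bounded[of "cis (\<theta> m q)"] xi by (auto simp: r_def divide_right_mono)
  have r: "bounded_functional r (pi / \<xi>)" using rm rb by (auto simp: bounded_functional_def)
  have ubx: "\<bar>u n x / \<xi>\<bar> \<le> pi / \<xi>" for n x using ub[of n x] xi by (simp add: divide_right_mono)
  have hb: "\<bar>h m (x, x')\<bar> \<le> R + 3 * (pi / \<xi>)" if "x \<in> space (B m)" "x' \<in> space (B (Suc m))" for m x x'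
  proof (cases "m < 4")
    case True then show ?thesis using bounded_functional_bound[OF f that] xi by (simp add: h_def add_increasing2)
  next
    case False
    then show ?thesis using rb[of m "(x, x')"] cb[of "m - 2"] ubx[of "m - 1" x'] ubx[of "m - 2" x]
      unfolding h_def fst_conv snd_conv if_not_P[OF False] by linarith
  qed
  have h: "bounded_functional h (R + 3 * (pi / \<xi>))" using hm hb by (auto simp: bounded_functional_def)
  \<comment> \<open>The factor 16 is 8 from \<open>square_le_one_minus_cos\<close> times 2 from
    \<open>one_minus_cos_le_bridge_defect\<close>; the 1/e^3 comes from
    \<open>second_moment_le_hex_inner\<close>.\<close>
  define k where "k n = 16 / \<xi>\<^sup>2 / e ^ 3 * hex_inner f \<xi> (Suc (Suc n)) (z (Suc (Suc n))) (z (Suc (Suc (Suc n))))" for n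
  have k0: "0 \<le> k n" for n
    unfolding k_def z_def using hex_inner_X_bounds(1)[OF f w] e_pos by (intro mult_nonneg_nonneg) auto
  have ks: "summable k" unfolding k_def[abs_def] z_def by (rule summable_mult[OF sum])
  have sm: "second_moment r (Suc (Suc (Suc (Suc n)))) \<le> k n" for n
    unfolding k_def
  proof (rule second_moment_le_hex_inner[of f, OF f_measurable r z z])
    let ?n = "Suc (Suc n)"
    fix x x' assume x: "x \<in> space (B (Suc (Suc ?n)))" "x' \<in> space (B (Suc (Suc (Suc ?n))))"
    let ?t = "\<theta> (Suc (Suc ?n)) (x, x')"
    have t: "?t = \<xi> * (f (Suc (Suc ?n)) (x, x') - f ?n (z ?n, z (Suc ?n))) + Arg (bridge_char f \<xi> ?n (z ?n) x)
        - Arg (bridge_char f \<xi> (Suc ?n) (z (Suc ?n)) x')"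
      by (simp add: \<theta>_def c_def u_def)
    have "cos (Arg (cis ?t)) = cos ?t"
    proof -
      have "cis (Arg (cis ?t)) = cis ?t" by (subst cis_Arg) (auto simp: sgn_eq)
      then show ?thesis by (metis cis.sel(1))
    qed
    moreover have "\<bar>Arg (cis ?t)\<bar> \<le> pi" using Arg_bounded[of "cis ?t"] by auto
    ultimately have "(Arg (cis ?t))\<^sup>2 \<le> 8 * (1 - cos ?t)" using square_le_one_minus_cos by metis
    also have "\<dots> \<le> 8 * (2 * bridge_defect f \<xi> ?n (z ?n) (z (Suc ?n)) x x')"
      unfolding t by (intro mult_left_mono one_minus_cos_le_bridge_defect[of f, OF f_measurable z z x]) simp
    finally have "(Arg (cis ?t))\<^sup>2 / \<xi>\<^sup>2 \<le> 8 * (2 * bridge_defect f \<xi> ?n (z ?n) (z (Suc ?n)) x x') / \<xi>\<^sup>2"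
      by (rule divide_right_mono) simp
    then show "(r (Suc (Suc ?n)) (x, x'))\<^sup>2 \<le> 16 / \<xi>\<^sup>2 * bridge_defect f \<xi> ?n (z ?n) (z (Suc ?n)) x x'"
      by (simp add: r_def power_divide)
  qed simp
  have V: "variance (psum h N) \<le> 2 * ((4 + 16 / e ^ 4) * suminf k) + 2 * (4 * R + 2 * (pi / \<xi>))\<^sup>2" for N
  proof -
    have "variance (psum h N) \<le> 2 * ((4 + 16 / e ^ 4) * (\<Sum>n<N. second_moment r n)) + 2 * (4 * R + 2 * (pi / \<xi>))\<^sup>2"
    proof (rule variance_coboundary_le[OF h r])
      show "(\<lambda>x. u n x / \<xi>) \<in> borel_measurable (B (Suc (Suc n)))" for n using um[of n] by measurable
      show "\<bar>u n x / \<xi>\<bar> \<le> pi / \<xi>" for n x by (rule ubx)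
      show "h (Suc (Suc (Suc (Suc n)))) (x, x') = r (Suc (Suc (Suc (Suc n)))) (x, x') + c (Suc (Suc n))
          + u (Suc (Suc (Suc n))) x' / \<xi> - u (Suc (Suc n)) x / \<xi>" for n x x'
        by (simp add: h_def)
      show "\<bar>h m (x, x')\<bar> \<le> R" if "m < 4" "x \<in> space (B m)" "x' \<in> space (B (Suc m))" for m x x'
        using bounded_functional_bound[OF f that(2,3)] that(1) by (simp add: h_def)
    qed (simp add: r_def)
    also have "(\<Sum>n<N. second_moment r n) \<le> suminf k"
    proof -
      have "(\<Sum>n<N. second_moment r n) \<le> (\<Sum>n<N - 4. k n)"
        by (rule sum_second_moment_le) (use sm k0 in \<open>auto simp: r_def\<close>)
      also have "\<dots> \<le> suminf k" by (rule sum_le_suminf[OF ks]) (use k0 in auto)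
      finally show ?thesis .
    qed
    finally show ?thesis using e_pos by (simp add: mult_left_mono)
  qed
  have lat: "\<exists>j::int. g m (x, x') = 2 * pi / \<xi> * of_int j" for m x x'
  proof (cases "m < 4")
    case True then show ?thesis by (intro exI[of _ 0]) (simp add: g_def h_def)
  next
    case False
    let ?t = "\<theta> m (x, x')"
    have "cis (Arg (cis ?t)) = cis ?t" by (subst cis_Arg) (auto simp: sgn_eq)
    then have "sin ?t = sin (Arg (cis ?t)) \<and> cos ?t = cos (Arg (cis ?t))" by (metis cis.sel)
    then obtain j :: int where j: "?t = Arg (cis ?t) + 2 * pi * of_int j" using sin_cos_eq_iff by blast
    have "\<xi> * g m (x, x') = ?t - Arg (cis ?t)"
      using False xi by (simp add: g_def h_def r_def \<theta>_def field_simps)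
    then have "g m (x, x') = 2 * pi / \<xi> * of_int j" using j xi by (simp add: field_simps)
    then show ?thesis by blast
  qed
  have hg: "(\<lambda>n q. f n q - g n q) = h" by (simp add: g_def fun_eq_iff)
  have gm: "g n \<in> borel_measurable (B n \<Otimes>\<^sub>M B (Suc n))" for n
    unfolding g_def[abs_def] using f_measurable hm by (intro borel_measurable_diff)
  show ?thesis using gm lat h V unfolding hg[symmetric] by blast
qed

end

end

subsection \<open>Growth of the hexagon sums\<close>

text \<open>The triangle inequality for the chord from e^(ia) to e^(ib) through 1, squared. The
  slack is half of |e^(ia) + e^(ib) - 2|^2, the sum of squares in the proof.\<close>

lemma one_minus_cos_diff_le:
  fixes a b :: real
  shows "1 - cos (a - b) \<le> 2 * (1 - cos a) + 2 * (1 - cos b)"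
proof -
  have "0 \<le> (cos a + cos b - 2)\<^sup>2 + (sin a + sin b)\<^sup>2" by simp
  also have "\<dots> = ((sin a)\<^sup>2 + (cos a)\<^sup>2) + ((sin b)\<^sup>2 + (cos b)\<^sup>2) + 2 * (cos a * cos b + sin a * sin b)
      + 4 - 4 * cos a - 4 * cos b"
    by algebra
  also have "\<dots> = 6 + 2 * cos (a - b) - 4 * cos a - 4 * cos b" by (simp add: cos_diff)
  finally show ?thesis by simp
qed

lemma abs_cos_diff_le: "\<bar>cos a - cos b\<bar> \<le> \<bar>a - (b::real)\<bar>"
proof -
  have "norm (cis a - cis b) = norm (cis b * (cis (a - b) - 1))"
    by (simp add: right_diff_distrib cis_mult)
  also have "\<dots> \<le> \<bar>a - b\<bar>" by (simp add: norm_mult norm_cis_minus_1_le)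
  finally have "norm (cis a - cis b) \<le> \<bar>a - b\<bar>" .
  moreover have "\<bar>Re (cis a - cis b)\<bar> \<le> norm (cis a - cis b)" by (rule abs_Re_le_cmod)
  ultimately show ?thesis by simp
qed

context elliptic_process
begin

context
  fixes f :: "nat \<Rightarrow> 'a \<times> 'a \<Rightarrow> real" and R :: real
  assumes f: "bounded_functional f R"
begin

text \<open>The measure, the weight W and the balance G do not involve \<xi>, so pointwise
  inequalities between cosines at several frequencies pass to \<open>hex\<close>.\<close>

lemma hex_representation:
  obtains M :: "(('a \<times> 'a) \<times> (('a \<times> 'a) \<times> ('a \<times> 'a))) measure" and W G
  where "prob_space M" "W \<in> borel_measurable M" "G \<in> borel_measurable M"
    "\<And>v. v \<in> space M \<Longrightarrow> 0 \<le> W v \<and> W v \<le> (1 / e) ^ 6" "\<And>v. v \<in> space M \<Longrightarrow> \<bar>G v\<bar> \<le> 6 * R"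
    "\<And>\<xi>. hex f \<xi> n = (\<integral>v. W v * (1 - cos (\<xi> * G v)) \<partial>M)"
proof -
  let ?n1 = "Suc n" let ?n3 = "Suc (Suc ?n1)"
  note measurable_path_sum[of f, OF bounded_functional_measurable[OF f], measurable (raw)]
  define M1 where "M1 = mu n \<Otimes>\<^sub>M mu ?n3"
  define M2 where "M2 = mu_pair ?n1 \<Otimes>\<^sub>M mu_pair ?n1"
  have pr: "prob_space (M \<Otimes>\<^sub>M N)" if "prob_space M" "prob_space N" for M :: "'x measure" and N :: "'y measure"
  proof -
    interpret M: prob_space M by fact
    interpret N: prob_space N by fact
    interpret pair_prob_space M N ..
    show ?thesis by (rule P.prob_space_axioms)
  qed
  have p1: "prob_space M1" and p2: "prob_space M2"
    unfolding M1_def M2_def by (intro pr prob_mu prob_mu_pair)+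
  define W where "W v = path_weight n (fst (fst v)) (fst (snd v)) (snd (fst v)) * path_weight n (fst (fst v)) (snd (snd v)) (snd (fst v))" for v
  define G where "G v = path_sum f n (fst (fst v)) (fst (snd v)) (snd (fst v)) - path_sum f n (fst (fst v)) (snd (snd v)) (snd (fst v))" for v
  have s1 [measurable_cong]: "sets M1 = sets (B n \<Otimes>\<^sub>M B ?n3)" unfolding M1_def by (rule sets_pair_measure_cong) simp_all
  have s2 [measurable_cong]: "sets M2 = sets ((B ?n1 \<Otimes>\<^sub>M B (Suc ?n1)) \<Otimes>\<^sub>M (B ?n1 \<Otimes>\<^sub>M B (Suc ?n1)))"
    unfolding M2_def by (rule sets_pair_measure_cong) simp_all
  have Wm [measurable]: "W \<in> borel_measurable (M1 \<Otimes>\<^sub>M M2)" unfolding W_def[abs_def] by measurable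
  have Gm [measurable]: "G \<in> borel_measurable (M1 \<Otimes>\<^sub>M M2)" unfolding G_def[abs_def] by measurable
  have Wb: "0 \<le> W v \<and> W v \<le> (1 / e) ^ 6" for v
  proof
    show "0 \<le> W v" unfolding W_def by (intro mult_nonneg_nonneg path_weight_bounds)
    have "W v \<le> (1 / e) ^ 3 * (1 / e) ^ 3" unfolding W_def
      using e_pos by (intro mult_mono path_weight_bounds) auto
    then show "W v \<le> (1 / e) ^ 6" unfolding power_add[symmetric] by simp
  qed
  have Gb: "\<bar>G v\<bar> \<le> 6 * R" if v: "v \<in> space (M1 \<Otimes>\<^sub>M M2)" for v
  proof -
    obtain z x y u y' u' where vv: "v = ((z, x), ((y, u), (y', u')))" by (metis surj_pair)
    have sp: "z \<in> space (B n)" "x \<in> space (B ?n3)" "y \<in> space (B ?n1)" "y' \<in> space (B ?n1)"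
      "u \<in> space (B (Suc ?n1))" "u' \<in> space (B (Suc ?n1))"
      using v by (auto simp: vv M1_def M2_def space_pair_measure)
    have "\<bar>path_sum f n z (y, u) x\<bar> \<le> 3 * R" if "y \<in> space (B ?n1)" "u \<in> space (B (Suc ?n1))" for y u
      unfolding path_sum_def fst_conv snd_conv
      using bounded_functional_bound[OF f sp(1) that(1)] bounded_functional_bound[OF f that]
        bounded_functional_bound[OF f that(2) sp(2)] by linarith
    from this[OF sp(3,5)] this[OF sp(4,6)] show ?thesis unfolding G_def vv fst_conv snd_conv by linarith
  qed
  have "hex f \<xi> n = (\<integral>v. W v * (1 - cos (\<xi> * G v)) \<partial>(M1 \<Otimes>\<^sub>M M2))" for \<xi>
  proof -
    let ?g = "\<lambda>a q. W (a, q) * (1 - cos (\<xi> * G (a, q)))"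
    have gb: "\<bar>?g a q\<bar> \<le> 2 * (1 / e) ^ 6" for a q unfolding W_def by (rule hex_integrand_bounds(2))
    have gm: "(\<lambda>(a, q). ?g a q) \<in> borel_measurable (M1 \<Otimes>\<^sub>M M2)"
    proof -
      have "(\<lambda>v. W v * (1 - cos (\<xi> * G v))) \<in> borel_measurable (M1 \<Otimes>\<^sub>M M2)" by measurable
      then show ?thesis by (simp add: split_beta')
    qed
    have inner: "hex_defect f \<xi> n z x = (\<integral>q. ?g (z, x) q \<partial>M2)" if zx: "z \<in> space (B n)" "x \<in> space (B ?n3)" for z x
    proof -
      have a: "(z, x) \<in> space M1" using zx by (simp add: M1_def space_pair_measure)
      have gm1: "(\<lambda>q. ?g (z, x) q) \<in> borel_measurable M2"
        using measurable_compose[OF measurable_Pair1'[OF a] gm] by simp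
      have "(\<integral>q. \<integral>q'. ?g (z, x) (q, q') \<partial>mu_pair ?n1 \<partial>mu_pair ?n1) = (\<integral>q. ?g (z, x) (fst q, snd q) \<partial>(mu_pair ?n1 \<Otimes>\<^sub>M mu_pair ?n1))"
        by (rule bounded_Fubini(2)[OF prob_mu_pair prob_mu_pair, where c="2 * (1 / e) ^ 6"])
          (use gm1 gb in \<open>auto simp: M2_def split_beta'\<close>)
      then show ?thesis unfolding hex_defect_def M2_def by (simp add: W_def G_def right_diff_distrib)
    qed
    have hm: "(\<lambda>a. \<integral>q. ?g a q \<partial>M2) \<in> borel_measurable M1"
    proof -
      interpret m2: prob_space M2 by (rule p2)
      show ?thesis by (rule m2.borel_measurable_lebesgue_integral[OF gm])
    qed
    have "hex f \<xi> n = (\<integral>z. \<integral>x. \<integral>q. ?g (z, x) q \<partial>M2 \<partial>mu ?n3 \<partial>mu n)"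
      unfolding hex_def by (intro Bochner_Integration.integral_cong refl) (simp add: inner)
    also have "\<dots> = (\<integral>a. \<integral>q. ?g (fst a, snd a) q \<partial>M2 \<partial>(mu n \<Otimes>\<^sub>M mu ?n3))"
    proof (rule bounded_Fubini(2)[OF prob_mu prob_mu, where c="2 * (1 / e) ^ 6"])
      show "(\<lambda>(z, x). \<integral>q. ?g (z, x) q \<partial>M2) \<in> borel_measurable (mu n \<Otimes>\<^sub>M mu ?n3)"
        using hm by (simp add: M1_def split_beta')
      show "norm (\<integral>q. ?g (z, x) q \<partial>M2) \<le> 2 * (1 / e) ^ 6" if "z \<in> space (mu n)" "x \<in> space (mu ?n3)" for z x
        unfolding inner[symmetric, OF that[unfolded space_mu]] real_norm_def
        using hex_defect_bounds[of f, OF bounded_functional_measurable[OF f] that[unfolded space_mu], of \<xi>] by simp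
    qed
    also have "\<dots> = (\<integral>a. \<integral>q. ?g a q \<partial>M2 \<partial>M1)" by (simp add: M1_def)
    also have "\<dots> = (\<integral>v. ?g (fst v) (snd v) \<partial>(M1 \<Otimes>\<^sub>M M2))"
      by (rule bounded_Fubini(2)[OF p1 p2 gm, where c="2 * (1 / e) ^ 6"]) (simp add: gb del: abs_mult)
    finally show ?thesis by simp
  qed
  then show ?thesis using that[OF pr[OF p1 p2] Wm Gm] Wb Gb by blast
qed

lemma weighted_one_minus_cos_integrable:
  fixes W G :: "'x \<Rightarrow> real"
  assumes "prob_space M" and [measurable]: "W \<in> borel_measurable M" "G \<in> borel_measurable M"
    and W: "\<And>v. v \<in> space M \<Longrightarrow> 0 \<le> W v \<and> W v \<le> b"
  shows "integrable M (\<lambda>v. W v * (1 - cos (\<xi> * G v)))"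
proof -
  interpret Mx: prob_space M by fact
  show ?thesis
  proof (rule Mx.integrable_const_bound[where B="b * 2"])
    show "AE v in M. norm (W v * (1 - cos (\<xi> * G v))) \<le> b * 2"
    proof (rule AE_I2)
      fix v assume v: "v \<in> space M"
      have "\<bar>1 - cos (\<xi> * G v)\<bar> \<le> 2" using cos_ge_minus_one[of "\<xi> * G v"] cos_le_one[of "\<xi> * G v"] by linarith
      then show "norm (W v * (1 - cos (\<xi> * G v))) \<le> b * 2"
        unfolding real_norm_def abs_mult using W[OF v] by (intro mult_mono) auto
    qed
  qed measurable
qed

lemma hex_diff_le: "hex f (\<xi> - \<xi>') n \<le> 2 * hex f \<xi> n + 2 * hex f \<xi>' n"
proof -
  obtain M :: "(('a \<times> 'a) \<times> (('a \<times> 'a) \<times> ('a \<times> 'a))) measure" and W G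
    where M: "prob_space M" "W \<in> borel_measurable M" "G \<in> borel_measurable M"
      "\<And>v. v \<in> space M \<Longrightarrow> 0 \<le> W v \<and> W v \<le> (1 / e) ^ 6" "\<And>v. v \<in> space M \<Longrightarrow> \<bar>G v\<bar> \<le> 6 * R"
      "\<And>\<xi>. hex f \<xi> n = (\<integral>v. W v * (1 - cos (\<xi> * G v)) \<partial>M)"
    using hex_representation by blast
  note i = weighted_one_minus_cos_integrable[OF M(1-4)]
  have "hex f (\<xi> - \<xi>') n \<le> (\<integral>v. 2 * (W v * (1 - cos (\<xi> * G v))) + 2 * (W v * (1 - cos (\<xi>' * G v))) \<partial>M)"
    unfolding M(6)
  proof (rule integral_mono)
    show "W v * (1 - cos ((\<xi> - \<xi>') * G v)) \<le> 2 * (W v * (1 - cos (\<xi> * G v))) + 2 * (W v * (1 - cos (\<xi>' * G v)))"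
      if "v \<in> space M" for v
    proof -
      have "W v * (1 - cos (\<xi> * G v - \<xi>' * G v)) \<le> W v * (2 * (1 - cos (\<xi> * G v)) + 2 * (1 - cos (\<xi>' * G v)))"
        using M(4)[OF that] by (intro mult_left_mono one_minus_cos_diff_le) auto
      then show ?thesis by (simp add: algebra_simps)
    qed
  qed (use i in auto)
  also have "\<dots> = 2 * hex f \<xi> n + 2 * hex f \<xi>' n" using i by (simp add: M(6))
  finally show ?thesis .
qed

lemma hex_lipschitz: "\<bar>hex f \<xi> n - hex f \<xi>' n\<bar> \<le> (1 / e) ^ 6 * (6 * R) * \<bar>\<xi> - \<xi>'\<bar>"
proof -
  obtain M :: "(('a \<times> 'a) \<times> (('a \<times> 'a) \<times> ('a \<times> 'a))) measure" and W G
    where M: "prob_space M" "W \<in> borel_measurable M" "G \<in> borel_measurable M"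
      "\<And>v. v \<in> space M \<Longrightarrow> 0 \<le> W v \<and> W v \<le> (1 / e) ^ 6" "\<And>v. v \<in> space M \<Longrightarrow> \<bar>G v\<bar> \<le> 6 * R"
      "\<And>\<xi>. hex f \<xi> n = (\<integral>v. W v * (1 - cos (\<xi> * G v)) \<partial>M)"
    using hex_representation by blast
  note i = weighted_one_minus_cos_integrable[OF M(1-4)]
  interpret M: prob_space M by fact
  have "\<bar>hex f \<xi> n - hex f \<xi>' n\<bar> = norm (\<integral>v. W v * (1 - cos (\<xi> * G v)) - W v * (1 - cos (\<xi>' * G v)) \<partial>M)"
  proof -
    have "(\<integral>v. W v * (1 - cos (\<xi> * G v)) - W v * (1 - cos (\<xi>' * G v)) \<partial>M) = hex f \<xi> n - hex f \<xi>' n"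
      unfolding M(6) by (rule Bochner_Integration.integral_diff[OF i i])
    then show ?thesis by simp
  qed
  also have "\<dots> \<le> (\<integral>v. (1 / e) ^ 6 * (6 * R) * \<bar>\<xi> - \<xi>'\<bar> \<partial>M)"
  proof (rule norm_integral_le)
    show "norm (W v * (1 - cos (\<xi> * G v)) - W v * (1 - cos (\<xi>' * G v))) \<le> (1 / e) ^ 6 * (6 * R) * \<bar>\<xi> - \<xi>'\<bar>"
      if v: "v \<in> space M" for v
    proof -
      have R: "0 \<le> R" by (rule bounded_functional_nonneg[OF f])
      have "\<bar>cos (\<xi>' * G v) - cos (\<xi> * G v)\<bar> \<le> \<bar>\<xi>' * G v - \<xi> * G v\<bar>" by (rule abs_cos_diff_le)
      also have "\<dots> = \<bar>G v\<bar> * \<bar>\<xi> - \<xi>'\<bar>"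
      proof -
        have "\<xi>' * G v - \<xi> * G v = - (G v * (\<xi> - \<xi>'))" by (simp add: algebra_simps)
        then show ?thesis by (simp only: abs_minus_cancel abs_mult)
      qed
      also have "\<dots> \<le> (6 * R) * \<bar>\<xi> - \<xi>'\<bar>" using M(5)[OF v] by (intro mult_right_mono) auto
      finally have 1: "\<bar>cos (\<xi>' * G v) - cos (\<xi> * G v)\<bar> \<le> (6 * R) * \<bar>\<xi> - \<xi>'\<bar>" .
      have "W v * (1 - cos (\<xi> * G v)) - W v * (1 - cos (\<xi>' * G v)) = W v * (cos (\<xi>' * G v) - cos (\<xi> * G v))"
        by (simp add: algebra_simps)
      also have "norm \<dots> = \<bar>W v\<bar> * \<bar>cos (\<xi>' * G v) - cos (\<xi> * G v)\<bar>" by (simp add: abs_mult)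
      also have "\<dots> \<le> (1 / e) ^ 6 * ((6 * R) * \<bar>\<xi> - \<xi>'\<bar>)"
        using M(4)[OF v] 1 by (intro mult_mono) auto
      finally show ?thesis by (simp only: mult.assoc)
    qed
  qed (use i in auto)
  also have "\<dots> = (1 / e) ^ 6 * (6 * R) * \<bar>\<xi> - \<xi>'\<bar>" by (simp add: M.prob_space)
  finally show ?thesis .
qed

lemma hex_zero: "hex f 0 n = 0"
  by (simp add: hex_def hex_defect_def)

lemma hex_sum_diff_le: "hex_sum f N (\<xi> - \<xi>') \<le> 2 * hex_sum f N \<xi> + 2 * hex_sum f N \<xi>'"
  unfolding hex_sum_def sum_distrib_left sum.distrib[symmetric] by (intro sum_mono hex_diff_le)

lemma hex_sum_nonneg: "0 \<le> hex_sum f N \<xi>"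
  unfolding hex_sum_def by (intro sum_nonneg hex_bounds(1)[of f, OF bounded_functional_measurable[OF f]])

lemma hex_sum_mono: "N \<le> N' \<Longrightarrow> hex_sum f N \<xi> \<le> hex_sum f N' \<xi>"
  unfolding hex_sum_def
  by (intro sum_mono2 hex_bounds(1)[of f, OF bounded_functional_measurable[OF f]]) auto

text \<open>Continuity provides minimisers on an arc and closed sublevel sets.\<close>

lemma continuous_on_hex_sum: "continuous_on A (hex_sum f N)"
proof -
  have "continuous_on A (\<lambda>\<xi>. hex f \<xi> n)" for n
  proof (rule continuous_onI)
    fix x \<epsilon> :: real assume \<epsilon>: "0 < \<epsilon>"
    define L where "L = (1 / e) ^ 6 * (6 * R) + 1"
    have L: "0 < L" unfolding L_def using e_pos bounded_functional_nonneg[OF f] by (intro add_nonneg_pos) auto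
    show "\<exists>d>0. \<forall>x'\<in>A. dist x' x < d \<longrightarrow> dist (hex f x' n) (hex f x n) \<le> \<epsilon>"
    proof (intro exI[of _ "\<epsilon> / L"] conjI ballI impI)
      show "0 < \<epsilon> / L" using \<epsilon> L by simp
      fix x' assume d: "dist x' x < \<epsilon> / L"
      have "\<bar>hex f x' n - hex f x n\<bar> \<le> (1 / e) ^ 6 * (6 * R) * \<bar>x' - x\<bar>" by (rule hex_lipschitz)
      also have "\<dots> \<le> L * \<bar>x' - x\<bar>" unfolding L_def by (intro mult_right_mono) auto
      also have "\<dots> \<le> L * (\<epsilon> / L)" using d L by (intro mult_left_mono) (auto simp: dist_real_def)
      also have "\<dots> = \<epsilon>" using L by simp
      finally show "dist (hex f x' n) (hex f x n) \<le> \<epsilon>" by (simp add: dist_real_def)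
    qed
  qed
  then show ?thesis unfolding hex_sum_def[abs_def] by (intro continuous_on_sum) auto
qed

text \<open>Collected from \<open>variance_le_hex_sum\<close> after multiplication by d^2. The
  hexagon sum at the difference is at most twice the sum of the two others, which turns 8 into 16
  and 1/e into 2/e; and R d \<le> pi turns 2 (8 R)^2 d^2 into 128 pi^2.\<close>

definition growth_const :: real where
  "growth_const = (4 + 16 / e ^ 4) * (16 / e ^ 3) * (2 / e + 1) + 128 * pi\<^sup>2"

lemma growth_const_pos: "0 < growth_const"
  unfolding growth_const_def using e_pos by (intro add_pos_pos mult_pos_pos) auto

text \<open>\<open>variance_le_hex_sum\<close> is applied at the frequency |\<xi> - \<xi>'|, and
  \<open>hex_sum_diff_le\<close> passes from there to the two frequencies. For large variance the
  hexagon sums thus cannot both be small unless the frequencies are close.\<close>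

lemma variance_growth:
  assumes "6 * R * \<bar>\<xi> - \<xi>'\<bar> \<le> pi"
  shows "(\<xi> - \<xi>')\<^sup>2 * variance (psum f N) \<le> growth_const * (hex_sum f N \<xi> + hex_sum f N \<xi>' + 1)"
proof (cases "\<xi> = \<xi>'")
  case True
  then show ?thesis using growth_const_pos hex_sum_nonneg[of N \<xi>'] by simp
next
  case False
  have *: "d\<^sup>2 * variance (psum f N) \<le> growth_const * (hex_sum f N a + hex_sum f N b + 1)"
    if d: "d = a - b" "0 < d" "6 * R * d \<le> pi" for a b d
  proof -
    let ?S = "hex_sum f N a + hex_sum f N b"
    have S0: "0 \<le> ?S" using hex_sum_nonneg[of N a] hex_sum_nonneg[of N b] by simp
    let ?c = "(4 + 16 / e ^ 4) * (16 / e ^ 3)"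
    have c0: "0 \<le> ?c" using e_pos by simp
    have "d\<^sup>2 * variance (psum f N)
        \<le> d\<^sup>2 * (2 * ((4 + 16 / e ^ 4) * (8 / d\<^sup>2 / e ^ 3 * (hex_sum f N d / e + 1))) + 2 * (8 * R)\<^sup>2)"
      by (intro mult_left_mono variance_le_hex_sum[OF f] d) simp
    also have "\<dots> = ?c * (hex_sum f N d / e + 1) + 128 * (R * d)\<^sup>2"
    proof -
      have "d\<^sup>2 * (2 * (k * (8 / d\<^sup>2 / q * X)) + 2 * (8 * R)\<^sup>2) = k * (16 / q) * X + 128 * (R * d)\<^sup>2" for k q X
        using d by (simp add: distrib_left power_mult_distrib)
      then show ?thesis .
    qed
    also have "\<dots> \<le> ?c * ((2 * ?S) / e + 1) + 128 * pi\<^sup>2"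
    proof (intro add_mono mult_left_mono divide_right_mono)
      show "hex_sum f N d \<le> 2 * ?S" unfolding d(1) using hex_sum_diff_le[of N a b] by simp
      have "0 \<le> R * d" "R * d \<le> pi" using d bounded_functional_nonneg[OF f]
        by (auto intro: order_trans[rotated, OF d(3)] simp: mult_right_mono)
      then show "(R * d)\<^sup>2 \<le> pi\<^sup>2" by (intro power_mono)
    qed (use c0 e_pos in auto)
    also have "\<dots> \<le> (?c * (2 / e + 1) + 128 * pi\<^sup>2) * (?S + 1)"
    proof -
      have "(2 * S) / e + 1 \<le> (2 / e + 1) * (S + 1)" if "0 \<le> S" for S
      proof -
        have "(2 / e + 1) * (S + 1) = (2 * S) / e + 1 + (2 / e + S)" by (simp add: algebra_simps add_divide_distrib)
        moreover have "0 \<le> 2 / e + S" using that e_pos by simp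
        ultimately show ?thesis by linarith
      qed
      from this[OF S0] have "(2 * ?S) / e + 1 \<le> (2 / e + 1) * (?S + 1)" .
      then have "?c * ((2 * ?S) / e + 1) \<le> ?c * ((2 / e + 1) * (?S + 1))" using c0 by (rule mult_left_mono)
      moreover have "128 * pi\<^sup>2 \<le> 128 * pi\<^sup>2 * (?S + 1)" using S0 by simp
      moreover have eq: "(k * m + q) * (S + 1) = k * (m * (S + 1)) + q * (S + 1)" for k m q S :: real
        by (simp add: algebra_simps)
      ultimately show ?thesis unfolding eq by (intro add_mono)
    qed
    finally show ?thesis unfolding growth_const_def by (simp only: add.assoc mult.assoc)
  qed
  show ?thesis
  proof (cases "\<xi>' < \<xi>")
    case True then show ?thesis using *[of "\<xi> - \<xi>'" \<xi> \<xi>'] assms by simp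
  next
    case False
    with \<open>\<xi> \<noteq> \<xi>'\<close> have "0 < \<xi>' - \<xi>" by simp
    then show ?thesis using *[of "\<xi>' - \<xi>" \<xi>' \<xi>] assms by (simp add: power2_commute abs_minus_commute add_ac)
  qed
qed

end

end

subsection \<open>Fourier inversion\<close>

lemma gaussian_integral:
  fixes \<alpha> c :: real
  assumes "0 < \<alpha>"
  shows "integrable lborel (\<lambda>x. exp (- \<alpha> * (x - c)\<^sup>2))"
    and "(\<integral>x. exp (- \<alpha> * (x - c)\<^sup>2) \<partial>lborel) = sqrt (pi / \<alpha>)"
proof -
  define \<sigma> where "\<sigma> = sqrt (1 / (2 * \<alpha>))"
  have \<sigma>: "0 < \<sigma>" "\<sigma>\<^sup>2 = 1 / (2 * \<alpha>)" using assms by (auto simp: \<sigma>_def)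
  have eq: "exp (- \<alpha> * (x - c)\<^sup>2) = sqrt (pi / \<alpha>) * normal_density c \<sigma> x" for x
  proof -
    have "2 * pi * \<sigma>\<^sup>2 = pi / \<alpha>" using assms by (simp add: \<sigma>)
    moreover have "- (x - c)\<^sup>2 / (2 * \<sigma>\<^sup>2) = - \<alpha> * (x - c)\<^sup>2" using assms by (simp add: \<sigma>)
    ultimately show ?thesis using assms by (simp add: normal_density_def)
  qed
  show "integrable lborel (\<lambda>x. exp (- \<alpha> * (x - c)\<^sup>2))"
    unfolding eq using integrable_normal_density[OF \<sigma>(1)] by simp
  show "(\<integral>x. exp (- \<alpha> * (x - c)\<^sup>2) \<partial>lborel) = sqrt (pi / \<alpha>)"
    unfolding eq using integral_normal_density[OF \<sigma>(1)] by simp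
qed

lemma gaussian_fourier: "(\<integral>x. cis (- x * \<zeta>) * of_real (exp (- x\<^sup>2 / 2)) \<partial>lborel) = of_real (sqrt (2 * pi) * exp (- \<zeta>\<^sup>2 / 2))"
proof -
  have "char std_normal_distribution (- \<zeta>) = of_real (exp (- \<zeta>\<^sup>2 / 2))"
    by (simp add: char_std_normal_distribution)
  moreover have "char std_normal_distribution (- \<zeta>) = (\<integral>x. std_normal_density x *\<^sub>R iexp (- \<zeta> * x) \<partial>lborel)"
    unfolding char_def by (rule integral_density) (auto simp: normal_density_nonneg)
  moreover have "std_normal_density x *\<^sub>R iexp (- \<zeta> * x) = of_real (1 / sqrt (2 * pi)) * (cis (- x * \<zeta>) * of_real (exp (- x\<^sup>2 / 2)))" for x
    by (simp add: std_normal_density_def scaleR_conv_of_real cis_conv_exp mult_ac)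
  ultimately have "of_real (1 / sqrt (2 * pi)) * (\<integral>x. cis (- x * \<zeta>) * of_real (exp (- x\<^sup>2 / 2)) \<partial>lborel) = (of_real (exp (- \<zeta>\<^sup>2 / 2)) :: complex)"
    by simp
  then have "of_real (sqrt (2 * pi)) * (of_real (1 / sqrt (2 * pi)) * (\<integral>x. cis (- x * \<zeta>) * of_real (exp (- x\<^sup>2 / 2)) \<partial>lborel))
      = of_real (sqrt (2 * pi)) * (of_real (exp (- \<zeta>\<^sup>2 / 2)) :: complex)" by simp
  then show ?thesis by (simp flip: mult.assoc of_real_mult)
qed

text \<open>Orthogonality over a full period: the second assumption makes the antiderivative take
  equal values at the two end points.\<close>

lemma interval_integral_cis:
  fixes a b u :: real
  assumes "a \<le> b" "(b - a) * u = 2 * pi * of_int j"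
  shows "(\<integral>x. indicator {a..b} x *\<^sub>R cis (x * u) \<partial>lborel) = (if u = 0 then of_real (b - a) else 0)"
proof (cases "u = 0")
  case True
  then show ?thesis using assms(1) by (simp add: scaleR_conv_of_real)
next
  case False
  have "(\<integral>x. indicator {a..b} x *\<^sub>R cis (x * u) \<partial>lborel) = cis (b * u) / (\<i> * u) - cis (a * u) / (\<i> * u)"
  proof (rule integral_FTC_Icc[OF assms(1)])
    show "((\<lambda>x. cis (x * u) / (\<i> * u)) has_vector_derivative cis (x * u)) (at x within {a..b})" for x
      unfolding cis_conv_exp using False
      by (auto intro!: derivative_eq_intros has_vector_derivative_real_field simp: field_simps)
    show "continuous_on {a..b} (\<lambda>x. cis (x * u))" by (intro continuous_intros)
  qed
  also have "cis (b * u) = cis (a * u)"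
  proof -
    have "b * u = a * u + 2 * pi * of_int j" using assms(2) by (simp add: algebra_simps)
    then show ?thesis by (simp add: cis_mult[symmetric] cis_multiple_2pi)
  qed
  finally show ?thesis using False by simp
qed

context elliptic_process
begin

definition Phi :: "(nat \<Rightarrow> 'a \<times> 'a \<Rightarrow> real) \<Rightarrow> nat \<Rightarrow> real \<Rightarrow> complex" where
  "Phi f N \<xi> = expectation (\<lambda>w. cis (\<xi> * psum f N w))"

context
  fixes f :: "nat \<Rightarrow> 'a \<times> 'a \<Rightarrow> real" and R :: real
  assumes f: "bounded_functional f R"
begin

lemma Phi_measurable [measurable]: "Phi f N \<in> borel_measurable borel"
proof -
  note psum_measurable[OF f, measurable]
  show ?thesis unfolding Phi_def[abs_def] by measurable
qed

lemma Phi_norm_le_1: "norm (Phi f N \<xi>) \<le> 1"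
proof -
  note psum_measurable[OF f, measurable]
  have "norm (Phi f N \<xi>) \<le> expectation (\<lambda>w. 1)" unfolding Phi_def
    by (rule norm_integral_le) (auto intro!: P_integrable[where c=1])
  then show ?thesis by (simp add: prob_space)
qed

text \<open>Hexagon sums grow with N, so if the minima stayed below some M, the sublevel sets at
  height M would be nested, nonempty and compact. At a common point all partial sums are at most M,
  contradicting divergence there.\<close>

lemma hex_minimum_tends_to_infinity:
  assumes ab: "a \<le> b" and ns: "\<And>\<xi>. \<xi> \<in> {a..b} \<Longrightarrow> \<not> summable (\<lambda>n. hex f \<xi> (Suc (Suc n)))"
    and x: "\<And>N. x N \<in> {a..b}" "\<And>N \<xi>. \<xi> \<in> {a..b} \<Longrightarrow> hex_sum f N (x N) \<le> hex_sum f N \<xi>"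
  shows "filterlim (\<lambda>N. hex_sum f N (x N)) at_top sequentially"
proof (rule ccontr)
  assume "\<not> ?thesis"
  then obtain M where M: "\<not> (\<forall>\<^sub>F N in sequentially. M \<le> hex_sum f N (x N))"
    by (auto simp: filterlim_at_top)
  have le: "hex_sum f N (x N) \<le> M" for N
  proof -
    obtain N' where N': "N \<le> N'" "hex_sum f N' (x N') < M"
      using M by (auto simp: eventually_sequentially not_le)
    have "hex_sum f N (x N) \<le> hex_sum f N (x N')" by (rule x(2)[OF x(1)])
    also have "\<dots> \<le> hex_sum f N' (x N')" by (rule hex_sum_mono[OF f N'(1)])
    finally show ?thesis using N'(2) by simp
  qed
  define C where "C N = {\<xi> \<in> {a..b}. hex_sum f N \<xi> \<le> M}" for N
  have "compact (C N) \<and> C N \<noteq> {}" for N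
  proof
    have "C N = {a..b} \<inter> hex_sum f N -` {..M}" by (auto simp: C_def)
    then have "closed (C N)"
      by (simp add: continuous_closed_preimage[OF continuous_on_hex_sum[OF f]])
    moreover have "C N \<subseteq> {a..b}" by (auto simp: C_def)
    ultimately show "compact (C N)" using compact_Icc by (metis closed_subset compact_Int_closed inf.absorb_iff2)
    show "C N \<noteq> {}" using x(1) le by (auto simp: C_def)
  qed
  moreover have "C n \<subseteq> C m" if "m \<le> n" for m n
    using hex_sum_mono[OF f that] by (auto simp: C_def intro: order_trans)
  ultimately have "\<Inter> (range C) \<noteq> {}" by (intro compact_nest) auto
  then obtain \<xi> where \<xi>: "\<And>N. \<xi> \<in> C N" by auto
  have "summable (\<lambda>n. hex f \<xi> (Suc (Suc n)))"
  proof (rule summableI_nonneg_bounded[where x=M])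
    show "0 \<le> hex f \<xi> (Suc (Suc n))" for n
      by (rule hex_bounds(1)[of f, OF bounded_functional_measurable[OF f]])
    show "(\<Sum>i<n. hex f \<xi> (Suc (Suc i))) \<le> M" for n
      using \<xi>[of "n + 4"] by (simp add: C_def hex_sum_def)
  qed
  then show False using ns[of \<xi>] \<xi>[of 0] by (auto simp: C_def)
qed

text \<open>If \<open>x\<^sub>N\<close> minimises the hexagon sum on the arc, then the characteristic function at \<open>\<xi>\<close> is at most a Gaussian of
  variance of order \<open>1 / V\<^sub>N\<close> centred at \<open>x\<^sub>N\<close> times the exponential of minus the minimum, which tends to infinity.\<close>

lemma arc_integral_small:
  assumes ab: "a \<le> b" "6 * R * (b - a) \<le> pi" and ns: "\<And>\<xi>. \<xi> \<in> {a..b} \<Longrightarrow> \<not> summable (\<lambda>n. hex f \<xi> (Suc (Suc n)))"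
    and V: "filterlim (\<lambda>N. variance (psum f N)) at_top sequentially"
  shows "(\<lambda>N. sqrt (variance (psum f N)) * (\<integral>\<xi>. indicator {a..b} \<xi> * norm (Phi f N \<xi>) \<partial>lborel)) \<longlonglongrightarrow> 0"
proof -
  have "\<exists>x\<in>{a..b}. \<forall>\<xi>\<in>{a..b}. hex_sum f N x \<le> hex_sum f N \<xi>" for N
    using ab by (intro continuous_attains_inf continuous_on_hex_sum[OF f]) auto
  then obtain x where x: "\<And>N. x N \<in> {a..b}" "\<And>N \<xi>. \<xi> \<in> {a..b} \<Longrightarrow> hex_sum f N (x N) \<le> hex_sum f N \<xi>" by metis
  define m where "m N = hex_sum f N (x N)" for N
  have m: "filterlim m at_top sequentially"
    unfolding m_def[abs_def] by (rule hex_minimum_tends_to_infinity[OF ab(1) ns x])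
  define \<kappa> where "\<kappa> = e\<^sup>2 / 10"
  have \<kappa>: "0 < \<kappa>" using e_pos by (simp add: \<kappa>_def)
  define g where "g = growth_const"
  have g: "0 < g" unfolding g_def by (rule growth_const_pos[OF f])
  have point: "norm (Phi f N \<xi>) \<le> exp (\<kappa> / 4) * exp (- (\<kappa> / 2 * m N)) * exp (- (\<kappa> * variance (psum f N) / (4 * g)) * (\<xi> - x N)\<^sup>2)"
    if \<xi>: "\<xi> \<in> {a..b}" for N \<xi>
  proof -
    have "6 * R * \<bar>\<xi> - x N\<bar> \<le> 6 * R * (b - a)"
      using \<xi> x(1)[of N] bounded_functional_nonneg[OF f] by (intro mult_left_mono) auto
    then have le0: "(\<xi> - x N)\<^sup>2 * variance (psum f N) \<le> g * (hex_sum f N \<xi> + m N + 1)"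
      unfolding g_def m_def using ab(2) by (intro variance_growth[OF f]) simp
    define Q where "Q = (\<xi> - x N)\<^sup>2 * variance (psum f N) / g"
    have "Q \<le> hex_sum f N \<xi> + m N + 1"
      using g le0 by (simp add: Q_def divide_le_eq mult.commute)
    moreover have "m N \<le> hex_sum f N \<xi>" unfolding m_def by (rule x(2)[OF \<xi>])
    \<comment> \<open>Three quarters of \<open>m N \<le> hex_sum f N \<xi>\<close> plus one quarter
      of the bound on Q. The combination retains both a multiple of the minimum and a Gaussian
      exponent.\<close>
    ultimately have "m N / 2 + Q / 4 - 1 / 4 \<le> hex_sum f N \<xi>" by linarith
    then have "\<kappa> * (m N / 2 + Q / 4 - 1 / 4) \<le> \<kappa> * hex_sum f N \<xi>"
      using \<kappa> by (intro mult_left_mono) auto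
    then have le: "- (\<kappa> * hex_sum f N \<xi>) \<le> \<kappa> / 4 + (- (\<kappa> / 2 * m N)) + (- (\<kappa> * variance (psum f N) / (4 * g)) * (\<xi> - x N)\<^sup>2)"
    proof -
      have "(\<kappa> * variance (psum f N) / (4 * g)) * (\<xi> - x N)\<^sup>2 = \<kappa> * Q / 4" using g by (simp add: Q_def mult_ac)
      then show ?thesis using \<open>\<kappa> * (m N / 2 + Q / 4 - 1 / 4) \<le> \<kappa> * hex_sum f N \<xi>\<close>
        unfolding mult_minus_left by (simp add: right_diff_distrib distrib_left)
    qed
    have "norm (Phi f N \<xi>) \<le> exp (- (\<kappa> * hex_sum f N \<xi>))"
      unfolding Phi_def \<kappa>_def by (rule char_bound[OF f])
    also have "\<dots> \<le> exp (\<kappa> / 4 + (- (\<kappa> / 2 * m N)) + (- (\<kappa> * variance (psum f N) / (4 * g)) * (\<xi> - x N)\<^sup>2))"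
      using le by simp
    finally show ?thesis by (simp only: exp_add)
  qed
  have bound: "\<forall>\<^sub>F N in sequentially. norm (sqrt (variance (psum f N)) * (\<integral>\<xi>. indicator {a..b} \<xi> * norm (Phi f N \<xi>) \<partial>lborel))
      \<le> exp (\<kappa> / 4) * sqrt (4 * pi * g / \<kappa>) * exp (- (\<kappa> / 2 * m N))"
  proof -
    have "\<forall>\<^sub>F N in sequentially. 0 < variance (psum f N)" using V by (auto simp: filterlim_at_top_dense)
    then show ?thesis
    proof eventually_elim
      case (elim N)
      define v where "v = variance (psum f N)"
      have v: "0 < v" using elim by (simp add: v_def)
      define \<alpha> where "\<alpha> = \<kappa> * v / (4 * g)"
      have \<alpha>: "0 < \<alpha>" using \<kappa> v g by (simp add: \<alpha>_def)
      let ?c = "exp (\<kappa> / 4) * exp (- (\<kappa> / 2 * m N))"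
      have "(\<integral>\<xi>. indicator {a..b} \<xi> * norm (Phi f N \<xi>) \<partial>lborel) \<le> (\<integral>\<xi>. ?c * exp (- \<alpha> * (\<xi> - x N)\<^sup>2) \<partial>lborel)"
      proof (rule integral_mono)
        show "integrable lborel (\<lambda>\<xi>. indicator {a..b} \<xi> * norm (Phi f N \<xi>))"
        proof (rule Bochner_Integration.integrable_bound)
          show "integrable lborel (\<lambda>\<xi>. indicator {a..b} \<xi> * (1::real))"
            by (auto intro!: integrable_real_indicator simp: emeasure_lborel_Icc_eq)
          show "AE \<xi> in lborel. norm (indicator {a..b} \<xi> * norm (Phi f N \<xi>)) \<le> norm (indicator {a..b} \<xi> * (1::real))"
            using Phi_norm_le_1 by (intro AE_I2) (auto simp: indicator_def)
        qed measurable
        show "integrable lborel (\<lambda>\<xi>. ?c * exp (- \<alpha> * (\<xi> - x N)\<^sup>2))"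
          by (rule integrable_mult_right[OF gaussian_integral(1)[OF \<alpha>]])
        show "indicator {a..b} \<xi> * norm (Phi f N \<xi>) \<le> ?c * exp (- \<alpha> * (\<xi> - x N)\<^sup>2)" for \<xi>
          using point[of \<xi> N] by (cases "\<xi> \<in> {a..b}") (auto simp: \<alpha>_def v_def)
      qed
      also have "\<dots> = ?c * sqrt (pi / \<alpha>)"
        by (simp only: integral_mult_right_zero gaussian_integral(2)[OF \<alpha>])
      finally have "sqrt v * (\<integral>\<xi>. indicator {a..b} \<xi> * norm (Phi f N \<xi>) \<partial>lborel) \<le> sqrt v * (?c * sqrt (pi / \<alpha>))"
        using v by (intro mult_left_mono) auto
      \<comment> \<open>The mass of the Gaussian is of order 1 / sqrt v and cancels the factor in
        front.\<close>
      also have "sqrt v * (?c * sqrt (pi / \<alpha>)) = ?c * sqrt (v * (pi / \<alpha>))" by (simp only: real_sqrt_mult mult_ac)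
      also have "v * (pi / \<alpha>) = 4 * pi * g / \<kappa>" using v \<kappa> g by (simp add: \<alpha>_def)
      finally show ?case using v unfolding v_def[symmetric]
        by (subst real_norm_def, subst abs_of_nonneg) (auto intro!: mult_nonneg_nonneg Bochner_Integration.integral_nonneg simp: mult_ac)
    qed
  qed
  have "((\<lambda>y. exp (\<kappa> / 4) * sqrt (4 * pi * g / \<kappa>) * exp (- (\<kappa> / 2 * y))) \<longlongrightarrow> exp (\<kappa> / 4) * sqrt (4 * pi * g / \<kappa>) * 0) at_top"
    using \<kappa> by (intro tendsto_mult tendsto_const) real_asymp
  from filterlim_compose[OF this m] have "(\<lambda>N. exp (\<kappa> / 4) * sqrt (4 * pi * g / \<kappa>) * exp (- (\<kappa> / 2 * m N))) \<longlonglongrightarrow> 0" by simp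
  from Lim_null_comparison[OF bound this] show ?thesis .
qed

lemma indicator_Phi_integrable: "integrable lborel (\<lambda>\<xi>. indicator {a..b::real} \<xi> * norm (Phi f N \<xi>))"
proof (rule Bochner_Integration.integrable_bound)
  show "integrable lborel (\<lambda>\<xi>. indicator {a..b} \<xi> * (1::real))"
    by (auto intro!: integrable_real_indicator simp: emeasure_lborel_Icc_eq)
  show "AE \<xi> in lborel. norm (indicator {a..b} \<xi> * norm (Phi f N \<xi>)) \<le> norm (indicator {a..b} \<xi> * (1::real))"
    using Phi_norm_le_1 by (intro AE_I2) (auto simp: indicator_def)
qed measurable

text \<open>\<open>variance_growth\<close> requires short arcs, so the arc is cut into at most k
  pieces of length at most \<delta>, each with its own minimiser.\<close>

lemma long_arc_integral_small:
  assumes \<delta>: "0 < \<delta>" "6 * R * \<delta> \<le> pi"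
    and V: "filterlim (\<lambda>N. variance (psum f N)) at_top sequentially"
  shows "a \<le> b \<Longrightarrow> b - a \<le> real k * \<delta> \<Longrightarrow> (\<And>\<xi>. \<xi> \<in> {a..b} \<Longrightarrow> \<not> summable (\<lambda>n. hex f \<xi> (Suc (Suc n)))) \<Longrightarrow>
    (\<lambda>N. sqrt (variance (psum f N)) * (\<integral>\<xi>. indicator {a..b} \<xi> * norm (Phi f N \<xi>) \<partial>lborel)) \<longlonglongrightarrow> 0"
proof (induction k arbitrary: a)
  case 0
  have R: "0 \<le> R" by (rule bounded_functional_nonneg[OF f])
  from 0 show ?case by (intro arc_integral_small V) auto
next
  case (Suc k)
  have R: "0 \<le> R" by (rule bounded_functional_nonneg[OF f])
  define c where "c = min b (a + \<delta>)"
  have c: "a \<le> c" "c \<le> b" "c - a \<le> \<delta>" "b - c \<le> real k * \<delta>"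
    using Suc.prems(1,2) \<delta> by (auto simp: c_def min_def algebra_simps)
  have "6 * R * (c - a) \<le> 6 * R * \<delta>" using c R by (intro mult_left_mono) auto
  then have s1: "(\<lambda>N. sqrt (variance (psum f N)) * (\<integral>\<xi>. indicator {a..c} \<xi> * norm (Phi f N \<xi>) \<partial>lborel)) \<longlonglongrightarrow> 0"
    using c \<delta> Suc.prems(3) by (intro arc_integral_small V) auto
  have s2: "(\<lambda>N. sqrt (variance (psum f N)) * (\<integral>\<xi>. indicator {c..b} \<xi> * norm (Phi f N \<xi>) \<partial>lborel)) \<longlonglongrightarrow> 0"
    using c Suc.prems(3) by (intro Suc.IH) auto
  have s3: "(\<lambda>N. sqrt (variance (psum f N)) * (\<integral>\<xi>. indicator {a..c} \<xi> * norm (Phi f N \<xi>) \<partial>lborel)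
      + sqrt (variance (psum f N)) * (\<integral>\<xi>. indicator {c..b} \<xi> * norm (Phi f N \<xi>) \<partial>lborel)) \<longlonglongrightarrow> 0"
    using tendsto_add[OF s1 s2] by simp
  show ?case
  proof (rule Lim_null_comparison[OF always_eventually s3], rule allI)
    fix N
    have "(\<integral>\<xi>. indicator {a..b} \<xi> * norm (Phi f N \<xi>) \<partial>lborel)
        \<le> (\<integral>\<xi>. indicator {a..c} \<xi> * norm (Phi f N \<xi>) + indicator {c..b} \<xi> * norm (Phi f N \<xi>) \<partial>lborel)"
    proof (rule integral_mono)
      show "indicator {a..b} \<xi> * norm (Phi f N \<xi>) \<le> indicator {a..c} \<xi> * norm (Phi f N \<xi>) + indicator {c..b} \<xi> * norm (Phi f N \<xi>)" for \<xi>
        by (auto simp: indicator_def)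
    qed (auto intro!: indicator_Phi_integrable Bochner_Integration.integrable_add)
    also have "\<dots> = (\<integral>\<xi>. indicator {a..c} \<xi> * norm (Phi f N \<xi>) \<partial>lborel) + (\<integral>\<xi>. indicator {c..b} \<xi> * norm (Phi f N \<xi>) \<partial>lborel)"
      by (rule Bochner_Integration.integral_add) (rule indicator_Phi_integrable)+
    finally have le: "(\<integral>\<xi>. indicator {a..b} \<xi> * norm (Phi f N \<xi>) \<partial>lborel) \<le> \<dots>" .
    have v: "0 \<le> variance (psum f N)" by simp
    have i0: "0 \<le> (\<integral>\<xi>. indicator {a..b} \<xi> * norm (Phi f N \<xi>) \<partial>lborel)"
      by (intro Bochner_Integration.integral_nonneg) auto
    have "norm (sqrt (variance (psum f N)) * (\<integral>\<xi>. indicator {a..b} \<xi> * norm (Phi f N \<xi>) \<partial>lborel))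
        = sqrt (variance (psum f N)) * (\<integral>\<xi>. indicator {a..b} \<xi> * norm (Phi f N \<xi>) \<partial>lborel)"
      using v i0 by (simp only: real_norm_def abs_mult abs_of_nonneg real_sqrt_ge_zero)
    also have "\<dots> \<le> sqrt (variance (psum f N)) * ((\<integral>\<xi>. indicator {a..c} \<xi> * norm (Phi f N \<xi>) \<partial>lborel) + (\<integral>\<xi>. indicator {c..b} \<xi> * norm (Phi f N \<xi>) \<partial>lborel))"
      using le v by (intro mult_left_mono) auto
    finally show "norm (sqrt (variance (psum f N)) * (\<integral>\<xi>. indicator {a..b} \<xi> * norm (Phi f N \<xi>) \<partial>lborel))
       \<le> sqrt (variance (psum f N)) * (\<integral>\<xi>. indicator {a..c} \<xi> * norm (Phi f N \<xi>) \<partial>lborel)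
      + sqrt (variance (psum f N)) * (\<integral>\<xi>. indicator {c..b} \<xi> * norm (Phi f N \<xi>) \<partial>lborel)"
      by (simp only: distrib_left)
  qed
qed

text \<open>After the substitution s = \<sigma> \<xi> the integrand converges pointwise by
  \<open>clt\<close>. A Gaussian dominates it: \<open>variance_growth\<close> with \<xi>' = 0, where
  the hexagon sum vanishes, bounds the hexagon sum below by s^2 / g - 1.\<close>

lemma central_arc_limit:
  assumes \<delta>: "0 < \<delta>" "6 * R * \<delta> \<le> pi"
    and V: "filterlim (\<lambda>N. variance (psum f N)) at_top sequentially"
    and z: "(\<lambda>N. (z N - expectation (psum f N)) / sqrt (variance (psum f N))) \<longlonglongrightarrow> \<zeta>"
  shows "(\<lambda>N. of_real (sqrt (variance (psum f N))) * (\<integral>\<xi>. indicator {-\<delta>..\<delta>} \<xi> *\<^sub>R (cis (- (\<xi> * z N)) * Phi f N \<xi>) \<partial>lborel))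
    \<longlonglongrightarrow> of_real (sqrt (2 * pi) * exp (- \<zeta>\<^sup>2 / 2))"
proof -
  define \<sigma> where "\<sigma> N = sqrt (variance (psum f N))" for N
  define \<kappa> where "\<kappa> = e\<^sup>2 / 10"
  have \<kappa>: "0 < \<kappa>" using e_pos by (simp add: \<kappa>_def)
  define g where "g = growth_const"
  have g: "0 < g" unfolding g_def by (rule growth_const_pos[OF f])
  have \<sigma>lim: "filterlim \<sigma> at_top sequentially"
    unfolding \<sigma>_def[abs_def] by (rule filterlim_compose[OF sqrt_at_top V])
  define S where "S N s = indicator {-\<delta>..\<delta>} (s / \<sigma> N) *\<^sub>R (cis (- (s / \<sigma> N * z N)) * Phi f N (s / \<sigma> N))" for N s
  have "\<forall>\<^sub>F N in sequentially. 0 < \<sigma> N" using \<sigma>lim by (auto simp: filterlim_at_top_dense)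
  then obtain N0 where N0: "\<And>N. N0 \<le> N \<Longrightarrow> 0 < \<sigma> N" by (auto simp: eventually_sequentially)
  have Sm [measurable]: "S N \<in> borel_measurable borel" for N unfolding S_def[abs_def] by measurable
  have point: "norm (S N s) \<le> exp \<kappa> * exp (- (\<kappa> / g) * (s - 0)\<^sup>2)" if N: "N0 \<le> N" for N s
  proof (cases "s / \<sigma> N \<in> {-\<delta>..\<delta>}")
    case True
    let ?x = "s / \<sigma> N"
    have "6 * R * \<bar>?x - 0\<bar> \<le> 6 * R * \<delta>"
      using True bounded_functional_nonneg[OF f] by (intro mult_left_mono) auto
    then have "(?x - 0)\<^sup>2 * variance (psum f N) \<le> g * (hex_sum f N ?x + hex_sum f N 0 + 1)"
      unfolding g_def using \<delta>(2) by (intro variance_growth[OF f]) simp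
    moreover have "hex_sum f N 0 = 0" by (simp add: hex_sum_def hex_zero[OF f])
    moreover have "(?x - 0)\<^sup>2 * variance (psum f N) = s\<^sup>2"
    proof -
      have "variance (psum f N) = (\<sigma> N)\<^sup>2" by (simp add: \<sigma>_def)
      then show ?thesis using N0[OF N] by (simp add: power_divide)
    qed
    ultimately have "s\<^sup>2 \<le> g * (hex_sum f N ?x + 1)" by simp
    then have "s\<^sup>2 / g \<le> hex_sum f N ?x + 1" using g by (simp add: divide_le_eq mult.commute)
    then have "\<kappa> * (s\<^sup>2 / g) \<le> \<kappa> * (hex_sum f N ?x + 1)" using \<kappa> by (intro mult_left_mono) auto
    then have le: "- (\<kappa> * hex_sum f N ?x) \<le> \<kappa> + (- (\<kappa> / g) * (s - 0)\<^sup>2)" by (simp add: algebra_simps)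
    have "norm (S N s) = norm (Phi f N ?x)" using True by (simp add: S_def norm_mult)
    also have "\<dots> \<le> exp (- (\<kappa> * hex_sum f N ?x))" unfolding Phi_def \<kappa>_def by (rule char_bound[OF f])
    also have "\<dots> \<le> exp (\<kappa> + (- (\<kappa> / g) * (s - 0)\<^sup>2))" using le by simp
    finally show ?thesis by (simp only: exp_add)
  next
    case False
    then show ?thesis by (simp add: S_def)
  qed
  have lim: "(\<lambda>N. S N s) \<longlonglongrightarrow> cis (- s * \<zeta>) * of_real (exp (- s\<^sup>2 / 2))" for s
  proof -
    have "(\<lambda>N. s / \<sigma> N) \<longlonglongrightarrow> 0" by (rule tendsto_divide_0[OF tendsto_const filterlim_at_top_imp_at_infinity[OF \<sigma>lim]])
    then have "\<forall>\<^sub>F N in sequentially. \<bar>s / \<sigma> N\<bar> < \<delta>"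
      using \<delta>(1) by (auto simp: tendsto_iff dist_real_def)
    then have ev: "\<forall>\<^sub>F N in sequentially. S N s = cis (- (s * ((z N - expectation (psum f N)) / \<sigma> N)))
        * expectation (\<lambda>w. cis (s / sqrt (variance (psum f N)) * (psum f N w - expectation (psum f N))))"
    proof eventually_elim
      case (elim N)
      have "Phi f N (s / \<sigma> N) = cis (s / \<sigma> N * expectation (psum f N)) * expectation (\<lambda>w. cis (s / \<sigma> N * (psum f N w - expectation (psum f N))))"
        unfolding Phi_def by (simp add: cis_mult right_diff_distrib flip: integral_mult_right_zero)
      then have "S N s = (cis (- (s / \<sigma> N * z N)) * cis (s / \<sigma> N * expectation (psum f N)))
          * expectation (\<lambda>w. cis (s / \<sigma> N * (psum f N w - expectation (psum f N))))"
      proof -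
        have "s / \<sigma> N \<in> {-\<delta>..\<delta>}" using elim unfolding abs_less_iff by auto
        then show ?thesis using \<open>Phi f N (s / \<sigma> N) = _\<close> by (simp add: S_def mult.assoc)
      qed
      also have "cis (- (s / \<sigma> N * z N)) * cis (s / \<sigma> N * expectation (psum f N)) = cis (- (s * ((z N - expectation (psum f N)) / \<sigma> N)))"
        by (simp add: cis_mult diff_divide_distrib algebra_simps)
      finally show ?case by (simp add: \<sigma>_def)
    qed
    have "(\<lambda>N. cis (- (s * ((z N - expectation (psum f N)) / \<sigma> N)))) \<longlonglongrightarrow> cis (- (s * \<zeta>))"
      using z unfolding \<sigma>_def by (intro tendsto_intros)
    from tendsto_mult[OF this clt[OF f V, of s]] show ?thesis
      by (subst tendsto_cong[OF ev]) simp
  qed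
  \<comment> \<open>Dominated convergence needs the bound at every index; the shift discards those
    at which \<sigma> may vanish.\<close>
  have "(\<lambda>N. \<integral>s. S (N + N0) s \<partial>lborel) \<longlonglongrightarrow> (\<integral>s. cis (- s * \<zeta>) * of_real (exp (- s\<^sup>2 / 2)) \<partial>lborel)"
  proof (rule integral_dominated_convergence)
    show "integrable lborel (\<lambda>s. exp \<kappa> * exp (- (\<kappa> / g) * (s - 0)\<^sup>2))"
      using \<kappa> g by (intro integrable_mult_right gaussian_integral(1)) auto
    show "AE s in lborel. (\<lambda>N. S (N + N0) s) \<longlonglongrightarrow> cis (- s * \<zeta>) * of_real (exp (- s\<^sup>2 / 2))"
      using lim by (intro AE_I2 LIMSEQ_ignore_initial_segment) auto
    show "AE s in lborel. norm (S (N + N0) s) \<le> exp \<kappa> * exp (- (\<kappa> / g) * (s - 0)\<^sup>2)" for N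
      using point[of "N + N0"] by (intro AE_I2) auto
  qed measurable
  then have L: "(\<lambda>N. \<integral>s. S N s \<partial>lborel) \<longlonglongrightarrow> of_real (sqrt (2 * pi) * exp (- \<zeta>\<^sup>2 / 2))"
    unfolding gaussian_fourier by (rule LIMSEQ_offset)
  have "\<forall>\<^sub>F N in sequentially. (\<integral>s. S N s \<partial>lborel) = of_real (\<sigma> N) * (\<integral>\<xi>. indicator {-\<delta>..\<delta>} \<xi> *\<^sub>R (cis (- (\<xi> * z N)) * Phi f N \<xi>) \<partial>lborel)"
    using eventually_ge_at_top[of N0]
  proof eventually_elim
    case (elim N)
    have \<sigma>: "0 < \<sigma> N" by (rule N0[OF elim])
    have "(\<integral>\<xi>. indicator {-\<delta>..\<delta>} \<xi> *\<^sub>R (cis (- (\<xi> * z N)) * Phi f N \<xi>) \<partial>lborel)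
        = \<bar>1 / \<sigma> N\<bar> *\<^sub>R (\<integral>s. indicator {-\<delta>..\<delta>} (0 + 1 / \<sigma> N * s) *\<^sub>R (cis (- ((0 + 1 / \<sigma> N * s) * z N)) * Phi f N (0 + 1 / \<sigma> N * s)) \<partial>lborel)"
      by (rule lborel_integral_real_affine) (use \<sigma> in simp)
    also have "\<dots> = of_real (1 / \<sigma> N) * (\<integral>s. S N s \<partial>lborel)"
      using \<sigma> by (simp add: S_def scaleR_conv_of_real)
    finally show ?case using \<sigma> by simp
  qed
  from tendsto_cong[THEN iffD1, OF this L] show ?thesis by (simp add: \<sigma>_def)
qed

text \<open>On lattice values the integral over a full period is 2 pi / t or 0 according to whether
  the sum equals z. Only the length of [a, b] is prescribed, which permits a period starting at
  -\<delta>.\<close>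

lemma inversion:
  assumes t: "0 < t" and ab: "b - a = 2 * pi / t"
    and lat: "AE w in P. \<exists>j::int. psum f N w - z = t * of_int j"
  shows "of_real (2 * pi / t * prob {w \<in> space P. psum f N w = z})
    = (\<integral>\<xi>. indicator {a..b} \<xi> *\<^sub>R (cis (- (\<xi> * z)) * Phi f N \<xi>) \<partial>lborel)"
proof -
  note psum_measurable[OF f, measurable]
  interpret pair_sigma_finite P lborel by unfold_locales
  have ab': "a \<le> b" using ab t by (smt (verit) divide_pos_pos pi_gt_zero)
  have mg: "(\<lambda>(w, \<xi>). indicator {a..b} \<xi> *\<^sub>R cis (\<xi> * (psum f N w - z))) \<in> borel_measurable (P \<Otimes>\<^sub>M lborel)"
    by measurable
  have int: "integrable (P \<Otimes>\<^sub>M lborel) (\<lambda>(w, \<xi>). indicator {a..b} \<xi> *\<^sub>R cis (\<xi> * (psum f N w - z)))"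
  proof (rule integrableI_bounded_set[where A="space P \<times> {a..b}" and B=1])
    show "emeasure (P \<Otimes>\<^sub>M lborel) (space P \<times> {a..b}) < \<infinity>"
      using ab' by (subst lborel.emeasure_pair_measure_Times) (auto simp: emeasure_space_1)
  qed (use mg in \<open>auto simp: space_pair_measure indicator_def split: if_splits\<close>)
  have "(\<integral>\<xi>. indicator {a..b} \<xi> *\<^sub>R (cis (- (\<xi> * z)) * Phi f N \<xi>) \<partial>lborel)
      = (\<integral>\<xi>. \<integral>w. indicator {a..b} \<xi> *\<^sub>R cis (\<xi> * (psum f N w - z)) \<partial>P \<partial>lborel)"
  proof (rule Bochner_Integration.integral_cong[OF refl])
    fix \<xi>
    have "cis (- (\<xi> * z)) * Phi f N \<xi> = expectation (\<lambda>w. cis (\<xi> * (psum f N w - z)))"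
      unfolding Phi_def integral_mult_right_zero[symmetric] by (simp add: cis_mult right_diff_distrib)
    then show "indicator {a..b} \<xi> *\<^sub>R (cis (- (\<xi> * z)) * Phi f N \<xi>) = (\<integral>w. indicator {a..b} \<xi> *\<^sub>R cis (\<xi> * (psum f N w - z)) \<partial>P)"
      by simp
  qed
  also have "\<dots> = (\<integral>w. \<integral>\<xi>. indicator {a..b} \<xi> *\<^sub>R cis (\<xi> * (psum f N w - z)) \<partial>lborel \<partial>P)"
    by (rule Fubini_integral[OF int])
  also have "\<dots> = (\<integral>w. of_real (2 * pi / t) * of_real (indicator {w \<in> space P. psum f N w = z} w) \<partial>P)"
  proof (rule integral_cong_AE)
    show "AE w in P. (\<integral>\<xi>. indicator {a..b} \<xi> *\<^sub>R cis (\<xi> * (psum f N w - z)) \<partial>lborel)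
        = of_real (2 * pi / t) * of_real (indicator {w \<in> space P. psum f N w = z} w)"
      using lat AE_space
    proof eventually_elim
      case (elim w)
      then obtain j :: int where j: "psum f N w - z = t * of_int j" by blast
      have "(b - a) * (psum f N w - z) = 2 * pi * of_int j" using t by (simp add: ab j)
      from interval_integral_cis[OF ab' this] show ?case using elim(2) by (simp add: ab indicator_def)
    qed
    show "(\<lambda>w. \<integral>\<xi>. indicator {a..b} \<xi> *\<^sub>R cis (\<xi> * (psum f N w - z)) \<partial>lborel) \<in> borel_measurable P"
      by (rule lborel.borel_measurable_lebesgue_integral[OF mg])
  qed measurable
  also have "\<dots> = of_real (2 * pi / t) * of_real (prob {w \<in> space P. psum f N w = z})"
    by (simp del: of_real_divide)
  finally show ?thesis by simp
qed

end

context
  fixes f :: "nat \<Rightarrow> 'a \<times> 'a \<Rightarrow> real" and R :: real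
  assumes f: "bounded_functional f R"
begin
lemmas [measurable] = Phi_measurable[OF f]
lemma local_limit:
  assumes t: "0 < t"
    and ns: "\<And>\<xi>. 0 < \<xi> \<Longrightarrow> \<xi> < 2 * pi / t \<Longrightarrow> \<not> summable (\<lambda>n. hex f \<xi> (Suc (Suc n)))"
    and V: "filterlim (\<lambda>N. variance (psum f N)) at_top sequentially"
    and z: "(\<lambda>N. (z N - expectation (psum f N)) / sqrt (variance (psum f N))) \<longlonglongrightarrow> \<zeta>"
    and lat: "\<forall>\<^sub>F N in sequentially. AE w in P. \<exists>j::int. psum f N w - z N = t * of_int j"
  shows "(\<lambda>N. sqrt (variance (psum f N)) * prob {w \<in> space P. psum f N w = z N})
    \<longlonglongrightarrow> t * exp (- \<zeta>\<^sup>2 / 2) / sqrt (2 * pi)"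
proof -
  have R: "0 \<le> R" by (rule bounded_functional_nonneg[OF f])
  \<comment> \<open>The 1 in the first denominator covers R = 0; the second bound separates the
    central arc from its translate by 2 pi / t.\<close>
  define \<delta> where "\<delta> = min (pi / (6 * R + 1)) (pi / (2 * t))"
  have "0 < pi / (6 * R + 1)" "0 < pi / (2 * t)" "pi / (2 * t) < pi / t" using R t by (auto simp: field_simps)
  then have \<delta>: "0 < \<delta>" "\<delta> < pi / t" by (auto simp: \<delta>_def min_less_iff_disj)
  have \<delta>R: "6 * R * \<delta> \<le> pi"
  proof -
    have "6 * R * \<delta> \<le> (6 * R + 1) * (pi / (6 * R + 1))"
      using R by (intro mult_mono) (use \<delta> in \<open>auto simp: \<delta>_def\<close>)
    also have "\<dots> = pi" using R by simp
    finally show ?thesis .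
  qed
  \<comment> \<open>The remaining arc from \<delta> to c lies strictly inside (0, 2 pi / t), where
    hexagon sums diverge.\<close>
  define c where "c = 2 * pi / t - \<delta>"
  have c: "\<delta> \<le> c" "c < 2 * pi / t" using \<delta> by (auto simp: c_def)
  obtain k :: nat where k: "(c - \<delta>) / \<delta> \<le> real k" using real_arch_simple by blast
  define \<sigma> where "\<sigma> N = sqrt (variance (psum f N))" for N
  have \<sigma>0: "0 \<le> \<sigma> N" for N by (simp add: \<sigma>_def)
  have arc: "(\<lambda>N. \<sigma> N * (\<integral>\<xi>. indicator {\<delta>..c} \<xi> * norm (Phi f N \<xi>) \<partial>lborel)) \<longlonglongrightarrow> 0"
    unfolding \<sigma>_def
  proof (rule long_arc_integral_small[OF f \<delta>(1) \<delta>R V c(1)])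
    show "c - \<delta> \<le> real k * \<delta>" using k \<delta> by (simp add: divide_le_eq)
    show "\<not> summable (\<lambda>n. hex f \<xi> (Suc (Suc n)))" if "\<xi> \<in> {\<delta>..c}" for \<xi>
      using that \<delta> c by (intro ns) auto
  qed
  let ?I = "\<lambda>N a b. \<integral>\<xi>. indicator {a..b} \<xi> *\<^sub>R (cis (- (\<xi> * z N)) * Phi f N \<xi>) \<partial>lborel"
  have Ii: "integrable lborel (\<lambda>\<xi>. indicator {a..b} \<xi> *\<^sub>R (cis (- (\<xi> * z N)) * Phi f N \<xi>))" for N a b
    by (rule Bochner_Integration.integrable_bound[OF indicator_Phi_integrable[OF f, of a b N]])
      (measurable, auto simp: norm_mult intro!: AE_I2)
  have central: "(\<lambda>N. of_real (\<sigma> N) * ?I N (-\<delta>) \<delta>) \<longlonglongrightarrow> of_real (sqrt (2 * pi) * exp (- \<zeta>\<^sup>2 / 2))"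
    unfolding \<sigma>_def by (rule central_arc_limit[OF f \<delta>(1) \<delta>R V z])
  have "(\<lambda>N. of_real (\<sigma> N) * ?I N (-\<delta>) c - of_real (\<sigma> N) * ?I N (-\<delta>) \<delta>) \<longlonglongrightarrow> 0"
  proof (rule Lim_null_comparison[OF always_eventually arc], rule allI)
    fix N
    have "norm (?I N (-\<delta>) c - ?I N (-\<delta>) \<delta>)
        = norm (\<integral>\<xi>. indicator {-\<delta>..c} \<xi> *\<^sub>R (cis (- (\<xi> * z N)) * Phi f N \<xi>)
            - indicator {-\<delta>..\<delta>} \<xi> *\<^sub>R (cis (- (\<xi> * z N)) * Phi f N \<xi>) \<partial>lborel)"
      unfolding Bochner_Integration.integral_diff[OF Ii Ii] ..
    also have "\<dots> \<le> (\<integral>\<xi>. indicator {\<delta>..c} \<xi> * norm (Phi f N \<xi>) \<partial>lborel)"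
    proof (rule norm_integral_le[OF Bochner_Integration.integrable_diff[OF Ii Ii] indicator_Phi_integrable[OF f]])
      show "norm (indicator {-\<delta>..c} \<xi> *\<^sub>R (cis (- (\<xi> * z N)) * Phi f N \<xi>)
            - indicator {-\<delta>..\<delta>} \<xi> *\<^sub>R (cis (- (\<xi> * z N)) * Phi f N \<xi>))
          \<le> indicator {\<delta>..c} \<xi> * norm (Phi f N \<xi>)" for \<xi>
        using c by (auto simp: indicator_def norm_mult)
    qed
    finally have "\<sigma> N * norm (?I N (-\<delta>) c - ?I N (-\<delta>) \<delta>)
        \<le> \<sigma> N * (\<integral>\<xi>. indicator {\<delta>..c} \<xi> * norm (Phi f N \<xi>) \<partial>lborel)"
      using \<sigma>0 by (intro mult_left_mono) auto
    moreover have "norm (of_real (\<sigma> N) * ?I N (-\<delta>) c - of_real (\<sigma> N) * ?I N (-\<delta>) \<delta>)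
        = \<sigma> N * norm (?I N (-\<delta>) c - ?I N (-\<delta>) \<delta>)"
      unfolding right_diff_distrib[symmetric] norm_mult using \<sigma>0 by simp
    ultimately show "norm (of_real (\<sigma> N) * ?I N (-\<delta>) c - of_real (\<sigma> N) * ?I N (-\<delta>) \<delta>)
        \<le> \<sigma> N * (\<integral>\<xi>. indicator {\<delta>..c} \<xi> * norm (Phi f N \<xi>) \<partial>lborel)" by simp
  qed
  from tendsto_add[OF this central]
  have full: "(\<lambda>N. of_real (\<sigma> N) * ?I N (-\<delta>) c) \<longlonglongrightarrow> of_real (sqrt (2 * pi) * exp (- \<zeta>\<^sup>2 / 2))" by simp
  have "\<forall>\<^sub>F N in sequentially. of_real (\<sigma> N) * ?I N (-\<delta>) c
      = complex_of_real (\<sigma> N * (2 * pi / t * prob {w \<in> space P. psum f N w = z N}))"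
    using lat
  proof eventually_elim
    case (elim N)
    have "c - (-\<delta>) = 2 * pi / t" by (simp add: c_def)
    from inversion[OF f t this elim] show ?case by (simp only: of_real_mult)
  qed
  from tendsto_cong[THEN iffD1, OF this full]
  have "(\<lambda>N. \<sigma> N * (2 * pi / t * prob {w \<in> space P. psum f N w = z N})) \<longlonglongrightarrow> sqrt (2 * pi) * exp (- \<zeta>\<^sup>2 / 2)"
    by (simp only: tendsto_of_real_iff)
  from tendsto_mult[OF tendsto_const[of "t / (2 * pi)"] this]
  have "(\<lambda>N. t / (2 * pi) * (\<sigma> N * (2 * pi / t * prob {w \<in> space P. psum f N w = z N})))
      \<longlonglongrightarrow> t / (2 * pi) * (sqrt (2 * pi) * exp (- \<zeta>\<^sup>2 / 2))" .
  moreover have "t / (2 * pi) * (\<sigma> N * (2 * pi / t * prob {w \<in> space P. psum f N w = z N}))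
      = \<sigma> N * prob {w \<in> space P. psum f N w = z N}" for N
    using t by simp
  moreover have "t / (2 * pi) * (sqrt (2 * pi) * exp (- \<zeta>\<^sup>2 / 2)) = t * exp (- \<zeta>\<^sup>2 / 2) / sqrt (2 * pi)"
  proof -
    have "sqrt (2 * pi) / (2 * pi) = 1 / sqrt (2 * pi)"
      using real_sqrt_mult_self[of "2 * pi"] by (simp add: field_simps)
    then have "t * exp (- \<zeta>\<^sup>2 / 2) * (sqrt (2 * pi) / (2 * pi)) = t * exp (- \<zeta>\<^sup>2 / 2) * (1 / sqrt (2 * pi))" by simp
    then show ?thesis by (simp add: mult_ac)
  qed
  ultimately show ?thesis unfolding \<sigma>_def by simp
qed

text \<open>Variances need not increase with N, but they do up to a factor 2 and a constant. The
  conditional mean of the centred sum up to M, given level N, is the centred sum up to N plus a term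
  Z bounded by \<open>cum_expectation_osc\<close>, and conditioning does not increase second
  moments. One large variance therefore forces all later ones to be large.\<close>

lemma variance_tendsto_infinity_or_bounded:
  "filterlim (\<lambda>N. variance (psum f N)) at_top sequentially \<or> (\<exists>C. \<forall>N. variance (psum f N) \<le> C)"
proof (rule disjCI)
  assume nb: "\<not> (\<exists>C. \<forall>N. variance (psum f N) \<le> C)"
  have R: "0 \<le> R" by (rule bounded_functional_nonneg[OF f])
  have mono: "variance (psum f N) \<le> 2 * variance (psum f M) + 2 * (8 * R / e)\<^sup>2" if "N \<le> M" for N M
  proof -
    define k where "k = M - N"
    have M: "M = N + k" using that by (simp add: k_def)
    define c where "c = expectation (\<lambda>w. cum f k N (X N w))"
    define Z where "Z w = cum f k N (X N w) - c" for w
    note [measurable] = measurable_cum[OF f] psum_measurable[OF f] bounded_functional_measurable[OF f]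
    have PF [measurable]: "psum f N \<in> borel_measurable (F N)" by (rule psum_measurable_F[OF f])
    define Y where "Y w = psum f N w - expectation (psum f N) + Z w" for w
    define U where "U w = psum f M w - expectation (psum f M)" for w
    have YF [measurable]: "Y \<in> borel_measurable (F N)" unfolding Y_def[abs_def] Z_def[abs_def] by measurable
    have YP [measurable]: "Y \<in> borel_measurable P" by (rule measurable_F[OF YF])
    have Zb: "\<bar>Z w\<bar> \<le> 4 * R / e" if "w \<in> space P" for w
      unfolding Z_def c_def by (rule cum_expectation_osc[OF f]) (use that in auto)
    define b where "b = real N * R + \<bar>expectation (psum f N)\<bar> + 4 * R / e"
    have Yb: "\<bar>Y w\<bar> \<le> b" if "w \<in> space P" for w
      unfolding Y_def b_def using psum_bound[OF f that, of N] Zb[OF that] by linarith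
    have Ub: "\<bar>U w\<bar> \<le> real M * R + \<bar>expectation (psum f M)\<bar>" if "w \<in> space P" for w
      unfolding U_def using psum_bound[OF f that, of M] by linarith
    have UP [measurable]: "U \<in> borel_measurable P" unfolding U_def[abs_def] by measurable
    have b0: "0 \<le> b" unfolding b_def using R e_pos by simp
    have sq: "integrable P (\<lambda>w. (g w)\<^sup>2)" if "g \<in> borel_measurable P" "\<And>w. w \<in> space P \<Longrightarrow> \<bar>g w\<bar> \<le> d" for g :: "'w \<Rightarrow> real" and d
    proof (rule P_integrable[where c="d\<^sup>2"])
      show "(\<lambda>w. (g w)\<^sup>2) \<in> borel_measurable P" using that(1) by measurable
      show "norm ((g w)\<^sup>2) \<le> d\<^sup>2" if "w \<in> space P" for w
        unfolding real_norm_def abs_power2 by (rule square_le_of_abs_le) (rule \<open>\<And>w. w \<in> space P \<Longrightarrow> \<bar>g w\<bar> \<le> d\<close>[OF that])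
    qed
    define T where "T w = (\<Sum>m=N..<N + k. f m (X m w, X (Suc m) w))" for w
    have split: "psum f M w = psum f N w + T w" for w
      unfolding psum_def T_def M by (simp add: sum.atLeastLessThan_concat[symmetric, of 0 N "N + k", unfolded atLeast0LessThan])
    have Tb: "\<bar>T w\<bar> \<le> real M * R + real N * R" if "w \<in> space P" for w
      using psum_bound[OF f that, of M] psum_bound[OF f that, of N] split[of w] by linarith
    have TP [measurable]: "T \<in> borel_measurable P" unfolding T_def[abs_def] by measurable
    have Ti: "integrable P T" by (rule P_integrable[OF TP, where c="real M * R + real N * R"]) (use Tb in auto)
    have ET: "expectation T = c"
      using cum_expectation[OF f, of "\<lambda>_. 1" N 1 k] by (simp add: T_def[abs_def] c_def)
    have EM: "expectation (psum f M) = expectation (psum f N) + c"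
    proof -
      have "expectation (psum f M) = expectation (\<lambda>w. psum f N w + T w)"
        by (rule Bochner_Integration.integral_cong[OF refl]) (rule split)
      then show ?thesis using Bochner_Integration.integral_add[OF psum_integrable[OF f] Ti, of N] ET by simp
    qed
    \<comment> \<open>\<open>Y\<close> is the orthogonal projection of \<open>U\<close> onto
      functions of the past at level N, expressed through \<open>cum_expectation\<close>.\<close>
    have YU: "expectation (\<lambda>w. Y w * U w) = expectation (\<lambda>w. (Y w)\<^sup>2)"
    proof -
      have i1: "integrable P (\<lambda>w. Y w * T w)"
      proof (rule P_integrable[where c="b * (real M * R + real N * R)"])
        show "norm (Y w * T w) \<le> b * (real M * R + real N * R)" if "w \<in> space P" for w
          unfolding real_norm_def abs_mult using Yb[OF that] Tb[OF that] b0 by (intro mult_mono) auto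
      qed measurable
      have i2: "integrable P (\<lambda>w. Y w * cum f k N (X N w))"
      proof (rule P_integrable[where c="b * (real k * R)"])
        show "norm (Y w * cum f k N (X N w)) \<le> b * (real k * R)" if "w \<in> space P" for w
          unfolding real_norm_def abs_mult using Yb[OF that] cum_bound[OF f, of "X N w" N k] that b0 by (intro mult_mono) auto
      qed measurable
      have i3: "integrable P (\<lambda>w. Y w * (psum f N w - expectation (psum f N) - c))"
      proof (rule P_integrable[where c="b * (real N * R + \<bar>expectation (psum f N)\<bar> + \<bar>c\<bar>)"])
        show "norm (Y w * (psum f N w - expectation (psum f N) - c)) \<le> b * (real N * R + \<bar>expectation (psum f N)\<bar> + \<bar>c\<bar>)"
          if "w \<in> space P" for w
        proof -
          have "\<bar>psum f N w - expectation (psum f N) - c\<bar> \<le> real N * R + \<bar>expectation (psum f N)\<bar> + \<bar>c\<bar>"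
            using psum_bound[OF f that, of N] by linarith
          then show ?thesis unfolding real_norm_def abs_mult using Yb[OF that] b0 by (intro mult_mono) auto
        qed
      qed measurable
      have "expectation (\<lambda>w. Y w * U w) = expectation (\<lambda>w. Y w * T w + Y w * (psum f N w - expectation (psum f N) - c))"
        by (simp add: U_def split EM algebra_simps)
      also have "\<dots> = expectation (\<lambda>w. Y w * cum f k N (X N w)) + expectation (\<lambda>w. Y w * (psum f N w - expectation (psum f N) - c))"
        unfolding Bochner_Integration.integral_add[OF i1 i3]
        using cum_expectation[OF f YF Yb, of k] by (simp add: T_def)
      also have "\<dots> = expectation (\<lambda>w. Y w * cum f k N (X N w) + Y w * (psum f N w - expectation (psum f N) - c))"
        by (rule Bochner_Integration.integral_add[OF i2 i3, symmetric])
      also have "\<dots> = expectation (\<lambda>w. (Y w)\<^sup>2)"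
      proof (rule Bochner_Integration.integral_cong[OF refl])
        fix w
        have "Y w = cum f k N (X N w) + (psum f N w - expectation (psum f N) - c)" by (simp add: Y_def Z_def)
        then show "Y w * cum f k N (X N w) + Y w * (psum f N w - expectation (psum f N) - c) = (Y w)\<^sup>2"
          by (simp only: power2_eq_square distrib_left)
      qed
      finally show ?thesis .
    qed
    have "expectation (\<lambda>w. (Y w)\<^sup>2) \<le> expectation (\<lambda>w. (U w)\<^sup>2)"
    proof -
      have iUY: "integrable P (\<lambda>w. Y w * U w)"
      proof (rule P_integrable[where c="b * (real M * R + \<bar>expectation (psum f M)\<bar>)"])
        show "norm (Y w * U w) \<le> b * (real M * R + \<bar>expectation (psum f M)\<bar>)" if "w \<in> space P" for w
          unfolding real_norm_def abs_mult using Yb[OF that] Ub[OF that] b0 by (intro mult_mono) auto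
      qed measurable
      have "0 \<le> expectation (\<lambda>w. (U w - Y w)\<^sup>2)" by simp
      also have "(\<lambda>w. (U w - Y w)\<^sup>2) = (\<lambda>w. (U w)\<^sup>2 - 2 * (Y w * U w) + (Y w)\<^sup>2)"
        by (simp add: fun_eq_iff power2_eq_square algebra_simps)
      also have "expectation (\<lambda>w. (U w)\<^sup>2 - 2 * (Y w * U w) + (Y w)\<^sup>2)
          = expectation (\<lambda>w. (U w)\<^sup>2) - 2 * expectation (\<lambda>w. Y w * U w) + expectation (\<lambda>w. (Y w)\<^sup>2)"
        using sq[OF UP Ub] sq[OF YP Yb] iUY by simp
      finally show ?thesis using YU by simp
    qed
    moreover have "variance (psum f N) \<le> expectation (\<lambda>w. 2 * (Y w)\<^sup>2 + 2 * (4 * R / e)\<^sup>2)"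
    proof (rule integral_mono)
      show "integrable P (\<lambda>w. (psum f N w - expectation (psum f N))\<^sup>2)"
        proof (rule sq)
        show "(\<lambda>w. psum f N w - expectation (psum f N)) \<in> borel_measurable P" by measurable
        show "\<bar>psum f N w - expectation (psum f N)\<bar> \<le> real N * R + \<bar>expectation (psum f N)\<bar>" if "w \<in> space P" for w
          using psum_bound[OF f that, of N] by linarith
      qed
      show "integrable P (\<lambda>w. 2 * (Y w)\<^sup>2 + 2 * (4 * R / e)\<^sup>2)" using sq[OF YP Yb] by simp
      show "(psum f N w - expectation (psum f N))\<^sup>2 \<le> 2 * (Y w)\<^sup>2 + 2 * (4 * R / e)\<^sup>2" if "w \<in> space P" for w
      proof -
        have "(psum f N w - expectation (psum f N))\<^sup>2 = (Y w + (- Z w))\<^sup>2" by (simp add: Y_def)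
        also have "\<dots> \<le> 2 * (Y w)\<^sup>2 + 2 * (- Z w)\<^sup>2" by (rule square_sum_le)
        also have "(- Z w)\<^sup>2 \<le> (4 * R / e)\<^sup>2" by (rule square_le_of_abs_le) (use Zb[OF that] in simp)
        finally show ?thesis by simp
      qed
    qed
    moreover have "expectation (\<lambda>w. 2 * (Y w)\<^sup>2 + 2 * (4 * R / e)\<^sup>2) = 2 * expectation (\<lambda>w. (Y w)\<^sup>2) + 2 * (4 * R / e)\<^sup>2"
      using sq[OF YP Yb] by (simp add: prob_space)
    moreover have "(4 * R / e)\<^sup>2 \<le> (8 * R / e)\<^sup>2"
      using R e_pos by (intro power_mono divide_right_mono) auto
    ultimately show ?thesis unfolding U_def by linarith
  qed
  show "filterlim (\<lambda>N. variance (psum f N)) at_top sequentially"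
    unfolding filterlim_at_top
  proof
    fix C :: real
    obtain N where N: "2 * C + 2 * (8 * R / e)\<^sup>2 < variance (psum f N)" using nb not_le by metis
    have "C \<le> variance (psum f M)" if "N \<le> M" for M using mono[OF that] N by linarith
    then show "\<forall>\<^sub>F M in sequentially. C \<le> variance (psum f M)" by (auto simp: eventually_sequentially)
  qed
qed

end

end

subsection \<open>Markov chains and algebraic ranges\<close>

lemma space_borel_metric [simp]: "space (borel_metric m) = mspace m"
  by (simp add: borel_metric_def space_measure_of_conv)

context markov_chain
begin

lemma past_algebra_subalgebra: "subalgebra P (past_algebra P S X n)"
proof -
  have "(\<lambda>w. \<lambda>i\<in>{1..n}. X i w) \<in> P \<rightarrow>\<^sub>M (\<Pi>\<^sub>M i\<in>{1..n}. borel_metric (S i))"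
    by (intro measurable_restrict measurable_state) auto
  then show ?thesis by (simp add: past_algebra_def subalgebra_def measurable_iff_sets)
qed

lemma measurable_past_algebra:
  assumes i: "i \<in> {1..n}"
  shows "X i \<in> past_algebra P S X n \<rightarrow>\<^sub>M borel_metric (S i)"
proof -
  have "(\<lambda>w. \<lambda>i\<in>{1..n}. X i w) \<in> past_algebra P S X n \<rightarrow>\<^sub>M (\<Pi>\<^sub>M i\<in>{1..n}. borel_metric (S i))"
    unfolding past_algebra_def
    by (rule measurable_vimage_algebra1)
      (auto simp: space_PiM measurable_space[OF measurable_state, simplified])
  from measurable_compose[OF this measurable_component_singleton[OF i]] show ?thesis using i by simp
qed

lemma past_algebra_mono:
  assumes "n \<le> m"
  shows "subalgebra (past_algebra P S X m) (past_algebra P S X n)"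
proof -
  have "(\<lambda>w. \<lambda>i\<in>{1..n}. X i w) \<in> past_algebra P S X m \<rightarrow>\<^sub>M (\<Pi>\<^sub>M i\<in>{1..n}. borel_metric (S i))"
    using assms by (intro measurable_restrict measurable_past_algebra) auto
  moreover have "space (past_algebra P S X m) = space P" by (simp add: past_algebra_def)
  ultimately show ?thesis
    unfolding past_algebra_def[of P S X n] by (simp add: subalgebra_def measurable_iff_sets)
qed

text \<open>Integrating the almost sure identity for conditional probabilities over a past event A
  gives the form of the Markov property on which \<open>elliptic_process\<close> is based.\<close>

lemma emeasure_past_inter:
  assumes n: "1 \<le> n" and A: "A \<in> sets (past_algebra P S X n)"
    and E: "E \<in> sets (borel_metric (S (Suc n)))"
  shows "emeasure P (A \<inter> X (Suc n) -` E) = (\<integral>\<^sup>+w\<in>A. emeasure (K n (X n w)) E \<partial>P)"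
proof -
  interpret past: finite_measure_subalgebra P "past_algebra P S X n"
    by unfold_locales (rule past_algebra_subalgebra)
  note [measurable] = measurable_state[OF n] E transition_kernel[OF n, THEN measurable_prob_algebraD]
  have [measurable]: "X (Suc n) \<in> P \<rightarrow>\<^sub>M borel_metric (S (Suc n))" by (rule measurable_state) simp
  have AP [measurable]: "A \<in> sets P" using A past_algebra_subalgebra[of n] by (auto simp: subalgebra_def)
  have K1: "prob_space (K n (X n w))" if "w \<in> space P" for w
    using measurable_space[OF transition_kernel[OF n] measurable_space[OF measurable_state[OF n] that]]
    by (simp add: space_prob_algebra)
  have m1: "measure (K n (X n w)) E \<le> 1" if "w \<in> space P" for w
    using prob_space.prob_le_1[OF K1[OF that]] .
  have Km [measurable]: "(\<lambda>w. measure (K n (X n w)) E) \<in> borel_measurable P" by measurable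
  have "A \<inter> X (Suc n) -` E = A \<inter> (X (Suc n) -` E \<inter> space P)" using sets.sets_into_space[OF AP] by auto
  then have ev [measurable]: "A \<inter> X (Suc n) -` E \<in> sets P" by simp
  have "measure P (A \<inter> X (Suc n) -` E) = (\<integral>w. indicator (A \<inter> X (Suc n) -` E) w \<partial>P)"
    using sets.sets_into_space[OF ev] by (simp add: Int_absorb2)
  also have "\<dots> = (\<integral>w\<in>A. indicator E (X (Suc n) w) \<partial>P)"
    unfolding set_lebesgue_integral_def
    by (rule Bochner_Integration.integral_cong) (auto simp: indicator_def)
  also have "\<dots> = (\<integral>w\<in>A. real_cond_exp P (past_algebra P S X n) (\<lambda>w. indicator E (X (Suc n) w)) w \<partial>P)"
    by (rule past.real_cond_exp_intA[OF _ A])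
      (rule integrable_const_bound[where B=1]; auto simp: indicator_def)
  also have "\<dots> = (\<integral>w\<in>A. measure (K n (X n w)) E \<partial>P)"
    unfolding set_lebesgue_integral_def
    by (rule integral_cong_AE) (use markov_property[OF n E] in auto)
  also have "ennreal \<dots> = (\<integral>\<^sup>+w. ennreal (indicator A w *\<^sub>R measure (K n (X n w)) E) \<partial>P)"
    unfolding set_lebesgue_integral_def
  proof (rule nn_integral_eq_integral[symmetric])
    show "integrable P (\<lambda>w. indicator A w *\<^sub>R measure (K n (X n w)) E)"
      by (rule integrable_const_bound[where B=1]) (use m1 in \<open>auto simp: indicator_def\<close>)
  qed simp
  also have "\<dots> = (\<integral>\<^sup>+w\<in>A. emeasure (K n (X n w)) E \<partial>P)"
  proof (rule nn_integral_cong)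
    fix w assume "w \<in> space P"
    then interpret kx: prob_space "K n (X n w)" by (rule K1)
    show "ennreal (indicator A w *\<^sub>R measure (K n (X n w)) E) = emeasure (K n (X n w)) E * indicator A w"
      by (auto simp: indicator_def kx.emeasure_eq_measure)
  qed
  finally show ?thesis by (simp add: emeasure_eq_measure)
qed

text \<open>The process indexed from \<open>0\<close>; the density is truncated so that its bounds hold off the state spaces too.\<close>

lemma elliptic_process:
  assumes "uniformly_elliptic S K"
  obtains \<mu> p \<epsilon> where "elliptic_process P (\<lambda>n. borel_metric (S (Suc n))) (\<lambda>n. past_algebra P S X (Suc n))
    (\<lambda>n. X (Suc n)) (\<lambda>n. K (Suc n)) \<mu> p \<epsilon>"
proof -
  obtain \<epsilon> :: real and \<mu> :: "nat \<Rightarrow> 'a measure" and p :: "nat \<Rightarrow> 'a \<times> 'a \<Rightarrow> real"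
    where \<epsilon>: "0 < \<epsilon>" "\<epsilon> < 1"
      and \<mu>: "\<forall>n\<ge>1. prob_space (\<mu> n) \<and> sets (\<mu> n) = sets (borel_metric (S n))"
      and pm: "\<forall>n\<ge>1. p n \<in> borel_measurable (borel_metric (S n) \<Otimes>\<^sub>M borel_metric (S (Suc n)))"
      and Kp: "\<forall>n\<ge>1. \<forall>x\<in>mspace (S n). K n x = density (\<mu> (Suc n)) (\<lambda>y. ennreal (p n (x, y)))"
      and pb: "\<forall>n\<ge>1. \<forall>x\<in>mspace (S n). \<forall>y\<in>mspace (S (Suc n)). 0 \<le> p n (x, y) \<and> p n (x, y) \<le> 1 / \<epsilon>"
      and p2: "\<forall>n\<ge>1. \<forall>x\<in>mspace (S n). \<forall>z\<in>mspace (S (Suc (Suc n))).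
         (\<integral>y. p n (x, y) * p (Suc n) (y, z) \<partial>\<mu> (Suc n)) > \<epsilon>"
    using assms unfolding uniformly_elliptic_def by (elim exE conjE) (rule that; assumption)
  have mu: "prob_space (\<mu> (Suc n))" "sets (\<mu> (Suc n)) = sets (borel_metric (S (Suc n)))" for n
    using \<mu> by auto
  define q where "q n xy = max 0 (min (1 / \<epsilon>) (p (Suc n) xy))" for n xy
  have qp: "q n (x, y) = p (Suc n) (x, y)" if "x \<in> mspace (S (Suc n))" "y \<in> mspace (S (Suc (Suc n)))" for n x y
    using pb[rule_format, of "Suc n" x y] that by (simp add: q_def)
  have sp: "space (\<mu> (Suc n)) = mspace (S (Suc n))" for n
    using sets_eq_imp_space_eq[OF mu(2)[of n]] by simp
  have qm: "q n \<in> borel_measurable (borel_metric (S (Suc n)) \<Otimes>\<^sub>M borel_metric (S (Suc (Suc n))))" for n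
    unfolding q_def[abs_def] using pm[rule_format, of "Suc n"] by simp
  have "elliptic_process P (\<lambda>n. borel_metric (S (Suc n))) (\<lambda>n. past_algebra P S X (Suc n))
    (\<lambda>n. X (Suc n)) (\<lambda>n. K (Suc n)) (\<lambda>n. \<mu> (Suc n)) q \<epsilon>"
  proof (intro elliptic_process.intro elliptic_process_axioms.intro prob_space_axioms)
    show "subalgebra P (past_algebra P S X (Suc n))" for n by (rule past_algebra_subalgebra)
    show "subalgebra (past_algebra P S X (Suc (Suc n))) (past_algebra P S X (Suc n))" for n
      by (rule past_algebra_mono) simp
    show "X (Suc i) \<in> past_algebra P S X (Suc n) \<rightarrow>\<^sub>M borel_metric (S (Suc i))" if "i \<le> n" for i n
      using that by (intro measurable_past_algebra) auto
    show "K (Suc n) \<in> borel_metric (S (Suc n)) \<rightarrow>\<^sub>M prob_algebra (borel_metric (S (Suc (Suc n))))" for n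
      by (rule transition_kernel) simp
    show "emeasure P (A \<inter> X (Suc (Suc n)) -` C) = (\<integral>\<^sup>+w\<in>A. emeasure (K (Suc n) (X (Suc n) w)) C \<partial>P)"
      if "A \<in> sets (past_algebra P S X (Suc n))" "C \<in> sets (borel_metric (S (Suc (Suc n))))" for A C n
      by (rule emeasure_past_inter[OF _ that]) simp
    show "prob_space (\<mu> (Suc n))" "sets (\<mu> (Suc n)) = sets (borel_metric (S (Suc n)))" for n
      by (rule mu)+
    show "K (Suc n) x = density (\<mu> (Suc (Suc n))) (\<lambda>y. ennreal (q n (x, y)))"
      if "x \<in> space (borel_metric (S (Suc n)))" for n x
    proof -
      have x: "x \<in> mspace (S (Suc n))" using that by simp
      have meas: "(\<lambda>y. h (x, y)) \<in> borel_measurable (\<mu> (Suc (Suc n)))"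
        if "h \<in> borel_measurable (borel_metric (S (Suc n)) \<Otimes>\<^sub>M borel_metric (S (Suc (Suc n))))"
        for h :: "'a \<times> 'a \<Rightarrow> real"
        using measurable_compose[OF measurable_Pair1'[of x "borel_metric (S (Suc n))" "borel_metric (S (Suc (Suc n)))"] that] x
        by (simp add: measurable_cong_sets[OF mu(2) refl])
      have "density (\<mu> (Suc (Suc n))) (\<lambda>y. ennreal (p (Suc n) (x, y))) = density (\<mu> (Suc (Suc n))) (\<lambda>y. ennreal (q n (x, y)))"
      proof (rule density_cong)
        show "AE y in \<mu> (Suc (Suc n)). ennreal (p (Suc n) (x, y)) = ennreal (q n (x, y))"
          by (rule AE_I2) (use x in \<open>simp add: sp qp\<close>)
        show "(\<lambda>y. ennreal (p (Suc n) (x, y))) \<in> borel_measurable (\<mu> (Suc (Suc n)))"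
          using meas[OF pm[rule_format, of "Suc n"]] by simp
        show "(\<lambda>y. ennreal (q n (x, y))) \<in> borel_measurable (\<mu> (Suc (Suc n)))"
          using meas[OF qm[of n]] by simp
      qed
      then show ?thesis using Kp[rule_format, of "Suc n" x] x by simp
    qed
    show "\<epsilon> < (\<integral>y. q n (x, y) * q (Suc n) (y, z) \<partial>\<mu> (Suc (Suc n)))"
      if "x \<in> space (borel_metric (S (Suc n)))" "z \<in> space (borel_metric (S (Suc (Suc (Suc n)))))" for n x z
    proof -
      have "(\<integral>y. q n (x, y) * q (Suc n) (y, z) \<partial>\<mu> (Suc (Suc n)))
          = (\<integral>y. p (Suc n) (x, y) * p (Suc (Suc n)) (y, z) \<partial>\<mu> (Suc (Suc n)))"
        by (rule Bochner_Integration.integral_cong[OF refl]) (use that in \<open>simp add: sp qp\<close>)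
      then show ?thesis using p2[rule_format, of "Suc n" x z] that by simp
    qed
  qed (use \<epsilon> qm in \<open>auto simp: q_def\<close>)
  then show ?thesis by (rule that)
qed

end

lemma real_add_subgroup_iff:
  "subgroup G real_add_group \<longleftrightarrow> 0 \<in> G \<and> (\<forall>x\<in>G. \<forall>y\<in>G. x + y \<in> G) \<and> (\<forall>x\<in>G. - x \<in> G)"
proof -
  have "m_inv real_add_group x = - x" for x
    unfolding m_inv_def by (rule the_equality) (auto simp: real_add_group_def)
  then show ?thesis by (auto simp: subgroup_def real_add_group_def)
qed

lemma lattice_coset_iff: "x \<in> lattice_coset a t \<longleftrightarrow> (\<exists>j::int. x = a + t * of_int j)"
  by (auto simp: lattice_coset_def)

lemma closed_lattice_coset: "closed (lattice_coset a t)"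
proof -
  have "lattice_coset a t = (+) a ` ((\<lambda>x. t *\<^sub>R x) ` \<int>)"
    by (auto simp: lattice_coset_def Ints_def image_image)
  then show ?thesis by (simp only: closed_translation closed_scaling closed_Ints)
qed

lemma subgroup_lattice_coset: "subgroup (lattice_coset 0 t) real_add_group"
  unfolding real_add_subgroup_iff
proof (intro conjI ballI)
  show "0 \<in> lattice_coset 0 t" unfolding lattice_coset_iff by (rule exI[of _ 0]) simp
  fix x assume "x \<in> lattice_coset 0 t"
  then obtain i :: int where x: "x = 0 + t * of_int i" unfolding lattice_coset_iff by blast
  show "- x \<in> lattice_coset 0 t" unfolding lattice_coset_iff x by (rule exI[of _ "- i"]) simp
  fix y assume "y \<in> lattice_coset 0 t"
  then obtain j :: int where y: "y = 0 + t * of_int j" unfolding lattice_coset_iff by blast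
  show "x + y \<in> lattice_coset 0 t" unfolding lattice_coset_iff x y
    by (rule exI[of _ "i + j"]) (simp add: distrib_left)
qed

lemma algebraic_range_subset:
  assumes "closed G" "subgroup G real_add_group"
    and "\<And>n. 1 \<le> n \<Longrightarrow> measure P {w \<in> space P. f n (X n w, X (Suc n) w) - c n \<in> G} = 1"
  shows "algebraic_range P X f \<subseteq> G"
  unfolding algebraic_range_def using assms by (intro Inter_lower CollectI conjI exI[of _ c]) auto

context prob_space
begin

text \<open>Any point of the support of \<open>Y\<close> serves as the shift, simultaneously for all closed subgroups.\<close>

lemma exists_common_shift:
  fixes Y :: "'a \<Rightarrow> real"
  obtains c where "AE w in M. \<forall>G a. closed G \<and> subgroup G real_add_group \<and> (AE w in M. Y w - a \<in> G) \<longrightarrow> Y w - c \<in> G"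
proof -
  obtain U :: "real set set" where U: "countable U" "topological_basis U" using ex_countable_basis by blast
  \<comment> \<open>The complement of the support of Y, a null event because the basis is
    countable.\<close>
  define N where "N = \<Union>{u \<in> U. AE w in M. Y w \<notin> u}"
  have N: "AE w in M. Y w \<notin> N"
  proof -
    have cU: "countable {u \<in> U. AE w in M. Y w \<notin> u}" by (rule countable_subset[OF _ U(1)]) auto
    have "AE w in M. \<forall>u\<in>{u \<in> U. AE w in M. Y w \<notin> u}. Y w \<notin> u"
      unfolding AE_ball_countable[OF cU] by simp
    then show ?thesis by eventually_elim (auto simp: N_def)
  qed
  then obtain w0 where w0: "Y w0 \<notin> N" using eventually_happens'[OF ae_filter_bot] by blast
  have *: "v - a \<in> G" if "v \<notin> N" "closed G" "AE w in M. Y w - a \<in> G" for v a G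
  proof (rule ccontr)
    assume "v - a \<notin> G"
    have "open ((\<lambda>y. y - a) -` (- G))"
      using that(2) by (intro open_vimage continuous_intros) auto
    then obtain u where u: "u \<in> U" "v \<in> u" "u \<subseteq> (\<lambda>y. y - a) -` (- G)"
      using topological_basisE[OF U(2), of "(\<lambda>y. y - a) -` (- G)" v] \<open>v - a \<notin> G\<close> by auto
    have "AE w in M. Y w \<notin> u" using that(3) by eventually_elim (use u in auto)
    then have "v \<in> N" using u by (auto simp: N_def)
    with that(1) show False by simp
  qed
  have "AE w in M. \<forall>G a. closed G \<and> subgroup G real_add_group \<and> (AE w in M. Y w - a \<in> G) \<longrightarrow> Y w - Y w0 \<in> G"
    using N
  proof eventually_elim
    case (elim w)
    show ?case
    proof (intro allI impI)
      fix G a assume G: "closed G \<and> subgroup G real_add_group \<and> (AE w in M. Y w - a \<in> G)"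
      \<comment> \<open>The shift a, which varies with G, cancels in the difference of two points of
        the support.\<close>
      have "(Y w - a) + - (Y w0 - a) \<in> G"
        using *[OF elim, of G a] *[OF w0, of G a] G unfolding real_add_subgroup_iff by blast
      then show "Y w - Y w0 \<in> G" by simp
    qed
  qed
  then show ?thesis by (rule that)
qed

lemma AE_of_measure_1: "measure M {w \<in> space M. Q w} = 1 \<Longrightarrow> AE w in M. Q w"
proof -
  assume 1: "measure M {w \<in> space M. Q w} = 1"
  then have "{w \<in> space M. Q w} \<in> sets M"
    by (metis measure_notin_sets zero_neq_one)
  from prob_eq_1[OF this] 1 show ?thesis by auto
qed

text \<open>In the definition of the algebraic range the shifts may depend on the group, and there
  may be uncountably many groups. The shift of \<open>exists_common_shift\<close> serves all of them
  outside one null set, so the intersection itself carries the shifted values.\<close>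

lemma exists_shifts_into_algebraic_range:
  obtains c where "\<And>n. 1 \<le> n \<Longrightarrow> AE w in M. f n (X n w, X (Suc n) w) - c n \<in> algebraic_range M X f"
proof -
  have ex: "\<exists>c. AE w in M. f n (X n w, X (Suc n) w) - c \<in> algebraic_range M X f" if n: "1 \<le> n" for n
  proof -
    obtain c where c: "AE w in M. \<forall>G a. closed G \<and> subgroup G real_add_group
        \<and> (AE w in M. f n (X n w, X (Suc n) w) - a \<in> G) \<longrightarrow> f n (X n w, X (Suc n) w) - c \<in> G"
      by (rule exists_common_shift)
    have "AE w in M. f n (X n w, X (Suc n) w) - c \<in> algebraic_range M X f"
      using c
    proof eventually_elim
      case (elim w)
      show ?case unfolding algebraic_range_def
      proof (rule InterI)
        fix G assume "G \<in> {G. closed G \<and> subgroup G real_add_group \<and>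
          (\<exists>c :: nat \<Rightarrow> real. \<forall>n\<ge>1. measure M {w \<in> space M. f n (X n w, X (Suc n) w) - c n \<in> G} = 1)}"
        then obtain a :: "nat \<Rightarrow> real" where "closed G" "subgroup G real_add_group"
          "measure M {w \<in> space M. f n (X n w, X (Suc n) w) - a n \<in> G} = 1" using n by auto
        then show "f n (X n w, X (Suc n) w) - c \<in> G"
          by (intro elim[rule_format, of G "a n"] conjI AE_of_measure_1)
      qed
    qed
    then show ?thesis ..
  qed
  have "AE w in M. f n (X n w, X (Suc n) w)
      - (SOME c. AE w in M. f n (X n w, X (Suc n) w) - c \<in> algebraic_range M X f) \<in> algebraic_range M X f"
    if "1 \<le> n" for n
    by (rule someI_ex[OF ex[OF that]])
  then show ?thesis by (rule that)
qed

text \<open>Chebyshev's inequality around the means of Y. The detour through Y allows sums of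
  everywhere bounded functionals to stand in for partial sums with which they agree almost
  surely.\<close>

lemma center_tight_of_bounded_variance:
  assumes Y: "\<And>N. Y N \<in> borel_measurable M" "\<And>N. integrable M (\<lambda>w. (Y N w)\<^sup>2)"
    and C: "\<And>N. variance (Y N) \<le> C" and eq: "\<And>N. AE w in M. partial_sum X h N w = Y N w"
  shows "center_tight M X h"
  unfolding center_tight_def
proof (intro exI[of _ "\<lambda>N. expectation (Y N)"] allI impI)
  fix \<epsilon> :: real assume \<epsilon>: "0 < \<epsilon>"
  have C0: "0 \<le> C" using C[of 0] by (rule order_trans[rotated]) simp
  \<comment> \<open>Any L with C / L^2 < \<epsilon> would do; here L \<ge> 1 gives L \<le> L^2, so
    that C < L \<epsilon> suffices.\<close>
  define L where "L = C / \<epsilon> + 1"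
  have L: "1 \<le> L" using C0 \<epsilon> by (simp add: L_def)
  have "C < L * \<epsilon>" using \<epsilon> by (simp add: L_def field_simps)
  also have "L * \<epsilon> \<le> L\<^sup>2 * \<epsilon>"
    using \<epsilon> L self_le_power[of L 2] by (intro mult_right_mono) auto
  finally have CL: "C / L\<^sup>2 < \<epsilon>" using L by (simp add: pos_divide_less_eq mult.commute)
  show "\<exists>L. \<forall>N\<ge>1. measure M {w \<in> space M. L < \<bar>partial_sum X h N w - expectation (Y N)\<bar>} < \<epsilon>"
  proof (intro exI[of _ L] allI impI)
    fix N
    note [measurable] = Y(1)
    have "measure M {w \<in> space M. L < \<bar>partial_sum X h N w - expectation (Y N)\<bar>}
        \<le> measure M {w \<in> space M. L \<le> \<bar>Y N w - expectation (Y N)\<bar>}"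
    proof (rule finite_measure_mono_AE)
      show "AE w in M. w \<in> {w \<in> space M. L < \<bar>partial_sum X h N w - expectation (Y N)\<bar>}
          \<longrightarrow> w \<in> {w \<in> space M. L \<le> \<bar>Y N w - expectation (Y N)\<bar>}"
        using eq[of N] by eventually_elim auto
    qed measurable
    also have "\<dots> \<le> variance (Y N) / L\<^sup>2"
      by (rule Chebyshev_inequality) (use Y L in auto)
    also have "\<dots> \<le> C / L\<^sup>2" using C by (intro divide_right_mono) auto
    finally show "measure M {w \<in> space M. L < \<bar>partial_sum X h N w - expectation (Y N)\<bar>} < \<epsilon>"
      using CL by simp
  qed
qed

end

lemma (in prob_space) variance_cong_AE:
  fixes Y Z :: "'a \<Rightarrow> real"
  assumes "Y \<in> borel_measurable M" "Z \<in> borel_measurable M" "AE w in M. Y w = Z w"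
  shows "expectation Y = expectation Z" "variance Y = variance Z"
proof -
  show E: "expectation Y = expectation Z" using assms by (rule integral_cong_AE)
  show "variance Y = variance Z" unfolding E
    by (rule integral_cong_AE) (use assms in \<open>auto elim: eventually_mono\<close>)
qed

context elliptic_process
begin

lemma psum_square_integrable:
  assumes r: "bounded_functional r R"
  shows "integrable P (\<lambda>w. (psum r N w)\<^sup>2)"
proof (rule P_integrable[where c="(real N * R)\<^sup>2"])
  show "(\<lambda>w. (psum r N w)\<^sup>2) \<in> borel_measurable P" using psum_measurable[OF r] by measurable
  show "norm ((psum r N w)\<^sup>2) \<le> (real N * R)\<^sup>2" if "w \<in> space P" for w
    unfolding real_norm_def abs_power2 by (rule square_le_of_abs_le) (rule psum_bound[OF r that])
qed

end

theorem theorem4p2: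
  fixes P :: "'w measure"
    and S :: "nat \<Rightarrow> 'a metric"
    and X :: "nat \<Rightarrow> 'w \<Rightarrow> 'a"
    and K :: "nat \<Rightarrow> 'a \<Rightarrow> 'a measure"
    and f :: "nat \<Rightarrow> 'a \<times> 'a \<Rightarrow> real"
    and t :: real
  assumes "markov_chain P S X K"
    and "uniformly_elliptic S K"
    and "additive_functional S f"
    and "as_uniformly_bounded P X f"
    and "t > 0"
    and "irreducible_functional P S X f"
    and "algebraic_range P X f = lattice_coset 0 t"
  shows "filterlim (\<lambda>N. prob_space.variance P (partial_sum X f N)) at_top sequentially \<and>
    (\<exists>\<gamma> :: nat \<Rightarrow> real.
      (\<forall>N\<ge>1. 0 \<le> \<gamma> N \<and> \<gamma> N < t) \<and>
      (\<forall>N\<ge>1. \<forall>c. 0 \<le> c \<and> c < t \<longrightarrow>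
         (measure P {w \<in> space P. partial_sum X f N w \<in> lattice_coset c t} = 1 \<longleftrightarrow> c = \<gamma> N)) \<and>
      (\<forall>(k::int) (z :: nat \<Rightarrow> real) (\<zeta>::real).
         (\<forall>N\<ge>1. z N \<in> lattice_coset (\<gamma> N) t) \<longrightarrow>
         (\<lambda>N. (z N - prob_space.expectation P (partial_sum X f N))
              / sqrt (prob_space.variance P (partial_sum X f N))) \<longlonglongrightarrow> \<zeta> \<longrightarrow>
         (\<lambda>N. measure P {w \<in> space P. partial_sum X f N w - z N = of_int k * t})
           \<sim>[sequentially]
         (\<lambda>N. exp (- (\<zeta>\<^sup>2) / 2) * t / sqrt (2 * pi * prob_space.variance P (partial_sum X f N)))))"
proof -

  \<comment> \<open>Reduction to an everywhere bounded functional\<close>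
  obtain \<mu> p \<epsilon> where "elliptic_process P (\<lambda>n. borel_metric (S (Suc n))) (\<lambda>n. past_algebra P S X (Suc n))
    (\<lambda>n. X (Suc n)) (\<lambda>n. K (Suc n)) \<mu> p \<epsilon>"
    by (rule markov_chain.elliptic_process[OF assms(1,2)])
  then interpret elliptic_process P "\<lambda>n. borel_metric (S (Suc n))" "\<lambda>n. past_algebra P S X (Suc n)"
    "\<lambda>n. X (Suc n)" "\<lambda>n. K (Suc n)" \<mu> p \<epsilon> .
  have psum: "partial_sum X h N w = psum (\<lambda>n. h (Suc n)) N w" for h N w
    unfolding partial_sum_def psum_def by (simp add: sum.atLeast1_atMost_eq)
  note t = \<open>t > 0\<close>
  have fm [measurable]: "f (Suc n) \<in> borel_measurable (borel_metric (S (Suc n)) \<Otimes>\<^sub>M borel_metric (S (Suc (Suc n))))" for n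
    using assms(3) by (simp add: additive_functional_def)
  obtain R where R: "0 \<le> R" "\<And>n. AE w in P. \<bar>f (Suc n) (X (Suc n) w, X (Suc (Suc n)) w)\<bar> \<le> R"
  proof -
    have "(SUP n\<in>{1..}. esssup P (\<lambda>w. ereal \<bar>f n (X n w, X (Suc n) w)\<bar>)) \<noteq> \<infinity>"
      using assms(4) by (simp add: as_uniformly_bounded_def)
    then obtain m :: nat where m: "(SUP n\<in>{1..}. esssup P (\<lambda>w. ereal \<bar>f n (X n w, X (Suc n) w)\<bar>)) < ereal (real m)"
      unfolding less_PInf_Ex_of_nat by blast
    have "AE w in P. \<bar>f (Suc n) (X (Suc n) w, X (Suc (Suc n)) w)\<bar> \<le> real m" for n
    proof -
      have "esssup P (\<lambda>w. ereal \<bar>f (Suc n) (X (Suc n) w, X (Suc (Suc n)) w)\<bar>)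
          \<le> (SUP n\<in>{1..}. esssup P (\<lambda>w. ereal \<bar>f n (X n w, X (Suc n) w)\<bar>))"
        by (rule SUP_upper) simp
      then have le: "esssup P (\<lambda>w. ereal \<bar>f (Suc n) (X (Suc n) w, X (Suc (Suc n)) w)\<bar>) \<le> ereal (real m)"
        using m by order
      show ?thesis
        using esssup_AE[of "\<lambda>w. ereal \<bar>f (Suc n) (X (Suc n) w, X (Suc (Suc n)) w)\<bar>" P]
      proof eventually_elim
        case (elim w)
        from order_trans[OF elim le] show ?case by simp
      qed
    qed
    then show ?thesis by (intro that[of "real m"]) auto
  qed
  \<comment> \<open>Truncation at the essential bound changes the functional only on a null set of
    outcomes, so sums, moments and probabilities are unaffected; the index is shifted to start at
    0.\<close>
  define h where "h n q = max (- R) (min R (f (Suc n) q))" for n q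
  have h: "bounded_functional h R"
    unfolding bounded_functional_def h_def[abs_def] using R(1) by auto
  have hf: "AE w in P. \<forall>n. f (Suc n) (X (Suc n) w, X (Suc (Suc n)) w) = h n (X (Suc n) w, X (Suc (Suc n)) w)"
    unfolding AE_all_countable
  proof
    fix n
    show "AE w in P. f (Suc n) (X (Suc n) w, X (Suc (Suc n)) w) = h n (X (Suc n) w, X (Suc (Suc n)) w)"
      using R(2)[of n] by eventually_elim (auto simp: h_def)
  qed
  have Sh: "AE w in P. partial_sum X f N w = psum h N w" for N
    using hf by eventually_elim (simp add: psum, simp add: psum_def)
  have Sm [measurable]: "partial_sum X f N \<in> borel_measurable P" for N
    unfolding psum[abs_def] psum_def[abs_def] by measurable
  have hm [measurable]: "psum h N \<in> borel_measurable P" for N by (rule psum_measurable[OF h])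
  note EV = variance_cong_AE[OF Sm hm Sh]

  \<comment> \<open>Divergence of the variance\<close>
  have V: "filterlim (\<lambda>N. variance (psum h N)) at_top sequentially"
  proof (rule ccontr)
    assume "\<not> filterlim (\<lambda>N. variance (psum h N)) at_top sequentially"
    then obtain C where C: "\<And>N. variance (psum h N) \<le> C"
      using variance_tendsto_infinity_or_bounded[OF h] by blast
    have "center_tight P X f"
      by (rule center_tight_of_bounded_variance[OF hm psum_square_integrable[OF h] C Sh])
    \<comment> \<open>With f center-tight, the functional 0 is admissible in the essential range,
      which then collapses to {0}, whereas the algebraic range contains t > 0.\<close>
    then have "algebraic_range P X (\<lambda>_ _. 0) \<in>
        {algebraic_range P X g | g. additive_functional S g \<and> center_tight P X (\<lambda>n xy. f n xy - g n xy)}"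
      by (intro CollectI exI[of _ "\<lambda>_ _. 0"]) (simp add: additive_functional_def)
    then have "essential_range P S X f \<subseteq> algebraic_range P X (\<lambda>_ _. 0)"
      unfolding essential_range_def by (rule Inter_lower)
    also have "\<dots> \<subseteq> {0}"
      by (rule algebraic_range_subset[where c="\<lambda>_. 0"]) (auto simp: real_add_subgroup_iff prob_space)
    finally have "lattice_coset 0 t \<subseteq> {0}"
      using assms(6,7) by (simp add: irreducible_functional_def)
    moreover have "t \<in> lattice_coset 0 t" unfolding lattice_coset_iff by (rule exI[of _ 1]) simp
    ultimately show False using t by auto
  qed

  \<comment> \<open>Divergence of the hexagon sums at frequencies in (0, 2 pi / t)\<close>
  have ns: "\<not> summable (\<lambda>n. hex h \<xi> (Suc (Suc n)))" if \<xi>: "0 < \<xi>" "\<xi> < 2 * pi / t" for \<xi>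
  proof
    assume "summable (\<lambda>n. hex h \<xi> (Suc (Suc n)))"
    from lattice_reduction[OF h \<xi>(1) this]
    obtain g R' C where gm: "\<And>n. g n \<in> borel_measurable (borel_metric (S (Suc n)) \<Otimes>\<^sub>M borel_metric (S (Suc (Suc n))))"
      and gl: "\<And>n x x'. x \<in> mspace (S (Suc n)) \<Longrightarrow> x' \<in> mspace (S (Suc (Suc n))) \<Longrightarrow>
        \<exists>j::int. g n (x, x') = 2 * pi / \<xi> * of_int j"
      and gb: "bounded_functional (\<lambda>n q. h n q - g n q) R'"
      and C: "\<And>N. variance (psum (\<lambda>n q. h n q - g n q) N) \<le> C"
      unfolding space_borel_metric by blast
    \<comment> \<open>\<open>g\<close> is indexed from level 0 and the chain from level 1; the value
      at index 0 is arbitrary.\<close>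
    define g' where "g' n = (case n of 0 \<Rightarrow> \<lambda>_. 0 | Suc m \<Rightarrow> g m)" for n
    have g' [simp]: "g' (Suc n) = g n" for n by (simp add: g'_def)
    have "additive_functional S g'"
      unfolding additive_functional_def
    proof (intro allI impI)
      fix n :: nat assume "1 \<le> n"
      then obtain m where "n = Suc m" by (cases n) auto
      then show "g' n \<in> borel_measurable (borel_metric (S n) \<Otimes>\<^sub>M borel_metric (S (Suc n)))" using gm[of m] by simp
    qed
    moreover have "center_tight P X (\<lambda>n xy. f n xy - g' n xy)"
    proof (rule center_tight_of_bounded_variance[OF psum_measurable[OF gb] psum_square_integrable[OF gb] C])
      show "AE w in P. partial_sum X (\<lambda>n xy. f n xy - g' n xy) N w = psum (\<lambda>n q. h n q - g n q) N w" for N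
        using hf by eventually_elim (simp add: psum, simp add: psum_def)
    qed
    ultimately have "algebraic_range P X g' \<in>
        {algebraic_range P X g | g. additive_functional S g \<and> center_tight P X (\<lambda>n xy. f n xy - g n xy)}"
      by blast
    then have "essential_range P S X f \<subseteq> algebraic_range P X g'"
      unfolding essential_range_def by (rule Inter_lower)
    also have "\<dots> \<subseteq> lattice_coset 0 (2 * pi / \<xi>)"
    proof (rule algebraic_range_subset[where c="\<lambda>_. 0", OF closed_lattice_coset subgroup_lattice_coset])
      fix n :: nat assume "1 \<le> n"
      then obtain m where n: "n = Suc m" by (cases n) auto
      have "{w \<in> space P. g' n (X n w, X (Suc n) w) - 0 \<in> lattice_coset 0 (2 * pi / \<xi>)} = space P"
        using gl[of _ m] X_in_space[of _ m] X_in_space[of _ "Suc m"] unfolding n lattice_coset_iff by auto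
      then show "measure P {w \<in> space P. g' n (X n w, X (Suc n) w) - 0 \<in> lattice_coset 0 (2 * pi / \<xi>)} = 1"
        by (simp add: prob_space)
    qed
    finally have "lattice_coset 0 t \<subseteq> lattice_coset 0 (2 * pi / \<xi>)"
      using assms(6,7) by (simp add: irreducible_functional_def)
    moreover have "t \<in> lattice_coset 0 t" unfolding lattice_coset_iff by (rule exI[of _ 1]) simp
    ultimately have "t \<in> lattice_coset 0 (2 * pi / \<xi>)" by blast
    then obtain j :: int where "t = 0 + 2 * pi / \<xi> * of_int j" unfolding lattice_coset_iff ..
    then have j: "of_int j = t * \<xi> / (2 * pi)" using \<xi> by (simp add: field_simps)
    \<comment> \<open>By irreducibility t is a multiple j of 2 pi / \<xi>, but t \<xi> / (2 pi) lies
      strictly between 0 and 1.\<close>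
    have "0 < real_of_int j" "real_of_int j < 1" unfolding j using t \<xi> by (simp_all add: field_simps)
    then show False by simp
  qed

  \<comment> \<open>The residues of the partial sums modulo t\<close>
  obtain c where c: "\<And>n. 1 \<le> n \<Longrightarrow> AE w in P. f n (X n w, X (Suc n) w) - c n \<in> lattice_coset 0 t"
    using exists_shifts_into_algebraic_range[of f X] assms(7) by metis
  \<comment> \<open>The representative in [0, t) of the sum of the shifts.\<close>
  define \<gamma> where "\<gamma> N = (\<Sum>n=1..N. c n) - t * of_int \<lfloor>(\<Sum>n=1..N. c n) / t\<rfloor>" for N
  have \<gamma>: "0 \<le> \<gamma> N" "\<gamma> N < t" for N
  proof -
    define s where "s = (\<Sum>n=1..N. c n) / t"
    have "\<gamma> N = t * (s - of_int \<lfloor>s\<rfloor>)" using t by (simp add: \<gamma>_def s_def right_diff_distrib)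
    moreover have "0 \<le> s - of_int \<lfloor>s\<rfloor>" "s - of_int \<lfloor>s\<rfloor> < 1" by linarith+
    ultimately show "0 \<le> \<gamma> N" "\<gamma> N < t" using t by auto
  qed
  have lat: "AE w in P. \<exists>j::int. partial_sum X f N w - \<gamma> N = t * of_int j" for N
  proof -
    have "AE w in P. \<forall>n\<in>{1..N}. f n (X n w, X (Suc n) w) - c n \<in> lattice_coset 0 t"
      by (subst AE_ball_countable) (use c in auto)
    then show ?thesis
    proof eventually_elim
      case (elim w)
      then obtain j :: "nat \<Rightarrow> int" where j: "\<And>n. n \<in> {1..N} \<Longrightarrow> f n (X n w, X (Suc n) w) - c n = t * of_int (j n)"
        unfolding lattice_coset_iff by (simp add: Ball_def) metis
      have "partial_sum X f N w = (\<Sum>n=1..N. c n + t * of_int (j n))"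
        unfolding partial_sum_def by (rule sum.cong[OF refl]) (use j in \<open>simp add: algebra_simps\<close>)
      also have "\<dots> = (\<Sum>n=1..N. c n) + t * of_int (\<Sum>n=1..N. j n)"
        by (simp add: sum.distrib sum_distrib_left)
      finally have "partial_sum X f N w - \<gamma> N = t * of_int ((\<Sum>n=1..N. j n) + \<lfloor>(\<Sum>n=1..N. c n) / t\<rfloor>)"
        by (simp add: \<gamma>_def distrib_left)
      then show ?case ..
    qed
  qed
  have unique: "measure P {w \<in> space P. partial_sum X f N w \<in> lattice_coset d t} = 1 \<longleftrightarrow> d = \<gamma> N"
    if d: "0 \<le> d" "d < t" for N d
  proof
    assume "measure P {w \<in> space P. partial_sum X f N w \<in> lattice_coset d t} = 1"
    from AE_of_measure_1[OF this] lat[of N]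
    have "AE w in P. \<exists>i j::int. d + t * of_int i = \<gamma> N + t * of_int j"
    proof eventually_elim
      case (elim w)
      then obtain i j :: int where "partial_sum X f N w = d + t * of_int i" "partial_sum X f N w - \<gamma> N = t * of_int j"
        unfolding lattice_coset_iff by blast
      then have "d + t * of_int i = \<gamma> N + t * of_int j" by linarith
      then show ?case by blast
    qed
    then obtain i j :: int where ij: "d + t * of_int i = \<gamma> N + t * of_int j" by (auto simp: AE_const)
    then have eq: "d - \<gamma> N = t * of_int (j - i)" by (simp add: algebra_simps)
    have "\<bar>t * of_int (j - i)\<bar> < t * 1" unfolding eq[symmetric] using d \<gamma>[of N] by linarith
    then have "\<bar>real_of_int (j - i)\<bar> < 1" unfolding abs_mult using t by simp
    then have "j - i = 0" by linarith
    then show "d = \<gamma> N" using eq by simp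
  next
    assume "d = \<gamma> N"
    have "{w \<in> space P. partial_sum X f N w \<in> lattice_coset d t} \<in> sets P"
      using measurable_sets[OF Sm borel_closed[OF closed_lattice_coset]]
      by (simp add: vimage_def Int_def conj_commute)
    moreover have "AE w in P. partial_sum X f N w \<in> lattice_coset d t"
      using lat[of N]
    proof eventually_elim
      case (elim w)
      then obtain j :: int where "partial_sum X f N w - \<gamma> N = t * of_int j" ..
      then have "partial_sum X f N w = d + t * of_int j" using \<open>d = \<gamma> N\<close> by simp
      then show ?case unfolding lattice_coset_iff ..
    qed
    ultimately show "measure P {w \<in> space P. partial_sum X f N w \<in> lattice_coset d t} = 1"
      by (subst prob_eq_1) auto
  qed

  \<comment> \<open>The local limit\<close>
  have llt: "(\<lambda>N. measure P {w \<in> space P. partial_sum X f N w - z N = of_int k * t}) \<sim>[sequentially]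
      (\<lambda>N. exp (- (\<zeta>\<^sup>2) / 2) * t / sqrt (2 * pi * variance (partial_sum X f N)))"
    if z: "\<forall>N\<ge>1. z N \<in> lattice_coset (\<gamma> N) t"
      and lim: "(\<lambda>N. (z N - expectation (partial_sum X f N)) / sqrt (variance (partial_sum X f N))) \<longlonglongrightarrow> \<zeta>"
    for k :: int and z :: "nat \<Rightarrow> real" and \<zeta> :: real
  proof -
    define \<sigma> where "\<sigma> N = sqrt (variance (psum h N))" for N
    \<comment> \<open>Adding k t moves the target by a fixed amount, negligible after division by
      \<sigma> N, so every k reduces to the case k = 0 for the sequence \<open>y\<close>.\<close>
    define y where "y N = z N + of_int k * t" for N
    have "filterlim \<sigma> at_top sequentially"
      unfolding \<sigma>_def by (rule filterlim_compose[OF sqrt_at_top V])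
    then have "(\<lambda>N. of_int k * t / \<sigma> N) \<longlonglongrightarrow> 0"
      by (rule tendsto_divide_0[OF tendsto_const filterlim_at_top_imp_at_infinity])
    from tendsto_add[OF lim[unfolded EV(2), unfolded EV(1)] this]
    have ylim: "(\<lambda>N. (y N - expectation (psum h N)) / sqrt (variance (psum h N))) \<longlonglongrightarrow> \<zeta>"
      by (simp add: y_def \<sigma>_def add_divide_distrib diff_divide_distrib algebra_simps)
    have "\<forall>\<^sub>F N in sequentially. AE w in P. \<exists>j::int. psum h N w - y N = t * of_int j"
      using eventually_ge_at_top[of 1]
    proof eventually_elim
      case (elim N)
      then obtain i :: int where i: "z N = \<gamma> N + t * of_int i" using z unfolding lattice_coset_iff by blast
      show ?case using lat[of N] Sh[of N]
      proof eventually_elim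
        case (elim w)
        then obtain j :: int where "partial_sum X f N w - \<gamma> N = t * of_int j" by blast
        then have "psum h N w - y N = t * of_int (j - i - k)" using elim i by (simp add: y_def algebra_simps)
        then show ?case ..
      qed
    qed
    from local_limit[OF h t ns V ylim this]
    have L: "(\<lambda>N. \<sigma> N * prob {w \<in> space P. psum h N w = y N}) \<longlonglongrightarrow> t * exp (- \<zeta>\<^sup>2 / 2) / sqrt (2 * pi)"
      by (simp add: \<sigma>_def)
    have ev: "measure P {w \<in> space P. partial_sum X f N w - z N = of_int k * t} = prob {w \<in> space P. psum h N w = y N}" for N
    proof (rule finite_measure_eq_AE)
      show "AE w in P. (w \<in> {w \<in> space P. partial_sum X f N w - z N = of_int k * t}) = (w \<in> {w \<in> space P. psum h N w = y N})"
        using Sh[of N] by eventually_elim (auto simp: y_def)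
    qed measurable
    show ?thesis
    proof (rule asymp_equivI')
      have "(\<lambda>N. \<sigma> N * prob {w \<in> space P. psum h N w = y N} / (t * exp (- \<zeta>\<^sup>2 / 2) / sqrt (2 * pi))) \<longlonglongrightarrow> 1"
        using tendsto_divide[OF L tendsto_const[of "t * exp (- \<zeta>\<^sup>2 / 2) / sqrt (2 * pi)"]] t by simp
      then show "(\<lambda>N. measure P {w \<in> space P. partial_sum X f N w - z N = of_int k * t}
          / (exp (- (\<zeta>\<^sup>2) / 2) * t / sqrt (2 * pi * variance (partial_sum X f N)))) \<longlonglongrightarrow> 1"
        unfolding ev EV(2) by (simp add: \<sigma>_def real_sqrt_mult mult_ac)
    qed
  qed
  have "filterlim (\<lambda>N. variance (partial_sum X f N)) at_top sequentially" using V by (simp only: EV(2))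
  then show ?thesis using \<gamma> unique llt by (intro conjI exI[of _ \<gamma>] allI impI) simp_all
qed

end
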